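(* Let $\Sigma=S^2$, let $k\ge 1$, $m\ge 0$, $N\ge 1$ be integers and $1<p<\infty$ with $[k-2/p]>0$. Let $G_e=B^n_\epsilon\subset\mathbf{R}^n$ be an open $\epsilon$-ball centered at the origin and let $\phi:G_e\times\Sigma\to\Sigma$ be a $C^\infty$ map such that for every $\gamma\in G_e$ the map $\phi_\gamma=\phi(\gamma,\cdot):\Sigma\to\Sigma$ is a diffeomorphism ($\phi$ is not required to be a group action or a local group action). Then the map $$\Phi_m:G_e\times L^p_{k+m}(\Sigma,\mathbf{R}^N)\to L^p_k(\Sigma,\mathbf{R}^N),\qquad \Phi_m(\gamma,\xi)=\xi\circ\phi_\gamma,$$ is of class $C^m$.
   Context: $L^p_k(\Sigma,\mathbf{R}^N)$ denotes the Sobolev space of maps $\Sigma\to\mathbf{R}^N$ whose weak derivatives up to order $k$ are in $L^p$, with respect to a fixed Riemannian metric on the compact surface $\Sigma$. $[\cdot]$ denotes the integer part. "Of class $C^m$" is in the sense of Fréchet differentiability on open subsets of Banach spaces ($C^0$ means continuous). *)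

theory Defs
  imports "HOL-Analysis.Analysis"
begin

section \<open>Maps of class \<open>C\<^sup>m\<close> between normed spaces\<close>

text \<open>
  The exponents of a Sobolev space are term parameters, so its norm cannot come from a type class
  instance.  A normed space is therefore a linear subspace of some real vector space together with
  a norm on it.
\<close>

record 'a nspace =
  points :: "'a set"
  nrm :: "'a \<Rightarrow> real"

definition euclidean_nspace :: "'a::euclidean_space nspace" where
  "euclidean_nspace = \<lparr>points = UNIV, nrm = norm\<rparr>"

definition prod_nspace :: "'a nspace \<Rightarrow> 'b nspace \<Rightarrow> ('a \<times> 'b) nspace" where
  "prod_nspace X Y =
     \<lparr>points = points X \<times> points Y, nrm = (\<lambda>z. nrm X (fst z) + nrm Y (snd z))\<rparr>"

definition multilinear_on ::
    "'a::real_vector set \<Rightarrow> nat \<Rightarrow> ('a list \<Rightarrow> 'b::real_vector) \<Rightarrow> bool" where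
  "multilinear_on V j T \<longleftrightarrow>
     (\<forall>hs i u v a b. length hs = j \<and> set hs \<subseteq> V \<and> i < j \<and> u \<in> V \<and> v \<in> V \<longrightarrow>
        T (hs[i := a *\<^sub>R u + b *\<^sub>R v]) = a *\<^sub>R T (hs[i := u]) + b *\<^sub>R T (hs[i := v]))"

text \<open>
  The space \<open>L\<^sup>j(X; Y)\<close> of bounded \<open>j\<close>-linear maps, with arguments given as lists of length \<open>j\<close>
  (so \<open>L\<^sup>0(X; Y)\<close> is \<open>Y\<close>), and its operator norm.
\<close>

definition bounded_multilinear ::
    "'a::real_vector nspace \<Rightarrow> 'b::real_vector nspace \<Rightarrow> nat \<Rightarrow> ('a list \<Rightarrow> 'b) \<Rightarrow> bool" where
  "bounded_multilinear X Y j T \<longleftrightarrow>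
     multilinear_on (points X) j T \<and>
     (\<forall>hs. length hs = j \<and> set hs \<subseteq> points X \<longrightarrow> T hs \<in> points Y) \<and>
     (\<exists>C. \<forall>hs. length hs = j \<and> set hs \<subseteq> points X \<longrightarrow>
        nrm Y (T hs) \<le> C * prod_list (map (nrm X) hs))"

definition op_nrm :: "'a nspace \<Rightarrow> 'b nspace \<Rightarrow> nat \<Rightarrow> ('a list \<Rightarrow> 'b) \<Rightarrow> real" where
  "op_nrm X Y j T =
     (SUP hs \<in> {hs. length hs = j \<and> (\<forall>h\<in>set hs. h \<in> points X \<and> nrm X h \<le> 1)}. nrm Y (T hs))"

text \<open>
  \<open>Cm_multi m X Y U j F\<close>: the map \<open>F : U \<rightarrow> L\<^sup>j(X; Y)\<close> is of class \<open>C\<^sup>m\<close>.  Its Frechet derivative is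
  a map \<open>U \<rightarrow> L(X; L\<^sup>j(X; Y))\<close>, and \<open>L(X; L\<^sup>j(X; Y))\<close> is identified isometrically with
  \<open>L\<^bsup>j+1\<^esup>(X; Y)\<close>, the direction of differentiation being the head of the argument list.
\<close>

primrec Cm_multi ::
    "nat \<Rightarrow> 'a::real_vector nspace \<Rightarrow> 'b::real_vector nspace \<Rightarrow> 'a set \<Rightarrow>
     nat \<Rightarrow> ('a \<Rightarrow> 'a list \<Rightarrow> 'b) \<Rightarrow> bool" where
  "Cm_multi 0 X Y U j F \<longleftrightarrow>
     (\<forall>x\<in>U. bounded_multilinear X Y j (F x)) \<and>
     (\<forall>x\<in>U. \<forall>e>0. \<exists>d>0. \<forall>y\<in>U. nrm X (y - x) < d \<longrightarrow>
        op_nrm X Y j (\<lambda>hs. F y hs - F x hs) < e)"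
| "Cm_multi (Suc m) X Y U j F \<longleftrightarrow>
     (\<forall>x\<in>U. bounded_multilinear X Y j (F x)) \<and>
     (\<exists>F'. (\<forall>x\<in>U. \<forall>e>0. \<exists>d>0. \<forall>y\<in>U. nrm X (y - x) < d \<longrightarrow>
              op_nrm X Y j (\<lambda>hs. F y hs - F x hs - F' x ((y - x) # hs)) \<le> e * nrm X (y - x)) \<and>
           Cm_multi m X Y U (Suc j) F')"

text \<open>Here \<open>U\<close> is meant to be open in \<open>X\<close>.\<close>

definition Cm_map ::
    "nat \<Rightarrow> 'a::real_vector nspace \<Rightarrow> 'b::real_vector nspace \<Rightarrow> 'a set \<Rightarrow> ('a \<Rightarrow> 'b) \<Rightarrow> bool" where
  "Cm_map m X Y U f \<longleftrightarrow> Cm_multi m X Y U 0 (\<lambda>x hs. f x)"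


section \<open>Smooth maps on the unit sphere of \<open>\<real>\<^sup>3\<close>\<close>

primrec Ck_on ::
    "nat \<Rightarrow> 'a::euclidean_space set \<Rightarrow> ('a \<Rightarrow> 'b::real_normed_vector) \<Rightarrow> bool" where
  "Ck_on 0 S f \<longleftrightarrow> continuous_on S f"
| "Ck_on (Suc k) S f \<longleftrightarrow>
     (\<forall>x\<in>S. f differentiable (at x)) \<and> (\<forall>v. Ck_on k S (\<lambda>x. frechet_derivative f (at x) v))"

definition smooth_on :: "'a::euclidean_space set \<Rightarrow> ('a \<Rightarrow> 'b::real_normed_vector) \<Rightarrow> bool" where
  "smooth_on S f \<longleftrightarrow> open S \<and> (\<forall>k. Ck_on k S f)"

abbreviation S2 :: "(real^3) set" where
  "S2 \<equiv> sphere 0 1"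

definition tangent :: "real^3 \<Rightarrow> (real^3) set" where
  "tangent x = {v. v \<bullet> x = 0}"

text \<open>
  Functions on the sphere are represented by functions on \<open>\<real>\<^sup>3\<close> whose values off the sphere are
  ignored.  As \<open>sgn y = y / \<parallel>y\<parallel>\<close> is a smooth retraction of \<open>\<real>\<^sup>3 - {0}\<close> onto the sphere, \<open>f\<close> is smooth
  on the sphere iff \<open>f \<circ> sgn\<close> is smooth on \<open>\<real>\<^sup>3 - {0}\<close>, and the derivative of \<open>f\<close> at \<open>x\<close> along a
  tangent vector is that of \<open>f \<circ> sgn\<close>.
\<close>

definition smooth_on_S2 :: "(real^3 \<Rightarrow> 'b::real_normed_vector) \<Rightarrow> bool" where
  "smooth_on_S2 f \<longleftrightarrow> smooth_on (- {0}) (\<lambda>y. f (sgn y))"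

definition D_S2 :: "(real^3 \<Rightarrow> 'b::real_normed_vector) \<Rightarrow> real^3 \<Rightarrow> real^3 \<Rightarrow> 'b" where
  "D_S2 f x v = frechet_derivative (\<lambda>y. f (sgn y)) (at x) v"

definition S2_diffeo :: "(real^3 \<Rightarrow> real^3) \<Rightarrow> bool" where
  "S2_diffeo h \<longleftrightarrow> bij_betw h S2 S2 \<and> smooth_on_S2 h \<and> smooth_on_S2 (inv_into S2 h)"

definition vector_field :: "(real^3 \<Rightarrow> real^3) \<Rightarrow> bool" where
  "vector_field X \<longleftrightarrow> smooth_on_S2 X \<and> (\<forall>x\<in>S2. X x \<in> tangent x)"


section \<open>Riemannian metrics on the sphere\<close>

definition riemannian_metric :: "(real^3 \<Rightarrow> real^3 \<Rightarrow> real^3 \<Rightarrow> real) \<Rightarrow> bool" where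
  "riemannian_metric g \<longleftrightarrow>
     (\<forall>x\<in>S2. \<forall>u\<in>tangent x. \<forall>v\<in>tangent x. \<forall>w\<in>tangent x. \<forall>a b.
        g x u v = g x v u \<and> g x (a *\<^sub>R u + b *\<^sub>R v) w = a * g x u w + b * g x v w) \<and>
     (\<forall>x\<in>S2. \<forall>u\<in>tangent x. u \<noteq> 0 \<longrightarrow> g x u u > 0) \<and>
     (\<forall>X Y. vector_field X \<and> vector_field Y \<longrightarrow> smooth_on_S2 (\<lambda>x. g x (X x) (Y x)))"

text \<open>
  \<open>nabla Y x v\<close> is the covariant derivative of the vector field \<open>Y\<close> at \<open>x\<close> in the direction \<open>v\<close>.
  The conditions are: affine connection, compatibility with \<open>g\<close>, vanishing torsion.  They determine
  \<open>nabla Y x v\<close> for smooth \<open>Y\<close>, \<open>x\<close> in the sphere and \<open>v\<close> tangent at \<open>x\<close>.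
\<close>

definition levi_civita ::
    "(real^3 \<Rightarrow> real^3 \<Rightarrow> real^3 \<Rightarrow> real) \<Rightarrow>
     ((real^3 \<Rightarrow> real^3) \<Rightarrow> real^3 \<Rightarrow> real^3 \<Rightarrow> real^3) \<Rightarrow> bool" where
  "levi_civita g nabla \<longleftrightarrow>
     (\<forall>X Y. vector_field X \<and> vector_field Y \<longrightarrow> vector_field (\<lambda>x. nabla Y x (X x))) \<and>
     (\<forall>Y. vector_field Y \<longrightarrow> (\<forall>x\<in>S2. \<forall>u\<in>tangent x. \<forall>v\<in>tangent x. \<forall>a b.
        nabla Y x (a *\<^sub>R u + b *\<^sub>R v) = a *\<^sub>R nabla Y x u + b *\<^sub>R nabla Y x v)) \<and>
     (\<forall>Y Z. vector_field Y \<and> vector_field Z \<longrightarrow> (\<forall>x\<in>S2. \<forall>v\<in>tangent x.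
        nabla (\<lambda>z. Y z + Z z) x v = nabla Y x v + nabla Z x v)) \<and>
     (\<forall>f Y. smooth_on_S2 f \<and> vector_field Y \<longrightarrow> (\<forall>x\<in>S2. \<forall>v\<in>tangent x.
        nabla (\<lambda>z. f z *\<^sub>R Y z) x v = D_S2 f x v *\<^sub>R Y x + f x *\<^sub>R nabla Y x v)) \<and>
     (\<forall>Y Z. vector_field Y \<and> vector_field Z \<longrightarrow> (\<forall>x\<in>S2. \<forall>v\<in>tangent x.
        D_S2 (\<lambda>z. g z (Y z) (Z z)) x v = g x (nabla Y x v) (Z x) + g x (Y x) (nabla Z x v))) \<and>
     (\<forall>X Y. vector_field X \<and> vector_field Y \<longrightarrow> (\<forall>x\<in>S2.
        nabla Y x (X x) - nabla X x (Y x) = D_S2 Y x (X x) - D_S2 X x (Y x)))"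

text \<open>
  A \<open>g\<close>-orthonormal basis of the tangent plane at \<open>x\<close>.  The quantities defined from it below do not
  depend on the choice.
\<close>

definition frame :: "(real^3 \<Rightarrow> real^3 \<Rightarrow> real^3 \<Rightarrow> real) \<Rightarrow> real^3 \<Rightarrow> (real^3) \<times> (real^3)" where
  "frame g x = (SOME (e1, e2). e1 \<in> tangent x \<and> e2 \<in> tangent x \<and>
     g x e1 e1 = 1 \<and> g x e2 e2 = 1 \<and> g x e1 e2 = 0)"

definition divergence ::
    "(real^3 \<Rightarrow> real^3 \<Rightarrow> real^3 \<Rightarrow> real) \<Rightarrow>
     ((real^3 \<Rightarrow> real^3) \<Rightarrow> real^3 \<Rightarrow> real^3 \<Rightarrow> real^3) \<Rightarrow>
     (real^3 \<Rightarrow> real^3) \<Rightarrow> real^3 \<Rightarrow> real" where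
  "divergence g nabla X x =
     (let (e1, e2) = frame g x in g x (nabla X x e1) e1 + g x (nabla X x e2) e2)"

definition tensor_norm ::
    "(real^3 \<Rightarrow> real^3 \<Rightarrow> real^3 \<Rightarrow> real) \<Rightarrow> nat \<Rightarrow> real^3 \<Rightarrow>
     ((real^3) list \<Rightarrow> 'b::real_normed_vector) \<Rightarrow> real" where
  "tensor_norm g j x T =
     (let (e1, e2) = frame g x in
        sqrt (\<Sum>es \<in> {es. length es = j \<and> set es \<subseteq> {e1, e2}}. (norm (T es))\<^sup>2))"

text \<open>
  The Euclidean surface measure of the sphere, as a cone measure: the area of \<open>A\<close> is three times the
  volume of the cone \<open>{t x | 0 < t < 1, x \<in> A}\<close>.
\<close>

definition S2_measure :: "(real^3) measure" where
  "S2_measure = scale_measure 3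
     (distr (restrict_space lborel (ball 0 1 - {0})) (restrict_space borel S2) sgn)"

text \<open>
  The Riemannian volume; \<open>(e1, e2)\<close> is a Euclidean orthonormal basis of the tangent plane.
\<close>

definition vol :: "(real^3 \<Rightarrow> real^3 \<Rightarrow> real^3 \<Rightarrow> real) \<Rightarrow> (real^3) measure" where
  "vol g = density S2_measure (\<lambda>x.
     let (e1, e2) = frame (\<lambda>_ u v. u \<bullet> v) x
     in ennreal (sqrt (g x e1 e1 * g x e2 e2 - (g x e1 e2)\<^sup>2)))"


section \<open>Sobolev spaces on the sphere\<close>

text \<open>
  Measurable functions on the sphere modulo equality almost everywhere.  Null sets are the same for
  the volume of every Riemannian metric.
\<close>

quotient_type (overloaded) 'b S2_fun = "real^3 \<Rightarrow> 'b::euclidean_space" / partial: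
  "\<lambda>f h. f \<in> borel_measurable S2_measure \<and> h \<in> borel_measurable S2_measure \<and>
         (AE x in S2_measure. f x = h x)"
proof (rule part_equivpI)
  show "\<exists>f. f \<in> borel_measurable S2_measure \<and> f \<in> borel_measurable S2_measure \<and>
      (AE x in S2_measure. f x = (f x :: 'b))"
    by (rule exI[of _ "\<lambda>_. 0"]) simp
qed (auto intro!: sympI transpI elim: AE_mp)

instantiation S2_fun :: (euclidean_space) real_vector
begin

lift_definition zero_S2_fun :: "'a S2_fun" is "\<lambda>_. 0" by simp

lift_definition plus_S2_fun :: "'a S2_fun \<Rightarrow> 'a S2_fun \<Rightarrow> 'a S2_fun" is "\<lambda>f h x. f x + h x"
  by (auto elim: AE_mp)

lift_definition minus_S2_fun :: "'a S2_fun \<Rightarrow> 'a S2_fun \<Rightarrow> 'a S2_fun" is "\<lambda>f h x. f x - h x"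
  by (auto elim: AE_mp)

lift_definition uminus_S2_fun :: "'a S2_fun \<Rightarrow> 'a S2_fun" is "\<lambda>f x. - f x"
  by (auto elim: AE_mp)

lift_definition scaleR_S2_fun :: "real \<Rightarrow> 'a S2_fun \<Rightarrow> 'a S2_fun" is "\<lambda>c f x. c *\<^sub>R f x"
  by (auto elim: AE_mp)

instance
  by standard (transfer; auto simp: algebra_simps)+

end

text \<open>
  The composition \<open>\<xi> \<circ> h\<close>, for \<open>h\<close> a diffeomorphism of the sphere; as \<open>h\<close> preserves null sets, it does
  not depend on the representative of \<open>\<xi>\<close>.
\<close>

definition S2_comp :: "'b::euclidean_space S2_fun \<Rightarrow> (real^3 \<Rightarrow> real^3) \<Rightarrow> 'b S2_fun" where
  "S2_comp \<xi> h = abs_S2_fun (\<lambda>x. rep_S2_fun \<xi> (h x))"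

text \<open>
  Integrable covariant \<open>j\<close>-tensor fields with values in \<open>'b\<close>, tested against smooth vector fields.
\<close>

definition tensor_field ::
    "(real^3 \<Rightarrow> real^3 \<Rightarrow> real^3 \<Rightarrow> real) \<Rightarrow> nat \<Rightarrow>
     (real^3 \<Rightarrow> (real^3) list \<Rightarrow> 'b::euclidean_space) \<Rightarrow> bool" where
  "tensor_field g j T \<longleftrightarrow>
     (\<forall>x\<in>S2. multilinear_on (tangent x) j (T x)) \<and>
     (\<forall>Ys. length Ys = j \<and> (\<forall>Y\<in>set Ys. vector_field Y) \<longrightarrow>
        integrable (vol g) (\<lambda>x. T x (map (\<lambda>Y. Y x) Ys)))"

text \<open>
  \<open>T'\<close> is the weak covariant derivative of the \<open>j\<close>-tensor field \<open>T\<close>.  For smooth \<open>T\<close> one has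
  \<open>T'(X, Y\<^sub>1, \<dots>, Y\<^sub>j) = X (T(Y\<^sub>1, \<dots>, Y\<^sub>j)) - (\<Sum>i. T(Y\<^sub>1, \<dots>, \<nabla>\<^sub>X Y\<^sub>i, \<dots>, Y\<^sub>j))\<close>, and the divergence theorem
  gives \<open>\<integral> X f = - \<integral> f div X\<close>.  Test functions are absorbed into \<open>X\<close>.
\<close>

definition weak_covariant_derivative ::
    "(real^3 \<Rightarrow> real^3 \<Rightarrow> real^3 \<Rightarrow> real) \<Rightarrow>
     ((real^3 \<Rightarrow> real^3) \<Rightarrow> real^3 \<Rightarrow> real^3 \<Rightarrow> real^3) \<Rightarrow> nat \<Rightarrow>
     (real^3 \<Rightarrow> (real^3) list \<Rightarrow> 'b::euclidean_space) \<Rightarrow>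
     (real^3 \<Rightarrow> (real^3) list \<Rightarrow> 'b) \<Rightarrow> bool" where
  "weak_covariant_derivative g nabla j T T' \<longleftrightarrow>
     (\<forall>X Ys. vector_field X \<and> length Ys = j \<and> (\<forall>Y\<in>set Ys. vector_field Y) \<longrightarrow>
        integral\<^sup>L (vol g) (\<lambda>x. T' x (X x # map (\<lambda>Y. Y x) Ys)) =
        - integral\<^sup>L (vol g) (\<lambda>x. divergence g nabla X x *\<^sub>R T x (map (\<lambda>Y. Y x) Ys))
        - (\<Sum>i<j. integral\<^sup>L (vol g)
             (\<lambda>x. T x ((map (\<lambda>Y. Y x) Ys)[i := nabla (Ys ! i) x (X x)]))))"

text \<open>\<open>T j\<close> is the \<open>j\<close>-th weak covariant derivative of \<open>f\<close>, for all \<open>j \<le> k\<close>.\<close>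

definition weak_jet ::
    "(real^3 \<Rightarrow> real^3 \<Rightarrow> real^3 \<Rightarrow> real) \<Rightarrow>
     ((real^3 \<Rightarrow> real^3) \<Rightarrow> real^3 \<Rightarrow> real^3 \<Rightarrow> real^3) \<Rightarrow> nat \<Rightarrow>
     (real^3 \<Rightarrow> 'b::euclidean_space) \<Rightarrow> (nat \<Rightarrow> real^3 \<Rightarrow> (real^3) list \<Rightarrow> 'b) \<Rightarrow> bool" where
  "weak_jet g nabla k f T \<longleftrightarrow>
     (AE x in vol g. T 0 x [] = f x) \<and>
     (\<forall>j\<le>k. tensor_field g j (T j)) \<and>
     (\<forall>j<k. weak_covariant_derivative g nabla j (T j) (T (Suc j)))"

definition sobolev_set ::
    "(real^3 \<Rightarrow> real^3 \<Rightarrow> real^3 \<Rightarrow> real) \<Rightarrow>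
     ((real^3 \<Rightarrow> real^3) \<Rightarrow> real^3 \<Rightarrow> real^3 \<Rightarrow> real^3) \<Rightarrow>
     nat \<Rightarrow> real \<Rightarrow> 'b::euclidean_space S2_fun set" where
  "sobolev_set g nabla k p =
     {\<xi>. \<exists>T. weak_jet g nabla k (rep_S2_fun \<xi>) T \<and>
          (\<forall>j\<le>k. integrable (vol g) (\<lambda>x. tensor_norm g j x (T j x) powr p))}"

text \<open>Weak covariant derivatives are unique almost everywhere, so the choice of \<open>T\<close> is immaterial.\<close>

definition sobolev_norm ::
    "(real^3 \<Rightarrow> real^3 \<Rightarrow> real^3 \<Rightarrow> real) \<Rightarrow>
     ((real^3 \<Rightarrow> real^3) \<Rightarrow> real^3 \<Rightarrow> real^3 \<Rightarrow> real^3) \<Rightarrow>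
     nat \<Rightarrow> real \<Rightarrow> 'b::euclidean_space S2_fun \<Rightarrow> real" where
  "sobolev_norm g nabla k p \<xi> =
     (let T = (SOME T. weak_jet g nabla k (rep_S2_fun \<xi>) T)
      in (\<Sum>j\<le>k. integral\<^sup>L (vol g) (\<lambda>x. tensor_norm g j x (T j x) powr p)) powr (1 / p))"

definition sobolev_space ::
    "(real^3 \<Rightarrow> real^3 \<Rightarrow> real^3 \<Rightarrow> real) \<Rightarrow>
     ((real^3 \<Rightarrow> real^3) \<Rightarrow> real^3 \<Rightarrow> real^3 \<Rightarrow> real^3) \<Rightarrow>
     nat \<Rightarrow> real \<Rightarrow> 'b::euclidean_space S2_fun nspace" where
  "sobolev_space g nabla k p =
     \<lparr>points = sobolev_set g nabla k p, nrm = sobolev_norm g nabla k p\<rparr>"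

end

theory Submission
  imports Defs
begin

text \<open>
  The rotation fields \<open>a \<times> x\<close> span every tangent plane and preserve the surface measure, so iterated weak
  derivatives along them, for \<open>a\<close> in the standard basis (jets), describe Sobolev functions on the sphere without charts.
  Through the coefficients of the covariant derivatives of rotation fields along rotation fields, the Sobolev norm
  of any metric is equivalent to the sum of the \<open>L\<^sup>p\<close> norms of a jet.  Convolution with the zonal
  kernels \<open>(1 + x \<bullet> y)\<^sup>n\<close> commutes with rotations and approximates a jet by jets of smooth functions.

  The jet of \<open>\<xi> \<circ> \<phi>\<^sub>\<gamma>\<close> is obtained from that of \<open>\<xi>\<close> by operators \<open>J \<mapsto> \<Sum>v. C\<^sub>v(\<gamma>, x) J\<^sub>v(\<phi>\<^sub>\<gamma> x)\<close>; derivatives in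
  \<open>\<gamma>\<close> or \<open>x\<close> are operators of the same kind, of one order more.  By Taylor's formula for smooth functions and
  density, an operator of order \<open>r\<close> is strongly continuous in \<open>\<gamma>\<close> on jets of order \<open>r\<close>; one more order
  makes it strongly differentiable and Lipschitz in operator norm, two more make the remainder quadratic in
  operator norm.  As composition is linear in \<open>\<xi>\<close>, the \<open>j\<close>-th derivative of \<open>(\<gamma>, \<xi>) \<mapsto> \<xi> \<circ> \<phi>\<^sub>\<gamma>\<close> consists of operators
  applied to \<open>\<xi>\<close>, of order at most \<open>j\<close>, and to a direction \<open>\<eta>\<close>, of order at most \<open>j - 1\<close>.  Hence \<open>m\<close> additional orders
  suffice for \<open>m\<close> continuous derivatives.
\<close>

text \<open>The obstacle is that without a spare derivative the pullback operator depends on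
  \<open>\<gamma>\<close> continuously only for each fixed \<open>\<xi>\<close>, not in operator
  norm, so it cannot be differentiated as an operator-valued map. Every statement at fixed
  \<open>\<xi>\<close> comes from one device: a crude bound at the given order and a rate at the
  next order yield, by density, a limit without rate but also without loss of order. Charts are
  avoided by extending functions on the sphere constantly along rays and maps homogeneously of
  degree one; derivatives and the change of variables are then those of \<open>real^3\<close>. The
  kernel is a polynomial in \<open>x \<bullet> y\<close>, which makes smoothness of the convolution
  a matter of algebra instead of differentiation under an integral. The operator classes are closed
  under differentiation, so no formula for higher derivatives of a composition is ever written down.
  Tensors enter through their values on rotation fields. As these fields are linearly dependent, not
  every family of values comes from a tensor; this is why the way back from jets to tensors goes
  through weighted sums.\<close>

type_synonym 'b jets = "(real^3) list => real^3 => 'b"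

abbreviation mu :: "(real^3) measure" where "mu \<equiv> S2_measure"

notation scaleR (infixr "*R" 75)
notation cross3 (infixr "><" 80)

section \<open>Calculus of smooth maps\<close>

lemma frechet_derivative_cong_open:
  assumes "open S" "x \<in> S" "!!y. y \<in> S ==> f y = g y"
  shows "frechet_derivative f (at x) = frechet_derivative g (at x)"
proof -
  have "(f has_derivative D) (at x) \<longleftrightarrow> (g has_derivative D) (at x)" for D
    using assms has_derivative_transform_within_open[of f D x UNIV S g]
      has_derivative_transform_within_open[of g D x UNIV S f] by auto
  then show ?thesis by (simp add: frechet_derivative_def)
qed

text \<open>In the closure lemmas below the derivative is computed only at points of the open set;
  this transfers the induction hypothesis from the formula to
  \<open>frechet_derivative\<close>.\<close>

lemma Ck_on_cong:
  assumes "open S" "!!x. x \<in> S ==> f x = g x" "Ck_on k S f"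
  shows "Ck_on k S g"
  using assms(2,3)
proof (induction k arbitrary: f g)
  case 0
  then show ?case by (simp cong: continuous_on_cong)
next
  case (Suc k)
  have "g differentiable (at x)" if "x \<in> S" for x
    using Suc.prems that assms(1) has_derivative_transform_within_open[of f _ x UNIV S g]
    by (force simp: differentiable_def)
  moreover have "Ck_on k S (%x. frechet_derivative g (at x) v)" for v
  proof (rule Suc.IH)
    show "Ck_on k S (%x. frechet_derivative f (at x) v)" using Suc.prems by simp
    show "frechet_derivative f (at x) v = frechet_derivative g (at x) v" if "x \<in> S" for x
      using frechet_derivative_cong_open[OF assms(1) that, of f g] Suc.prems by simp
  qed
  ultimately show ?case by simp
qed

lemma Ck_on_imp_continuous_on: "Ck_on k S f ==> continuous_on S f"
  by (cases k) (auto intro!: differentiable_imp_continuous_on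
      simp: differentiable_on_def differentiable_at_withinI)

lemma Ck_on_SucD: "Ck_on (Suc k) S f ==> Ck_on k S f"
proof (induction k arbitrary: f)
  case 0
  then show ?case using Ck_on_imp_continuous_on by (metis Ck_on.simps(1))
qed simp

lemma Ck_on_const: "Ck_on k S (%_. c)"
  by (induction k arbitrary: c) auto

lemma Ck_on_bounded_linear_comp:
  assumes "open S" "bounded_linear L" "Ck_on k S f"
  shows "Ck_on k S (%x. L (f x))"
  using assms(3)
proof (induction k arbitrary: f)
  case 0
  then show ?case
    using bounded_linear.continuous_on[OF assms(2)] by simp
next
  case (Suc k)
  have D: "((%x. L (f x)) has_derivative (%v. L (frechet_derivative f (at x) v))) (at x)" if "x \<in> S" for x
    using Suc.prems that by (intro bounded_linear.has_derivative[OF assms(2)])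
      (simp add: frechet_derivative_works[symmetric])
  have "Ck_on k S (%x. frechet_derivative (%x. L (f x)) (at x) v)" for v
    by (rule Ck_on_cong[OF assms(1) _ Suc.IH[of "%x. frechet_derivative f (at x) v"]])
      (use Suc.prems in \<open>auto dest!: D simp: frechet_derivative_at[symmetric]\<close>)
  then show ?case using D by (auto simp: differentiable_def)
qed

lemma Ck_on_bounded_linear:
  assumes "bounded_linear L" shows "Ck_on k S L"
proof (cases k)
  case 0
  then show ?thesis
    using linear_continuous_on[OF assms] by simp
next
  case (Suc l)
  have D: "(L has_derivative L) (at x)" for x
    using assms bounded_linear_imp_has_derivative by blast
  then have "frechet_derivative L (at x) = L" for x
    by (simp add: frechet_derivative_at[symmetric])
  then show ?thesis using D by (auto simp: Suc Ck_on_const differentiable_def)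
qed

lemma Ck_on_add:
  assumes "open S" "Ck_on k S f" "Ck_on k S g"
  shows "Ck_on k S (%x. f x + g x)"
  using assms(2,3)
proof (induction k arbitrary: f g)
  case 0
  then show ?case by (simp add: continuous_on_add)
next
  case (Suc k)
  have D: "((%x. f x + g x) has_derivative
      (%v. frechet_derivative f (at x) v + frechet_derivative g (at x) v)) (at x)" if "x \<in> S" for x
    using Suc.prems that by (intro has_derivative_add) (simp_all add: frechet_derivative_works[symmetric])
  have "Ck_on k S (%x. frechet_derivative (%x. f x + g x) (at x) v)" for v
    by (rule Ck_on_cong[OF assms(1) _ Suc.IH[of "%x. frechet_derivative f (at x) v"
            "%x. frechet_derivative g (at x) v"]])
      (use Suc.prems in \<open>auto dest!: D simp: frechet_derivative_at[symmetric]\<close>)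
  then show ?case using D by (auto simp: differentiable_def)
qed

lemma Ck_on_sum:
  assumes "open S" "!!i. i \<in> I ==> Ck_on k S (f i)"
  shows "Ck_on k S (%x. \<Sum>i\<in>I. f i x)"
proof (cases "finite I")
  case True
  then show ?thesis using assms(2)
    by (induction I) (auto intro!: Ck_on_add assms(1) simp: Ck_on_const)
qed (simp add: Ck_on_const)

lemma Ck_on_bilinear:
  assumes "open S" "bounded_bilinear B" "Ck_on k S f" "Ck_on k S g"
  shows "Ck_on k S (%x. B (f x) (g x))"
  using assms(3,4)
proof (induction k arbitrary: f g)
  case 0
  then show ?case using bounded_bilinear.continuous_on[OF assms(2)] by simp
next
  case (Suc k)
  have D: "((%x. B (f x) (g x)) has_derivative
      (%v. B (f x) (frechet_derivative g (at x) v) + B (frechet_derivative f (at x) v) (g x))) (at x)"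
    if "x \<in> S" for x
    using Suc.prems that
    by (intro bounded_bilinear.FDERIV[OF assms(2)]) (simp_all add: frechet_derivative_works[symmetric])
  have "Ck_on k S (%x. frechet_derivative (%x. B (f x) (g x)) (at x) v)" for v
    by (rule Ck_on_cong[OF assms(1) _ Ck_on_add[OF assms(1)
        Suc.IH[of "f" "%x. frechet_derivative g (at x) v"]
        Suc.IH[of "%x. frechet_derivative f (at x) v" g]]])
      (use Suc.prems Ck_on_SucD in \<open>auto dest!: D simp: frechet_derivative_at[symmetric]\<close>)
  then show ?case using D by (auto simp: differentiable_def)
qed

text \<open>\<open>Ck_on\<close> controls derivatives in fixed directions only. In the chain rule
  and for vector fields the direction varies with the point; expanding it in the basis moves the
  variation into scalar coefficients.\<close>

lemma linear_frechet_derivative_Basis: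
  fixes f :: "'a::euclidean_space => 'b::real_normed_vector"
  assumes "f differentiable (at x)"
  shows "frechet_derivative f (at x) v = (\<Sum>b\<in>Basis. (v \<bullet> b) *R frechet_derivative f (at x) b)"
proof -
  have l: "linear (frechet_derivative f (at x))"
    using assms by (rule linear_frechet_derivative)
  have "frechet_derivative f (at x) v = frechet_derivative f (at x) (\<Sum>b\<in>Basis. (v \<bullet> b) *R b)"
    by (simp add: euclidean_representation)
  also have "... = (\<Sum>b\<in>Basis. (v \<bullet> b) *R frechet_derivative f (at x) b)"
    by (simp add: linear_sum[OF l] linear_cmul[OF l])
  finally show ?thesis .
qed

lemma Ck_on_compose:
  fixes f :: "'b::euclidean_space => 'c::real_normed_vector" and g :: "'a::euclidean_space => 'b"
  assumes "open S" "open T" "Ck_on k T f" "Ck_on k S g" "!!x. x \<in> S ==> g x \<in> T"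
  shows "Ck_on k S (%x. f (g x))"
  using assms(3,4)
proof (induction k arbitrary: f)
  case 0
  then show ?case using assms(5) by (auto intro!: continuous_on_compose2[of T f S g])
next
  case (Suc k)
  have D: "((%x. f (g x)) has_derivative
      (%v. frechet_derivative f (at (g x)) (frechet_derivative g (at x) v))) (at x)" if "x \<in> S" for x
    using Suc.prems that assms(5)
    by (intro has_derivative_compose[of g _ x UNIV f]) (simp_all add: frechet_derivative_works[symmetric])
  have "Ck_on k S (%x. frechet_derivative (%x. f (g x)) (at x) v)" for v
  proof (rule Ck_on_cong[OF assms(1)])
    show "Ck_on k S (%x. \<Sum>b\<in>Basis. (frechet_derivative g (at x) v \<bullet> b) *R frechet_derivative f (at (g x)) b)"
      using Suc.prems Ck_on_SucD[OF Suc.prems(2)]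
      by (intro Ck_on_sum Ck_on_bilinear[OF _ bounded_bilinear_scaleR] assms(1) Suc.IH
          Ck_on_bounded_linear_comp[OF assms(1) bounded_linear_inner_left]) auto
    show "(\<Sum>b\<in>Basis. (frechet_derivative g (at x) v \<bullet> b) *R frechet_derivative f (at (g x)) b) =
        frechet_derivative (%x. f (g x)) (at x) v" if "x \<in> S" for x
      using D[OF that] Suc.prems(1) assms(5)[OF that]
      by (subst linear_frechet_derivative_Basis[symmetric]) (auto simp: frechet_derivative_at[symmetric])
  qed
  then show ?case using D by (auto simp: differentiable_def)
qed

text \<open>The exponent is arbitrary in the induction because each derivative lowers it. The cases
  \<open>-1\<close> and \<open>1/2\<close> supply inverses and square roots, hence smoothness of
  \<open>norm\<close> and \<open>sgn\<close>.\<close>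

lemma Ck_on_powr: "Ck_on k {0<..} (%x::real. x powr a)"
proof (induction k arbitrary: a)
  case 0
  then show ?case by (auto intro!: continuous_intros)
next
  case (Suc k)
  have D: "((%x. x powr a) has_derivative (%v. v * (a * x powr (a - 1)))) (at x)" if "x > 0" for x :: real
    using has_real_derivative_powr[OF that, of a, unfolded has_field_derivative_def]
    by (rule has_derivative_eq_rhs) (simp add: fun_eq_iff)
  have "Ck_on k {0<..} (%x. frechet_derivative (%x. x powr a) (at x) v)" for v
    by (rule Ck_on_cong[OF _ _ Ck_on_bilinear[OF _ bounded_bilinear_mult Ck_on_const[of _ _ "v * a"] Suc.IH[of "a-1"]]])
      (auto dest!: D simp: frechet_derivative_at[symmetric])
  then show ?case using D by (auto simp: differentiable_def)
qed

section \<open>Smooth functions and derivatives along vector fields\<close>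

definition Der :: "('a::euclidean_space => 'a) => ('a => 'b::real_normed_vector) => 'a => 'b" where
  "Der Z f x = frechet_derivative f (at x) (Z x)"

lemma smooth_onD:
  assumes "smooth_on S f"
  shows smooth_on_open: "open S"
    and smooth_on_Ck: "Ck_on k S f"
    and smooth_on_continuous: "continuous_on S f"
    and smooth_on_differentiable: "x \<in> S ==> f differentiable (at x)"
    and smooth_on_has_derivative: "x \<in> S ==> (f has_derivative frechet_derivative f (at x)) (at x)"
proof -
  show "open S" "Ck_on k S f" using assms by (auto simp: smooth_on_def)
  show "continuous_on S f" using assms Ck_on_imp_continuous_on by (auto simp: smooth_on_def)
  have "Ck_on 1 S f" using assms by (simp only: smooth_on_def)
  then show "x \<in> S ==> f differentiable (at x)" by simp
  then show "x \<in> S ==> (f has_derivative frechet_derivative f (at x)) (at x)"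
    by (simp add: frechet_derivative_works[symmetric])
qed

lemma smooth_on_cong:
  assumes "smooth_on S f" "!!x. x \<in> S ==> f x = g x" shows "smooth_on S g"
  using assms Ck_on_cong unfolding smooth_on_def by blast

lemma smooth_on_const: "open S ==> smooth_on S (%_. c)"
  and smooth_on_linear: "open S ==> bounded_linear L ==> smooth_on S L"
  and smooth_on_linear_comp: "bounded_linear L2 ==> smooth_on S f ==> smooth_on S (%x. L2 (f x))"
  and smooth_on_add: "smooth_on S f ==> smooth_on S g ==> smooth_on S (%x. f x + g x)"
  and smooth_on_sum: "open S ==> (!!i. i \<in> I ==> smooth_on S (F i)) ==> smooth_on S (%x. \<Sum>i\<in>I. F i x)"
  and smooth_on_bilinear:
    "bounded_bilinear B ==> smooth_on S f1 ==> smooth_on S f2 ==> smooth_on S (%x. B (f1 x) (f2 x))"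
  by (auto simp: smooth_on_def Ck_on_const Ck_on_bounded_linear Ck_on_bounded_linear_comp Ck_on_add
      Ck_on_sum Ck_on_bilinear)

lemma smooth_on_ident: "open S ==> smooth_on S (%x. x)"
  and smooth_on_fst: "open S' ==> smooth_on S' fst"
  and smooth_on_snd: "open S' ==> smooth_on S' snd"
  by (auto intro!: smooth_on_linear bounded_linear_ident bounded_linear_fst bounded_linear_snd)

lemmas smooth_on_scaleR = smooth_on_bilinear[OF bounded_bilinear_scaleR]
lemmas smooth_on_inner = smooth_on_bilinear[OF bounded_bilinear_inner]

lemma bounded_bilinear_cross3: "bounded_bilinear (><)"
  using bilinear_cross bilinear_conv_bounded_bilinear by blast

lemma smooth_on_minus: "smooth_on S f ==> smooth_on S (%x. - f x)"
  using smooth_on_linear_comp[of uminus S f] bounded_linear_minus[OF bounded_linear_ident] by simp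

lemma smooth_on_diff: "smooth_on S f ==> smooth_on S g ==> smooth_on S (%x. f x - g x)"
  using smooth_on_add[of S f "%x. - g x"] smooth_on_minus[of S g] by simp

lemma smooth_on_compose:
  assumes "smooth_on T f" "smooth_on S g" "!!x. x \<in> S ==> g x \<in> T"
  shows "smooth_on S (%x. f (g x))"
  using assms Ck_on_compose[of S T _ f g] by (auto simp: smooth_on_def)

lemma smooth_on_Pair:
  fixes f :: "'a::euclidean_space => 'b::euclidean_space" and g :: "'a => 'c::euclidean_space"
  assumes "smooth_on S f" "smooth_on S g"
  shows "smooth_on S (%x. (f x, g x))"
proof -
  have "smooth_on S (%x. (f x, 0) + (0, g x))"
    using smooth_on_linear_comp[OF bounded_linear_Pair[OF bounded_linear_ident bounded_linear_zero] assms(1)]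
      smooth_on_linear_comp[OF bounded_linear_Pair[OF bounded_linear_zero bounded_linear_ident] assms(2)]
    by (intro smooth_on_add) simp_all
  then show ?thesis by simp
qed

lemma smooth_on_powr:
  assumes "smooth_on S f" "!!x. x \<in> S ==> f x > (0::real)"
  shows "smooth_on S (%x. f x powr a)"
proof -
  have "smooth_on {0<..} (%x. x powr a)" by (simp add: smooth_on_def Ck_on_powr)
  from smooth_on_compose[OF this assms(1)] assms(2) show ?thesis by simp
qed

lemma smooth_on_inverse:
  assumes "smooth_on S f" "!!x. x \<in> S ==> f x > (0::real)"
  shows "smooth_on S (%x. inverse (f x))"
  by (rule smooth_on_cong[OF smooth_on_powr[OF assms, of "-1"]])
    (use assms(2) in \<open>auto simp: powr_minus order_less_imp_le\<close>)

lemma smooth_on_sqrt: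
  assumes "smooth_on S f" "!!x. x \<in> S ==> f x > (0::real)"
  shows "smooth_on S (%x. sqrt (f x))"
  by (rule smooth_on_cong[OF smooth_on_powr[OF assms, of "1/2"]])
    (use assms(2) in \<open>auto simp: powr_half_sqrt order_less_imp_le\<close>)

lemma smooth_on_norm: "smooth_on (- {0}) (norm :: 'a::euclidean_space => real)"
proof -
  have "smooth_on (- {0}) (%x::'a. sqrt (x \<bullet> x))"
    by (intro smooth_on_sqrt smooth_on_inner smooth_on_ident) auto
  then show ?thesis by (simp add: norm_eq_sqrt_inner[abs_def])
qed

lemma smooth_on_sgn: "smooth_on (- {0}) (sgn :: 'a::euclidean_space => 'a)"
proof -
  have "smooth_on (- {0}) (%x::'a. inverse (norm x) *R x)"
    by (intro smooth_on_scaleR smooth_on_inverse smooth_on_norm smooth_on_ident) auto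
  then show ?thesis by (simp add: sgn_div_norm[abs_def])
qed

lemma smooth_on_Der:
  assumes "smooth_on S f" "smooth_on S Z"
  shows "smooth_on S (Der Z f)"
proof -
  have "open S" using assms(1) smooth_on_open by blast
  have *: "smooth_on S (%x. frechet_derivative f (at x) v)" for v
    unfolding smooth_on_def using assms(1) smooth_on_Ck[OF assms(1), of "Suc _"] \<open>open S\<close> by auto
  have "smooth_on S (%x. \<Sum>b\<in>Basis. (Z x \<bullet> b) *R frechet_derivative f (at x) b)"
    by (intro smooth_on_sum \<open>open S\<close> smooth_on_scaleR * smooth_on_linear_comp[OF bounded_linear_inner_left] assms)
  then show ?thesis
    by (rule smooth_on_cong)
      (simp add: Der_def linear_frechet_derivative_Basis[of f _ "Z _", symmetric]
        smooth_on_differentiable[OF assms(1)])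
qed

lemma Der_eqI: "(f has_derivative D) (at x) ==> Der Z f x = D (Z x)"
  by (simp add: Der_def frechet_derivative_at[symmetric])

lemma Der_const [simp]: "Der Z (%_. c) x = 0"
  by (rule Der_eqI) simp

lemma Der_bilinear:
  assumes "bounded_bilinear B" "f differentiable (at x)" "g differentiable (at x)"
  shows "Der Z (%x. B (f x) (g x)) x = B (f x) (Der Z g x) + B (Der Z f x) (g x)"
  unfolding Der_def[of _ f] Der_def[of _ g]
  by (rule Der_eqI, rule bounded_bilinear.FDERIV[OF assms(1)])
    (use assms in \<open>simp_all add: frechet_derivative_works[symmetric]\<close>)

lemma Der_linear_comp:
  assumes "bounded_linear L" "f differentiable (at x)"
  shows "Der Z (%x. L (f x)) x = L (Der Z f x)"
  unfolding Der_def[of _ f]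
  by (rule Der_eqI, rule bounded_linear.has_derivative[OF assms(1)])
    (use assms in \<open>simp_all add: frechet_derivative_works[symmetric]\<close>)

lemma Der_add:
  assumes "f differentiable (at x)" "g differentiable (at x)"
  shows "Der Z (%x. f x + g x) x = Der Z f x + Der Z g x"
  unfolding Der_def[of _ f] Der_def[of _ g]
  by (rule Der_eqI, rule has_derivative_add)
    (use assms in \<open>simp_all add: frechet_derivative_works[symmetric]\<close>)

lemma Der_sum:
  assumes "!!i. i \<in> I ==> f i differentiable (at x)"
  shows "Der Z (%x. \<Sum>i\<in>I. f i x) x = (\<Sum>i\<in>I. Der Z (f i) x)"
  unfolding Der_def[of _ "f _"]
  by (rule Der_eqI, rule has_derivative_sum)
    (use assms in \<open>simp_all add: frechet_derivative_works[symmetric]\<close>)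

lemma Der_compose:
  assumes "f differentiable (at (g x))" "g differentiable (at x)"
  shows "Der Z (%x. f (g x)) x = frechet_derivative f (at (g x)) (Der Z g x)"
  unfolding Der_def[of _ g]
  by (rule Der_eqI, rule has_derivative_compose[of g _ x UNIV f])
    (use assms in \<open>simp_all add: frechet_derivative_works[symmetric]\<close>)

lemma Der_cong:
  assumes "open S" "x \<in> S" "!!y. y \<in> S ==> f y = g y"
  shows "Der Z f x = Der Z g x"
  using frechet_derivative_cong_open[OF assms] by (simp add: Der_def)

section \<open>Rotation fields on the sphere\<close>

definition rot :: "real^3 => (real^3 => 'b::real_normed_vector) => real^3 => 'b" where
  "rot a = Der (%y. a >< y)"

text \<open>Smooth functions on the sphere, extended constantly along rays. The extension makes all
  derivatives those of \<open>real^3\<close>, and the class is stable under \<open>rot\<close> since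
  rotation fields scale linearly along rays.\<close>

definition hsmooth :: "(real^3 => 'b::real_normed_vector) => bool" where
  "hsmooth u \<longleftrightarrow> smooth_on (- {0}) u & (\<forall>y. y ~= 0 --> u (sgn y) = u y)"

lemma sgn_sgn_vector: "sgn (sgn y) = sgn y" for y :: "'a::real_normed_vector"
  by (cases "y = 0") (simp_all add: sgn_div_norm)

lemma hsmooth_sgn_comp: "smooth_on_S2 f \<longleftrightarrow> hsmooth (%y. f (sgn y))"
  by (auto simp: smooth_on_S2_def hsmooth_def sgn_sgn_vector)

lemma hsmooth_imp_smooth_on_S2:
  assumes "hsmooth u" shows "smooth_on_S2 u"
  unfolding smooth_on_S2_def
  by (rule smooth_on_cong[of _ u]) (use assms in \<open>auto simp: hsmooth_def\<close>)

lemma hsmooth_differentiable: "hsmooth u ==> y ~= 0 ==> u differentiable (at y)"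
  by (auto simp: hsmooth_def intro!: smooth_on_differentiable)

lemma hsmooth_const: "hsmooth (%_. c)"
  by (auto simp: hsmooth_def intro: smooth_on_const)

lemma hsmooth_sgn: "hsmooth sgn"
  by (auto simp: hsmooth_def sgn_sgn_vector intro: smooth_on_sgn)

lemma hsmooth_add: "hsmooth u ==> hsmooth v ==> hsmooth (%x. u x + v x)"
  by (auto simp: hsmooth_def intro: smooth_on_add)

lemma hsmooth_sum: "(!!i. i \<in> I ==> hsmooth (u i)) ==> hsmooth (%x. \<Sum>i\<in>I. u i x)"
  by (auto simp: hsmooth_def intro!: smooth_on_sum sum.cong)

lemma hsmooth_bilinear: "bounded_bilinear B ==> hsmooth u ==> hsmooth v ==> hsmooth (%x. B (u x) (v x))"
  by (auto simp: hsmooth_def intro: smooth_on_bilinear)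

lemmas hsmooth_scaleR = hsmooth_bilinear[OF bounded_bilinear_scaleR]
lemmas hsmooth_mult = hsmooth_bilinear[OF bounded_bilinear_mult]
lemma hsmooth_linear_comp: "bounded_linear L ==> hsmooth u ==> hsmooth (%x. L (u x))"
  by (auto simp: hsmooth_def intro: smooth_on_linear_comp)

lemma hsmooth_diff: "hsmooth u ==> hsmooth v ==> hsmooth (%x. u x - v x)"
  by (auto simp: hsmooth_def intro: smooth_on_diff)

lemma hsmooth_cong:
  assumes "hsmooth u" "!!y. y ~= 0 ==> u y = v y" shows "hsmooth v"
  unfolding hsmooth_def
proof safe
  show "smooth_on (- {0}) v" by (rule smooth_on_cong[of _ u]) (use assms in \<open>auto simp: hsmooth_def\<close>)
  show "v (sgn y) = v y" if "y ~= 0" for y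
    using that assms(2)[of y] assms(2)[of "sgn y"] assms(1) by (auto simp: hsmooth_def sgn_zero_iff)
qed

lemma cross_inner_zero: "y \<bullet> (a >< y) = 0" "x \<bullet> (x >< y) = 0" "(a >< y) \<bullet> y = 0" "(x >< y) \<bullet> x = 0"
  by (simp_all add: dot_cross_self)

text \<open>The derivative of the factor \<open>inverse (norm y)\<close> vanishes along
  \<open>a >< y\<close>, which is orthogonal to \<open>y\<close>; so \<open>sgn\<close> carries the
  rotation field at \<open>y\<close> to the one at \<open>sgn y\<close>.\<close>

lemma rot_sgn:
  assumes "y ~= 0" shows "rot a sgn y = a >< sgn y"
proof -
  have "((%y. inverse (norm y) *R y) has_derivative
      (%h. inverse (norm y) *R h + (- (inverse (norm y) * (sgn y \<bullet> h) * inverse (norm y))) *R y)) (at y)"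
    by (rule derivative_eq_intros has_derivative_norm assms refl | simp add: assms inner_commute)+
  then have "(sgn has_derivative
      (%h. inverse (norm y) *R h + (- (inverse (norm y) * (sgn y \<bullet> h) * inverse (norm y))) *R y)) (at y)"
    by (simp add: sgn_div_norm[abs_def])
  from Der_eqI[OF this, of "%y. a >< y"] show ?thesis
    by (simp add: rot_def sgn_div_norm cross_inner_zero cross_mult_right)
qed

lemma smooth_rot_field: "smooth_on (- {0}) (%y. a >< y)"
  using bounded_bilinear.bounded_linear_right[OF bounded_bilinear_cross3] by (intro smooth_on_linear) auto

lemma rot_homogeneous:
  assumes "hsmooth u" "y ~= 0" shows "rot a u (sgn y) = rot a u y"
proof -
  have s: "sgn y ~= 0" using assms(2) by (simp add: sgn_zero_iff)
  have "rot a u y = rot a (%y. u (sgn y)) y"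
    unfolding rot_def using assms by (intro Der_cong[of "- {0}"]) (auto simp: hsmooth_def)
  also have "... = frechet_derivative u (at (sgn y)) (rot a sgn y)"
    unfolding rot_def
    by (rule Der_compose) (use assms s hsmooth_differentiable hsmooth_sgn in auto)
  also have "... = rot a u (sgn y)"
    by (simp add: rot_sgn[OF assms(2)]) (simp add: rot_def Der_def)
  finally show ?thesis by simp
qed

lemma hsmooth_rot: "hsmooth u ==> hsmooth (rot a u)"
  using rot_homogeneous[of u] smooth_on_Der[OF _ smooth_rot_field, of u a] by (auto simp: hsmooth_def rot_def)

lemma rot_const [simp]: "rot a (%_. c) y = 0"
  by (simp add: rot_def)

lemma rot_add: "hsmooth u ==> hsmooth v ==> y ~= 0 ==> rot a (%x. u x + v x) y = rot a u y + rot a v y"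
  unfolding rot_def by (intro Der_add hsmooth_differentiable)

lemma rot_sum: "(!!i. i \<in> I ==> hsmooth (u i)) ==> y ~= 0 ==>
    rot a (%x. \<Sum>i\<in>I. u i x) y = (\<Sum>i\<in>I. rot a (u i) y)"
  unfolding rot_def by (intro Der_sum hsmooth_differentiable)

lemma rot_bilinear: "bounded_bilinear B ==> hsmooth u ==> hsmooth v ==> y ~= 0 ==>
    rot a (%x. B (u x) (v x)) y = B (u y) (rot a v y) + B (rot a u y) (v y)"
  unfolding rot_def by (intro Der_bilinear hsmooth_differentiable)

lemmas rot_scaleR = rot_bilinear[OF bounded_bilinear_scaleR]
lemmas rot_mult = rot_bilinear[OF bounded_bilinear_mult]
lemma rot_linear_comp: "bounded_linear L ==> hsmooth u ==> y ~= 0 ==> rot a (%x. L (u x)) y = L (rot a u y)"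
  unfolding rot_def by (intro Der_linear_comp hsmooth_differentiable)

lemma rot_cong: "y ~= 0 ==> (!!y. y ~= 0 ==> u y = v y) ==> rot a u y = rot a v y"
  unfolding rot_def by (rule Der_cong[of "- {0}"]) auto

lemma S2_nonzero: "x \<in> S2 ==> x ~= 0" and S2_sgn: "x \<in> S2 ==> sgn x = x"
  and sgn_in_S2: "y ~= 0 ==> sgn y \<in> S2"
  by (auto simp: sgn_div_norm)

lemma tangent_cross_cross:
  assumes "x \<in> S2" "v \<bullet> x = 0" shows "(x >< v) >< x = v"
proof -
  have "x \<bullet> x = 1" using assms by (simp add: norm_eq_1)
  moreover have "(x >< v) >< x = (x \<bullet> x) *R v - (v \<bullet> x) *R x"
    by (simp add: cross3_simps forall_3)
  ultimately show ?thesis using assms by simp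
qed

text \<open>The sphere has no global frame. The three rotation fields span each tangent plane
  redundantly; reading the coefficients off the rotation vector \<open>x >< v\<close> makes them
  depend smoothly on \<open>x\<close> and \<open>v\<close>.\<close>

lemma tangent_rot_representation:
  assumes "x \<in> S2" "v \<bullet> x = 0"
  shows "v = (\<Sum>b\<in>Basis. ((x >< v) \<bullet> b) *R (b >< x))"
proof -
  have "(\<Sum>b\<in>Basis. ((x >< v) \<bullet> b) *R (b >< x)) = (\<Sum>b\<in>Basis. ((x >< v) \<bullet> b) *R b) >< x"
    by (simp add: bounded_bilinear.sum_left[OF bounded_bilinear_cross3] cross_mult_left)
  also have "... = v"
    using tangent_cross_cross[OF assms] by (simp add: euclidean_representation)
  finally show ?thesis ..
qed

lemma frechet_tangent_rot:
  assumes "u differentiable (at x)" "x \<in> S2" "v \<bullet> x = 0"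
  shows "frechet_derivative u (at x) v = (\<Sum>b\<in>Basis. ((x >< v) \<bullet> b) *R rot b u x)"
proof -
  have l: "linear (frechet_derivative u (at x))"
    using assms by (intro linear_frechet_derivative)
  have "frechet_derivative u (at x) v =
      frechet_derivative u (at x) (\<Sum>b\<in>Basis. ((x >< v) \<bullet> b) *R (b >< x))"
    using tangent_rot_representation[OF assms(2,3)] by simp
  also have "... = (\<Sum>b\<in>Basis. ((x >< v) \<bullet> b) *R rot b u x)"
    by (simp add: linear_sum[OF l] linear_cmul[OF l] rot_def Der_def)
  finally show ?thesis .
qed

lemma hsmooth_continuous_on: "hsmooth u ==> continuous_on S2 u"
  by (rule continuous_on_subset[of "- {0}"]) (auto simp: hsmooth_def intro: smooth_on_continuous)

lemma continuous_on_S2_bounded: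
  fixes u :: "real^3 => 'b::real_normed_vector"
  assumes "continuous_on S2 u" obtains B where "B > 0" "!!x. x \<in> S2 ==> norm (u x) <= B"
proof -
  have "bounded (u ` S2)" using assms by (intro compact_imp_bounded compact_continuous_image) auto
  then obtain B where "B > 0" "\<forall>y\<in>u ` S2. norm y <= B" by (auto simp: bounded_pos)
  with that show ?thesis by auto
qed

section \<open>The surface measure\<close>

definition cone_over :: "(real^3) set => (real^3) set" where
  "cone_over A = {y \<in> ball 0 1 - {0}. sgn y \<in> A}"

lemma space_S2_measure [simp]: "space mu = S2"
  and sets_S2_measure [measurable_cong]: "sets mu = sets (restrict_space borel S2)"
  by (simp_all add: S2_measure_def space_scale_measure space_restrict_space)

lemma sets_S2_measure_iff: "A \<in> sets mu \<longleftrightarrow> A \<subseteq> S2 & A \<in> sets borel"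
  by (auto simp: sets_S2_measure sets_restrict_space_iff)

lemma borel_measurable_sgn_vec [measurable]: "(sgn :: 'a::euclidean_space => 'a) \<in> borel_measurable borel"
  by (simp add: sgn_div_norm[abs_def])

lemma cone_over_sets: "A \<in> sets borel ==> cone_over A \<in> sets borel"
proof -
  assume [measurable]: "A \<in> sets borel"
  have "sgn -` A \<inter> space borel \<in> sets (borel :: (real^3) measure)"
    by (rule measurable_sets[OF borel_measurable_sgn_vec]) fact
  moreover have "cone_over A = (ball 0 1 - {0}) \<inter> sgn -` A" by (auto simp: cone_over_def)
  ultimately show ?thesis by simp
qed

lemma cone_over_lmeasurable: "A \<in> sets borel ==> cone_over A \<in> lmeasurable"
  by (rule bounded_set_imp_lmeasurable)
    (auto simp: cone_over_sets intro!: bounded_subset[OF bounded_ball[of 0 1]] simp: cone_over_def)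

lemma emeasure_S2_measure:
  assumes "A \<in> sets mu"
  shows "emeasure mu A = 3 * emeasure lborel (cone_over A)"
proof -
  have m: "sgn \<in> measurable (restrict_space lborel (ball 0 1 - {0})) (restrict_space borel S2)"
    by (rule measurable_restrict_space2)
      (auto simp: space_restrict_space sgn_div_norm intro!: measurable_restrict_space1)
  have A: "A \<in> sets (restrict_space borel S2)" using assms by (simp add: sets_S2_measure)
  show ?thesis
    unfolding S2_measure_def emeasure_scale_measure emeasure_distr[OF m A]
    by (subst emeasure_restrict_space) (auto simp: cone_over_def space_restrict_space intro!: arg_cong[where f="emeasure lborel"] arg_cong[where f="(*) 3"])
qed

lemma measure_S2_measure:
  assumes "A \<in> sets mu"
  shows "measure mu A = 3 * measure lebesgue (cone_over A)"
  using emeasure_S2_measure[OF assms] assms cone_over_sets[of A]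
  by (simp add: measure_def enn2real_mult sets_S2_measure_iff)

lemma finite_measure_S2: "finite_measure mu"
proof
  have "emeasure mu (space mu) = 3 * emeasure lborel (cone_over S2)"
    using emeasure_S2_measure[OF sets.top[of mu]] by simp
  moreover have "emeasure lborel (cone_over S2) < \<infinity>"
    using cone_over_lmeasurable[of S2] cone_over_sets[of S2] by (auto simp: fmeasurable_def)
  ultimately show "emeasure mu (space mu) ~= \<infinity>"
    by (simp add: ennreal_mult_eq_top_iff less_top[symmetric])
qed

interpretation S2: finite_measure mu by (rule finite_measure_S2)

lemma measurable_S2_continuous:
  fixes f :: "real^3 => 'b::topological_space"
  shows "continuous_on S2 f ==> f \<in> borel_measurable mu"
  using borel_measurable_continuous_on_restrict[of S2 f]
  by (simp cong: measurable_cong_sets add: measurable_cong_sets[OF sets_S2_measure refl])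

lemma integrable_S2_continuous:
  fixes f :: "real^3 => 'b::{banach,second_countable_topology}"
  assumes "continuous_on S2 f" shows "integrable mu f"
proof -
  obtain B where "!!x. x \<in> S2 ==> norm (f x) <= B" using continuous_on_S2_bounded[OF assms] by metis
  then show ?thesis
    by (intro S2.integrable_const_bound[of _ B] measurable_S2_continuous assms) auto
qed

lemma integrable_S2_mult_continuous:
  fixes f :: "real^3 => 'b::{banach,second_countable_topology}"
  assumes "continuous_on S2 c" "integrable mu f"
  shows "integrable mu (%x. c x *R f x)"
proof -
  obtain B where B: "!!x. x \<in> S2 ==> norm (c x) <= B" using continuous_on_S2_bounded[OF assms(1)] by metis
  have [measurable]: "c \<in> borel_measurable mu" by (rule measurable_S2_continuous[OF assms(1)])
  show ?thesis
  proof (rule Bochner_Integration.integrable_bound[of _ "%x. B *R f x"])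
    show "AE x in S2_measure. norm (c x *R f x) <= norm (B *R f x)"
      using B by (intro AE_I2) (auto intro!: mult_right_mono intro: order_trans[OF _ abs_ge_self])
  qed (use assms in auto)
qed

lemma measurable_S2_map:
  assumes "continuous_on S2 \<psi>" "\<psi> ` S2 \<subseteq> S2" shows "\<psi> \<in> measurable mu mu"
proof -
  have "\<psi> \<in> measurable mu (restrict_space borel S2)"
    using assms by (intro measurable_restrict_space2 measurable_S2_continuous) auto
  then show ?thesis by (simp add: measurable_cong_sets[OF refl sets_S2_measure])
qed

text \<open>\<open>\<Phi>\<close> extends \<open>\<psi>\<close> homogeneously of degree one and
  preserves norms, so it maps the cone over the preimage of \<open>A\<close> bijectively onto the
  cone over \<open>A\<close>; the claim is then the change of variables formula in
  \<open>real^3\<close>.\<close>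

lemma S2_measure_pullback_le:
  fixes \<Phi> :: "real^3 => real^3"
  assumes der: "!!y. y ~= 0 ==> (\<Phi> has_derivative \<Phi>' y) (at y)"
    and det: "!!y. y ~= 0 ==> c <= \<bar>det (matrix (\<Phi>' y))\<bar>"
    and bij: "bij_betw \<psi> S2 S2" and \<Phi>: "!!y. y ~= 0 ==> \<Phi> y = norm y *R \<psi> (sgn y)"
    and A: "A \<in> sets mu"
  shows "\<psi> \<in> measurable mu mu"
    and "c * measure mu (\<psi> -` A \<inter> S2) <= measure mu A"
proof -
  have cont: "continuous_on S2 \<psi>"
  proof -
    have "continuous_on S2 \<Phi>"
      using der has_derivative_continuous S2_nonzero by (intro continuous_at_imp_continuous_on) blast
    then show ?thesis
      by (rule continuous_on_cong[THEN iffD1, rotated 2]) (auto simp: \<Phi> S2_nonzero S2_sgn)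
  qed
  have im: "\<psi> ` S2 = S2" and inj: "inj_on \<psi> S2" using bij by (auto simp: bij_betw_def)
  have \<psi>n: "norm (\<psi> x) = 1" if "x \<in> S2" for x using im that by auto
  show meas: "\<psi> \<in> measurable mu mu"
    using cont im by (intro measurable_S2_map) auto
  define S where "S = cone_over (\<psi> -` A \<inter> S2)"
  have sA: "\<psi> -` A \<inter> S2 \<in> sets mu" using measurable_sets[OF meas A] by simp
  then have S: "S \<in> lmeasurable" by (auto simp: S_def sets_S2_measure_iff intro: cone_over_lmeasurable)
  have nz: "y ~= 0" if "y \<in> S" for y using that by (auto simp: S_def cone_over_def)
  have sg: "sgn (\<Phi> y) = \<psi> (sgn y)" "norm (\<Phi> y) = norm y" if "y ~= 0" for y
  proof -
    have "norm (\<psi> (sgn y)) = 1" using that sgn_in_S2 \<psi>n by blast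
    then show "sgn (\<Phi> y) = \<psi> (sgn y)" "norm (\<Phi> y) = norm y"
      using that by (simp_all add: \<Phi> sgn_div_norm)
  qed
  have inj\<Phi>: "inj_on \<Phi> S"
  proof
    fix y z assume yz: "y \<in> S" "z \<in> S" "\<Phi> y = \<Phi> z"
    then have "norm y = norm z" "\<psi> (sgn y) = \<psi> (sgn z)" using sg nz by metis+
    then have "norm y = norm z" "sgn y = sgn z"
      using inj_onD[OF inj] yz nz sgn_in_S2 by blast+
    then show "y = z" using sgn_div_norm nz[OF yz(1)] nz[OF yz(2)]
      by (metis norm_eq_zero real_vector.scale_left_imp_eq inverse_nonzero_iff_nonzero)
  qed
  have img: "\<Phi> ` S = cone_over A"
  proof safe
    fix y assume "y \<in> S" then show "\<Phi> y \<in> cone_over A"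
      using sg[of y] by (auto simp: S_def cone_over_def)
  next
    fix z assume z: "z \<in> cone_over A"
    then have z0: "z ~= 0" by (auto simp: cone_over_def)
    obtain x where x: "x \<in> S2" "\<psi> x = sgn z" using sgn_in_S2[OF z0] im by (metis imageE)
    have s: "sgn (norm z *R x) = x" "norm (norm z *R x) = norm z" "norm z *R x ~= 0"
      using x z0 S2_nonzero[OF x(1)] by (auto simp: sgn_div_norm)
    then have "\<Phi> (norm z *R x) = z" using x z0 by (simp add: \<Phi> sgn_div_norm)
    moreover have "norm z *R x \<in> S" using z s x by (auto simp: S_def cone_over_def)
    ultimately show "z \<in> \<Phi> ` S" by force
  qed
  have derS: "(\<Phi> has_derivative \<Phi>' y) (at y within S)" if "y \<in> S" for y
    using der nz that has_derivative_at_withinI by blast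
  have Sl: "S \<in> sets lebesgue" using S by auto
  have "cone_over A \<in> lmeasurable" using A by (auto simp: sets_S2_measure_iff intro: cone_over_lmeasurable)
  then have int: "(%x. \<bar>det (matrix (\<Phi>' x))\<bar>) integrable_on S"
    using measurable_differentiable_image_eq[OF Sl derS inj\<Phi>] img by simp
  have "c * measure lebesgue S = integral S (%_. c)"
    using S integral_mult_right[of S c "%_. 1"] by (simp add: lmeasure_integral)
  also have "... <= integral S (%x. \<bar>det (matrix (\<Phi>' x))\<bar>)"
  proof (rule integral_le[OF _ int])
    show "(%_. c) integrable_on S"
      using integrable_on_cmult_left[of "%_. 1::real" S c] S by (simp add: lmeasurable_iff_integrable_on)
  qed (use det nz in auto)
  also have "... = measure lebesgue (cone_over A)"
    using measure_differentiable_image_eq[OF Sl derS inj\<Phi> int] img by simp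
  finally show "c * measure mu (\<psi> -` A \<inter> S2) <= measure mu A"
    using measure_S2_measure[OF A] measure_S2_measure[OF sA] by (simp add: S_def)
qed

text \<open>The inequality on sets says that the image measure of \<open>mu\<close> under
  \<open>\<psi>\<close> is dominated by a multiple of \<open>mu\<close>, and the integral is
  monotone in the measure.\<close>

lemma S2_nn_integral_pullback_le:
  assumes meas: "\<psi> \<in> measurable mu mu" and "c > 0"
    and le: "!!A. A \<in> sets mu ==> c * measure mu (\<psi> -` A \<inter> S2) <= measure mu A"
    and f: "f \<in> borel_measurable mu"
  shows "(\<integral>\<^sup>+x. f (\<psi> x) \<partial>mu) <= ennreal (1 / c) * (\<integral>\<^sup>+x. f x \<partial>mu)"
proof -
  have "(\<integral>\<^sup>+x. f (\<psi> x) \<partial>mu) = (\<integral>\<^sup>+x. f x \<partial>distr mu mu \<psi>)"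
    using meas f by (simp add: nn_integral_distr)
  also have "... <= (\<integral>\<^sup>+x. f x \<partial>scale_measure (ennreal (1/c)) mu)"
  proof (rule nn_integral_mono_measure)
    show "distr mu mu \<psi> <= scale_measure (ennreal (1/c)) mu"
    proof (rule less_eq_measure.intros(3))
      show "emeasure (distr mu mu \<psi>) <= emeasure (scale_measure (ennreal (1/c)) mu)"
      proof (rule le_funI)
        fix A show "emeasure (distr mu mu \<psi>) A <= emeasure (scale_measure (ennreal (1/c)) mu) A"
        proof (cases "A \<in> sets mu")
          case True
          have "measure mu (\<psi> -` A \<inter> S2) <= 1 / c * measure mu A"
            using le[OF True] \<open>c > 0\<close> by (simp add: field_simps)
          then show ?thesis using True meas \<open>c > 0\<close>
            by (simp add: emeasure_distr S2.emeasure_eq_measure ennreal_mult[symmetric] ennreal_leI)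
        qed (simp add: emeasure_notin_sets)
      qed
    qed (auto simp: space_scale_measure)
  qed simp
  also have "... = ennreal (1 / c) * (\<integral>\<^sup>+x. f x \<partial>mu)"
    by (rule nn_integral_scale_measure[OF f])
  finally show ?thesis .
qed

lemma S2_measure_orthogonal_image:
  assumes R: "orthogonal_transformation (R :: real^3 => real^3)"
  shows "R \<in> measurable mu mu" "distr mu mu R = mu"
proof -
  have n: "norm (R x) = norm x" for x using R by (simp add: orthogonal_transformation_norm)
  have lin: "linear R" using R by (rule orthogonal_transformation_linear)
  show m: "R \<in> measurable mu mu"
    using n lin by (intro measurable_S2_map linear_continuous_on) (auto simp: linear_conv_bounded_linear)
  show "distr mu mu R = mu"
  proof (rule measure_eqI)
    fix A assume "A \<in> sets (distr mu mu R)"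
    then have A: "A \<in> sets mu" by simp
    have sA: "R -` A \<inter> S2 \<in> sets mu" using measurable_sets[OF m A] by simp
    have "R ` cone_over (R -` A \<inter> S2) = cone_over A"
    proof safe
      fix y assume "y \<in> cone_over (R -` A \<inter> S2)"
      then show "R y \<in> cone_over A"
        using n[of y] by (auto simp: cone_over_def sgn_div_norm linear_cmul[OF lin])
    next
      fix z assume z: "z \<in> cone_over A"
      obtain y where y: "R y = z" using R by (metis orthogonal_transformation_surj surj_def)
      then have "y ~= 0" "norm y = norm z" "R (sgn y) = sgn z"
        using z n[of y] by (auto simp: cone_over_def sgn_div_norm linear_cmul[OF lin] linear_0[OF lin])
      then have "y \<in> cone_over (R -` A \<inter> S2)" using z sgn_in_S2[of y] by (auto simp: cone_over_def)
      then show "z \<in> R ` cone_over (R -` A \<inter> S2)" using y by blast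
    qed
    then have "measure lebesgue (cone_over A) = measure lebesgue (cone_over (R -` A \<inter> S2))"
      using measure_orthogonal_image[OF R cone_over_lmeasurable[of "R -` A \<inter> S2"]] sA
      by (simp add: sets_S2_measure_iff)
    then show "emeasure (distr mu mu R) A = emeasure mu A"
      using m A sA by (simp add: emeasure_distr S2.emeasure_eq_measure measure_S2_measure)
  qed simp
qed

lemma S2_integral_orthogonal:
  fixes f :: "real^3 => 'b::{banach,second_countable_topology}"
  assumes R: "orthogonal_transformation R" and f: "f \<in> borel_measurable mu"
  shows "(\<integral>x. f (R x) \<partial>mu) = (\<integral>x. f x \<partial>mu)"
  using integral_distr[OF S2_measure_orthogonal_image(1)[OF R] f] S2_measure_orthogonal_image(2)[OF R] by simp

text \<open>Rodrigues' formula for the rotation about the unit vector \<open>a\<close> through the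
  angle \<open>t\<close>; it is the flow of the field \<open>a >< x\<close>.\<close>

definition axis_rotation :: "real^3 => real => real^3 => real^3" where
  "axis_rotation a t x = cos t *R x + sin t *R (a >< x) + ((1 - cos t) * (a \<bullet> x)) *R a"

lemma orthogonal_axis_rotation:
  assumes "norm a = 1" shows "orthogonal_transformation (axis_rotation a t)"
  unfolding orthogonal_transformation
proof
  show "linear (axis_rotation a t)"
    by (rule linearI) (simp_all add: axis_rotation_def cross_add_right cross_mult_right algebra_simps inner_add_right)
  show "\<forall>v. norm (axis_rotation a t v) = norm v"
  proof
    fix x :: "real^3"
    have a: "a \<bullet> a = 1" using assms by (simp add: norm_eq_1)
    have c: "(a >< x) \<bullet> (a >< x) = x \<bullet> x - (a \<bullet> x)\<^sup>2"
      using norm_cross_dot[of a x] assms by (simp add: power2_norm_eq_inner[symmetric] power_mult_distrib)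
    have "axis_rotation a t x \<bullet> axis_rotation a t x = (cos t)\<^sup>2 * (x \<bullet> x) + (sin t)\<^sup>2 * (x \<bullet> x - (a \<bullet> x)\<^sup>2)
       + ((1 - cos t) * (a \<bullet> x))\<^sup>2 + 2 * cos t * (1 - cos t) * (a \<bullet> x)\<^sup>2"
      by (simp add: axis_rotation_def inner_add_left inner_add_right a c cross_inner_zero inner_commute[of x a]
          inner_commute[of x "a >< x"] inner_commute[of "a >< x" a] power2_eq_square algebra_simps)
    also have "... = ((sin t)\<^sup>2 + (cos t)\<^sup>2) * (x \<bullet> x) - ((sin t)\<^sup>2 + (cos t)\<^sup>2 - 1) * (a \<bullet> x)\<^sup>2"
      by algebra
    finally show "norm (axis_rotation a t x) = norm x" by (simp add: norm_eq_sqrt_inner)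
  qed
qed

lemma has_derivative_axis_rotation:
  assumes "norm a = 1"
  shows "((%t. axis_rotation a t x) has_derivative (%h. h *R (a >< axis_rotation a t x))) (at t within T)"
proof -
  have a: "a \<bullet> a = 1" using assms by (simp add: norm_eq_1)
  have cc: "a >< (a >< x) = (a \<bullet> x) *R a - (a \<bullet> a) *R x"
    by (simp add: cross3_simps forall_3)
  have "((%t. axis_rotation a t x) has_vector_derivative
      (- sin t) *R x + cos t *R (a >< x) + (sin t * (a \<bullet> x)) *R a) (at t within T)"
    unfolding axis_rotation_def by (rule derivative_eq_intros refl | simp)+
  moreover have "(- sin t) *R x + cos t *R (a >< x) + (sin t * (a \<bullet> x)) *R a = a >< axis_rotation a t x"
    by (simp add: axis_rotation_def cross_add_right cross_mult_right bounded_bilinear.diff_right[OF bounded_bilinear_cross3] cc a algebra_simps)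
  ultimately show ?thesis by (simp add: has_vector_derivative_def)
qed

text \<open>The flow of the field preserves \<open>mu\<close>, so difference quotients of
  \<open>u\<close> along it have integral zero, and dominated convergence passes to the derivative.
  In other words rotation fields are divergence free for \<open>mu\<close>; all integration by parts
  below rests on this.\<close>

lemma integral_rot:
  fixes u :: "real^3 => 'b::euclidean_space"
  assumes u: "hsmooth u" and a: "norm a = 1"
  shows "(\<integral>x. rot a u x \<partial>mu) = 0"
proof -
  let ?R = "axis_rotation a"
  have inS2: "?R t x \<in> S2" if "x \<in> S2" for t x
    using orthogonal_transformation_norm[OF orthogonal_axis_rotation[OF a]] that by simp
  obtain B where B: "!!x. x \<in> S2 ==> norm (rot a u x) <= B"
    using continuous_on_S2_bounded[OF hsmooth_continuous_on[OF hsmooth_rot[OF u]]] by metis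
  have der: "((%t. u (?R t x)) has_derivative (%h. h *R rot a u (?R t x))) (at t within T)" if "x \<in> S2" for x t T
  proof -
    have "(u has_derivative frechet_derivative u (at (?R t x))) (at (?R t x))"
      using hsmooth_differentiable[OF u S2_nonzero[OF inS2[OF that]]] by (simp add: frechet_derivative_works[symmetric])
    from has_derivative_compose[OF has_derivative_axis_rotation[OF a] this, of T]
    show ?thesis
      using linear_cmul[OF linear_frechet_derivative[OF hsmooth_differentiable[OF u S2_nonzero[OF inS2[OF that]]]]]
      by (simp add: rot_def Der_def)
  qed
  define s where "s n = inverse (real (Suc n))" for n
  have s: "s n > 0" for n by (simp add: s_def)
  have s0: "s \<longlonglongrightarrow> 0" unfolding s_def by (rule LIMSEQ_inverse_real_of_nat)
  define g where "g n x = (1 / s n) *R (u (?R (s n) x) - u x)" for n x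
  have R0: "?R 0 x = x" for x by (simp add: axis_rotation_def)
  have mu: "u \<in> borel_measurable mu" by (intro measurable_S2_continuous hsmooth_continuous_on u)
  have iu: "integrable mu u" by (intro integrable_S2_continuous hsmooth_continuous_on u)
  have iuR: "integrable mu (%x. u (?R t x))" for t
    by (rule integrable_distr[OF S2_measure_orthogonal_image(1)[OF orthogonal_axis_rotation[OF a]]])
      (simp add: S2_measure_orthogonal_image(2)[OF orthogonal_axis_rotation[OF a]] iu)
  have "(%n. \<integral>x. g n x \<partial>mu) \<longlonglongrightarrow> (\<integral>x. rot a u x \<partial>mu)"
  proof (rule integral_dominated_convergence[where w="%_. B"])
    show "rot a u \<in> borel_measurable mu"
      by (intro measurable_S2_continuous hsmooth_continuous_on hsmooth_rot u)
    show "g n \<in> borel_measurable mu" for n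
      unfolding g_def using iu iuR by (auto intro!: borel_measurable_integrable)
    show "AE x in S2_measure. (%n. g n x) \<longlonglongrightarrow> rot a u x"
    proof (rule AE_I2)
      fix x assume "x \<in> space mu"
      then have "((%t. (1 / norm (t - 0)) *R (u (?R t x) - (u (?R 0 x) + (t - 0) *R rot a u x))) \<longlongrightarrow> 0) (at 0)"
        using der[of x 0 UNIV] unfolding has_derivative_at2 by (simp add: R0)
      then have "(%n. (1 / norm (s n - 0)) *R (u (?R (s n) x) - (u (?R 0 x) + (s n - 0) *R rot a u x))) \<longlonglongrightarrow> 0"
        by (rule filterlim_compose) (use s0 s in \<open>auto simp: filterlim_at less_imp_neq[THEN not_sym]\<close>)
      also have "(%n. (1 / norm (s n - 0)) *R (u (?R (s n) x) - (u (?R 0 x) + (s n - 0) *R rot a u x)))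
          = (%n. g n x - rot a u x)"
        using s by (simp add: g_def R0 fun_eq_iff abs_of_pos scaleR_diff_right scaleR_add_right less_imp_neq[THEN not_sym])
      finally show "(%n. g n x) \<longlonglongrightarrow> rot a u x" by (simp add: LIM_zero_iff)
    qed
    \<comment> \<open>The mean value inequality bounds every quotient by the bound \<open>B\<close>
      for the derivative over the whole sphere, as the flow stays on it.\<close>
    show "AE x in S2_measure. norm (g n x) <= B" for n
    proof (rule AE_I2)
      fix x assume "x \<in> space mu"
      then have x: "x \<in> S2" by simp
      have "norm (u (?R (s n) x) - u (?R 0 x)) <= B * norm (s n - 0)"
      proof (rule differentiable_bound[of "{0..s n}"])
        show "((%t. u (?R t x)) has_derivative (%h. h *R rot a u (?R t x))) (at t within {0..s n})" for t
          using der[OF x] by blast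
        show "onorm (%h. h *R rot a u (?R t x)) <= B" for t
          by (rule onorm_le) (use B[OF inS2[OF x, of t]] in \<open>auto simp: mult.commute[of _ "norm (rot _ _ _)"] intro!: mult_right_mono\<close>)
      qed (use s[of n] in auto)
      then show "norm (g n x) <= B"
        unfolding g_def norm_scaleR using s[of n] by (simp add: R0 pos_divide_le_eq)
    qed
  qed simp
  moreover have "(\<integral>x. g n x \<partial>mu) = 0" for n
    unfolding g_def using iu iuR S2_integral_orthogonal[OF orthogonal_axis_rotation[OF a] mu]
    by (simp add: Bochner_Integration.integral_diff)
  ultimately show ?thesis by (simp add: LIMSEQ_const_iff)
qed

text \<open>The cone over the cap is open and contains \<open>(1/2) *R x\<close>, hence is not a
  null set. This bounds the mass of the zonal kernels from below.\<close>

lemma S2_cap_pos: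
  assumes "x \<in> S2" "\<delta> > 0"
  shows "measure mu {y \<in> S2. x \<bullet> y > 1 - \<delta>} > 0"
proof -
  let ?A = "{y \<in> S2. x \<bullet> y > 1 - \<delta>}"
  have op: "open {y. x \<bullet> y > 1 - \<delta>}" by (intro open_Collect_less continuous_intros)
  have A: "?A \<in> sets mu"
    using op by (auto simp: sets_S2_measure_iff Collect_conj_eq intro!: sets.Int)
  have "cone_over ?A = (ball 0 1 - {0}) \<inter> (sgn -` {y. x \<bullet> y > 1 - \<delta>} \<inter> - {0})"
    using sgn_in_S2 by (auto simp: cone_over_def)
  moreover have "open (sgn -` {y. x \<bullet> y > 1 - \<delta>} \<inter> - {0})"
    using continuous_on_open_vimage[of "- {0}" "sgn :: real^3 => real^3"] smooth_on_continuous[OF smooth_on_sgn]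
      op by (metis open_Compl closed_singleton)
  ultimately have o: "open (cone_over ?A)" by auto
  have "norm x = 1" "x \<bullet> x = 1" using assms by (simp_all add: norm_eq_1)
  then have "(1/2) *R x \<in> cone_over ?A"
    using assms S2_nonzero by (auto simp: cone_over_def sgn_div_norm)
  then have "\<not> negligible (cone_over ?A)" using open_not_negligible[OF o] by auto
  moreover have "cone_over ?A \<in> lmeasurable"
    using A by (intro cone_over_lmeasurable) (simp add: sets_S2_measure_iff)
  ultimately have "measure lebesgue (cone_over ?A) ~= 0"
    by (simp add: negligible_iff_measure0)
  then have "measure lebesgue (cone_over ?A) > 0"
    by (simp add: zero_less_measure_iff)
  then show ?thesis using measure_S2_measure[OF A] by simp
qed

section \<open>\<open>L\<^sup>p\<close> functions on the sphere\<close>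

definition lp :: "real => (real^3 => 'b::euclidean_space) => bool" where
  "lp p f \<longleftrightarrow> f \<in> borel_measurable mu & integrable mu (%x. norm (f x) powr p)"

text \<open>The p-th power of the norm, without the root: it behaves additively under integrals, and
  a pullback multiplies it by at most a factor that does not involve \<open>p\<close>. The price is
  the factor \<open>2 powr p\<close> in the triangle inequality, harmless where only equivalence of
  norms matters.\<close>

definition Lp :: "real => (real^3 => 'b::euclidean_space) => real" where
  "Lp p f = (\<integral>x. norm (f x) powr p \<partial>mu)"

lemma Lp_nonneg: "Lp p f >= 0"
  by (simp add: Lp_def)

lemma lp_measurable: "lp p f ==> f \<in> borel_measurable mu"
  by (simp add: lp_def)

lemma lp_continuous: "continuous_on S2 f ==> 0 <= p ==> lp p f"
  unfolding lp_def
proof (intro conjI measurable_S2_continuous)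
  assume f: "continuous_on S2 f" and p: "0 <= p"
  obtain B where B: "B > 0" "!!x. x \<in> S2 ==> norm (f x) <= B" using continuous_on_S2_bounded[OF f] by metis
  have [measurable]: "f \<in> borel_measurable mu" by (rule measurable_S2_continuous[OF f])
  show "integrable mu (%x. norm (f x) powr p)"
    by (rule S2.integrable_const_bound[of _ "B powr p"]) (use B p in \<open>auto intro!: AE_I2 powr_mono2\<close>)
qed

lemma lp_mono:
  assumes f: "lp p f" and g: "g \<in> borel_measurable mu" and p: "p >= 0" and B: "B >= 0"
    and le: "AE x in S2_measure. norm (g x) <= B * norm (f x)"
  shows "lp p g" "Lp p g <= B powr p * Lp p f"
proof -
  have i: "integrable mu (%x. B powr p * norm (f x) powr p)" using f by (simp add: lp_def)
  have le': "AE x in S2_measure. norm (g x) powr p <= B powr p * norm (f x) powr p"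
    using le by (rule AE_mp) (auto intro!: AE_I2 simp: powr_mult[symmetric] B p intro: powr_mono2)
  show "lp p g" unfolding lp_def
  proof
    show "integrable mu (%x. norm (g x) powr p)"
      by (rule Bochner_Integration.integrable_bound[OF i]) (use g le' in \<open>auto elim: AE_mp\<close>)
  qed fact
  then show "Lp p g <= B powr p * Lp p f"
    unfolding Lp_def integral_mult_right_zero[symmetric]
    using i le' by (intro integral_mono_AE) (auto simp: lp_def)
qed

lemma lp_cong_AE:
  assumes "lp p f" "g \<in> borel_measurable mu" "AE x in S2_measure. f x = g x"
  shows "lp p g" "Lp p g = Lp p f"
proof -
  have [measurable]: "f \<in> borel_measurable mu" "g \<in> borel_measurable mu"
    using assms by (auto simp: lp_def)
  have ae: "AE x in S2_measure. norm (f x) powr p = norm (g x) powr p"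
    using assms(3) by (rule AE_mp) simp
  have "integrable mu (%x. norm (f x) powr p) = integrable mu (%x. norm (g x) powr p)"
    by (rule integrable_cong_AE) (use ae in auto)
  then show "lp p g" using assms by (simp add: lp_def)
  show "Lp p g = Lp p f" unfolding Lp_def
    by (rule integral_cong_AE) (use assms(3) in \<open>auto elim: AE_mp\<close>)
qed

lemma lp_cong_S2: "lp p f ==> (!!x. x \<in> S2 ==> f x = g x) ==> lp p g"
  and Lp_cong_S2: "(!!x. x \<in> S2 ==> f x = g x) ==> Lp p f = Lp p g"
proof -
  assume e: "!!x. x \<in> S2 ==> f x = g x"
  show "Lp p f = Lp p g" unfolding Lp_def by (rule Bochner_Integration.integral_cong) (auto simp: e)
  assume "lp p f"
  then show "lp p g" unfolding lp_def
    using e measurable_cong[of mu f g borel]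
      Bochner_Integration.integrable_cong[of mu mu "%x. norm (f x) powr p" "%x. norm (g x) powr p"]
    by simp
qed

text \<open>A sum of \<open>card I\<close> terms is at most \<open>card I\<close> times its largest
  one; this crude bound stands in for Minkowski's inequality.\<close>

lemma norm_sum_powr:
  assumes "finite I" "p >= 0"
  shows "norm (\<Sum>i\<in>I. f i) powr p <= real (card I) powr p * (\<Sum>i\<in>I. norm (f i) powr p)"
proof (cases "I = {}")
  case False
  obtain i where i: "i \<in> I" "!!j. j \<in> I ==> norm (f j) <= norm (f i)"
  proof -
    have "Max ((%i. norm (f i)) ` I) \<in> (%i. norm (f i)) ` I" using assms(1) False by (intro Max_in) auto
    then obtain i where "i \<in> I" "Max ((%i. norm (f i)) ` I) = norm (f i)" by auto
    then show thesis using assms(1) by (intro that[of i]) (auto simp flip: \<open>Max _ = _\<close>)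
  qed
  have "norm (\<Sum>i\<in>I. f i) <= (\<Sum>i\<in>I. norm (f i))" by (rule norm_sum)
  also have "... <= real (card I) * norm (f i)" using i by (intro sum_bounded_above) auto
  finally have "norm (\<Sum>i\<in>I. f i) powr p <= (real (card I) * norm (f i)) powr p"
    using assms by (intro powr_mono2) auto
  also have "... = real (card I) powr p * norm (f i) powr p" by (simp add: powr_mult)
  also have "... <= real (card I) powr p * (\<Sum>i\<in>I. norm (f i) powr p)"
    using i assms by (intro mult_left_mono member_le_sum) auto
  finally show ?thesis .
qed (simp)

lemma lp_sum:
  assumes "finite I" "p >= 0" "!!i. i \<in> I ==> lp p (f i)"
  shows "lp p (%x. \<Sum>i\<in>I. f i x)" "Lp p (%x. \<Sum>i\<in>I. f i x) <= real (card I) powr p * (\<Sum>i\<in>I. Lp p (f i))"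
proof -
  have [measurable]: "i \<in> I ==> f i \<in> borel_measurable mu" for i using assms by (auto simp: lp_def)
  have i: "integrable mu (%x. real (card I) powr p * (\<Sum>i\<in>I. norm (f i x) powr p))"
    using assms by (auto simp: lp_def)
  have le: "norm (\<Sum>i\<in>I. f i x) powr p <= real (card I) powr p * (\<Sum>i\<in>I. norm (f i x) powr p)" for x
    using assms by (intro norm_sum_powr)
  show 1: "lp p (%x. \<Sum>i\<in>I. f i x)" unfolding lp_def
  proof
    show "integrable mu (%x. norm (\<Sum>i\<in>I. f i x) powr p)"
      by (rule Bochner_Integration.integrable_bound[OF i]) (auto intro!: AE_I2 order_trans[OF le])
  qed simp
  have "Lp p (%x. \<Sum>i\<in>I. f i x) <= (\<integral>x. real (card I) powr p * (\<Sum>i\<in>I. norm (f i x) powr p) \<partial>mu)"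
    unfolding Lp_def using 1 i le by (intro integral_mono) (auto simp: lp_def)
  also have "... = real (card I) powr p * (\<Sum>i\<in>I. Lp p (f i))"
    using assms by (simp add: Lp_def lp_def)
  finally show "Lp p (%x. \<Sum>i\<in>I. f i x) <= real (card I) powr p * (\<Sum>i\<in>I. Lp p (f i))" .
qed

lemma lp_add:
  assumes "p >= 0" "lp p f" "lp p g"
  shows "lp p (%x. f x + g x)" "Lp p (%x. f x + g x) <= 2 powr p * (Lp p f + Lp p g)"
  using lp_sum[of "{True,False}" p "%b. if b then f else g"] assms by auto

lemma lp_scaleR:
  assumes "lp p f" shows "lp p (%x. c *R f x)" "Lp p (%x. c *R f x) = \<bar>c\<bar> powr p * Lp p f"
  using assms by (auto simp: lp_def Lp_def powr_mult)

lemma lp_diff: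
  assumes "p >= 0" "lp p f" "lp p g"
  shows "lp p (%x. f x - g x)" "Lp p (%x. f x - g x) <= 2 powr p * (Lp p f + Lp p g)"
proof -
  have "lp p (%x. f x + - g x)" "Lp p (%x. f x + - g x) <= 2 powr p * (Lp p f + Lp p (%x. - g x))"
    by (intro lp_add assms; use assms in \<open>simp add: lp_def\<close>)+
  then show "lp p (%x. f x - g x)" "Lp p (%x. f x - g x) <= 2 powr p * (Lp p f + Lp p g)"
    by (simp_all add: Lp_def)
qed

lemma Lp_triangle:
  assumes "p >= 0" "lp p (%x. f x - g x)" "lp p (%x. g x - h x)"
  shows "Lp p (%x. f x - h x) <= 2 powr p * (Lp p (%x. f x - g x) + Lp p (%x. g x - h x))"
  using lp_add(2)[OF assms] by simp

lemma Lp_minus_commute: "Lp p (%x. f x - g x) = Lp p (%x. g x - f x)"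
  by (simp add: Lp_def norm_minus_commute)

text \<open>Splitting at the threshold \<open>e\<close>: above it, \<open>r powr (1 - p)\<close> is
  at most \<open>e powr (1 - p)\<close>. On a finite measure space this replaces Hoelder's
  inequality when L^1 is compared with L^p.\<close>

lemma norm_le_powr_bound:
  fixes r e p :: real
  assumes "r >= 0" "e > 0" "p >= 1"
  shows "r <= e + e powr (1 - p) * r powr p"
proof (cases "r <= e")
  case True
  then show ?thesis using assms by (smt (verit) powr_ge_zero zero_le_mult_iff)
next
  case False
  then have "r = r powr (1 - p) * r powr p" using assms by (simp add: powr_add[symmetric])
  also have "... <= e powr (1 - p) * r powr p"
    using False assms by (intro mult_right_mono powr_mono2') auto
  finally show ?thesis using assms by simp
qed

lemma lp_integrable:
  assumes "lp p f" "p >= 1" shows "integrable mu f"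
proof (rule Bochner_Integration.integrable_bound)
  show "integrable mu (%x. 1 + norm (f x) powr p)" using assms by (auto simp: lp_def)
  show "AE x in S2_measure. norm (f x) <= norm (1 + norm (f x) powr p)"
    using norm_le_powr_bound[of "norm (f _)" 1 p] assms by (auto intro!: AE_I2)
qed (use assms in \<open>auto simp: lp_def\<close>)

lemma Lp_tendsto_imp_integral_norm_tendsto:
  assumes "p >= 1" "!!n. lp p (f n)" "(%n. Lp p (f n)) \<longlonglongrightarrow> 0"
  shows "(%n. \<integral>x. norm (f n x) \<partial>mu) \<longlonglongrightarrow> 0"
proof (rule LIMSEQ_I)
  fix r :: real assume "r > 0"
  define \<mu> where "\<mu> = measure mu S2"
  define e where "e = r / (2 * (\<mu> + 1))"
  have \<mu>: "\<mu> >= 0" by (simp add: \<mu>_def)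
  have e: "e > 0" "e * \<mu> < r / 2 \<or> \<mu> = 0" "e * \<mu> <= r / 2"
    using \<open>r > 0\<close> \<mu> by (auto simp: e_def field_simps)
  have "eventually (%n. Lp p (f n) < r / (2 * e powr (1 - p))) sequentially"
    using assms(3) \<open>r > 0\<close> e by (intro order_tendstoD(2)[OF assms(3)]) auto
  then obtain N where N: "!!n. n >= N ==> Lp p (f n) < r / (2 * e powr (1 - p))"
    by (auto simp: eventually_sequentially)
  have "norm ((\<integral>x. norm (f n x) \<partial>mu) - 0) < r" if "n >= N" for n
  proof -
    have "(\<integral>x. norm (f n x) \<partial>mu) <= (\<integral>x. e + e powr (1 - p) * norm (f n x) powr p \<partial>mu)"
      using lp_integrable[OF assms(2) assms(1)] assms(2)[of n] assms(1) e
      by (intro integral_mono) (auto simp: lp_def norm_le_powr_bound)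
    also have "... = e * \<mu> + e powr (1 - p) * Lp p (f n)"
      using assms(2)[of n] by (simp add: lp_def Lp_def \<mu>_def)
    also have "... < r"
      using N[OF that] e by (simp add: field_simps)
    finally show ?thesis by simp
  qed
  then show "\<exists>no. \<forall>n\<ge>no. norm ((\<integral>x. norm (f n x) \<partial>mu) - 0) < r" by blast
qed

lemma Lp_tendsto_integral:
  fixes f :: "nat => real^3 => 'b::euclidean_space"
  assumes p: "p >= 1" and f: "!!n. lp p (f n)" "lp p g" and lim: "(%n. Lp p (%x. f n x - g x)) \<longlonglongrightarrow> 0"
    and c: "continuous_on S2 c"
  shows "(%n. \<integral>x. c x *R f n x \<partial>mu) \<longlonglongrightarrow> (\<integral>x. c x *R g x \<partial>mu)"
proof -
  obtain B where B: "B > 0" "!!x. x \<in> S2 ==> norm (c x) <= B" using continuous_on_S2_bounded[OF c] by metis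
  have d: "lp p (%x. f n x - g x)" for n using lp_diff(1)[of p "f n" g] f p by simp
  have "(%n. (\<integral>x. c x *R f n x \<partial>mu) - (\<integral>x. c x *R g x \<partial>mu)) \<longlonglongrightarrow> 0"
  proof (rule Lim_null_comparison)
    show "(%n. B * (\<integral>x. norm (f n x - g x) \<partial>mu)) \<longlonglongrightarrow> 0"
      using tendsto_mult_right_zero[OF Lp_tendsto_imp_integral_norm_tendsto[OF p d lim]] .
    show "\<forall>\<^sub>F n in sequentially. norm ((\<integral>x. c x *R f n x \<partial>mu) - (\<integral>x. c x *R g x \<partial>mu))
        <= B * (\<integral>x. norm (f n x - g x) \<partial>mu)"
    proof (rule always_eventually, rule allI)
      fix n
      have i: "integrable mu (%x. c x *R f n x)" "integrable mu (%x. c x *R g x)"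
        "integrable mu (%x. c x *R (f n x - g x))" "integrable mu (%x. f n x - g x)"
        using lp_integrable[OF f(1) p] lp_integrable[OF f(2) p] lp_integrable[OF d p] c
        by (auto intro!: integrable_S2_mult_continuous)
      have "norm ((\<integral>x. c x *R f n x \<partial>mu) - (\<integral>x. c x *R g x \<partial>mu))
          = norm (\<integral>x. c x *R (f n x - g x) \<partial>mu)"
        using i by (simp add: scaleR_diff_right)
      also have "... <= (\<integral>x. B * norm (f n x - g x) \<partial>mu)"
        using i B by (intro Bochner_Integration.integral_norm_bound_integral) (auto intro!: mult_right_mono)
      finally show "norm ((\<integral>x. c x *R f n x \<partial>mu) - (\<integral>x. c x *R g x \<partial>mu))
        <= B * (\<integral>x. norm (f n x - g x) \<partial>mu)" by simp
    qed
  qed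
  then show ?thesis by (simp add: LIM_zero_iff)
qed

lemma lp_nn_integral_bound:
  assumes "f \<in> borel_measurable mu" "B >= 0"
    and "(\<integral>\<^sup>+x. ennreal (norm (f x) powr p) \<partial>mu) <= ennreal B"
  shows "lp p f" "Lp p f <= B"
proof -
  note [measurable] = assms(1)
  have "integrable mu (%x. norm (f x) powr p)"
    by (rule integrableI_nonneg) (use assms(3) in \<open>auto intro: le_less_trans\<close>)
  then show "lp p f" using assms(1) by (simp add: lp_def)
  then show "Lp p f <= B"
    using assms(2,3) unfolding Lp_def lp_def
    by (subst (asm) nn_integral_eq_integral) auto
qed

lemma lp_nn_integral: "lp p f ==> (\<integral>\<^sup>+x. ennreal (norm (f x) powr p) \<partial>mu) = ennreal (Lp p f)"
  unfolding Lp_def lp_def by (subst nn_integral_eq_integral) auto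

lemma Lp_eq_0_imp_AE:
  assumes "lp p f" "Lp p f = 0" shows "AE x in S2_measure. f x = 0"
proof -
  have "AE x in S2_measure. norm (f x) powr p = 0"
    using assms integral_nonneg_eq_0_iff_AE[of mu "%x. norm (f x) powr p"] by (simp add: lp_def Lp_def)
  then show ?thesis by (rule AE_mp) simp
qed

text \<open>Jensen's inequality, by integrating the tangent line of the \<open>p\<close>-th power at the mean.\<close>

lemma weighted_powr_mean:
  fixes h k :: "'a => real"
  assumes p: "p >= 1" and h: "!!x. h x >= 0" and k: "!!x. x \<in> space M ==> k x >= 0"
    and i: "integrable M k" "integrable M (%x. k x * h x)" "integrable M (%x. k x * h x powr p)"
    and k1: "(\<integral>x. k x \<partial>M) = 1"
  shows "(\<integral>x. k x * h x \<partial>M) powr p <= (\<integral>x. k x * h x powr p \<partial>M)"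
proof -
  define m where "m = (\<integral>x. k x * h x \<partial>M)"
  have m0: "m >= 0" unfolding m_def using h k by (intro Bochner_Integration.integral_nonneg) auto
  show ?thesis
  proof (cases "m = 0")
    case True
    then have "(\<integral>x. k x * h x \<partial>M) powr p = 0" by (simp add: m_def)
    also have "0 <= (\<integral>x. k x * h x powr p \<partial>M)" using k by (intro Bochner_Integration.integral_nonneg) auto
    finally show ?thesis .
  next
    case False
    then have m: "m > 0" using m0 by simp
    have tan: "m powr p + p * m powr (p - 1) * (a - m) <= a powr p" if "a >= 0" for a
    \<comment> \<open>Convexity is used on the open half line, where the power is differentiable; at
      \<open>a = 0\<close> the tangent has the value \<open>(1 - p) * m powr p\<close>, nonpositive
      because \<open>p >= 1\<close>.\<close>
    proof (cases "a = 0")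
      case True
      have "m powr (p - 1) * m = m powr p" using m by (simp add: powr_diff)
      then have "m powr p + p * m powr (p - 1) * (a - m) = (1 - p) * m powr p"
        using True by (simp add: algebra_simps)
      also have "... <= 0" using p by (simp add: mult_nonpos_nonneg)
      finally show ?thesis using True by simp
    next
      case False
      have "a powr p - m powr p >= (p * m powr (p - 1)) * (a - m)"
        by (rule convex_on_imp_above_tangent[of "{0<..}"])
          (use that False m powr_convex[OF p] in \<open>auto simp: interior_open intro!: derivative_eq_intros\<close>)
      then show ?thesis by simp
    qed
    have "(\<integral>x. k x * (m powr p + p * m powr (p - 1) * (h x - m)) \<partial>M) <= (\<integral>x. k x * h x powr p \<partial>M)"
    proof (rule integral_mono)
      show "integrable M (%x. k x * (m powr p + p * m powr (p - 1) * (h x - m)))"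
      proof -
        have "integrable M (%x. (m powr p - p * m powr (p - 1) * m) * k x + (p * m powr (p - 1)) * (k x * h x))"
          using i by auto
        then show ?thesis by (simp add: algebra_simps)
      qed
      show "k x * (m powr p + p * m powr (p - 1) * (h x - m)) <= k x * h x powr p" if "x \<in> space M" for x
        using tan[OF h] k[OF that] by (rule mult_left_mono)
    qed (use i in auto)
    also have "(%x. k x * (m powr p + p * m powr (p - 1) * (h x - m))) =
        (%x. (m powr p - p * m powr (p - 1) * m) * k x + (p * m powr (p - 1)) * (k x * h x))"
      by (simp add: algebra_simps fun_eq_iff)
    also have "(\<integral>x. (m powr p - p * m powr (p - 1) * m) * k x + (p * m powr (p - 1)) * (k x * h x) \<partial>M) = m powr p"
      using i k1 by (simp add: m_def[symmetric])
    finally show ?thesis by (simp add: m_def)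
  qed
qed

section \<open>Density of continuous functions\<close>

definition approx :: "real => (real^3 => 'b::euclidean_space) => bool" where
  "approx p f \<longleftrightarrow> lp p f & (\<forall>e>0. \<exists>g. continuous_on S2 g & Lp p (%x. f x - g x) < e)"

lemma approx_close:
  assumes p: "p >= 0" and f: "lp p f"
    and a: "!!e. e > 0 ==> \<exists>s. approx p s & Lp p (%x. f x - s x) < e"
  shows "approx p f"
  unfolding approx_def
proof (intro conjI f allI impI)
  fix e :: real assume "e > 0"
  define d where "d = e / (2 * 2 powr p)"
  have d: "d > 0" using \<open>e > 0\<close> by (simp add: d_def)
  obtain s where s: "approx p s" "Lp p (%x. f x - s x) < d" using a[OF d] by blast
  obtain g where g: "continuous_on S2 g" "Lp p (%x. s x - g x) < d" using s d by (auto simp: approx_def)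
  have "Lp p (%x. f x - g x) <= 2 powr p * (Lp p (%x. f x - s x) + Lp p (%x. s x - g x))"
    using s g f p by (intro Lp_triangle lp_diff(1)) (auto simp: approx_def intro: lp_continuous)
  also have "... < 2 powr p * (d + d)" using s g by (intro mult_strict_left_mono) auto
  also have "... = e" by (simp add: d_def)
  finally show "\<exists>g. continuous_on S2 g & Lp p (%x. f x - g x) < e" using g by blast
qed

lemma approx_sum:
  assumes "p >= 0" "finite I" "!!i. i \<in> I ==> approx p (f i)"
  shows "approx p (%x. \<Sum>i\<in>I. f i x)"
  unfolding approx_def
proof (intro conjI allI impI)
  show "lp p (%x. \<Sum>i\<in>I. f i x)" using assms by (intro lp_sum) (auto simp: approx_def)
  fix e :: real assume e: "e > 0"
  define d where "d = e / (2 * (real (card I) powr p + 1) * (real (card I) + 1))"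
  have d: "d > 0" using e by (auto simp: d_def intro!: divide_pos_pos mult_pos_pos add_nonneg_pos)
  have "\<forall>i\<in>I. \<exists>g. continuous_on S2 g & Lp p (%x. f i x - g x) < d" using assms d by (auto simp: approx_def)
  then obtain g where g: "!!i. i \<in> I ==> continuous_on S2 (g i)" "!!i. i \<in> I ==> Lp p (%x. f i x - g i x) < d"
    by metis
  have "Lp p (%x. (\<Sum>i\<in>I. f i x) - (\<Sum>i\<in>I. g i x)) = Lp p (%x. \<Sum>i\<in>I. f i x - g i x)"
    by (simp add: sum_subtractf)
  also have "... <= real (card I) powr p * (\<Sum>i\<in>I. Lp p (%x. f i x - g i x))"
    using assms g by (intro lp_sum lp_diff) (auto simp: approx_def intro: lp_continuous)
  also have "... <= real (card I) powr p * (real (card I) * d)"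
    using g by (intro mult_left_mono sum_bounded_above) (auto intro: less_imp_le)
  also have "... <= (real (card I) powr p + 1) * ((real (card I) + 1) * d)"
    using d by (intro mult_mono) auto
  also have "... = e / 2"
    unfolding d_def using powr_ge_zero[of "real (card I)" p] by (simp add: field_simps add_nonneg_eq_0_iff)
  also have "... < e" using e by simp
  finally show "\<exists>g. continuous_on S2 g & Lp p (%x. (\<Sum>i\<in>I. f i x) - g x) < e"
    using g(1) by (intro exI[of _ "%x. \<Sum>i\<in>I. g i x"]) (auto intro: continuous_on_sum)
qed

text \<open>Regularity squeezes \<open>A\<close> between a compact \<open>K\<close> and an open
  \<open>U\<close> with little measure between them; a Urysohn function for \<open>K\<close> and
  \<open>- U\<close> differs from the indicator only there.\<close>

lemma approx_indicator:
  fixes y :: "'b::euclidean_space"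
  assumes p: "p >= 1" and A: "A \<in> sets mu"
  shows "approx p (%x. indicator A x *R y)"
  unfolding approx_def
proof (intro conjI allI impI)
  have Am[measurable]: "A \<in> sets mu" by fact
  show l: "lp p (%x. indicator A x *R y)"
    unfolding lp_def
  proof
    have "integrable mu (%x. indicator A x *R (norm y powr p))"
      using A by (intro integrable_scaleR_left) (simp add: S2.emeasure_eq_measure)
    also have "(%x. indicator A x *R (norm y powr p)) = (%x. norm (indicator A x *R y) powr p)"
      by (auto simp: indicator_def fun_eq_iff)
    finally show "integrable mu ..." .
  qed measurable
  fix e :: real assume e: "e > 0"
  define d where "d = e / (norm y powr p + 1)"
  have d: "d > 0" using e by (auto simp: d_def intro!: divide_pos_pos add_nonneg_pos)
  \<comment> \<open>\<open>mu\<close> lives on the sphere only, whereas regularity concerns Borel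
    measures on all of \<open>real^3\<close>; so \<open>mu\<close> is pushed forward by the
    inclusion.\<close>
  let ?M = "distr mu borel (%x. x)"
  have idm: "(%x. x) \<in> borel_measurable mu" by (intro measurable_S2_continuous continuous_on_id)
  have eM: "emeasure ?M B = emeasure mu (B \<inter> S2)" if "B \<in> sets borel" for B
    using emeasure_distr[OF idm that] by (simp add: vimage_def Int_def)
  have AS: "A \<subseteq> S2" "A \<in> sets borel" using A by (auto simp: sets_S2_measure_iff)
  have fin: "emeasure ?M (space ?M) ~= \<infinity>" using eM[of UNIV] by (simp add: S2.emeasure_eq_measure)
  have less: "emeasure ?M A < emeasure ?M A + ennreal (d/2)"
    using eM[of A] AS d by (simp add: Int_absorb2 S2.emeasure_eq_measure ennreal_plus[symmetric] ennreal_less_iff del: ennreal_plus)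
  have "\<exists>K. K \<subseteq> A & compact K & emeasure ?M A < emeasure ?M K + ennreal (d/2)"
  proof -
    have "emeasure ?M A = (SUP K \<in> {K. K \<subseteq> A & compact K}. emeasure ?M K)"
      by (rule inner_regular) (use fin AS in auto)
    moreover have "(SUP K \<in> {K. K \<subseteq> A & compact K}. emeasure ?M K + ennreal (d/2)) =
       (SUP K \<in> {K. K \<subseteq> A & compact K}. emeasure ?M K) + ennreal (d/2)"
      by (rule ennreal_SUP_add_left) auto
    ultimately have "emeasure ?M A < (SUP K \<in> {K. K \<subseteq> A & compact K}. emeasure ?M K + ennreal (d/2))" using less by simp
    then show ?thesis by (auto simp: less_SUP_iff)
  qed
  then obtain K where K: "K \<subseteq> A" "compact K" "emeasure ?M A < emeasure ?M K + ennreal (d/2)" by blast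
  have "emeasure ?M A = (INF U \<in> {U. A \<subseteq> U & open U}. emeasure ?M U)"
    by (rule outer_regular) (use fin AS in auto)
  then have "(INF U \<in> {U. A \<subseteq> U & open U}. emeasure ?M U) < emeasure ?M A + ennreal (d/2)" using less by simp
  then obtain U where U: "A \<subseteq> U" "open U" "emeasure ?M U < emeasure ?M A + ennreal (d/2)"
    by (auto simp: INF_less_iff)
  have Ks: "K \<in> sets borel" "K \<subseteq> S2" using K AS by (auto intro: borel_compact)
  have mm: "measure mu A < measure mu K + d/2" "measure mu (U \<inter> S2) < measure mu A + d/2"
  proof -
    have e: "emeasure ?M A = ennreal (measure mu A)" "emeasure ?M K = ennreal (measure mu K)"
      "emeasure ?M U = ennreal (measure mu (U \<inter> S2))"
      using eM[of A] eM[of K] eM[of U] AS Ks U by (simp_all add: S2.emeasure_eq_measure Int_absorb2)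
    show "measure mu A < measure mu K + d/2"
      using K(3) d unfolding e by (simp add: ennreal_plus[symmetric] ennreal_less_iff del: ennreal_plus)
    show "measure mu (U \<inter> S2) < measure mu A + d/2"
      using U(3) d unfolding e by (simp add: ennreal_plus[symmetric] ennreal_less_iff del: ennreal_plus)
  qed
  obtain g :: "real^3 => real" where g: "continuous_on UNIV g" "!!x. g x \<in> closed_segment 1 0"
     "!!x. x \<in> K ==> g x = 1" "!!x. x \<in> - U ==> g x = 0"
  proof (rule Urysohn[of K "- U" "1::real" "0::real"])
    show "closed K" using K by (simp add: compact_imp_closed)
    show "closed (- U)" using U by (simp add: closed_Compl)
    show "K \<inter> - U = {}" using K U by auto
  qed blast
  have g01: "0 <= g x" "g x <= 1" for x using g(2)[of x] by (auto simp: closed_segment_eq_real_ivl)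
  have Ds: "U \<inter> S2 - K \<in> sets mu" using U Ks by (auto simp: sets_S2_measure_iff)
  have gc: "continuous_on S2 (%x. g x *R y)"
    using continuous_on_subset[OF g(1), of S2] by (auto intro!: continuous_intros)
  have "Lp p (%x. indicator A x *R y - g x *R y) <= (\<integral>x. indicator (U \<inter> S2 - K) x *R (norm y powr p) \<partial>mu)"
    unfolding Lp_def
  proof (rule integral_mono)
    show "integrable mu (%x. norm (indicator A x *R y - g x *R y) powr p)"
      using lp_diff(1)[of p, OF _ l lp_continuous[OF gc]] p by (auto simp: lp_def)
    show "integrable mu (%x. indicator (U \<inter> S2 - K) x *R (norm y powr p))"
      using Ds by (intro integrable_scaleR_left) (simp add: S2.emeasure_eq_measure)
    fix x assume x: "x \<in> space mu"
    have "norm (indicator A x *R y - g x *R y) <= indicator (U \<inter> S2 - K) x * norm y"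
    proof -
      have "norm (indicator A x *R y - g x *R y) = \<bar>indicator A x - g x\<bar> * norm y"
        by (simp add: scaleR_left_diff_distrib[symmetric])
      also have "... <= indicator (U \<inter> S2 - K) x * norm y"
        using g(3,4)[of x] g01[of x] K(1) U(1) x by (intro mult_right_mono) (auto simp: indicator_def)
      finally show ?thesis .
    qed
    then have "norm (indicator A x *R y - g x *R y) powr p <= (indicator (U \<inter> S2 - K) x * norm y) powr p"
      using p by (intro powr_mono2) auto
    also have "... = indicator (U \<inter> S2 - K) x *R (norm y powr p)" by (auto simp: indicator_def)
    finally show "norm (indicator A x *R y - g x *R y) powr p <= indicator (U \<inter> S2 - K) x *R (norm y powr p)" .
  qed
  also have "... = measure mu (U \<inter> S2 - K) * norm y powr p"
    using Ds sets.sets_into_space[OF Ds] by (simp add: Int_absorb2)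
  also have "measure mu (U \<inter> S2 - K) = measure mu (U \<inter> S2) - measure mu K"
    using U K Ks AS by (intro S2.finite_measure_Diff) (auto simp: sets_S2_measure_iff)
  also have "(measure mu (U \<inter> S2) - measure mu K) * norm y powr p <= d * norm y powr p"
    using mm by (intro mult_right_mono) auto
  also have "... < d * (norm y powr p + 1)" using d by (intro mult_strict_left_mono) auto
  also have "... = e" unfolding d_def using powr_ge_zero[of "norm y" p] by (simp add: add_nonneg_eq_0_iff)
  finally show "\<exists>g. continuous_on S2 g & Lp p (%x. indicator A x *R y - g x) < e" using gc by blast
qed

lemma lp_approx:
  fixes f :: "real^3 => 'b::euclidean_space"
  assumes p: "p >= 1" and f: "lp p f" shows "approx p f"
proof (rule approx_close[OF _ f])
  have simple: "approx p s" if s: "simple_function mu s" for s :: "real^3 => 'b"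
  proof -
    have fin: "finite (s ` S2)" using s by (auto simp: simple_function_def)
    have "approx p (%x. \<Sum>y\<in>s ` S2. indicator (s -` {y} \<inter> S2) x *R y)"
      using p s fin by (intro approx_sum approx_indicator) (auto simp: simple_function_def)
    moreover have "(\<Sum>y\<in>s ` S2. indicator (s -` {y} \<inter> S2) x *R y) = s x" if "x \<in> S2" for x
    proof -
      have "(\<Sum>y\<in>s ` S2. indicator (s -` {y} \<inter> S2) x *R y) = (\<Sum>y\<in>s ` S2. if y = s x then y else 0)"
        using that by (intro sum.cong) (auto simp: indicator_def)
      then show ?thesis using fin that by simp
    qed
    ultimately show ?thesis
      using lp_cong_S2[of p "%x. \<Sum>y\<in>s ` S2. indicator (s -` {y} \<inter> S2) x *R y" s]
        Lp_cong_S2[of "%x. (\<Sum>y\<in>s ` S2. indicator (s -` {y} \<inter> S2) x *R y) - g x" "%x. s x - g x" for g]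
      by (auto simp: approx_def)
  qed
  fix e :: real assume e: "e > 0"
  have fm[measurable]: "f \<in> borel_measurable mu" using f by (simp add: lp_def)
  obtain F where F: "!!i. simple_function mu (F i)" "!!x. x \<in> S2 ==> (%i. F i x) \<longlonglongrightarrow> f x"
     "!!i x. x \<in> S2 ==> norm (F i x) <= 2 * norm (f x)"
    using borel_measurable_implies_sequence_metric[OF fm, of 0] unfolding dist_0_norm space_S2_measure dist_norm diff_zero by metis
  have Fm[measurable]: "F i \<in> borel_measurable mu" for i
    using F(1) by (rule borel_measurable_simple_function)
  have "(%i. \<integral>x. norm (f x - F i x) powr p \<partial>mu) \<longlonglongrightarrow> (\<integral>x. 0 \<partial>mu)"
  proof (rule integral_dominated_convergence[where w="%x. 3 powr p * norm (f x) powr p"])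
    show "integrable mu (%x. 3 powr p * norm (f x) powr p)" using f by (simp add: lp_def)
    show "AE x in S2_measure. (%i. norm (f x - F i x) powr p) \<longlonglongrightarrow> 0"
    proof (rule AE_I2)
      fix x assume "x \<in> space mu"
      then have "(%i. norm (f x - F i x) powr p) \<longlonglongrightarrow> norm (f x - f x) powr p"
        using F(2) p by (intro tendsto_powr2 tendsto_intros) auto
      then show "(%i. norm (f x - F i x) powr p) \<longlonglongrightarrow> 0" by simp
    qed
    show "AE x in S2_measure. norm (norm (f x - F i x) powr p) <= 3 powr p * norm (f x) powr p" for i
    proof (rule AE_I2)
      fix x assume "x \<in> space mu"
      then have "norm (f x - F i x) <= 3 * norm (f x)"
        using F(3)[of x i] norm_triangle_ineq4[of "f x" "F i x"] by simp
      then have "norm (f x - F i x) powr p <= (3 * norm (f x)) powr p" using p by (intro powr_mono2) auto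
      then show "norm (norm (f x - F i x) powr p) <= 3 powr p * norm (f x) powr p" by (simp add: powr_mult)
    qed
  qed auto
  then have "eventually (%i. Lp p (%x. f x - F i x) < e) sequentially"
    using e by (simp add: Lp_def order_tendstoD(2))
  then show "\<exists>s. approx p s & Lp p (%x. f x - s x) < e"
    using simple[OF F(1)] by (auto simp: eventually_sequentially)
qed (use p in auto)

section \<open>Zonal mollifiers\<close>

declare mem_sphere [simp del] mem_sphere_0 [simp del] S2_nonzero [simp] S2_sgn [simp]

lemma axis_in_S2: "axis i 1 \<in> S2"
  by (simp add: mem_sphere_0)

definition zonal :: "nat => (real^3 => 'b::euclidean_space) => real^3 => 'b" where
  "zonal n f x = (\<integral>y. (1 + x \<bullet> y) ^ n *R f y \<partial>mu)"

definition zonal_mass :: "nat => real" where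
  "zonal_mass n = zonal n (%_. 1) (axis 1 1)"

text \<open>Convolution with the zonal kernel normalised to mass one; \<open>sgn\<close> extends the
  result constantly along rays. By rotation invariance \<open>zonal_mass n\<close> is the mass for
  every centre on the sphere, not only for the first axis.\<close>

definition moll :: "nat => (real^3 => 'b::euclidean_space) => real^3 => 'b" where
  "moll n f x = (1 / zonal_mass n) *R zonal n f (sgn x)"

lemma integrable_zonal:
  fixes f :: "real^3 => 'b::euclidean_space"
  assumes "integrable mu f"
  shows "integrable mu (%y. (1 + x \<bullet> y) ^ n *R f y)"
  using assms by (intro integrable_S2_mult_continuous) (auto intro!: continuous_intros)

lemma integral_affine_sum:
  fixes A :: "'a => 'b::euclidean_space"
  assumes "integrable M A" "!!b. b \<in> B ==> integrable M (P b)"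
  shows "(\<integral>x. A x + (\<Sum>b\<in>B. c b *R P b x) \<partial>M) = (\<integral>x. A x \<partial>M) + (\<Sum>b\<in>B. c b *R (\<integral>x. P b x \<partial>M))"
  using assms by (subst Bochner_Integration.integral_add) (auto simp: Bochner_Integration.integral_sum)

text \<open>One factor \<open>1 + x \<bullet> y\<close> is expanded in coordinates, so exponent
  \<open>n + 1\<close> reduces to exponent \<open>n\<close> applied to coordinate multiples of
  \<open>f\<close>. Smoothness and the action of rotation fields then follow by induction on the
  exponent.\<close>

lemma zonal_Suc:
  assumes "integrable mu f"
  shows "zonal (Suc n) f = (%x. zonal n f x + (\<Sum>b\<in>Basis. (x \<bullet> b) *R zonal n (%y. (y \<bullet> b) *R f y) x))"
proof
  fix x
  have i: "integrable mu (%y. (y \<bullet> b) *R f y)" for b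
    using assms by (intro integrable_S2_mult_continuous) (auto intro!: continuous_intros)
  have eq: "(1 + x \<bullet> y) ^ Suc n *R f y =
     (1 + x \<bullet> y) ^ n *R f y + (\<Sum>b\<in>Basis. (x \<bullet> b) *R ((1 + x \<bullet> y) ^ n *R ((y \<bullet> b) *R f y)))" for y
  proof -
    have e: "(1 + x \<bullet> y) ^ n * (x \<bullet> y) = (\<Sum>b\<in>Basis. (1 + x \<bullet> y) ^ n * ((x \<bullet> b) * (y \<bullet> b)))"
      unfolding sum_distrib_left[symmetric] euclidean_inner[symmetric] ..
    have "(1 + x \<bullet> y) ^ Suc n *R f y = (1 + x \<bullet> y) ^ n *R f y + ((1 + x \<bullet> y) ^ n * (x \<bullet> y)) *R f y"
      by (simp add: algebra_simps)
    then show ?thesis unfolding e by (simp add: scaleR_sum_left mult_ac)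
  qed
  show "zonal (Suc n) f x = zonal n f x + (\<Sum>b\<in>Basis. (x \<bullet> b) *R zonal n (%y. (y \<bullet> b) *R f y) x)"
    unfolding zonal_def eq
    by (rule integral_affine_sum) (rule integrable_zonal, rule assms i)+
qed

lemma smooth_zonal: "integrable mu f ==> smooth_on UNIV (zonal n f)"
proof (induction n arbitrary: f)
  case 0
  have "zonal 0 f = (%x. \<integral>y. f y \<partial>mu)" by (simp add: zonal_def fun_eq_iff)
  then show ?case by (simp add: smooth_on_const)
next
  case (Suc n)
  have i: "integrable mu (%y. (y \<bullet> b) *R f y)" for b
    using Suc.prems by (intro integrable_S2_mult_continuous) (auto intro!: continuous_intros)
  show ?case unfolding zonal_Suc[OF Suc.prems]
    by (intro smooth_on_add Suc.IH Suc.prems smooth_on_sum smooth_on_scaleR i smooth_on_linear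
        bounded_linear_inner_left) auto
qed

lemma zonal_mass_eq:
  assumes "x \<in> S2" shows "(\<integral>y. (1 + x \<bullet> y) ^ n \<partial>mu) = zonal_mass n"
proof -
  have "norm (axis 1 1 :: real^3) = norm x" using assms by (simp add: mem_sphere_0)
  then obtain R :: "real^3 => real^3" where R: "orthogonal_transformation R" "R (axis 1 1) = x"
    using orthogonal_transformation_exists[of "axis 1 1 :: real^3" x] by metis
  have "(\<integral>y. (1 + x \<bullet> y) ^ n \<partial>mu) = (\<integral>y. (1 + x \<bullet> R y) ^ n \<partial>mu)"
    by (rule S2_integral_orthogonal[OF R(1), symmetric]) (auto intro!: measurable_S2_continuous continuous_intros)
  also have "... = zonal_mass n"
    using R by (simp add: zonal_mass_def zonal_def orthogonal_transformation_def flip: R(2))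
  finally show ?thesis .
qed

lemma zonal_kernel_nonneg: "x \<in> S2 ==> y \<in> S2 ==> 0 <= 1 + x \<bullet> y"
  using Cauchy_Schwarz_ineq2[of x y] by (auto simp: mem_sphere_0)

lemma zonal_mass_ge:
  assumes "x \<in> S2" "0 < d" "d <= 2"
  shows "(2 - d) ^ n * measure mu {y \<in> S2. x \<bullet> y > 1 - d} <= zonal_mass n"
proof -
  let ?A = "{y \<in> S2. x \<bullet> y > 1 - d}"
  have A: "?A \<in> sets mu"
    by (auto simp: sets_S2_measure_iff Collect_conj_eq intro!: sets.Int borel_open open_Collect_less continuous_intros)
  have "(2 - d) ^ n * measure mu ?A = (\<integral>y. indicator ?A y *R (2 - d) ^ n \<partial>mu)"
    using A sets.sets_into_space[OF A] by (simp add: Int_absorb2)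
  also have "... <= (\<integral>y. (1 + x \<bullet> y) ^ n \<partial>mu)"
  proof (rule integral_mono)
    show "integrable mu (%y. indicator ?A y *R (2 - d) ^ n)"
      using A by (intro integrable_scaleR_left) (simp add: S2.emeasure_eq_measure)
    show "integrable mu (%y. (1 + x \<bullet> y) ^ n)" by (intro integrable_S2_continuous continuous_intros)
    show "indicator ?A y *R (2 - d) ^ n <= (1 + x \<bullet> y) ^ n" if "y \<in> space mu" for y
      using zonal_kernel_nonneg[of x y] assms that by (auto simp: indicator_def intro!: power_mono)
  qed
  finally show ?thesis using zonal_mass_eq[OF assms(1)] by simp
qed

lemma zonal_mass_pos: "zonal_mass n > 0"
proof -
  have x: "axis 1 1 \<in> S2" by (rule axis_in_S2)
  have "0 < (2 - 1) ^ n * measure mu {y \<in> S2. axis 1 1 \<bullet> y > 1 - (1::real)}"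
    using S2_cap_pos[OF x, of 1] by simp
  also have "... <= zonal_mass n" using zonal_mass_ge[OF x, of 1 n] by simp
  finally show ?thesis .
qed

lemma hsmooth_zonal: "integrable mu f ==> hsmooth (%x. zonal n f (sgn x))"
  unfolding hsmooth_def by (auto simp: sgn_sgn_vector intro!: smooth_on_compose[OF smooth_zonal smooth_on_sgn])

lemma hsmooth_moll: "integrable mu f ==> hsmooth (moll n f)"
  unfolding moll_def[abs_def] by (rule hsmooth_linear_comp[OF bounded_linear_scaleR_right hsmooth_zonal])

lemma moll_diff:
  assumes "integrable mu f" "integrable mu g"
  shows "moll n (%x. f x - g x) x = moll n f x - moll n g x"
  using assms by (simp add: moll_def zonal_def scaleR_diff_right integrable_zonal)

text \<open>Young's inequality: Jensen for the probability density \<open>k x\<close>, then Fubini;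
  by symmetry of the kernel its integral over the other argument is again one.\<close>

lemma moll_lp:
  fixes f :: "real^3 => 'b::euclidean_space"
  assumes p: "p >= 1" and f: "lp p f"
  shows "lp p (moll n f)" "Lp p (moll n f) <= Lp p f"
proof -
  interpret pair_sigma_finite mu mu ..
  have fi: "integrable mu f" using lp_integrable[OF f p] .
  have fm[measurable]: "f \<in> borel_measurable mu" using f by (simp add: lp_def)
  define k where "k x y = (1 + x \<bullet> y) ^ n / zonal_mass n" for x y :: "real^3"
  have k0: "k x y >= 0" if "x \<in> S2" "y \<in> S2" for x y
    using zonal_kernel_nonneg[OF that] zonal_mass_pos[of n] by (simp add: k_def)
  have k1: "(\<integral>y. k x y \<partial>mu) = 1" if "x \<in> S2" for x
    using zonal_mass_eq[OF that, of n] zonal_mass_pos[of n] by (simp add: k_def)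
  have ks: "k x y = k y x" for x y by (simp add: k_def inner_commute)
  have ck: "continuous_on S2 (k x)" for x using zonal_mass_pos[of n] unfolding k_def by (intro continuous_intros) auto
  have mk: "(%(x, y). ennreal (k x y * norm (f y) powr p)) \<in> borel_measurable (mu \<Otimes>\<^sub>M mu)"
  proof -
    have idm: "(%x. x) \<in> borel_measurable mu" by (intro measurable_S2_continuous continuous_on_id)
    have [measurable]: "fst \<in> borel_measurable (mu \<Otimes>\<^sub>M mu)" "snd \<in> borel_measurable (mu \<Otimes>\<^sub>M mu)"
      by (rule measurable_compose[OF measurable_fst idm], rule measurable_compose[OF measurable_snd idm])
    have [measurable]: "(%z. f (snd z)) \<in> borel_measurable (mu \<Otimes>\<^sub>M mu)"
      by (rule measurable_compose[OF measurable_snd fm])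
    show ?thesis unfolding k_def case_prod_beta by measurable
  qed
  have pw: "norm (moll n f x) powr p <= (\<integral>y. k x y * norm (f y) powr p \<partial>mu)" if x: "x \<in> S2" for x
  proof -
    have "moll n f x = (\<integral>y. k x y *R f y \<partial>mu)"
      using x by (simp add: moll_def zonal_def S2_sgn k_def divide_inverse mult.commute[of _ "inverse _"]
          flip: integral_scaleR_right scaleR_scaleR)
    then have "norm (moll n f x) <= (\<integral>y. norm (k x y *R f y) \<partial>mu)"
      by (simp only: Bochner_Integration.integral_norm_bound)
    also have "... = (\<integral>y. k x y * norm (f y) \<partial>mu)"
      by (rule Bochner_Integration.integral_cong) (use k0 x in auto)
    finally have "norm (moll n f x) powr p <= (\<integral>y. k x y * norm (f y) \<partial>mu) powr p"
      using p by (intro powr_mono2) auto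
    also have "... <= (\<integral>y. k x y * norm (f y) powr p \<partial>mu)"
      using p x k0 k1 ck fi f
        integrable_S2_mult_continuous[OF ck[of x], of "%y. norm (f y)"]
        integrable_S2_mult_continuous[OF ck[of x], of "%y. norm (f y) powr p"]
      by (intro weighted_powr_mean) (auto simp: lp_def intro!: integrable_S2_continuous)
    finally show ?thesis .
  qed
  have "(\<integral>\<^sup>+x. ennreal (norm (moll n f x) powr p) \<partial>mu) \<le>
      (\<integral>\<^sup>+x. (\<integral>\<^sup>+y. ennreal (k x y * norm (f y) powr p) \<partial>mu) \<partial>mu)"
  proof (rule nn_integral_mono)
    fix x assume "x \<in> space mu"
    then have x: "x \<in> S2" by simp
    have "(\<integral>\<^sup>+y. ennreal (k x y * norm (f y) powr p) \<partial>mu) = ennreal (\<integral>y. k x y * norm (f y) powr p \<partial>mu)"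
      using x k0 f integrable_S2_mult_continuous[OF ck[of x], of "%y. norm (f y) powr p"]
      by (intro nn_integral_eq_integral) (auto simp: lp_def)
    then show "ennreal (norm (moll n f x) powr p) <= (\<integral>\<^sup>+y. ennreal (k x y * norm (f y) powr p) \<partial>mu)"
      using pw[OF x] by (simp add: ennreal_leI)
  qed
  also have "... = (\<integral>\<^sup>+y. (\<integral>\<^sup>+x. ennreal (k x y * norm (f y) powr p) \<partial>mu) \<partial>mu)"
    using Fubini'[OF mk] by simp
  also have "... = (\<integral>\<^sup>+y. ennreal (norm (f y) powr p) \<partial>mu)"
  proof (rule nn_integral_cong)
    fix y assume "y \<in> space mu"
    then have y: "y \<in> S2" by simp
    have i: "integrable mu (%x. k x y * norm (f y) powr p)"
      using integrable_S2_continuous[OF ck[of y]] by (simp add: ks[of _ y])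
    have "(\<integral>\<^sup>+x. ennreal (k x y * norm (f y) powr p) \<partial>mu) = ennreal (\<integral>x. k x y * norm (f y) powr p \<partial>mu)"
      using i k0 y by (intro nn_integral_eq_integral) auto
    also have "(\<integral>x. k x y * norm (f y) powr p \<partial>mu) = norm (f y) powr p"
      using k1[OF y] by (simp add: ks[of _ y])
    finally show "(\<integral>\<^sup>+x. ennreal (k x y * norm (f y) powr p) \<partial>mu) = ennreal (norm (f y) powr p)" .
  qed
  also have "... = ennreal (Lp p f)" by (rule lp_nn_integral[OF f])
  finally have "(\<integral>\<^sup>+x. ennreal (norm (moll n f x) powr p) \<partial>mu) <= ennreal (Lp p f)" .
  from lp_nn_integral_bound[OF _ Lp_nonneg this] hsmooth_continuous_on[OF hsmooth_moll[OF fi]]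
  show "lp p (moll n f)" "Lp p (moll n f) <= Lp p f"
    by (auto intro!: measurable_S2_continuous)
qed

text \<open>Away from the centre the kernel is at most \<open>(2 - d) ^ n\<close> before
  normalisation, while the smaller cap of parameter \<open>d / 2\<close> already contributes
  \<open>(2 - d / 2) ^ n * \<nu>\<close> to the mass; the ratio decays geometrically.\<close>

lemma moll_continuous_uniform:
  fixes g :: "real^3 => 'b::euclidean_space"
  assumes g: "continuous_on S2 g" and e: "e > 0"
  shows "\<forall>\<^sub>F n in sequentially. \<forall>x\<in>S2. norm (moll n g x - g x) <= e"
proof -
  obtain B where B: "B > 0" "!!x. x \<in> S2 ==> norm (g x) <= B" using continuous_on_S2_bounded[OF g] by metis
  have "uniformly_continuous_on S2 g" using g by (intro compact_uniformly_continuous) auto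
  then obtain r where r: "r > 0" "!!x y. x \<in> S2 ==> y \<in> S2 ==> dist y x < r ==> dist (g y) (g x) < e / 2"
    using e unfolding uniformly_continuous_on_def by (metis half_gt_zero)
  \<comment> \<open>On the sphere \<open>norm (y - x) ^ 2 = 2 - 2 * (x \<bullet> y)\<close>, so
    points with inner product above \<open>1 - r ^ 2 / 2\<close> are closer than
    \<open>r\<close>.\<close>
  define d where "d = min 1 (r\<^sup>2 / 2)"
  have d: "d > 0" "d <= 1" "d <= r\<^sup>2 / 2" using r by (auto simp: d_def)
  have close: "norm (g y - g x) < e / 2" if "x \<in> S2" "y \<in> S2" "x \<bullet> y > 1 - d" for x y
  proof -
    have "(norm (y - x))\<^sup>2 = 2 - 2 * (x \<bullet> y)"
      using that by (simp add: power2_norm_eq_inner inner_diff_left inner_diff_right inner_commute norm_eq_1 mem_sphere_0)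
    then have "(norm (y - x))\<^sup>2 < r\<^sup>2" using that d by simp
    then have "dist y x < r" using r by (simp add: dist_norm power_less_imp_less_base)
    then show ?thesis using r(2) that by (simp add: dist_norm)
  qed
  define \<mu> where "\<mu> = measure mu S2"
  let ?e1 = "axis 1 1 :: real^3"
  define \<nu> where "\<nu> = measure mu {y \<in> S2. ?e1 \<bullet> y > 1 - d/2}"
  have \<nu>: "\<nu> > 0" using S2_cap_pos[OF axis_in_S2, of "d/2" 1] d by (simp add: \<nu>_def)
  define q where "q = (2 - d) / (2 - d / 2)"
  have q: "0 <= q" "q < 1" using d by (auto simp: q_def field_simps)
  have "(%n. (2 * B * \<mu> / \<nu>) * q ^ n) \<longlonglongrightarrow> (2 * B * \<mu> / \<nu>) * 0"
    using q by (intro tendsto_intros) auto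
  then have "\<forall>\<^sub>F n in sequentially. (2 * B * \<mu> / \<nu>) * q ^ n < e / 2"
    using e by (intro order_tendstoD(2)[where y=0]) auto
  then show ?thesis
  proof eventually_elim
    case (elim n)
    show ?case
    proof
      fix x :: "real^3" assume x: "x \<in> S2"
      define k where "k y = (1 + x \<bullet> y) ^ n / zonal_mass n" for y :: "real^3"
      have k0: "k y >= 0" if "y \<in> S2" for y
        using zonal_kernel_nonneg[OF x that] zonal_mass_pos[of n] by (simp add: k_def)
      have k1: "(\<integral>y. k y \<partial>mu) = 1"
        using zonal_mass_eq[OF x, of n] zonal_mass_pos[of n] by (simp add: k_def)
      have ck: "continuous_on S2 k" using zonal_mass_pos[of n] unfolding k_def by (intro continuous_intros) auto
      have gi: "integrable mu g" by (rule integrable_S2_continuous[OF g])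
      have ki: "integrable mu k" by (rule integrable_S2_continuous[OF ck])
      have "moll n g x = (\<integral>y. k y *R g y \<partial>mu)"
        using x by (simp add: moll_def zonal_def S2_sgn k_def divide_inverse mult.commute[of _ "inverse _"]
            flip: integral_scaleR_right scaleR_scaleR)
      then have "moll n g x - g x = (\<integral>y. k y *R g y \<partial>mu) - (\<integral>y. k y *R g x \<partial>mu)"
        using k1 ki by simp
      also have "... = (\<integral>y. k y *R (g y - g x) \<partial>mu)"
        using ck gi ki by (simp add: scaleR_diff_right integrable_S2_mult_continuous)
      also have "norm ... <= (\<integral>y. e / 2 * k y + 2 * B * ((2 - d) ^ n / zonal_mass n) \<partial>mu)"
      proof (rule Bochner_Integration.integral_norm_bound_integral)
        show "integrable mu (%y. k y *R (g y - g x))"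
          using ck gi by (intro integrable_S2_mult_continuous) auto
        show "integrable mu (%y. e / 2 * k y + 2 * B * ((2 - d) ^ n / zonal_mass n))"
          using ki by auto
        fix y assume "y \<in> space mu"
        then have y: "y \<in> S2" by simp
        show "norm (k y *R (g y - g x)) <= e / 2 * k y + 2 * B * ((2 - d) ^ n / zonal_mass n)"
        proof (cases "x \<bullet> y > 1 - d")
          case True
          have "norm (k y *R (g y - g x)) <= k y * (e / 2)"
            using mult_left_mono[OF less_imp_le[OF close[OF x y True]] k0[OF y]] k0[OF y] by simp
          moreover have "0 <= 2 * B * ((2 - d) ^ n / zonal_mass n)" using B d zonal_mass_pos[of n] by simp
          ultimately show ?thesis by (simp add: mult.commute)
        next
          case False
          have "norm (g y - g x) <= 2 * B" using B(2)[OF x] B(2)[OF y] norm_triangle_ineq4[of "g y" "g x"] by simp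
          moreover have "k y <= (2 - d) ^ n / zonal_mass n"
            unfolding k_def using False zonal_mass_pos[of n] zonal_kernel_nonneg[OF x y]
            by (intro divide_right_mono power_mono) auto
          ultimately have "k y * norm (g y - g x) <= ((2 - d) ^ n / zonal_mass n) * (2 * B)"
            using k0[OF y] by (intro mult_mono) auto
          moreover have "0 <= e / 2 * k y" using k0[OF y] e by simp
          ultimately show ?thesis using k0[OF y] by (simp add: mult_ac)
        qed
      qed
      also have "... = e / 2 + 2 * B * \<mu> * ((2 - d) ^ n / zonal_mass n)"
        using ki k1 by (simp add: \<mu>_def)
      also have "2 * B * \<mu> * ((2 - d) ^ n / zonal_mass n) <= 2 * B * \<mu> * ((2 - d) ^ n / ((2 - d / 2) ^ n * \<nu>))"
        using zonal_mass_ge[OF axis_in_S2, of "d/2" n 1] d \<nu> B zonal_mass_pos[of n]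
        by (intro mult_left_mono divide_left_mono mult_pos_pos zero_less_power) (auto simp: \<nu>_def \<mu>_def)
      also have "... = (2 * B * \<mu> / \<nu>) * q ^ n" by (simp add: q_def power_divide)
      finally show "norm (moll n g x - g x) <= e" using elim by simp
    qed
  qed
qed

lemma moll_tendsto:
  fixes f :: "real^3 => 'b::euclidean_space"
  assumes p: "p >= 1" and f: "lp p f"
  shows "(%n. Lp p (%x. moll n f x - f x)) \<longlonglongrightarrow> 0"
proof (rule LIMSEQ_I)
  fix e :: real assume e: "e > 0"
  define \<mu> where "\<mu> = measure mu S2"
  define C where "C = (3::real) powr p"
  define d where "d = e / (4 * C)"
  have C: "C > 0" by (simp add: C_def)
  have d: "d > 0" using e C by (simp add: d_def)
  obtain g where g: "continuous_on S2 g" "Lp p (%x. f x - g x) < d"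
    using lp_approx[OF p f] d by (auto simp: approx_def)
  \<comment> \<open>A uniform error \<open>h\<close> contributes \<open>h powr p * \<mu>\<close>,
    which this choice keeps at most \<open>d\<close>; the summand 1 spares a proof that
    \<open>\<mu>\<close> is positive.\<close>
  define h where "h = (d / (\<mu> + 1)) powr (1 / p)"
  have \<mu>: "\<mu> >= 0" by (simp add: \<mu>_def)
  have h: "h > 0" using d \<mu> by (auto simp: h_def)
  have hp: "h powr p = d / (\<mu> + 1)" using p d \<mu> by (simp add: h_def powr_powr)
  have lg: "lp p g" using g p by (intro lp_continuous) auto
  have ig: "integrable mu g" "integrable mu f"
    using lp_integrable[OF lg p] lp_integrable[OF f p] by auto
  from moll_continuous_uniform[OF g(1) h] obtain N
    where N: "!!n x. n >= N ==> x \<in> S2 ==> norm (moll n g x - g x) <= h"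
    by (auto simp: eventually_sequentially)
  have "Lp p (%x. moll n f x - f x) < e" if n: "n >= N" for n
  proof -
    \<comment> \<open>The three errors: the mollification of \<open>f - g\<close>, the uniform error
      on \<open>g\<close>, and \<open>g - f\<close>. The first is no larger than the last because
      mollification does not increase \<open>Lp\<close>.\<close>
    define F where "F i = (if i = 0 then (%x. moll n (%x. f x - g x) x) else if i = 1 then (%x. moll n g x - g x) else (%x. g x - f x))" for i :: nat
    have l0: "lp p (F 0)" "Lp p (F 0) <= Lp p (%x. f x - g x)"
      unfolding F_def using moll_lp[OF p lp_diff(1)[OF _ f lg]] p by auto
    have l1: "lp p (F 1)" unfolding F_def
      using p lp_diff(1)[OF _ moll_lp(1)[OF p lg] lg] by auto
    have l2: "lp p (F 2)" "Lp p (F 2) = Lp p (%x. f x - g x)" unfolding F_def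
      using p lp_diff(1)[OF _ lg f] Lp_minus_commute[of p g f] by auto
    have L1: "Lp p (F 1) <= d"
    proof -
      have "Lp p (F 1) <= (\<integral>x. h powr p \<partial>mu)"
        unfolding Lp_def using l1 N[OF n] h p
        by (intro integral_mono) (auto simp: lp_def F_def intro!: powr_mono2)
      also have "... = d * (\<mu> / (\<mu> + 1))" by (simp add: hp \<mu>_def)
      also have "... <= d" using d \<mu> by (simp add: pos_divide_le_eq add_pos_nonneg)
      finally show ?thesis .
    qed
    have "Lp p (%x. moll n f x - f x) = Lp p (%x. \<Sum>i\<in>{0,1,2}. F i x)"
      by (simp add: F_def moll_diff ig)
    also have "... <= real (card {0,1,2::nat}) powr p * (\<Sum>i\<in>{0,1,2}. Lp p (F i))"
      using l0 l1 l2 p by (intro lp_sum) auto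
    also have "... = C * (Lp p (F 0) + Lp p (F 1) + Lp p (F 2))" by (simp add: C_def)
    also have "... <= C * (d + d + d)" using l0 l2 L1 g C by (intro mult_left_mono add_mono) auto
    also have "... < e" using C e by (simp add: d_def)
    finally show ?thesis .
  qed
  then show "\<exists>no. \<forall>n\<ge>no. norm (Lp p (%x. moll n f x - f x) - 0) < e"
    by (auto simp: Lp_nonneg intro!: exI[of _ N])
qed

section \<open>Weak derivatives along rotation fields\<close>

text \<open>No term of order zero appears because rotation fields are divergence free for
  \<open>mu\<close>. Scalar test functions suffice for vector-valued \<open>f\<close>.\<close>

definition weak_rot :: "real^3 => (real^3 => 'b::euclidean_space) => (real^3 => 'b) => bool" where
  "weak_rot a f h \<longleftrightarrow> integrable mu f & integrable mu h \<and>
     (\<forall>u. hsmooth u --> (\<integral>x. u x *R h x \<partial>mu) = - (\<integral>x. rot a u x *R f x \<partial>mu))"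

lemma integrable_hsmooth_scaleR:
  fixes f :: "real^3 => 'b::euclidean_space"
  shows "hsmooth u ==> integrable mu f ==> integrable mu (%x. u x *R f x)"
  by (intro integrable_S2_mult_continuous hsmooth_continuous_on)

lemma weak_rot_hsmooth:
  assumes u: "hsmooth u" and a: "norm a = 1" shows "weak_rot a u (rot a u)"
  unfolding weak_rot_def
proof (intro conjI allI impI)
  show i: "integrable mu u" "integrable mu (rot a u)"
    using u by (auto intro!: integrable_S2_continuous hsmooth_continuous_on hsmooth_rot)
  fix v :: "real^3 => real" assume v: "hsmooth v"
  have "0 = (\<integral>x. rot a (%x. v x *R u x) x \<partial>mu)"
    using integral_rot[OF hsmooth_scaleR[OF v u] a] by simp
  also have "... = (\<integral>x. v x *R rot a u x + rot a v x *R u x \<partial>mu)"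
    by (rule Bochner_Integration.integral_cong) (use u v in \<open>auto simp: rot_scaleR\<close>)
  also have "... = (\<integral>x. v x *R rot a u x \<partial>mu) + (\<integral>x. rot a v x *R u x \<partial>mu)"
    using i u v by (intro Bochner_Integration.integral_add integrable_hsmooth_scaleR hsmooth_rot)
  finally show "(\<integral>x. v x *R rot a u x \<partial>mu) = - (\<integral>x. rot a v x *R u x \<partial>mu)"
    by (simp add: eq_neg_iff_add_eq_0)
qed

lemma weak_rot_add:
  assumes "weak_rot a f h" "weak_rot a f' h'" shows "weak_rot a (%x. f x + f' x) (%x. h x + h' x)"
  using assms by (auto simp: weak_rot_def scaleR_add_right integrable_hsmooth_scaleR hsmooth_rot)

lemma weak_rot_const: "weak_rot a (%_. 0) (%_. 0)"
  by (auto simp: weak_rot_def)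

lemma weak_rot_mult:
  assumes c: "hsmooth c" and w: "weak_rot a f h"
  shows "weak_rot a (%x. c x *R f x) (%x. rot a c x *R f x + c x *R h x)"
  unfolding weak_rot_def
proof (intro conjI allI impI)
  have i: "integrable mu f" "integrable mu h" using w by (auto simp: weak_rot_def)
  show "integrable mu (%x. c x *R f x)" "integrable mu (%x. rot a c x *R f x + c x *R h x)"
    using i c by (auto intro!: integrable_hsmooth_scaleR hsmooth_rot)
  fix u :: "real^3 => real" assume u: "hsmooth u"
  have uc: "hsmooth (%x. u x * c x)" using u c by (rule hsmooth_mult)
  have "(\<integral>x. (u x * c x) *R h x \<partial>mu) = - (\<integral>x. rot a (%x. u x * c x) x *R f x \<partial>mu)"
    using w uc by (auto simp: weak_rot_def)
  also have "(\<integral>x. rot a (%x. u x * c x) x *R f x \<partial>mu)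
     = (\<integral>x. (u x * rot a c x) *R f x + (rot a u x * c x) *R f x \<partial>mu)"
    by (rule Bochner_Integration.integral_cong) (use u c in \<open>auto simp: rot_mult scaleR_add_left\<close>)
  also have "... = (\<integral>x. (u x * rot a c x) *R f x \<partial>mu) + (\<integral>x. (rot a u x * c x) *R f x \<partial>mu)"
    using i u c by (intro Bochner_Integration.integral_add integrable_hsmooth_scaleR hsmooth_rot hsmooth_mult)
  finally show "(\<integral>x. u x *R (rot a c x *R f x + c x *R h x) \<partial>mu) = - (\<integral>x. rot a u x *R c x *R f x \<partial>mu)"
    using i u c
    by (simp add: scaleR_add_right integrable_hsmooth_scaleR hsmooth_rot hsmooth_mult)
qed

lemma weak_rot_cong_AE:
  assumes "weak_rot a f h" "AE x in S2_measure. f x = f' x" "AE x in S2_measure. h x = h' x"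
    and m[measurable]: "f' \<in> borel_measurable mu" "h' \<in> borel_measurable mu"
  shows "weak_rot a f' h'"
proof -
  have [measurable]: "f \<in> borel_measurable mu" "h \<in> borel_measurable mu"
    using assms(1) by (auto simp: weak_rot_def)
  have "integrable mu f \<longleftrightarrow> integrable mu f'" "integrable mu h \<longleftrightarrow> integrable mu h'"
    using assms(2,3) by (intro integrable_cong_AE; simp)+
  moreover have "(\<integral>x. u x *R h x \<partial>mu) = (\<integral>x. u x *R h' x \<partial>mu)"
     "(\<integral>x. rot a u x *R f x \<partial>mu) = (\<integral>x. rot a u x *R f' x \<partial>mu)" if u: "hsmooth u" for u
  proof -
    have [measurable]: "u \<in> borel_measurable mu" "rot a u \<in> borel_measurable mu"
      using u by (auto intro!: measurable_S2_continuous hsmooth_continuous_on hsmooth_rot)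
    show "(\<integral>x. u x *R h x \<partial>mu) = (\<integral>x. u x *R h' x \<partial>mu)"
     "(\<integral>x. rot a u x *R f x \<partial>mu) = (\<integral>x. rot a u x *R f' x \<partial>mu)"
      by (rule integral_cong_AE, use assms(2,3) in \<open>auto elim: AE_mp\<close>)+
  qed
  ultimately show ?thesis using assms(1) by (auto simp: weak_rot_def)
qed

text \<open>The kernel \<open>(1 + x \<bullet> y) ^ n\<close> is invariant under rotating both arguments, so mollification commutes with rotation
  fields; the invariance enters as \<open>(a \<times> x) \<bullet> y + x \<bullet> (a \<times> y) = 0\<close>.\<close>

lemma rot_zonal:
  "weak_rot a f h ==> x ~= 0 ==> rot a (%x. zonal n f (sgn x)) x = zonal n h (sgn x)"
proof (induction n arbitrary: f h x)
  case 0
  have "(\<integral>y. 1 *R h y \<partial>mu) = - (\<integral>y. rot a (%_. 1) y *R f y \<partial>mu)"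
    using 0 hsmooth_const unfolding weak_rot_def by blast
  then show ?case by (simp add: zonal_def)
next
  case (Suc n)
  define c where "c b y = sgn y \<bullet> b" for b y :: "real^3"
  have c: "hsmooth (c b)" for b unfolding c_def[abs_def] by (rule hsmooth_linear_comp[OF bounded_linear_inner_left hsmooth_sgn])
  have rc: "rot a (c b) y = (a >< sgn y) \<bullet> b" if "y ~= 0" for b y
    using rot_linear_comp[OF bounded_linear_inner_left hsmooth_sgn that, of a b] rot_sgn[OF that] by (simp add: c_def[abs_def])
  have i: "integrable mu f" "integrable mu h" using Suc.prems by (auto simp: weak_rot_def)
  note ic = integrable_hsmooth_scaleR[OF c i(1)] integrable_hsmooth_scaleR[OF c i(2)] integrable_hsmooth_scaleR[OF hsmooth_rot[OF c] i(1)]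
  have z: "zonal (Suc n) k = (%x. zonal n k x + (\<Sum>b\<in>Basis. (x \<bullet> b) *R zonal n (%y. c b y *R k y) x))"
    if "integrable mu k" for k :: "real^3 => 'a"
    unfolding zonal_Suc[OF that] unfolding zonal_def
    by (intro ext arg_cong2[where f="(+)"] sum.cong refl arg_cong2[where f=scaleR] Bochner_Integration.integral_cong) (auto simp: c_def)
  have zadd: "zonal n (%y. F y + H y) s = zonal n F s + zonal n H s"
    if "integrable mu F" "integrable mu H" for F H :: "real^3 => 'a" and s
    using integrable_zonal[OF that(1), of s n] integrable_zonal[OF that(2), of s n] by (simp add: zonal_def scaleR_add_right)
  have "rot a (%x. zonal (Suc n) f (sgn x)) x =
      rot a (%x. zonal n f (sgn x) + (\<Sum>b\<in>Basis. c b x *R zonal n (%y. c b y *R f y) (sgn x))) x"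
    by (simp add: z[OF i(1)] c_def)
  also have "... = zonal n h (sgn x) + (\<Sum>b\<in>Basis. c b x *R zonal n (%y. rot a (c b) y *R f y + c b y *R h y) (sgn x) +
      rot a (c b) x *R zonal n (%y. c b y *R f y) (sgn x))"
    using Suc.prems
    by (simp add: rot_add rot_sum rot_scaleR hsmooth_sum hsmooth_scaleR hsmooth_zonal c i ic Suc.IH Suc.IH[OF weak_rot_mult[OF c]])
  also have "... = zonal n h (sgn x) + (\<Sum>b\<in>Basis. c b x *R zonal n (%y. c b y *R h y) (sgn x)) +
      (\<Sum>b\<in>Basis. c b x *R zonal n (%y. rot a (c b) y *R f y) (sgn x) + rot a (c b) x *R zonal n (%y. c b y *R f y) (sgn x))"
    unfolding zadd[OF ic(3) ic(2)] by (simp add: scaleR_add_right sum.distrib algebra_simps)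
  also have "(\<Sum>b\<in>Basis. c b x *R zonal n (%y. rot a (c b) y *R f y) (sgn x) + rot a (c b) x *R zonal n (%y. c b y *R f y) (sgn x)) =
      (\<integral>y. (\<Sum>b\<in>Basis. c b x *R (1 + sgn x \<bullet> y) ^ n *R rot a (c b) y *R f y + rot a (c b) x *R (1 + sgn x \<bullet> y) ^ n *R c b y *R f y) \<partial>mu)"
    by (simp add: zonal_def integrable_zonal ic del: scaleR_scaleR)
  also have "... = (\<integral>y. 0 \<partial>mu)"
  proof (rule Bochner_Integration.integral_cong[OF refl])
    fix y assume "y \<in> space mu"
    then have y: "y \<in> S2" by simp
    have "(\<Sum>b\<in>Basis. c b x * rot a (c b) y + rot a (c b) x * c b y) = sgn x \<bullet> (a >< y) + (a >< sgn x) \<bullet> y"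
      using y Suc.prems by (simp add: rc c_def euclidean_inner[symmetric] sum.distrib)
    also have "... = 0" by (simp add: cross3_simps)
    finally have z: "(\<Sum>b\<in>Basis. c b x * rot a (c b) y + rot a (c b) x * c b y) = 0" .
    have "(\<Sum>b\<in>Basis. c b x *R (1 + sgn x \<bullet> y) ^ n *R rot a (c b) y *R f y +
        rot a (c b) x *R (1 + sgn x \<bullet> y) ^ n *R c b y *R f y) =
        (\<Sum>b\<in>Basis. ((1 + sgn x \<bullet> y) ^ n * (c b x * rot a (c b) y + rot a (c b) x * c b y)) *R f y)"
      by (intro sum.cong refl) (simp add: algebra_simps)
    also have "... = 0" unfolding scaleR_sum_left[symmetric] sum_distrib_left[symmetric] z by simp
    finally show "(\<Sum>b\<in>Basis. c b x *R (1 + sgn x \<bullet> y) ^ n *R rot a (c b) y *R f y +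
        rot a (c b) x *R (1 + sgn x \<bullet> y) ^ n *R c b y *R f y) = 0" .
  qed
  finally show ?case by (simp add: z[OF i(2)] c_def)
qed

lemma rot_moll:
  assumes w: "weak_rot a f h" and x: "x ~= 0"
  shows "rot a (moll n f) x = moll n h x"
  unfolding moll_def[abs_def]
  by (subst rot_linear_comp[OF bounded_linear_scaleR_right hsmooth_zonal x]) (use w in \<open>auto simp: weak_rot_def rot_zonal[OF w x]\<close>)

lemma lp_1_integrable: "integrable mu f ==> lp 1 f"
  by (auto simp: lp_def)

text \<open>Mollification turns the weak derivative into the classical one of the mollified
  function, so \<open>h\<close> and \<open>h'\<close> have the same mollifications, and these
  converge to them in L^1.\<close>

lemma weak_rot_unique:
  assumes "weak_rot a f h" "weak_rot a f' h'" "AE x in S2_measure. f x = f' x"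
  shows "AE x in S2_measure. h x = h' x"
proof -
  have i: "integrable mu f" "integrable mu h" "integrable mu f'" "integrable mu h'"
    using assms by (auto simp: weak_rot_def)
  have "weak_rot a f h'"
    by (rule weak_rot_cong_AE[OF assms(2)]) (use assms(3) i in auto)
  then have "moll n h x - moll n h' x = 0" if "x ~= 0" for n x
    using rot_moll[OF assms(1) that, of n] rot_moll[of a f h', OF _ that, of n] by simp
  then have z: "moll n (%x. h x - h' x) x = 0" if "x \<in> S2" for n x
    using that S2_nonzero by (simp add: moll_diff i)
  have l: "lp 1 (%x. h x - h' x)" using i by (intro lp_1_integrable) auto
  have "Lp 1 (%x. moll n (%x. h x - h' x) x - (h x - h' x)) = Lp 1 (%x. h x - h' x)" for n
    unfolding Lp_def by (rule Bochner_Integration.integral_cong) (auto simp: z norm_minus_commute)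
  then have "Lp 1 (%x. h x - h' x) = 0"
    using moll_tendsto[OF _ l] by (simp add: LIMSEQ_const_iff)
  from Lp_eq_0_imp_AE[OF l this] show ?thesis by (rule AE_mp) simp
qed

lemma weak_rot_limit:
  assumes p: "p >= 1" and w: "!!n. weak_rot a (f n) (h n)"
    and l: "!!n. lp p (f n)" "!!n. lp p (h n)" "lp p g" "lp p k"
    and lim: "(%n. Lp p (%x. f n x - g x)) \<longlonglongrightarrow> 0" "(%n. Lp p (%x. h n x - k x)) \<longlonglongrightarrow> 0"
  shows "weak_rot a g k"
  unfolding weak_rot_def
proof (intro conjI allI impI)
  show "integrable mu g" "integrable mu k" using l p by (auto intro: lp_integrable)
  fix u :: "real^3 => real" assume u: "hsmooth u"
  have "(%n. \<integral>x. u x *R h n x \<partial>mu) \<longlonglongrightarrow> (\<integral>x. u x *R k x \<partial>mu)"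
    using u by (intro Lp_tendsto_integral[OF p l(2,4) lim(2)] hsmooth_continuous_on)
  moreover have "(%n. - (\<integral>x. rot a u x *R f n x \<partial>mu)) \<longlonglongrightarrow> - (\<integral>x. rot a u x *R g x \<partial>mu)"
    using u by (intro tendsto_minus Lp_tendsto_integral[OF p l(1,3) lim(1)] hsmooth_continuous_on hsmooth_rot)
  moreover have "(\<integral>x. u x *R h n x \<partial>mu) = - (\<integral>x. rot a u x *R f n x \<partial>mu)" for n
    using w[of n] u by (auto simp: weak_rot_def)
  ultimately show "(\<integral>x. u x *R k x \<partial>mu) = - (\<integral>x. rot a u x *R g x \<partial>mu)"
    using LIMSEQ_unique by force
qed

section \<open>Jets\<close>

definition words :: "nat => (real^3) list set" where
  "words k = {w. set w \<subseteq> Basis & length w <= k}"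

primrec jet :: "(real^3 => 'b::euclidean_space) => (real^3) list => real^3 => 'b" where
  "jet u [] = u"
| "jet u (a # w) = rot a (jet u w)"

text \<open>A family of functions indexed by words and tied together by weak derivatives. The order
  of the letters is kept because rotation fields do not commute; the head is the outermost
  derivative.\<close>

definition wjet :: "nat => 'b::euclidean_space jets => bool" where
  "wjet k J \<longleftrightarrow> (\<forall>w\<in>words k. integrable mu (J w)) \<and>
     (\<forall>a w. a # w \<in> words k --> weak_rot a (J w) (J (a # w)))"

definition lpjet :: "real => nat => 'b::euclidean_space jets => bool" where
  "lpjet p k J \<longleftrightarrow> (\<forall>w\<in>words k. lp p (J w))"

definition jetE :: "real => nat => 'b::euclidean_space jets => real" where
  "jetE p k J = (\<Sum>w\<in>words k. Lp p (J w))"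

lemma finite_words [simp]: "finite (words k)"
  unfolding words_def by (rule finite_lists_length_le) auto

lemma words_Nil [simp]: "[] \<in> words k" by (simp add: words_def)

lemma words_Cons: "a # w \<in> words (Suc k) \<longleftrightarrow> a \<in> Basis & w \<in> words k"
  by (auto simp: words_def)

lemma words_ConsD: "a # w \<in> words k ==> a \<in> Basis & w \<in> words k"
  by (auto simp: words_def)

lemma words_mono: "k <= l ==> words k \<subseteq> words l"
  by (auto simp: words_def)

lemma jetE_nonneg: "jetE p k J >= 0"
  unfolding jetE_def by (intro sum_nonneg Lp_nonneg)

lemma jetE_mono: "k <= l ==> jetE p k J <= jetE p l J"
  unfolding jetE_def by (intro sum_mono2 words_mono) (auto simp: Lp_nonneg)

lemma Lp_le_jetE: "w \<in> words k ==> Lp p (J w) <= jetE p k J"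
  unfolding jetE_def by (intro member_le_sum) (auto simp: Lp_nonneg)

lemma wjet_mono: "wjet l J ==> k <= l ==> wjet k J"
  using words_mono[of k l] by (auto simp: wjet_def)

lemma lpjet_mono: "lpjet p l J ==> k <= l ==> lpjet p k J"
  using words_mono[of k l] by (auto simp: lpjet_def)

lemma hsmooth_jet: "hsmooth u ==> hsmooth (jet u w)"
  by (induction w) (auto intro: hsmooth_rot)

lemma wjet_jet: "hsmooth u ==> wjet k (jet u)"
  by (auto simp: wjet_def words_def
      intro!: integrable_S2_continuous hsmooth_continuous_on hsmooth_jet weak_rot_hsmooth norm_Basis)

lemma lpjet_jet: "hsmooth u ==> p >= 1 ==> lpjet p k (jet u)"
  by (auto simp: lpjet_def intro!: lp_continuous hsmooth_continuous_on hsmooth_jet)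

lemma jet_moll:
  assumes "wjet k J" "w \<in> words k" "x ~= 0"
  shows "jet (moll n (J [])) w x = moll n (J w) x"
  using assms(2,3)
proof (induction w arbitrary: x)
  case (Cons a w)
  have "jet (moll n (J [])) (a # w) x = rot a (moll n (J w)) x"
    unfolding jet.simps using Cons words_ConsD[OF Cons.prems(1)] by (intro rot_cong) auto
  also have "... = moll n (J (a # w)) x"
    using assms(1) Cons.prems by (intro rot_moll) (auto simp: wjet_def)
  finally show ?case .
qed simp

text \<open>Since mollification commutes with every rotation derivative, mollifying the single
  function \<open>J []\<close> approximates all entries at once.\<close>

lemma wjet_approx:
  assumes p: "p >= 1" and J: "wjet k J" "lpjet p k J"
  obtains u where "!!n. hsmooth (u n)" "(%n. jetE p k (%w x. jet (u n) w x - J w x)) \<longlonglongrightarrow> 0"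
proof
  show "hsmooth (moll n (J []))" for n using J(1) by (intro hsmooth_moll) (auto simp: wjet_def)
  have "(%n. Lp p (%x. jet (moll n (J [])) w x - J w x)) \<longlonglongrightarrow> 0" if w: "w \<in> words k" for w
  proof -
    have "Lp p (%x. jet (moll n (J [])) w x - J w x) = Lp p (%x. moll n (J w) x - J w x)" for n
      by (rule Lp_cong_S2) (simp add: jet_moll[OF J(1) w] S2_nonzero)
    then show ?thesis using moll_tendsto[OF p, of "J w"] J(2) w by (simp add: lpjet_def)
  qed
  then show "(%n. jetE p k (%w x. jet (moll n (J [])) w x - J w x)) \<longlonglongrightarrow> 0"
    unfolding jetE_def by (auto intro!: tendsto_null_sum)
qed

section \<open>Families of diffeomorphisms\<close>

locale diffeo_family =
  fixes G :: "'p::euclidean_space set" and phi :: "'p => real^3 => real^3"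
  assumes open_G: "open G"
    and smooth_phi: "smooth_on (G \<times> (- {0})) (%(\<gamma>, y). phi \<gamma> (sgn y))"
    and diffeo_phi: "!!\<gamma>. \<gamma> \<in> G ==> S2_diffeo (phi \<gamma>)"
begin

abbreviation GS :: "('p \<times> (real^3)) set" where "GS \<equiv> G \<times> (- {0})"

definition psi :: "'p \<times> (real^3) => real^3" where
  "psi z = phi (fst z) (sgn (snd z))"

definition hsm :: "('p \<times> (real^3) => 'b::real_normed_vector) => bool" where
  "hsm C \<longleftrightarrow> smooth_on GS C & (\<forall>\<gamma>\<in>G. \<forall>y. y ~= 0 --> C (\<gamma>, sgn y) = C (\<gamma>, y))"

text \<open>Derivative in the parameter direction \<open>c\<close> and along the rotation field of
  \<open>a\<close> simultaneously, so that \<open>pder c 0\<close> and \<open>pder 0 a\<close> share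
  one product rule and one chain rule.\<close>

definition pder :: "'p => real^3 => ('p \<times> (real^3) => 'b::real_normed_vector) => 'p \<times> (real^3) => 'b" where
  "pder c a = Der (%z. (c, a >< snd z))"

lemma open_GS: "open GS"
  using open_G by (intro open_Times) auto

lemma hsm_differentiable: "hsm C ==> z \<in> GS ==> C differentiable (at z)"
  unfolding hsm_def using smooth_on_differentiable by blast

lemma hsm_const: "hsm (%_. c)"
  by (auto simp: hsm_def intro: smooth_on_const open_GS)

lemma hsm_add: "hsm f ==> hsm g ==> hsm (%z. f z + g z)"
  by (auto simp: hsm_def intro: smooth_on_add)

lemma hsm_bilinear: "bounded_bilinear B ==> hsm f ==> hsm g ==> hsm (%z. B (f z) (g z))"
  by (auto simp: hsm_def intro: smooth_on_bilinear)

lemma hsm_linear_comp: "bounded_linear L ==> hsm f ==> hsm (%z. L (f z))"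
  by (auto simp: hsm_def intro: smooth_on_linear_comp)

lemma hsm_cong:
  assumes "hsm f" "!!\<gamma> y. \<gamma> \<in> G ==> y ~= 0 ==> f (\<gamma>, y) = g (\<gamma>, y)" shows "hsm g"
  unfolding hsm_def
proof safe
  show "smooth_on GS g" by (rule smooth_on_cong[of _ f]) (use assms in \<open>auto simp: hsm_def\<close>)
  show "g (\<gamma>, sgn y) = g (\<gamma>, y)" if "\<gamma> \<in> G" "y ~= 0" for \<gamma> y
    using that assms(2)[of \<gamma> y] assms(2)[of \<gamma> "sgn y"] assms(1) by (auto simp: hsm_def sgn_zero_iff)
qed

lemma hsm_compose:
  fixes f :: "'p \<times> (real^3) => real^3" and u :: "real^3 => 'b::real_normed_vector"
  assumes u: "hsmooth u" and f: "hsm f" and nz: "!!\<gamma> y. \<gamma> \<in> G ==> y ~= 0 ==> f (\<gamma>, y) ~= 0"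
  shows "hsm (%z. u (f z))"
  unfolding hsm_def
proof safe
  show "smooth_on GS (%z. u (f z))"
    by (rule smooth_on_compose[of "- {0}"]) (use assms in \<open>auto simp: hsm_def hsmooth_def\<close>)
qed (use f in \<open>auto simp: hsm_def\<close>)

lemma hsm_psi: "hsm psi"
  using smooth_phi by (auto simp: hsm_def psi_def[abs_def] case_prod_unfold sgn_sgn_vector)

lemma phi_S2: "\<gamma> \<in> G ==> x \<in> S2 ==> phi \<gamma> x \<in> S2"
  using diffeo_phi by (auto simp: S2_diffeo_def bij_betw_def)

lemma psi_S2: "\<gamma> \<in> G ==> y ~= 0 ==> psi (\<gamma>, y) \<in> S2"
  using phi_S2 sgn_in_S2 by (auto simp: psi_def)

lemma psi_eq_phi: "x \<in> S2 ==> psi (\<gamma>, x) = phi \<gamma> x"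
  by (simp add: psi_def)

lemma hsm_slice:
  assumes C: "hsm C" and \<gamma>: "\<gamma> \<in> G" shows "hsmooth (%y. C (\<gamma>, y))"
  unfolding hsmooth_def
proof safe
  show "smooth_on (- {0}) (%y. C (\<gamma>, y))"
    by (rule smooth_on_compose[of GS C])
      (use assms in \<open>auto simp: hsm_def intro!: smooth_on_Pair smooth_on_const smooth_on_ident\<close>)
qed (use assms in \<open>auto simp: hsm_def\<close>)

lemma smooth_pder_field: "smooth_on GS (%z. (c :: 'p, a >< snd z))"
proof (intro smooth_on_Pair smooth_on_const open_GS)
  show "smooth_on GS (%z. a >< snd z)"
    using smooth_on_linear_comp[OF bounded_bilinear.bounded_linear_right[OF bounded_bilinear_cross3] smooth_on_snd[OF open_GS]] .
qed

lemma hsm_pder: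
  assumes C: "hsm C" shows "hsm (pder c a C)"
  unfolding hsm_def
proof safe
  show "smooth_on GS (pder c a C)"
    unfolding pder_def using C smooth_pder_field by (intro smooth_on_Der) (auto simp: hsm_def)
  fix \<gamma> y assume g: "\<gamma> \<in> G" and y: "(y :: real^3) ~= 0"
  let ?q = "%z::'p \<times> (real^3). (fst z, sgn (snd z))"
  have sy: "sgn y ~= 0" using sgn_in_S2[OF y] by simp
  have d: "(?q has_derivative (%h. (fst h, frechet_derivative sgn (at y) (snd h)))) (at (\<gamma>, y))"
  proof (rule has_derivative_Pair)
    have "(sgn has_derivative frechet_derivative sgn (at y)) (at (snd (\<gamma>, y)))"
      using hsmooth_differentiable[OF hsmooth_sgn y] by (simp add: frechet_derivative_works[symmetric])
    from has_derivative_compose[OF bounded_linear_imp_has_derivative[OF bounded_linear_snd] this, of UNIV]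
    show "((%z. sgn (snd z)) has_derivative (%h. frechet_derivative sgn (at y) (snd h))) (at (\<gamma>, y))" by simp
  qed (rule bounded_linear_imp_has_derivative[OF bounded_linear_fst])
  have dq: "Der (%z. (c, a >< snd z)) ?q (\<gamma>, y) = (c, a >< sgn y)"
    using rot_sgn[OF y, of a] by (simp add: Der_eqI[OF d]) (simp add: rot_def Der_def)
  have "pder c a C (\<gamma>, y) = Der (%z. (c, a >< snd z)) (%z. C (?q z)) (\<gamma>, y)"
    unfolding pder_def
  proof (rule Der_cong[OF open_GS])
    fix w assume w: "w \<in> GS"
    then obtain \<gamma>' y' where "w = (\<gamma>', y')" "\<gamma>' \<in> G" "y' ~= 0" by auto
    then show "C w = C (?q w)" using C by (simp add: hsm_def)
  qed (use g y in auto)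
  also have "... = frechet_derivative C (at (?q (\<gamma>, y))) (c, a >< sgn y)"
    unfolding dq[symmetric]
    by (rule Der_compose) (use C g sy d hsm_differentiable in \<open>auto simp: differentiable_def[of ?q]\<close>)
  also have "... = pder c a C (\<gamma>, sgn y)" by (simp add: pder_def Der_def)
  finally show "pder c a C (\<gamma>, sgn y) = pder c a C (\<gamma>, y)" by simp
qed

lemma rot_slice:
  assumes C: "hsm C" and \<gamma>: "\<gamma> \<in> G" and y: "y ~= 0"
  shows "rot a (%y. C (\<gamma>, y)) y = pder 0 a C (\<gamma>, y)"
proof -
  have D: "((%y. (\<gamma>, y)) has_derivative (%h. (0, h))) (at y)"
    by (intro has_derivative_Pair has_derivative_const has_derivative_ident)
  have "rot a (%y. C (\<gamma>, y)) y = frechet_derivative C (at (\<gamma>, y)) (Der (%y. a >< y) (%y. (\<gamma>, y)) y)"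
    unfolding rot_def
    by (rule Der_compose) (use C \<gamma> y hsm_differentiable D in \<open>auto simp: differentiable_def[of "Pair \<gamma>"]\<close>)
  then show ?thesis by (simp add: Der_eqI[OF D]) (simp add: pder_def Der_def)
qed

text \<open>The coefficients of \<open>tangent_rot_representation\<close> for the tangent vector
  \<open>pder c a psi z\<close> at the point \<open>psi z\<close>.\<close>

definition pcoef :: "'p => real^3 => real^3 => 'p \<times> (real^3) => real" where
  "pcoef c a b z = (psi z >< pder c a psi z) \<bullet> b"

lemma hsm_pcoef: "hsm (pcoef c a b)"
  unfolding pcoef_def
  by (intro hsm_linear_comp[OF bounded_linear_inner_left] hsm_bilinear[OF bounded_bilinear_cross3]
      hsm_pder hsm_psi)

lemma pder_bilinear: "bounded_bilinear B ==> hsm f ==> hsm g ==> z \<in> GS ==>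
    pder c a (%z. B (f z) (g z)) z = B (f z) (pder c a g z) + B (pder c a f z) (g z)"
  unfolding pder_def by (intro Der_bilinear hsm_differentiable)

lemma pder_add: "hsm f ==> hsm g ==> z \<in> GS ==> pder c a (%z. f z + g z) z = pder c a f z + pder c a g z"
  unfolding pder_def by (intro Der_add hsm_differentiable)

lemma pder_cong: "z \<in> GS ==> (!!z. z \<in> GS ==> f z = g z) ==> pder c a f z = pder c a g z"
  unfolding pder_def by (rule Der_cong[OF open_GS])

lemma pder_linear:
  assumes C: "hsm C" and z: "z \<in> GS"
  shows "pder c 0 C z = (\<Sum>b\<in>Basis. (c \<bullet> b) *R pder b 0 C z)"
proof -
  have l: "linear (frechet_derivative C (at z))"
    using hsm_differentiable[OF C z] by (rule linear_frechet_derivative)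
  have "(c, 0 :: real^3) = (\<Sum>b\<in>Basis. (c \<bullet> b) *R (b, 0))"
    by (simp add: prod_eq_iff fst_sum snd_sum euclidean_representation)
  then have "frechet_derivative C (at z) (c, 0) = frechet_derivative C (at z) (\<Sum>b\<in>Basis. (c \<bullet> b) *R (b, 0))"
    by (rule arg_cong)
  also have "... = (\<Sum>b\<in>Basis. (c \<bullet> b) *R frechet_derivative C (at z) (b, 0))"
    unfolding linear_sum[OF l] linear_cmul[OF l] ..
  finally show ?thesis by (simp add: pder_def Der_def)
qed

text \<open>The image of \<open>psi\<close> lies in the sphere, so its derivative is tangent and expands in rotation fields.\<close>

lemma pder_comp_psi:
  assumes u: "hsmooth u" and z: "z \<in> GS"
  shows "pder c a (%z. u (psi z)) z = (\<Sum>b\<in>Basis. pcoef c a b z *R rot b u (psi z))"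
proof -
  have S: "psi z \<in> S2" if "z \<in> GS" for z using that psi_S2 by auto
  have "0 = pder c a (%z. psi z \<bullet> psi z) z"
  proof -
    have "pder c a (%z. psi z \<bullet> psi z) z = pder c a (%z. 1) z"
      using S by (intro pder_cong z) (auto simp: mem_sphere_0 norm_eq_1)
    then show ?thesis by (simp add: pder_def)
  qed
  also have "... = 2 * (pder c a psi z \<bullet> psi z)"
    using pder_bilinear[OF bounded_bilinear_inner hsm_psi hsm_psi z, of c a] by (simp add: inner_commute)
  finally have t: "pder c a psi z \<bullet> psi z = 0" by simp
  have "pder c a (%z. u (psi z)) z = frechet_derivative u (at (psi z)) (pder c a psi z)"
    unfolding pder_def
    by (rule Der_compose[OF hsmooth_differentiable[OF u S2_nonzero[OF S[OF z]]] hsm_differentiable[OF hsm_psi z]])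
  also have "... = (\<Sum>b\<in>Basis. pcoef c a b z *R rot b u (psi z))"
    unfolding pcoef_def
    by (rule frechet_tangent_rot[OF hsmooth_differentiable[OF u S2_nonzero[OF S[OF z]]] S[OF z] t])
  finally show ?thesis .
qed

section \<open>Pullbacks are bounded on \<open>L\<^sup>p\<close>\<close>

lemma hsm_continuous_on: "hsm C ==> continuous_on (G \<times> S2) C"
  by (rule continuous_on_subset[of GS]) (auto simp: hsm_def intro: smooth_on_continuous dest: S2_nonzero)

lemma hsm_bounded:
  assumes "hsm C" "compact K" "K \<subseteq> G"
  obtains B where "B > 0" "!!\<gamma> x. \<gamma> \<in> K ==> x \<in> S2 ==> norm (C (\<gamma>, x)) <= B"
proof -
  have "compact (C ` (K \<times> S2))"
    using assms by (intro compact_continuous_image continuous_on_subset[OF hsm_continuous_on] compact_Times) auto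
  then obtain B where "B > 0" "\<forall>v\<in>C ` (K \<times> S2). norm v <= B"
    using compact_imp_bounded bounded_pos by metis
  with that show ?thesis by auto
qed

lemma det_matrix_frechet_continuous:
  fixes F :: "'p \<times> (real^3) => real^3"
  assumes F: "smooth_on GS F"
  shows "continuous_on GS (%z. det (matrix (%v. frechet_derivative F (at z) (0, v))))"
proof -
  have c: "continuous_on GS (%z. frechet_derivative F (at z) (0, axis j 1))" for j
    using smooth_on_Ck[OF F, of 1] by simp
  show ?thesis
    unfolding det_def matrix_def vec_lambda_beta
    by (intro continuous_intros c)
qed

text \<open>The Jacobian of the degree one extension of \<open>phi \<gamma>\<close> is constant
  along rays and never zero, hence bounded below by compactness of \<open>K \<times> S2\<close>;
  this gives one constant for all parameters in \<open>K\<close>.\<close>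

lemma phi_pullback_bound:
  assumes K: "compact K" "K \<subseteq> G"
  obtains c where "c > 0" "!!\<gamma>. \<gamma> \<in> K ==> phi \<gamma> \<in> measurable mu mu"
    "!!\<gamma> A. \<gamma> \<in> K ==> A \<in> sets mu ==>
       c * measure mu (phi \<gamma> -` A \<inter> S2) <= measure mu A"
proof -
  define F where "F z = norm (snd z) *R psi z" for z :: "'p \<times> (real^3)"
  have F: "smooth_on GS F"
    unfolding F_def[abs_def]
  proof (intro smooth_on_scaleR)
    show "smooth_on GS (%z. norm (snd z))"
      using smooth_on_compose[OF smooth_on_norm smooth_on_snd[OF open_GS]] by auto
    show "smooth_on GS psi" using hsm_psi by (simp add: hsm_def)
  qed
  define D where "D z v = frechet_derivative F (at z) (0, v)" for z and v :: "real^3"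
  have DF: "((%y. F (\<gamma>, y)) has_derivative D (\<gamma>, y)) (at y)" if "\<gamma> \<in> G" "y ~= 0" for \<gamma> y
  proof -
    have 1: "((%y. (\<gamma>, y)) has_derivative (%h. (0, h))) (at y)"
      by (intro has_derivative_Pair has_derivative_const has_derivative_ident)
    have "(F has_derivative frechet_derivative F (at (\<gamma>, y))) (at (\<gamma>, y))"
      using smooth_on_has_derivative[OF F] that by auto
    from has_derivative_compose[OF 1 this] show ?thesis by (simp add: D_def[abs_def])
  qed
  have Dlin: "linear (D (\<gamma>, y))" if "\<gamma> \<in> G" "y ~= 0" for \<gamma> y
    using DF[OF that] has_derivative_linear by blast
  have hom: "D (\<gamma>, sgn y) = D (\<gamma>, y)" if g: "\<gamma> \<in> G" and y: "y ~= 0" for \<gamma> and y :: "real^3"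
  proof -
    have s: "sgn y ~= 0" using sgn_in_S2[OF y] by simp
    define r where "r = norm y"
    have r: "r > 0" "r *R sgn y = y" using y by (auto simp: r_def sgn_div_norm)
    have sc: "F (\<gamma>, r *R w) = r *R F (\<gamma>, w)" for w
      using r by (simp add: F_def psi_def sgn_scaleR)
    have "((%w. (1 / r) *R F (\<gamma>, r *R w)) has_derivative (%h. (1 / r) *R D (\<gamma>, y) (r *R h))) (at (sgn y))"
      using has_derivative_compose[of "%w. r *R w" "%h. r *R h" "sgn y" UNIV "%y. F (\<gamma>, y)" "D (\<gamma>, y)"] DF[OF g y] r
      by (intro has_derivative_scaleR_right) (simp add: has_derivative_scaleR_right[OF has_derivative_ident])
    moreover have "(%w. (1 / r) *R F (\<gamma>, r *R w)) = (%w. F (\<gamma>, w))" using r by (simp add: sc)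
    moreover have "(%h. (1 / r) *R D (\<gamma>, y) (r *R h)) = D (\<gamma>, y)"
      using r linear_cmul[OF Dlin[OF g y]] by simp
    ultimately show ?thesis using has_derivative_unique[OF DF[OF g s]] by simp
  qed
  \<comment> \<open>The degree one extension \<open>Q\<close> of the inverse map is a smooth left
    inverse of \<open>F\<close>; differentiating \<open>Q (F (\<gamma>, w)) = w\<close> shows that
    the derivative of \<open>F\<close> is injective.\<close>
  have nz: "det (matrix (D (\<gamma>, y))) ~= 0" if g: "\<gamma> \<in> G" and y: "y ~= 0" for \<gamma> y
  proof -
    define \<eta> where "\<eta> = inv_into S2 (phi \<gamma>)"
    define Q where "Q w = norm w *R \<eta> (sgn w)" for w :: "real^3"
    have b: "bij_betw (phi \<gamma>) S2 S2" "smooth_on_S2 \<eta>"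
      using diffeo_phi[OF g] by (auto simp: S2_diffeo_def \<eta>_def)
    have Qs: "smooth_on (- {0}) Q"
      unfolding Q_def using b(2) by (intro smooth_on_scaleR smooth_on_norm) (simp add: smooth_on_S2_def)
    have QF: "Q (F (\<gamma>, w)) = w" if w: "w ~= 0" for w
    proof -
      have sw: "sgn w \<in> S2" using sgn_in_S2[OF w] .
      have p: "phi \<gamma> (sgn w) \<in> S2" using phi_S2[OF g sw] .
      have "sgn (F (\<gamma>, w)) = phi \<gamma> (sgn w)" "norm (F (\<gamma>, w)) = norm w"
        using w p by (simp_all add: F_def psi_def sgn_scaleR) (simp add: mem_sphere_0)
      moreover have "\<eta> (phi \<gamma> (sgn w)) = sgn w"
        using b(1) sw by (simp add: \<eta>_def bij_betw_def inv_into_f_f)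
      ultimately show ?thesis using w by (simp add: Q_def sgn_div_norm)
    qed
    have "F (\<gamma>, y) ~= 0" using QF[OF y] y psi_S2[OF g y] by (auto simp: F_def)
    then have "(Q has_derivative frechet_derivative Q (at (F (\<gamma>, y)))) (at (F (\<gamma>, y)))"
      using smooth_on_has_derivative[OF Qs] by auto
    from has_derivative_compose[OF DF[OF g y] this]
    have "((%w. Q (F (\<gamma>, w))) has_derivative (%v. frechet_derivative Q (at (F (\<gamma>, y))) (D (\<gamma>, y) v))) (at y)" .
    then have "((%w. w) has_derivative (%v. frechet_derivative Q (at (F (\<gamma>, y))) (D (\<gamma>, y) v))) (at y)"
      by (rule has_derivative_transform_within_open[of _ _ _ _ "- {0}"]) (use y QF in auto)
    then have "(%v. frechet_derivative Q (at (F (\<gamma>, y))) (D (\<gamma>, y) v)) = (%v. v)"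
      using has_derivative_unique has_derivative_ident by blast
    then have "inj (D (\<gamma>, y))" by (intro injI) metis
    then show ?thesis using det_nz_iff_inj[OF Dlin[OF g y]] by simp
  qed
  have cont: "continuous_on (K \<times> S2) (%z. \<bar>det (matrix (D z))\<bar>)"
    unfolding D_def[abs_def]
    by (intro continuous_on_rabs continuous_on_subset[OF det_matrix_frechet_continuous[OF F]])
      (use K S2_nonzero in blast)
  obtain c where c: "c > 0" "!!\<gamma> x. \<gamma> \<in> K ==> x \<in> S2 ==> c <= \<bar>det (matrix (D (\<gamma>, x)))\<bar>"
  proof (cases "K = {}")
    case False
    have "\<exists>z\<in>K \<times> S2. \<forall>w\<in>K \<times> S2. \<bar>det (matrix (D z))\<bar> <= \<bar>det (matrix (D w))\<bar>"
      using K False axis_in_S2 by (intro continuous_attains_inf cont compact_Times) auto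
    then obtain \<gamma>0 x0 where z: "\<gamma>0 \<in> K" "x0 \<in> S2"
      "!!\<gamma> x. \<gamma> \<in> K ==> x \<in> S2 ==> \<bar>det (matrix (D (\<gamma>0, x0)))\<bar> <= \<bar>det (matrix (D (\<gamma>, x)))\<bar>" by auto
    show ?thesis
      by (rule that[of "\<bar>det (matrix (D (\<gamma>0, x0)))\<bar>"]) (use z K nz[of \<gamma>0 x0] in auto)
  qed (use that[of 1] in auto)
  have fin: "phi \<gamma> \<in> measurable mu mu & (\<forall>A\<in>sets S2_measure.
       c * measure mu (phi \<gamma> -` A \<inter> S2) <= measure mu A)" if \<gamma>: "\<gamma> \<in> K" for \<gamma>
  proof -
    have g: "\<gamma> \<in> G" using \<gamma> K by auto
    have 1: "!!y. y ~= 0 ==> ((%y. F (\<gamma>, y)) has_derivative D (\<gamma>, y)) (at y)" by (rule DF[OF g])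
    have 2: "!!y. y ~= 0 ==> c <= \<bar>det (matrix (D (\<gamma>, y)))\<bar>"
      using c(2)[OF \<gamma>] sgn_in_S2 hom[OF g] by metis
    have 3: "bij_betw (phi \<gamma>) S2 S2" using diffeo_phi[OF g] by (simp add: S2_diffeo_def)
    have 4: "!!y. y ~= 0 ==> F (\<gamma>, y) = norm y *R phi \<gamma> (sgn y)" by (simp add: F_def psi_def)
    show ?thesis
      using S2_measure_pullback_le[OF 1 2 3 4] sets.empty_sets by blast
  qed
  show ?thesis by (rule that[OF c(1)]) (use fin in auto)
qed

lemma lp_pullback:
  assumes K: "compact K" "K \<subseteq> G"
  obtains B where "B >= 0" "!!\<gamma>. \<gamma> \<in> K ==> phi \<gamma> \<in> measurable mu mu"
    "!!\<gamma> p f. \<gamma> \<in> K ==> lp p (f :: real^3 => 'b::euclidean_space) ==>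
       lp p (%x. f (phi \<gamma> x)) & Lp p (%x. f (phi \<gamma> x)) <= B * Lp p f"
proof -
  obtain c where c: "c > 0" "!!\<gamma>. \<gamma> \<in> K ==> phi \<gamma> \<in> measurable mu mu"
    "!!\<gamma> A. \<gamma> \<in> K ==> A \<in> sets mu ==>
       c * measure mu (phi \<gamma> -` A \<inter> S2) <= measure mu A"
    using phi_pullback_bound[OF K] by metis
  show ?thesis
  proof (rule that[of "1 / c"])
    fix \<gamma> p and f :: "real^3 => 'b::euclidean_space" assume \<gamma>: "\<gamma> \<in> K" and f: "lp p f"
    have fm[measurable]: "f \<in> borel_measurable mu" using f by (rule lp_measurable)
    note [measurable] = c(2)[OF \<gamma>]
    have "(\<integral>\<^sup>+x. ennreal (norm (f (phi \<gamma> x)) powr p) \<partial>mu) \<le>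
        ennreal (1 / c) * (\<integral>\<^sup>+x. ennreal (norm (f x) powr p) \<partial>mu)"
      by (rule S2_nn_integral_pullback_le[OF c(2)[OF \<gamma>] c(1) c(3)[OF \<gamma>]]) auto
    also have "... = ennreal (1 / c * Lp p f)"
      using c(1) Lp_nonneg[of p f] by (simp add: lp_nn_integral[OF f] ennreal_mult[symmetric])
    finally show "lp p (%x. f (phi \<gamma> x)) & Lp p (%x. f (phi \<gamma> x)) <= 1 / c * Lp p f"
      using lp_nn_integral_bound[of "%x. f (phi \<gamma> x)" "1 / c * Lp p f" p] c(1) Lp_nonneg[of p f] by simp
  qed (use c in auto)
qed

section \<open>Pullback operators on jets\<close>

text \<open>\<open>J\<close> ranges over arbitrary families, not only jets: this makes the operators
  linear in \<open>J\<close> at every point, and separates their boundedness from the weak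
  derivative relations.\<close>

inductive pop :: "nat => ('p => 'b::euclidean_space jets => real^3 => 'b) => bool" where
  pop_term: "hsm C ==> v \<in> words r ==> pop r (%\<gamma> J x. C (\<gamma>, x) *R J v (phi \<gamma> x))"
| pop_add: "pop r P ==> pop r Q ==> pop r (%\<gamma> J x. P \<gamma> J x + Q \<gamma> J x)"

lemma pop_zero: "pop r (%\<gamma> J x. 0)"
  using pop_term[OF hsm_const[of 0], of "[]" r] by simp

lemma pop_sum: "finite I ==> (!!i. i \<in> I ==> pop r (P i)) ==> pop r (%\<gamma> J x. \<Sum>i\<in>I. P i \<gamma> J x)"
  by (induction I rule: finite_induct) (auto intro: pop_zero pop_add)

lemma pop_linear:
  assumes "pop r P"
  shows "P \<gamma> (%w x. c *R J w x + d *R J' w x) x = c *R P \<gamma> J x + d *R P \<gamma> J' x"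
  using assms by induction (auto simp: algebra_simps)

lemma pop_diff:
  assumes "pop r P" shows "P \<gamma> (%w x. J w x - J' w x) = (%x. P \<gamma> J x - P \<gamma> J' x)"
  using pop_linear[OF assms, of \<gamma> 1 J "-1" J'] by (simp add: fun_eq_iff)

lemma pop_hsm:
  assumes "pop r P" "!!v. v \<in> words r ==> hsmooth (J v)"
  shows "hsm (%z. P (fst z) J (sgn (snd z)))"
  using assms
proof induction
  case (pop_term C v r)
  have "hsm (%z. J v (psi z))"
    using hsm_compose[OF pop_term(3)[OF pop_term(2)] hsm_psi] psi_S2 S2_nonzero by blast
  then have "hsm (%z. C z *R J v (psi z))"
    by (rule hsm_bilinear[OF bounded_bilinear_scaleR pop_term(1)])
  then show ?case
    by (rule hsm_cong) (use pop_term in \<open>auto simp: hsm_def psi_def\<close>)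
qed (auto intro: hsm_add)

text \<open>Tested only on jets of smooth functions, where the derivative is classical. For general
  jets it is recovered by density, as a weak derivative in \<open>x\<close> or as an L^p limit of
  difference quotients in \<open>\<gamma>\<close>.\<close>

definition pder_rel :: "'p => real^3 => ('p => 'b::euclidean_space jets => real^3 => 'b) =>
    ('p => 'b jets => real^3 => 'b) => bool" where
  "pder_rel c a P Q \<longleftrightarrow> (\<forall>u. hsmooth u --> (\<forall>\<gamma>\<in>G. \<forall>x\<in>S2.
     pder c a (%z. P (fst z) (jet u) (sgn (snd z))) (\<gamma>, x) = Q \<gamma> (jet u) x))"

text \<open>A derivative either hits the coefficient or, by the chain rule
  \<open>pder_comp_psi\<close>, prefixes a letter to the word at the price of a factor
  \<open>pcoef\<close>.\<close>

lemma pop_step: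
  fixes P :: "'p => 'b::euclidean_space jets => real^3 => 'b"
  assumes "pop r P"
  shows "\<exists>Q. pop (Suc r) Q & pder_rel c a P Q"
  using assms
proof induction
  case (pop_term C v r)
  define Q where "Q \<gamma> J x = pder c a C (\<gamma>, x) *R J v (phi \<gamma> x) +
      (\<Sum>b\<in>Basis. (C (\<gamma>, x) * pcoef c a b (\<gamma>, x)) *R J (b # v) (phi \<gamma> x))"
    for \<gamma> x and J :: "'b jets"
  have "pop (Suc r) Q"
    unfolding Q_def
  proof (intro pop.pop_add pop_sum finite_Basis)
    show "pop (Suc r) (%\<gamma> J x. pder c a C (\<gamma>, x) *R J v (phi \<gamma> x))"
      using pop_term by (intro pop.pop_term hsm_pder) (auto simp: words_def)
    show "pop (Suc r) (%\<gamma> J x. (C (\<gamma>, x) * pcoef c a b (\<gamma>, x)) *R J (b # v) (phi \<gamma> x))" if "b \<in> Basis" for b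
      by (rule pop.pop_term[of "%z. C z * pcoef c a b z"])
        (use pop_term that in \<open>auto simp: words_Cons intro: hsm_bilinear[OF bounded_bilinear_mult] hsm_pcoef\<close>)
  qed
  moreover have "pder_rel c a (%\<gamma> J x. C (\<gamma>, x) *R J v (phi \<gamma> x)) Q"
    unfolding pder_rel_def
  proof (intro allI impI ballI)
    fix u :: "real^3 => 'b" and \<gamma> x assume u: "hsmooth u" and g: "\<gamma> \<in> G" and x: "x \<in> S2"
    have z: "(\<gamma>, x) \<in> GS" using g x by auto
    have ju: "hsmooth (jet u v)" by (rule hsmooth_jet[OF u])
    have "pder c a (%z. C (fst z, sgn (snd z)) *R jet u v (phi (fst z) (sgn (snd z)))) (\<gamma>, x)
      = pder c a (%z. C z *R jet u v (psi z)) (\<gamma>, x)"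
      using pop_term(1) by (intro pder_cong z) (auto simp: hsm_def psi_def)
    also have "... = C (\<gamma>, x) *R pder c a (%z. jet u v (psi z)) (\<gamma>, x) + pder c a C (\<gamma>, x) *R jet u v (psi (\<gamma>, x))"
      using hsm_compose[OF ju hsm_psi] psi_S2 S2_nonzero
      by (intro pder_bilinear[OF bounded_bilinear_scaleR pop_term(1) _ z]) blast
    also have "... = Q \<gamma> (jet u) x"
      unfolding pder_comp_psi[OF ju z] using x by (simp add: Q_def psi_eq_phi scaleR_sum_right)
    finally show "pder c a (%z. C (fst z, sgn (snd z)) *R jet u v (phi (fst z) (sgn (snd z)))) (\<gamma>, x) = Q \<gamma> (jet u) x" .
  qed
  ultimately show ?case by blast
next
  case (pop_add r P1 P2)
  then obtain Q1 Q2 where Q: "pop (Suc r) Q1" "pop (Suc r) Q2" "pder_rel c a P1 Q1" "pder_rel c a P2 Q2" by blast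
  have "pder_rel c a (%\<gamma> J x. P1 \<gamma> J x + P2 \<gamma> J x) (%\<gamma> J x. Q1 \<gamma> J x + Q2 \<gamma> J x)"
    unfolding pder_rel_def
  proof (intro allI impI ballI)
    fix u :: "real^3 => 'b" and \<gamma> x assume u: "hsmooth u" and g: "\<gamma> \<in> G" and x: "x \<in> S2"
    have z: "(\<gamma>, x) \<in> GS" using g x by auto
    show "pder c a (%z. P1 (fst z) (jet u) (sgn (snd z)) + P2 (fst z) (jet u) (sgn (snd z))) (\<gamma>, x)
       = Q1 \<gamma> (jet u) x + Q2 \<gamma> (jet u) x"
      using Q(3,4) u g x
      by (subst pder_add[OF pop_hsm[OF pop_add.hyps(1)] pop_hsm[OF pop_add.hyps(2)] z])
        (auto simp: pder_rel_def intro: hsmooth_jet)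
  qed
  then show ?case using pop.pop_add[OF Q(1,2)] by blast
qed

lemma pop_bound:
  fixes P :: "'p => 'b::euclidean_space jets => real^3 => 'b"
  assumes "pop r P" and K: "compact K" "K \<subseteq> G" and p: "p >= 0"
  shows "\<exists>B\<ge>0. \<forall>\<gamma>\<in>K. \<forall>J. lpjet p r J --> lp p (P \<gamma> J) & Lp p (P \<gamma> J) <= B * jetE p r J"
  using assms(1)
proof induction
  case (pop_term C v r)
  obtain B where B: "B >= 0" "!!\<gamma>. \<gamma> \<in> K ==> phi \<gamma> \<in> measurable mu mu"
    "!!\<gamma> p f. \<gamma> \<in> K ==> lp p (f :: real^3 => 'b) ==>
       lp p (%x. f (phi \<gamma> x)) & Lp p (%x. f (phi \<gamma> x)) <= B * Lp p f"
    using lp_pullback[OF K] by metis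
  obtain M where M: "M > 0" "!!\<gamma> x. \<gamma> \<in> K ==> x \<in> S2 ==> norm (C (\<gamma>, x)) <= M"
    using hsm_bounded[OF pop_term(1) K] by metis
  show ?case
  proof (intro exI[of _ "M powr p * B"] conjI ballI allI impI)
    fix \<gamma> and J :: "'b jets" assume \<gamma>: "\<gamma> \<in> K" and J: "lpjet p r J"
    have Jv: "lp p (J v)" using J pop_term by (auto simp: lpjet_def)
    note b = B(3)[OF \<gamma> Jv]
    have [measurable]: "(%x. C (\<gamma>, x)) \<in> borel_measurable mu"
      using hsm_slice[OF pop_term(1), of \<gamma>] \<gamma> K by (auto intro!: measurable_S2_continuous hsmooth_continuous_on)
    have [measurable]: "(%x. J v (phi \<gamma> x)) \<in> borel_measurable mu" using b lp_measurable by blast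
    have le: "AE x in S2_measure. norm (C (\<gamma>, x) *R J v (phi \<gamma> x)) <= M * norm (J v (phi \<gamma> x))"
      using M(2)[OF \<gamma>] by (auto intro!: AE_I2 mult_right_mono)
    have mm: "(%x. C (\<gamma>, x) *R J v (phi \<gamma> x)) \<in> borel_measurable mu" by measurable
    note m = lp_mono[OF conjunct1[OF b] mm p less_imp_le[OF M(1)] le]
    show "lp p (%x. C (\<gamma>, x) *R J v (phi \<gamma> x))" by (rule m)
    have "M powr p * Lp p (%x. J v (phi \<gamma> x)) <= M powr p * (B * Lp p (J v))"
      using b by (intro mult_left_mono) auto
    also have "... <= M powr p * (B * jetE p r J)"
      using B pop_term by (intro mult_left_mono Lp_le_jetE) auto
    finally show "Lp p (%x. C (\<gamma>, x) *R J v (phi \<gamma> x)) <= M powr p * B * jetE p r J"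
      using m by (simp add: mult.assoc)
  qed (use B in auto)
next
  case (pop_add r P Q)
  then obtain B1 B2 where B: "B1 >= 0" "B2 >= 0"
    "!!\<gamma> J. \<gamma> \<in> K ==> lpjet p r J ==> lp p (P \<gamma> J) & Lp p (P \<gamma> J) <= B1 * jetE p r J"
    "!!\<gamma> J. \<gamma> \<in> K ==> lpjet p r J ==> lp p (Q \<gamma> J) & Lp p (Q \<gamma> J) <= B2 * jetE p r J" by metis
  show ?case
  proof (intro exI[of _ "2 powr p * (B1 + B2)"] conjI ballI allI impI)
    fix \<gamma> and J :: "'b jets" assume \<gamma>: "\<gamma> \<in> K" and J: "lpjet p r J"
    note b = B(3,4)[OF \<gamma> J]
    show "lp p (%x. P \<gamma> J x + Q \<gamma> J x)" using b p by (intro lp_add) auto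
    have "Lp p (%x. P \<gamma> J x + Q \<gamma> J x) <= 2 powr p * (Lp p (P \<gamma> J) + Lp p (Q \<gamma> J))"
      using b p by (intro lp_add) auto
    also have "... <= 2 powr p * (B1 * jetE p r J + B2 * jetE p r J)"
      using b by (intro mult_left_mono add_mono) auto
    finally show "Lp p (%x. P \<gamma> J x + Q \<gamma> J x) <= 2 powr p * (B1 + B2) * jetE p r J"
      by (simp add: algebra_simps)
  qed (use B in auto)
qed

end

section \<open>Estimates for operators on jets near a fixed parameter\<close>

lemma lpjet_diff: "p >= 0 ==> lpjet p k J ==> lpjet p k J' ==> lpjet p k (%w x. J w x - J' w x)"
  by (auto simp: lpjet_def intro: lp_diff(1))

lemma jetE_minus_commute: "jetE p k (%w x. J w x - J' w x) = jetE p k (%w x. J' w x - J w x)"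
  unfolding jetE_def by (intro sum.cong refl Lp_minus_commute)

lemma wjet_lincomb:
  assumes J: "wjet k J" and J': "wjet k J'" shows "wjet k (%w x. a *R J w x + b *R J' w x)"
  unfolding wjet_def
proof (intro conjI ballI allI impI)
  note * = J[unfolded wjet_def] J'[unfolded wjet_def]
  show "integrable mu (%x. a *R J w x + b *R J' w x)" if "w \<in> words k" for w using * that by auto
  show "weak_rot c (%x. a *R J w x + b *R J' w x) (%x. a *R J (c # w) x + b *R J' (c # w) x)" if "c # w \<in> words k" for c w
    using weak_rot_add[OF weak_rot_mult[OF hsmooth_const, of c "J w" "J (c # w)" a] weak_rot_mult[OF hsmooth_const, of c "J' w" "J' (c # w)" b]]
      * that by simp
qed

lemma wjet_diff: "wjet k J ==> wjet k J' ==> wjet k (%w x. J w x - J' w x)"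
  using wjet_lincomb[of k J J' 1 "-1"] by simp

text \<open>\<open>near_le\<close> expresses an estimate for \<open>h\<close> close to \<open>0\<close>; one constant serves for both the size of the
  neighbourhood and the bound, which makes such estimates easy to combine.\<close>

definition near_le :: "real => nat => ('p::real_normed_vector => real) =>
    ('p => 'b::euclidean_space jets => real^3 => 'b) => real => bool" where
  "near_le p s v F C \<longleftrightarrow> (\<forall>h J. norm h * C <= 1 & wjet s J & lpjet p s J -->
     lp p (F h J) & Lp p (F h J) <= C * v h * jetE p s J)"

lemma near_leD: "[|near_le p s v F C; norm h * C <= 1; wjet s J; lpjet p s J|] ==>
    lp p (F h J) & Lp p (F h J) <= C * v h * jetE p s J"
  by (simp add: near_le_def)

lemma near_le_mono:
  assumes F: "near_le p s v F C" and C: "0 <= C" "C <= D" "s <= s'" and v: "!!h. v h >= 0"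
  shows "near_le p s' v F D"
  unfolding near_le_def
proof (intro allI impI)
  fix h :: 'a and J :: "'b jets" assume h: "norm h * D <= 1 & wjet s' J & lpjet p s' J"
  have "norm h * C <= 1" using h mult_left_mono[OF C(2) norm_ge_zero, of h] by linarith
  moreover have "C * v h * jetE p s J <= D * v h * jetE p s' J"
    using C v jetE_mono[OF C(3), of p J] by (intro mult_mono) (auto simp: jetE_nonneg)
  ultimately show "lp p (F h J) & Lp p (F h J) <= D * v h * jetE p s' J"
    using near_leD[OF F, of h J] h C(3) wjet_mono lpjet_mono by (meson order_trans)
qed

lemma uniform_const:
  fixes P :: "'a => real => bool"
  assumes "finite I" "!!i. i \<in> I ==> \<exists>C\<ge>0. P i C" "!!i C D. i \<in> I ==> P i C ==> 0 <= C ==> C <= D ==> P i D"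
  shows "\<exists>C>0. \<forall>i\<in>I. P i C"
proof -
  obtain c where c: "!!i. i \<in> I ==> c i >= 0 & P i (c i)" using assms(2) by metis
  have "c i <= 1 + sum c I" if "i \<in> I" for i using member_le_sum[OF that, of c] c assms(1) by fastforce
  then have "\<forall>i\<in>I. P i (1 + sum c I)" using c assms(3) by blast
  moreover have "1 + sum c I > 0" using c by (intro add_pos_nonneg sum_nonneg) auto
  ultimately show ?thesis by blast
qed

lemma near_le_uniform:
  assumes "finite I" "!!h. v h >= 0" "!!i. i \<in> I ==> \<exists>C>0. near_le p s v (F i) C"
  shows "\<exists>C>0. \<forall>i\<in>I. near_le p s v (F i) C"
proof (rule uniform_const[OF assms(1)])
  show "\<exists>C\<ge>0. near_le p s v (F i) C" if "i \<in> I" for i using assms(3)[OF that] less_imp_le by blast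
qed (rule near_le_mono[OF _ _ _ order_refl assms(2)])

text \<open>Operators on jets that are additive and bounded in \<open>L\<^sup>p\<close>; estimates for them extend from the jets of smooth
  functions by density.\<close>

definition jet_op :: "real => nat => ('b::euclidean_space jets => real^3 => 'b) => bool" where
  "jet_op p s R \<longleftrightarrow> (\<forall>J J'. R (%w x. J w x - J' w x) = (%x. R J x - R J' x)) \<and>
     (\<exists>A\<ge>0. \<forall>J. lpjet p s J --> lp p (R J) & Lp p (R J) <= A * jetE p s J)"

lemma jet_op_lincomb:
  assumes p: "p >= 0" and R: "jet_op p s R" and S: "jet_op p s S"
  shows "jet_op p s (%J x. a *R R J x + b *R S J x)"
proof -
  obtain A where A: "A >= 0" "!!J. lpjet p s J ==> lp p (R J) & Lp p (R J) <= A * jetE p s J" using R unfolding jet_op_def by blast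
  obtain B where B: "B >= 0" "!!J. lpjet p s J ==> lp p (S J) & Lp p (S J) <= B * jetE p s J" using S unfolding jet_op_def by blast
  have "lp p (%x. a *R R J x + b *R S J x) & Lp p (%x. a *R R J x + b *R S J x) \<le>
      (2 powr p * (\<bar>a\<bar> powr p * A + \<bar>b\<bar> powr p * B)) * jetE p s J" if J: "lpjet p s J" for J
  proof -
    note l = lp_scaleR[OF A(2)[OF J, THEN conjunct1], of a] lp_scaleR[OF B(2)[OF J, THEN conjunct1], of b]
    have "Lp p (%x. a *R R J x + b *R S J x) <= 2 powr p * (\<bar>a\<bar> powr p * Lp p (R J) + \<bar>b\<bar> powr p * Lp p (S J))"
      using lp_add(2)[OF p l(1,3)] by (simp add: l)
    also have "... <= 2 powr p * (\<bar>a\<bar> powr p * (A * jetE p s J) + \<bar>b\<bar> powr p * (B * jetE p s J))"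
      using A(2)[OF J] B(2)[OF J] by (intro mult_left_mono add_mono) auto
    finally show ?thesis using lp_add(1)[OF p l(1,3)] by (simp add: algebra_simps)
  qed
  moreover have "2 powr p * (\<bar>a\<bar> powr p * A + \<bar>b\<bar> powr p * B) >= 0" using A(1) B(1) by simp
  ultimately show ?thesis
    using R S unfolding jet_op_def by (auto simp: algebra_simps)
qed

lemma jet_op_zero: "p > 0 ==> jet_op p s (%J x. 0)"
  unfolding jet_op_def by (auto simp: jetE_nonneg Lp_def intro!: lp_continuous exI[of _ 0])

lemma jet_op_diff: "p >= 0 ==> jet_op p s R ==> jet_op p s S ==> jet_op p s (%J x. R J x - S J x)"
  using jet_op_lincomb[of p s R S 1 "-1"] by simp

lemma jet_op_sum:
  assumes "p > 0" "finite I" "!!c. c \<in> I ==> jet_op p s (R c)" shows "jet_op p s (%J x. \<Sum>c\<in>I. k c *R R c J x)"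
  using assms(2,3)
proof (induction I rule: finite_induct)
  case (insert c I)
  then show ?case using jet_op_lincomb[of p s "R c" "%J x. \<Sum>c\<in>I. k c *R R c J x" "k c" 1] assms(1) by simp
qed (use jet_op_zero assms in simp)

lemma lp_sub_add: "p >= 0 ==> lp p (%x. f x - g x) ==> lp p g ==> Lp p f <= 2 powr p * (Lp p (%x. f x - g x) + Lp p g)"
  using lp_add(2)[of p "%x. f x - g x" g] by simp

text \<open>Some bound \<open>A\<close> is enough to make \<open>R\<close> continuous, and then the
  bound \<open>C\<close> needs checking on smooth jets only: \<open>A\<close> is multiplied by an
  approximation error tending to zero and does not enter the conclusion.\<close>

lemma jet_op_dense:
  assumes p: "p >= 1" and R: "jet_op p s R" and J: "wjet s J" "lpjet p s J" and C: "C >= 0"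
    and le: "!!u. hsmooth u ==> Lp p (R (jet u)) <= C * jetE p s (jet u)"
  shows "lp p (R J) & Lp p (R J) <= 4 powr p * C * jetE p s J"
proof -
  have p0: "p >= 0" using p by simp
  obtain A where A: "A >= 0" "!!J. lpjet p s J ==> lp p (R J) & Lp p (R J) <= A * jetE p s J"
    and lin: "!!J J'. R (%w x. J w x - J' w x) = (%x. R J x - R J' x)" using R unfolding jet_op_def by blast
  obtain u where u: "!!n. hsmooth (u n)" "(%n. jetE p s (%w x. jet (u n) w x - J w x)) \<longlonglongrightarrow> 0"
    by (rule wjet_approx[OF p J]) (rule that, auto)
  define \<epsilon> where "\<epsilon> n = jetE p s (%w x. jet (u n) w x - J w x)" for n
  have lj: "lpjet p s (jet (u n))" for n using u p by (intro lpjet_jet)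
  have "Lp p (R J) <= 2 powr p * (A * \<epsilon> n + C * (2 powr p * (\<epsilon> n + jetE p s J)))" for n
  proof -
    have d: "lpjet p s (%w x. J w x - jet (u n) w x)" by (rule lpjet_diff[OF p0 J(2) lj])
    have "Lp p (R J) <= 2 powr p * (Lp p (%x. R J x - R (jet (u n)) x) + Lp p (R (jet (u n))))"
      using A(2)[OF d] A(2)[OF lj] unfolding lin by (intro lp_sub_add p0) auto
    moreover have "Lp p (%x. R J x - R (jet (u n)) x) <= A * \<epsilon> n"
      using A(2)[OF d] unfolding lin \<epsilon>_def jetE_minus_commute[of p s J] by simp
    moreover have "jetE p s (jet (u n)) <= 2 powr p * (\<epsilon> n + jetE p s J)"
    proof -
      have "jetE p s (jet (u n)) <= (\<Sum>w\<in>words s. 2 powr p * (Lp p (%x. jet (u n) w x - J w x) + Lp p (J w)))"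
        unfolding jetE_def using lpjet_diff[OF p0 lj J(2), of n] J(2) by (intro sum_mono lp_sub_add p0) (auto simp: lpjet_def)
      then show ?thesis by (simp add: \<epsilon>_def jetE_def sum_distrib_left sum.distrib distrib_left)
    qed
    ultimately have "Lp p (R J) <= 2 powr p * (A * \<epsilon> n + Lp p (R (jet (u n))))"
      "C * jetE p s (jet (u n)) <= C * (2 powr p * (\<epsilon> n + jetE p s J))"
      using C by (auto intro: order_trans mult_left_mono)
    then show ?thesis using le[OF u(1)[of n]] by (meson add_left_mono mult_left_mono order_trans powr_ge_zero)
  qed
  moreover have "(%n. 2 powr p * (A * \<epsilon> n + C * (2 powr p * (\<epsilon> n + jetE p s J)))) \<longlonglongrightarrow>
      2 powr p * (A * 0 + C * (2 powr p * (0 + jetE p s J)))"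
    using u(2) unfolding \<epsilon>_def by (intro tendsto_intros)
  ultimately have "Lp p (R J) <= 2 powr p * (A * 0 + C * (2 powr p * (0 + jetE p s J)))" by (intro LIMSEQ_le_const) blast+
  \<comment> \<open>One factor \<open>2 powr p\<close> comes from splitting off the smooth jet under
    \<open>R\<close>, the other from comparing its energy with that of \<open>J\<close>.\<close>
  moreover have "(4::real) powr p = 2 powr p * 2 powr p" using powr_mult[of 2 2 p] by simp
  ultimately show ?thesis using A(2)[OF J(2)] by (simp add: mult_ac)
qed

text \<open>If \<open>F h\<close> is of size \<open>v h\<close>, and of smaller size on more regular jets, then it is \<open>o (v h)\<close>.\<close>

lemma near_le_small:
  assumes p: "p >= 1" and lin: "!!h J J'. F h (%w x. J w x - J' w x) = (%x. F h J x - F h J' x)"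
    and F: "near_le p s v F C" "near_le p (Suc s) (%h. norm h powr p * v h) F D" and C: "C > 0" "D > 0"
    and v: "!!h. v h >= 0" and J: "wjet s J" "lpjet p s J" and e: "e > 0"
  shows "\<exists>d>0. \<forall>h. norm h < d --> Lp p (F h J) <= e * v h"
proof -
  define e' where "e' = e / (2 * 2 powr p)"
  have e': "e' > 0" "2 powr p * (e' + e') = e" using e by (simp_all add: e'_def)
  obtain u where u: "!!n. hsmooth (u n)" "(%n. jetE p s (%w x. jet (u n) w x - J w x)) \<longlonglongrightarrow> 0"
    by (rule wjet_approx[OF p J]) (rule that, auto)
  \<comment> \<open>The smooth approximation is fixed before the neighbourhood: \<open>K\<close> and
    \<open>d\<close> below depend on it, so the resulting limit is taken for a fixed
    \<open>J\<close> and is not uniform.\<close>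
  obtain n where n: "jetE p s (%w x. J w x - jet (u n) w x) < e' / C"
    using order_tendstoD(2)[OF u(2), of "e' / C"] e' C unfolding jetE_minus_commute[of p s J] by (auto simp: eventually_sequentially)
  let ?u = "jet (u n)"
  have uj: "wjet k ?u" "lpjet p k ?u" for k using u(1) p by (auto intro: wjet_jet lpjet_jet)
  define K where "K = D * jetE p (Suc s) ?u + 1"
  have K: "K > 0" using C(2) unfolding K_def by (intro add_nonneg_pos mult_nonneg_nonneg jetE_nonneg) auto
  define d where "d = min (min (1 / C) (1 / D)) ((e' / K) powr (1 / p))"
  have d: "d > 0" using C K e' by (simp add: d_def)
  have "Lp p (F h J) <= e * v h" if h: "norm h < d" for h
  proof -
    have h': "norm h * C <= 1" "norm h * D <= 1" using h C by (auto simp: d_def field_simps)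
    have "norm h powr p <= ((e' / K) powr (1 / p)) powr p" using h p by (intro powr_mono2) (auto simp: d_def)
    then have hp: "norm h powr p * K <= e'" using K e' p by (simp add: powr_powr field_simps)
    have "wjet s (%w x. J w x - ?u w x)" "lpjet p s (%w x. J w x - ?u w x)"
      using wjet_diff[OF J(1) uj(1)] lpjet_diff[OF _ J(2) uj(2)] p by auto
    from near_leD[OF F(1) h'(1) this] have 1: "lp p (%x. F h J x - F h ?u x)"
      "Lp p (%x. F h J x - F h ?u x) <= C * v h * jetE p s (%w x. J w x - ?u w x)" by (simp_all add: lin)
    have "C * v h * jetE p s (%w x. J w x - ?u w x) <= C * v h * (e' / C)" using n C v by (intro mult_left_mono) auto
    with 1(2) C have 2: "Lp p (%x. F h J x - F h ?u x) <= e' * v h" by (simp add: mult.commute)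
    have 3: "lp p (F h ?u)" "Lp p (F h ?u) <= D * (norm h powr p * v h) * jetE p (Suc s) ?u"
      using near_leD[OF F(2) h'(2) uj] by auto
    have "D * (norm h powr p * v h) * jetE p (Suc s) ?u <= (norm h powr p * K) * v h"
      using v[of h] by (simp add: K_def algebra_simps)
    also have "... <= e' * v h" using hp v by (intro mult_right_mono)
    finally have 4: "Lp p (F h ?u) <= e' * v h" using 3 by linarith
    have "Lp p (F h J) <= 2 powr p * (Lp p (%x. F h J x - F h ?u x) + Lp p (F h ?u))"
      using p by (intro lp_sub_add 1 3) auto
    also have "... <= 2 powr p * (e' * v h + e' * v h)" using 2 4 by (intro mult_left_mono add_mono) auto
    also have "... = (2 powr p * (e' + e')) * v h" by (simp add: algebra_simps)
    finally show ?thesis unfolding e'(2) .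
  qed
  then show ?thesis using d by blast
qed

section \<open>Dependence of pullback operators on the parameter\<close>

context diffeo_family
begin

lemma pop_mono: "pop r P ==> r <= s ==> pop s P"
proof (induction rule: pop.induct)
  case (pop_term C v r)
  then show ?case using words_mono by (intro pop.pop_term) auto
qed (auto intro: pop_add)

lemma pop_lp:
  assumes "pop r P" "\<gamma> \<in> G" "lpjet p r J" "p >= 0" shows "lp p (P \<gamma> J)"
  using pop_bound[OF assms(1), of "{\<gamma>}" p] assms by auto

lemma pop_tendsto:
  assumes P: "pop r P" and \<gamma>: "\<gamma> \<in> G" and p: "p >= 0"
    and J: "!!n. lpjet p r (Jn n)" "lpjet p r J" "(%n. jetE p r (%w x. Jn n w x - J w x)) \<longlonglongrightarrow> 0"
  shows "(%n. Lp p (%x. P \<gamma> (Jn n) x - P \<gamma> J x)) \<longlonglongrightarrow> 0"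
proof -
  obtain B where B: "B >= 0" "!!J. lpjet p r J ==> Lp p (P \<gamma> J) <= B * jetE p r J"
    using pop_bound[OF P, of "{\<gamma>}" p] \<gamma> p by auto
  show ?thesis
  proof (rule real_tendsto_sandwich[of "%_. 0"])
    show "\<forall>\<^sub>F n in sequentially. Lp p (%x. P \<gamma> (Jn n) x - P \<gamma> J x) <= B * jetE p r (%w x. Jn n w x - J w x)"
      using B(2)[OF lpjet_diff[OF p J(1) J(2)]] by (intro always_eventually allI) (simp add: pop_diff[OF P])
    show "(%n. B * jetE p r (%w x. Jn n w x - J w x)) \<longlonglongrightarrow> 0"
      using tendsto_mult_right_zero[OF J(3)] .
  qed (auto simp: Lp_nonneg)
qed

text \<open>On jets of smooth functions this is \<open>rot_slice\<close>. Both operators are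
  continuous on jets, and weak derivatives are closed under L^p limits.\<close>

lemma pop_weak_rot:
  assumes P: "pop r P" and Q: "pop (Suc r) Q" and rel: "pder_rel 0 a P Q" and a: "norm a = 1"
    and p: "p >= 1" and J: "wjet (Suc r) J" "lpjet p (Suc r) J" and \<gamma>: "\<gamma> \<in> G"
  shows "weak_rot a (P \<gamma> J) (Q \<gamma> J)"
proof -
  obtain u where u: "!!n. hsmooth (u n)" "(%n. jetE p (Suc r) (%w x. jet (u n) w x - J w x)) \<longlonglongrightarrow> 0"
    by (rule wjet_approx[OF p J]) (rule that, auto)
  have p0: "p >= 0" using p by simp
  have P': "pop (Suc r) P" using P by (rule pop_mono) simp
  have lj: "lpjet p k (jet (u n))" for n k using u p by (intro lpjet_jet)
  have l: "lp p (P \<gamma> (jet (u n)))" "lp p (Q \<gamma> (jet (u n)))" "lp p (P \<gamma> J)" "lp p (Q \<gamma> J)" for n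
    using pop_lp[OF P' \<gamma> _ p0] pop_lp[OF Q \<gamma> _ p0] lj J by auto
  have "weak_rot a (P \<gamma> (jet (u n))) (Q \<gamma> (jet (u n)))" for n
  proof -
    define E where "E = (%z. P (fst z) (jet (u n)) (sgn (snd z)))"
    have E: "hsm E" unfolding E_def by (rule pop_hsm[OF P]) (intro hsmooth_jet u)
    have w: "weak_rot a (%y. E (\<gamma>, y)) (rot a (%y. E (\<gamma>, y)))"
      by (rule weak_rot_hsmooth[OF hsm_slice[OF E \<gamma>] a])
    have r: "rot a (%y. E (\<gamma>, y)) x = Q \<gamma> (jet (u n)) x" if "x \<in> S2" for x
      using rel u(1)[of n] \<gamma> that rot_slice[OF E \<gamma> S2_nonzero[OF that]] by (auto simp: pder_rel_def E_def)
    show ?thesis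
      by (rule weak_rot_cong_AE[OF w]) (use r l in \<open>auto simp: E_def intro!: AE_I2 lp_measurable\<close>)
  qed
  then show ?thesis
    by (rule weak_rot_limit[OF p])
      (use l pop_tendsto[OF P' \<gamma> p0 lj J(2) u(2)] pop_tendsto[OF Q \<gamma> p0 lj J(2) u(2)] in auto)
qed

text \<open>The remainder is an integral over the segment; Jensen moves the \<open>p\<close>-th power inside and
  Fubini exchanges it with the integral over the sphere.\<close>

lemma pop_remainder_smooth:
  fixes P :: "'p => 'b::euclidean_space jets => real^3 => 'b"
  assumes P: "pop r P" and Q: "!!c. c \<in> Basis ==> pop (Suc r) (Q c)" "!!c. c \<in> Basis ==> pder_rel c 0 P (Q c)"
    and K: "!!t. 0 <= t ==> t <= 1 ==> \<gamma> + t *R h \<in> G"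
    and u: "hsmooth u" and p: "p >= 1"
    and B: "B >= 0" "!!t c. 0 <= t ==> t <= 1 ==> c \<in> Basis ==>
       Lp p (%x. Q c (\<gamma> + t *R h) (jet u) x - q c x) <= B"
    and q: "!!c. c \<in> Basis ==> continuous_on S2 (q c)"
  shows "Lp p (%x. P (\<gamma> + h) (jet u) x - P \<gamma> (jet u) x - (\<Sum>c\<in>Basis. (h \<bullet> c) *R q c x))
     <= (real DIM('p) powr p * real DIM('p)) * norm h powr p * B"
proof -
  have p0: "p >= 0" using p by simp
  define E where "E = (%z. P (fst z) (jet u) (sgn (snd z)))"
  define Ec where "Ec c = (%z. Q c (fst z) (jet u) (sgn (snd z)))" for c
  have E: "hsm E" unfolding E_def by (rule pop_hsm[OF P]) (intro hsmooth_jet u)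
  have Ec: "hsm (Ec c)" if "c \<in> Basis" for c
    unfolding Ec_def by (rule pop_hsm[OF Q(1)[OF that]]) (intro hsmooth_jet u)
  have dE: "pder c 0 E (\<gamma>', x) = Ec c (\<gamma>', x)" if "c \<in> Basis" "\<gamma>' \<in> G" "x \<in> S2" for c \<gamma>' x
    using Q(2)[OF that(1)] u that by (auto simp: pder_rel_def E_def Ec_def)
  have \<gamma>G: "\<gamma> \<in> G" using K[of 0] by simp
  define s where "s t = \<gamma> + t *R h" for t
  have s: "s t \<in> G" if "t \<in> {0..1}" for t using K that by (auto simp: s_def)
  define F where "F t x = (\<Sum>c\<in>Basis. (h \<bullet> c) *R (Ec c (s t, x) - q c x))" for t x
  define D where "D x = E (\<gamma> + h, x) - E (\<gamma>, x) - (\<Sum>c\<in>Basis. (h \<bullet> c) *R q c x)" for x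
  have contF: "continuous_on ({0..1} \<times> S2) (%z. F (fst z) (snd z))"
  proof -
    have 1: "continuous_on ({0..1} \<times> S2) (%z. Ec c (s (fst z), snd z))" if "c \<in> Basis" for c
      by (rule continuous_on_compose2[OF hsm_continuous_on[OF Ec[OF that]]])
        (use s in \<open>auto simp: s_def intro!: continuous_intros\<close>)
    have 2: "continuous_on ({0..1} \<times> S2) (%z. q c (snd z))" if "c \<in> Basis" for c
      by (rule continuous_on_compose2[OF q[OF that]]) (auto intro!: continuous_intros)
    show ?thesis unfolding F_def by (intro continuous_intros 1 2)
  qed
  have contFx: "continuous_on {0..1} (%t. F t x)" if "x \<in> S2" for x
    by (rule continuous_on_compose2[OF contF, of "{0..1}" "%t. (t, x)", simplified])
      (use that in \<open>auto intro!: continuous_intros\<close>)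
  have contFt: "continuous_on S2 (F t)" if "t \<in> {0..1}" for t
    by (rule continuous_on_compose2[OF contF, of S2 "%x. (t, x)", simplified])
      (use that in \<open>auto intro!: continuous_intros\<close>)
  have FTC: "(\<integral>t. indicator {0..1} t *R F t x \<partial>lborel) = D x" if x: "x \<in> S2" for x
  proof -
    have der: "((%t. E (s t, x) - t *R (\<Sum>c\<in>Basis. (h \<bullet> c) *R q c x)) has_vector_derivative F t x) (at t within {0..1})"
      if t: "0 <= t" "t <= 1" for t
    proof -
      have st: "s t \<in> G" using s t by auto
      have z: "(s t, x) \<in> GS" using st x by auto
      have 1: "((%t. (s t, x)) has_derivative (%k. (k *R h, 0))) (at t)"
        unfolding s_def by (rule derivative_eq_intros refl | simp)+
      have l: "linear (frechet_derivative E (at (s t, x)))"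
        using hsm_differentiable[OF E z] by (rule linear_frechet_derivative)
      have fe: "frechet_derivative E (at (s t, x)) (k *R h, 0) = k *R (\<Sum>c\<in>Basis. (h \<bullet> c) *R Ec c (s t, x))" for k
      proof -
        have "(k *R h, 0 :: real^3) = k *R (h, 0)" by simp
        then have "frechet_derivative E (at (s t, x)) (k *R h, 0) = k *R frechet_derivative E (at (s t, x)) (h, 0)"
          using linear_cmul[OF l] by metis
        also have "frechet_derivative E (at (s t, x)) (h, 0) = pder h 0 E (s t, x)" by (simp add: pder_def Der_def)
        also have "... = (\<Sum>c\<in>Basis. (h \<bullet> c) *R Ec c (s t, x))"
          by (rule trans[OF pder_linear[OF E z]]) (use st x dE in \<open>auto intro!: sum.cong\<close>)
        finally show ?thesis .
      qed
      have 2: "(E has_derivative frechet_derivative E (at (s t, x))) (at (s t, x))"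
        using hsm_differentiable[OF E z] by (simp add: frechet_derivative_works[symmetric])
      have "((%t. E (s t, x)) has_derivative (%k. k *R (\<Sum>c\<in>Basis. (h \<bullet> c) *R Ec c (s t, x)))) (at t)"
        using has_derivative_compose[OF 1 2] fe by simp
      then have "((%t. E (s t, x)) has_vector_derivative (\<Sum>c\<in>Basis. (h \<bullet> c) *R Ec c (s t, x))) (at t within {0..1})"
        unfolding has_vector_derivative_def by (rule has_derivative_at_withinI)
      then have "((%t. E (s t, x) - t *R (\<Sum>c\<in>Basis. (h \<bullet> c) *R q c x)) has_vector_derivative
         (\<Sum>c\<in>Basis. (h \<bullet> c) *R Ec c (s t, x)) - (\<Sum>c\<in>Basis. (h \<bullet> c) *R q c x)) (at t within {0..1})"
        by (rule has_vector_derivative_diff) (rule derivative_eq_intros refl | simp)+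
      then show ?thesis by (simp add: F_def scaleR_diff_right sum_subtractf)
    qed
    show ?thesis
      using integral_FTC_Icc[OF _ der contFx[OF x]] by (simp add: D_def s_def)
  qed
  have i2x: "integrable lborel (%t. indicator {0..1} t * norm (F t x) powr p)" if x: "x \<in> S2" for x
  proof -
    have "continuous_on {0..1} (%t. norm (F t x) powr p)"
      using contFx[OF x] p by (intro continuous_on_powr' continuous_intros) auto
    then show ?thesis
      using borel_integrable_atLeastAtMost'[of 0 1 "%t. norm (F t x) powr p"] by (simp add: set_integrable_def)
  qed
  have pw: "norm (D x) powr p <= (\<integral>t. indicator {0..1} t * norm (F t x) powr p \<partial>lborel)" if x: "x \<in> S2" for x
  proof -
    have i1: "integrable lborel (%t. indicator {0..1} t * norm (F t x))"
      using borel_integrable_atLeastAtMost'[OF continuous_on_norm[OF contFx[OF x]]]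
      by (simp add: set_integrable_def)
    have "norm (D x) <= (\<integral>t. norm (indicator {0..1} t *R F t x) \<partial>lborel)"
      unfolding FTC[OF x, symmetric] by (rule Bochner_Integration.integral_norm_bound)
    also have "... = (\<integral>t. indicator {0..1} t * norm (F t x) \<partial>lborel)" by simp
    finally have "norm (D x) powr p <= (\<integral>t. indicator {0..1} t * norm (F t x) \<partial>lborel) powr p"
      using p by (intro powr_mono2) auto
    also have "... <= (\<integral>t. indicator {0..1} t * norm (F t x) powr p \<partial>lborel)"
      by (rule weighted_powr_mean[OF p]) (use i1 i2x[OF x] in auto)
    finally show ?thesis .
  qed
  \<comment> \<open>\<open>lp_sum\<close> over the \<open>DIM('p)\<close> basis directions costs
    \<open>DIM('p) powr p\<close>, and the sum has \<open>DIM('p)\<close> terms.\<close>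
  define B' where "B' = (real DIM('p) powr p * real DIM('p)) * norm h powr p * B"
  have B': "B' >= 0" using B(1) by (simp add: B'_def)
  have LF: "Lp p (F t) <= B'" if t: "t \<in> {0..1}" for t
  proof -
    have lc: "lp p (%x. Ec c (s t, x) - q c x)" if "c \<in> Basis" for c
      using hsmooth_continuous_on[OF hsm_slice[OF Ec[OF that] s[OF t]]] q[OF that] p0
      by (intro lp_continuous continuous_intros)
    have le: "Lp p (%x. (h \<bullet> c) *R (Ec c (s t, x) - q c x)) <= norm h powr p * B" if c: "c \<in> Basis" for c
    proof -
      have "Lp p (%x. Ec c (s t, x) - q c x) = Lp p (%x. Q c (\<gamma> + t *R h) (jet u) x - q c x)"
        by (rule Lp_cong_S2) (simp add: Ec_def s_def)
      then have "Lp p (%x. Ec c (s t, x) - q c x) <= B" using B(2)[of t c] t c by simp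
      moreover have "\<bar>h \<bullet> c\<bar> powr p <= norm h powr p"
        using Basis_le_norm[OF c, of h] p by (intro powr_mono2) auto
      ultimately show ?thesis
        unfolding lp_scaleR(2)[OF lc[OF c]] by (intro mult_mono) (auto simp: Lp_nonneg)
    qed
    have "Lp p (F t) <= real (card (Basis :: 'p set)) powr p * (\<Sum>c\<in>Basis. Lp p (%x. (h \<bullet> c) *R (Ec c (s t, x) - q c x)))"
      unfolding F_def using lc p0 by (intro lp_sum) (auto intro: lp_scaleR)
    also have "... <= real DIM('p) powr p * (real DIM('p) * (norm h powr p * B))"
      using le by (intro mult_left_mono sum_bounded_above) auto
    finally show ?thesis by (simp add: B'_def mult_ac)
  qed
  interpret pair_sigma_finite lborel mu ..
  have meas: "(%(t, x). ennreal (indicator {0..1} t * norm (F t x) powr p)) \<in> borel_measurable (lborel \<Otimes>\<^sub>M mu)"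
  proof -
    define g where "g z = indicator ({0..1} \<times> S2) z *R F (fst z) (snd z)" for z
    have gm: "g \<in> borel_measurable borel"
      unfolding g_def using contF
      by (intro borel_measurable_continuous_on_indicator) (auto intro!: borel_closed closed_Times)
    have idm: "(%x. x) \<in> borel_measurable mu" by (intro measurable_S2_continuous continuous_on_id)
    have 1: "(%z. (fst z, snd z)) \<in> borel_measurable (lborel \<Otimes>\<^sub>M mu)"
    proof (rule borel_measurable_Pair)
      show "fst \<in> borel_measurable (lborel \<Otimes>\<^sub>M mu)" by simp
      show "snd \<in> borel_measurable (lborel \<Otimes>\<^sub>M mu)"
        by (rule measurable_compose[OF measurable_snd idm])
    qed
    have [measurable]: "(%z. g (fst z, snd z)) \<in> borel_measurable (lborel \<Otimes>\<^sub>M mu)"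
      by (rule measurable_compose[OF 1 gm])
    have "(%z. ennreal (norm (g (fst z, snd z)) powr p)) \<in> borel_measurable (lborel \<Otimes>\<^sub>M mu)" by measurable
    then show ?thesis
      by (rule measurable_cong[THEN iffD1, rotated])
        (auto simp: g_def space_pair_measure indicator_def split: if_splits)
  qed
  have Dc: "continuous_on S2 D"
    unfolding D_def using K[of 1] \<gamma>G
    by (intro continuous_intros hsmooth_continuous_on[OF hsm_slice[OF E]] q) auto
  have "(\<integral>\<^sup>+x. ennreal (norm (D x) powr p) \<partial>mu) \<le>
      (\<integral>\<^sup>+x. (\<integral>\<^sup>+t. ennreal (indicator {0..1} t * norm (F t x) powr p) \<partial>lborel) \<partial>mu)"
  proof (rule nn_integral_mono)
    fix x assume "x \<in> space mu"
    then have x: "x \<in> S2" by simp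
    have "(\<integral>\<^sup>+t. ennreal (indicator {0..1} t * norm (F t x) powr p) \<partial>lborel) =
        ennreal (\<integral>t. indicator {0..1} t * norm (F t x) powr p \<partial>lborel)"
      by (rule nn_integral_eq_integral[OF i2x[OF x]]) auto
    then show "ennreal (norm (D x) powr p) <= (\<integral>\<^sup>+t. ennreal (indicator {0..1} t * norm (F t x) powr p) \<partial>lborel)"
      using pw[OF x] by (simp add: ennreal_leI)
  qed
  also have "... = (\<integral>\<^sup>+t. (\<integral>\<^sup>+x. ennreal (indicator {0..1} t * norm (F t x) powr p) \<partial>mu) \<partial>lborel)"
    using Fubini'[OF meas] by simp
  also have "... <= (\<integral>\<^sup>+t. ennreal B' * indicator {0..1::real} t \<partial>lborel)"
  proof (rule nn_integral_mono)
    fix t :: real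
    show "(\<integral>\<^sup>+x. ennreal (indicator {0..1} t * norm (F t x) powr p) \<partial>mu) <= ennreal B' * indicator {0..1} t"
    proof (cases "t \<in> {0..1}")
      case True
      then show ?thesis
        using lp_nn_integral[OF lp_continuous[OF contFt[OF True] p0]] LF[OF True] by (simp add: ennreal_leI)
    qed simp
  qed
  also have "... = ennreal B'" by (simp add: nn_integral_cmult)
  finally have "Lp p D <= B'"
    using lp_nn_integral_bound(2)[OF measurable_S2_continuous[OF Dc] B'] by blast
  moreover have "Lp p D = Lp p (%x. P (\<gamma> + h) (jet u) x - P \<gamma> (jet u) x - (\<Sum>c\<in>Basis. (h \<bullet> c) *R q c x))"
    by (rule Lp_cong_S2) (simp add: D_def E_def Ec_def)
  ultimately show ?thesis by (simp add: B'_def)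
qed

lemma near_G: assumes "\<gamma> \<in> G" shows "\<exists>C>0. \<forall>h. norm h * C <= 1 --> \<gamma> + h \<in> G"
proof -
  obtain d where d: "d > 0" "cball \<gamma> d \<subseteq> G" using open_G assms open_contains_cball by blast
  have "\<gamma> + h \<in> G" if "norm h * (1 / d) <= 1" for h using d that by (intro subsetD[OF d(2)]) (simp add: dist_norm)
  then show ?thesis using d(1) by (intro exI[of _ "1 / d"]) auto
qed

lemma jet_op_pop: "pop r P ==> r <= s ==> \<gamma> \<in> G ==> p >= 0 ==> jet_op p s (P \<gamma>)"
  using pop_bound[OF pop_mono, of r P s "{\<gamma>}" p] pop_diff[of r P] unfolding jet_op_def by simp

lemma pop_near:
  fixes P :: "'p => 'b::euclidean_space jets => real^3 => 'b"
  assumes P: "pop r P" and \<gamma>: "\<gamma> \<in> G" and p: "p >= 0"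
  shows "\<exists>C>0. near_le p r (%_. 1) (%h. P (\<gamma> + h)) C"
proof -
  obtain d where d: "d > 0" "cball \<gamma> d \<subseteq> G" using open_G \<gamma> open_contains_cball by blast
  obtain B where B: "B >= 0" "!!\<gamma>' J. \<gamma>' \<in> cball \<gamma> d ==> lpjet p r J ==> lp p (P \<gamma>' J) & Lp p (P \<gamma>' J) <= B * jetE p r J"
    using pop_bound[OF P compact_cball d(2) p] by blast
  \<comment> \<open>Adding \<open>1 / d\<close> to the constant lets the smallness condition on
    \<open>h\<close> force \<open>\<gamma> + h\<close> into the ball where the bound
    \<open>B\<close> holds.\<close>
  have "lp p (P (\<gamma> + h) J) & Lp p (P (\<gamma> + h) J) <= (B + 1 / d) * jetE p r J"
    if h: "norm h * (B + 1 / d) <= 1" and J: "lpjet p r J" for h J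
  proof -
    have "norm h * (1 / d) <= norm h * (B + 1 / d)" using B(1) by (intro mult_left_mono) auto
    then have c: "\<gamma> + h \<in> cball \<gamma> d" using h d(1) by (simp add: dist_norm field_simps)
    have "B * jetE p r J <= (B + 1 / d) * jetE p r J" using d(1) jetE_nonneg by (intro mult_right_mono) auto
    then show ?thesis using B(2)[OF c J] by auto
  qed
  moreover have "B + 1 / d > 0" using B(1) d(1) by (simp add: add_nonneg_pos)
  ultimately show ?thesis unfolding near_le_def by (metis mult.right_neutral)
qed

lemma pop_near_diff:
  fixes P :: "'p => 'b::euclidean_space jets => real^3 => 'b"
  assumes P: "pop r P" and \<gamma>: "\<gamma> \<in> G" and p: "p >= 0"
  shows "\<exists>C>0. near_le p r (%_. 1) (%h J x. P (\<gamma> + h) J x - P \<gamma> J x) C"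
proof -
  obtain C where C: "C > 0" "near_le p r (%_. 1) (%h. P (\<gamma> + h)) C" using pop_near[OF assms] by blast
  define D where "D = 2 powr p * (C + C) + C"
  have D: "D > 0" "C <= D" using C(1) by (simp_all add: D_def add_nonneg_pos)
  have "lp p (%x. P (\<gamma> + h) J x - P \<gamma> J x) & Lp p (%x. P (\<gamma> + h) J x - P \<gamma> J x) <= D * 1 * jetE p r J"
    if h: "norm h * D <= 1" and J: "wjet r J" "lpjet p r J" for h J
  proof -
    have "norm h * C <= 1" using mult_left_mono[OF D(2), of "norm h"] h by simp
    note l = near_leD[OF C(2) this J] near_leD[OF C(2) _ J, of 0]
    have "Lp p (%x. P (\<gamma> + h) J x - P \<gamma> J x) <= 2 powr p * (Lp p (P (\<gamma> + h) J) + Lp p (P \<gamma> J))"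
      using l by (intro lp_diff p) simp_all
    also have "... <= 2 powr p * (C * jetE p r J + C * jetE p r J)" using l by (intro mult_left_mono add_mono) auto
    also have "... <= D * 1 * jetE p r J" using C(1) by (simp add: D_def algebra_simps jetE_nonneg)
    finally show ?thesis using l by (simp add: lp_diff p)
  qed
  then show ?thesis using D(1) unfolding near_le_def by blast
qed

text \<open>The comparison operators \<open>q\<close> are left free, so one estimate serves several
  times: \<open>q = 0\<close> gives a Lipschitz bound, the derivative at \<open>\<gamma>\<close>
  gives Taylor remainders. In each case a bound of size \<open>v\<close> for the derivative minus
  \<open>q\<close> gains the factor \<open>norm h powr p\<close>.\<close>

lemma pop_remainder:
  fixes P :: "'p => 'b::euclidean_space jets => real^3 => 'b"
  assumes P: "pop r P" and Q: "!!c. c \<in> Basis ==> pop (Suc r) (Q c)" "!!c. c \<in> Basis ==> pder_rel c 0 P (Q c)"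
    and p: "p >= 1" and \<gamma>: "\<gamma> \<in> G" and s: "Suc r <= s"
    and v: "!!h. v h >= 0" "!!t h. 0 <= t ==> t <= 1 ==> v (t *R h) <= v h"
    and q: "!!c. c \<in> Basis ==> jet_op p s (q c)" "!!c u. c \<in> Basis ==> hsmooth u ==> continuous_on S2 (q c (jet u))"
    and le: "!!c. c \<in> Basis ==> \<exists>C>0. near_le p s v (%h J x. Q c (\<gamma> + h) J x - q c J x) C"
  shows "\<exists>C>0. near_le p s (%h. norm h powr p * v h)
    (%h J x. P (\<gamma> + h) J x - P \<gamma> J x - (\<Sum>c\<in>Basis. (h \<bullet> c) *R q c J x)) C"
proof -
  have p0: "p >= 0" "p > 0" using p by auto
  obtain A where A: "A > 0" "!!c. c \<in> Basis ==> near_le p s v (%h J x. Q c (\<gamma> + h) J x - q c J x) A"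
    using near_le_uniform[where F="%c h J x. Q c (\<gamma> + h) J x - q c J x", OF finite_Basis v(1) le] by blast
  obtain B where B: "B > 0" "!!h. norm h * B <= 1 ==> \<gamma> + h \<in> G" using near_G[OF \<gamma>] by blast
  define n where "n = real DIM('p) powr p * real DIM('p)"
  define C where "C = A + B + 4 powr p * (n * A)"
  have C: "C > 0" "A <= C" "B <= C" "4 powr p * (n * A) <= C"
    using A(1) B(1) by (auto simp: C_def n_def intro!: add_pos_nonneg add_nonneg_nonneg)
  let ?R = "%h J x. P (\<gamma> + h) J x - P \<gamma> J x - (\<Sum>c\<in>Basis. (h \<bullet> c) *R q c J x)"
  have "lp p (?R h J) & Lp p (?R h J) <= C * (norm h powr p * v h) * jetE p s J"
    if h: "norm h * C <= 1" and J: "wjet s J" "lpjet p s J" for h J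
  proof -
    have near: "norm (t *R h) * A <= 1" "\<gamma> + t *R h \<in> G" if "0 <= t" "t <= 1" for t
    proof -
      have "norm (t *R h) * C <= norm h * C"
        using that C(1) mult_left_le_one_le[of "norm h" t] by (intro mult_right_mono) auto
      then show "norm (t *R h) * A <= 1" "\<gamma> + t *R h \<in> G"
        using h mult_left_mono[OF C(2) norm_ge_zero, of "t *R h"] mult_left_mono[OF C(3) norm_ge_zero, of "t *R h"]
        by (auto intro!: B(2))
    qed
    have g: "\<gamma> + h \<in> G" using near(2)[of 1] by simp
    have "jet_op p s (?R h)"
      using s p0 by (intro jet_op_diff jet_op_sum jet_op_pop[OF P] q g \<gamma>) auto
    moreover have "Lp p (?R h (jet u)) <= (n * norm h powr p * (A * v h)) * jetE p s (jet u)" if u: "hsmooth u" for u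
    proof -
      have "Lp p (?R h (jet u)) <= n * norm h powr p * (A * v h * jetE p s (jet u))"
        unfolding n_def
      proof (rule pop_remainder_smooth[OF P Q near(2) u p])
        fix t :: real and c :: 'p assume t: "0 <= t" "t <= 1" and c: "c \<in> Basis"
        have "A * v (t *R h) * jetE p s (jet u) <= A * v h * jetE p s (jet u)"
          using A(1) v(2)[OF t] by (intro mult_right_mono mult_left_mono) (auto simp: jetE_nonneg)
        then show "Lp p (%x. Q c (\<gamma> + t *R h) (jet u) x - q c (jet u) x) <= A * v h * jetE p s (jet u)"
          using near_leD[OF A(2)[OF c] near(1)[OF t] wjet_jet[OF u] lpjet_jet[OF u p]] by linarith
      qed (use A(1) v(1) u q in \<open>auto simp: jetE_nonneg intro!: mult_nonneg_nonneg\<close>)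
      then show ?thesis by (simp add: mult_ac)
    qed
    moreover have "n * norm h powr p * (A * v h) >= 0" using A(1) v(1) by (simp add: n_def)
    ultimately have "lp p (?R h J) & Lp p (?R h J) <= 4 powr p * (n * norm h powr p * (A * v h)) * jetE p s J"
      by (intro jet_op_dense[OF p _ J])
    moreover have "4 powr p * (n * norm h powr p * (A * v h)) * jetE p s J = (4 powr p * (n * A)) * ((norm h powr p * v h) * jetE p s J)"
      by (simp add: mult_ac)
    moreover have "... <= C * ((norm h powr p * v h) * jetE p s J)"
      using C(4) v(1) by (intro mult_right_mono) (auto simp: jetE_nonneg)
    ultimately show ?thesis by (simp add: mult_ac)
  qed
  then show ?thesis using C(1) unfolding near_le_def by blast
qed

lemma pop_derivatives:
  assumes "pop r P" obtains Q where "!!c. pop (Suc r) (Q c)" "!!c. pder_rel c 0 P (Q c)"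
proof -
  have "\<forall>c. \<exists>Q. pop (Suc r) Q & pder_rel c 0 P Q" using pop_step[OF assms] by blast
  then obtain Q where "\<forall>c. pop (Suc r) (Q c) & pder_rel c 0 P (Q c)" by (elim choice[THEN exE])
  then show ?thesis using that by blast
qed

lemma pop_lipschitz:
  fixes P :: "'p => 'b::euclidean_space jets => real^3 => 'b"
  assumes P: "pop r P" and \<gamma>: "\<gamma> \<in> G" and p: "p >= 1"
  shows "\<exists>C>0. near_le p (Suc r) (%h. norm h powr p) (%h J x. P (\<gamma> + h) J x - P \<gamma> J x) C"
proof -
  obtain Q where Q: "!!c. pop (Suc r) (Q c)" "!!c. pder_rel c 0 P (Q c)" by (rule pop_derivatives[OF P]) blast
  have "\<exists>C>0. near_le p (Suc r) (%h. norm h powr p * 1)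
      (%h J x. P (\<gamma> + h) J x - P \<gamma> J x - (\<Sum>c\<in>Basis. (h \<bullet> c) *R 0)) C"
    using pop_near[OF Q(1) \<gamma>, of p] p by (intro pop_remainder[OF P Q p \<gamma>] jet_op_zero) auto
  then show ?thesis by simp
qed

lemma pop_jet_continuous:
  assumes "pop r P" "\<gamma> \<in> G" "hsmooth u" shows "continuous_on S2 (P \<gamma> (jet u))"
proof -
  have "hsm (%z. P (fst z) (jet u) (sgn (snd z)))" using assms by (intro pop_hsm hsmooth_jet)
  from hsmooth_continuous_on[OF hsm_slice[OF this assms(2)]] show ?thesis by (rule continuous_on_eq) simp
qed

text \<open>On jets of order \<open>r + 1\<close> the increments of the derivatives
  \<open>Q c\<close> are merely bounded near \<open>\<gamma>\<close>; one order more makes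
  \<open>Q c\<close> Lipschitz at \<open>\<gamma>\<close>, and the remainder quadratic.\<close>

lemma pop_taylor:
  fixes P :: "'p => 'b::euclidean_space jets => real^3 => 'b"
  assumes P: "pop r P" and Q: "!!c. c \<in> Basis ==> pop (Suc r) (Q c)" "!!c. c \<in> Basis ==> pder_rel c 0 P (Q c)"
    and \<gamma>: "\<gamma> \<in> G" and p: "p >= 1"
  defines "R \<equiv> %h J x. P (\<gamma> + h) J x - P \<gamma> J x - (\<Sum>c\<in>Basis. (h \<bullet> c) *R Q c \<gamma> J x)"
  shows "\<exists>C>0. near_le p (Suc r) (%h. norm h powr p) R C"
    and "\<exists>C>0. near_le p (Suc (Suc r)) (%h. norm h powr p * norm h powr p) R C"
proof -
  have "\<exists>C>0. near_le p (Suc r) (%h. norm h powr p * 1) R C"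
    unfolding R_def using pop_near_diff[OF Q(1) \<gamma>, of _ p] p
    by (intro pop_remainder[OF P Q p \<gamma>] jet_op_pop[OF Q(1)] pop_jet_continuous[OF Q(1)] \<gamma>) auto
  then show "\<exists>C>0. near_le p (Suc r) (%h. norm h powr p) R C" by simp
  show "\<exists>C>0. near_le p (Suc (Suc r)) (%h. norm h powr p * norm h powr p) R C"
    unfolding R_def using pop_lipschitz[OF Q(1) \<gamma> p] p
    by (intro pop_remainder[OF P Q p \<gamma>] jet_op_pop[OF Q(1)] pop_jet_continuous[OF Q(1)] \<gamma>)
      (auto intro!: powr_mono2 mult_left_le_one_le)
qed

text \<open>Boundedness at order \<open>r\<close> and the Lipschitz rate at order
  \<open>r + 1\<close> combine through density; the rate is lost, but no order.\<close>

lemma pop_continuous: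
  fixes P :: "'p => 'b::euclidean_space jets => real^3 => 'b"
  assumes P: "pop r P" and J: "wjet r J" "lpjet p r J" and p: "p >= 1" and \<gamma>: "\<gamma> \<in> G" and e: "e > 0"
  shows "\<exists>d>0. \<forall>h. norm h < d --> Lp p (%x. P (\<gamma> + h) J x - P \<gamma> J x) <= e"
proof -
  let ?F = "%h J x. P (\<gamma> + h) J x - P \<gamma> J x"
  obtain C D where C: "C > 0" "near_le p r (%_. 1) ?F C" "D > 0" "near_le p (Suc r) (%h. norm h powr p) ?F D"
    using pop_near_diff[OF P \<gamma>, of p] pop_lipschitz[OF P \<gamma> p] p by auto
  have "\<exists>d>0. \<forall>h. norm h < d --> Lp p (?F h J) <= e * 1"
    using C by (intro near_le_small[OF p _ C(2) _ C(1,3) _ J e]) (simp_all add: pop_diff[OF P] algebra_simps)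
  then show ?thesis by simp
qed

text \<open>The remainder is of size \<open>norm h\<close> on jets of order \<open>r + 1\<close> and
  quadratic one order higher; density improves the first bound to little o for a fixed jet.\<close>

lemma pop_differentiable:
  fixes P :: "'p => 'b::euclidean_space jets => real^3 => 'b"
  assumes P: "pop r P" and Q: "!!c. c \<in> Basis ==> pop (Suc r) (Q c)" "!!c. c \<in> Basis ==> pder_rel c 0 P (Q c)"
    and J: "wjet (Suc r) J" "lpjet p (Suc r) J" and p: "p >= 1" and \<gamma>: "\<gamma> \<in> G" and e: "e > 0"
  shows "\<exists>d>0. \<forall>h. norm h < d -->
    Lp p (%x. P (\<gamma> + h) J x - P \<gamma> J x - (\<Sum>c\<in>Basis. (h \<bullet> c) *R Q c \<gamma> J x)) <= e * norm h powr p"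
proof -
  let ?F = "%h J x. P (\<gamma> + h) J x - P \<gamma> J x - (\<Sum>c\<in>Basis. (h \<bullet> c) *R Q c \<gamma> J x)"
  obtain C D where C: "C > 0" "near_le p (Suc r) (%h. norm h powr p) ?F C"
    "D > 0" "near_le p (Suc (Suc r)) (%h. norm h powr p * norm h powr p) ?F D"
    using pop_taylor[OF P Q \<gamma> p] by blast
  show ?thesis
    by (rule near_le_small[OF p _ C(2,4,1,3) _ J e])
      (simp_all add: pop_diff[OF P] pop_diff[OF Q(1)] scaleR_diff_right sum_subtractf algebra_simps)
qed

section \<open>Operators compatible with jets\<close>

text \<open>\<open>W w\<close> is the derivative along the word \<open>w\<close> of the function obtained by applying \<open>W []\<close>.\<close>

definition ojet :: "nat => ((real^3) list => 'p => 'b::euclidean_space jets => real^3 => 'b) => bool" where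
  "ojet r W \<longleftrightarrow> (\<forall>w. set w \<subseteq> Basis --> pop (r + length w) (W w)) \<and>
    (\<forall>a w. set (a # w) \<subseteq> Basis --> (\<forall>p J \<gamma>. p >= 1 & wjet (Suc (r + length w)) J & lpjet p (Suc (r + length w)) J & \<gamma> \<in> G -->
       weak_rot a (W w \<gamma> J) (W (a # w) \<gamma> J)))"

text \<open>Recursion on the word: for each new letter \<open>pop_step\<close> provides an operator,
  which \<open>pop_weak_rot\<close> identifies as the weak derivative.\<close>

lemma ojet_exists:
  fixes P :: "'p => 'b::euclidean_space jets => real^3 => 'b"
  assumes P: "pop r P" shows "\<exists>W. ojet r W & W [] = P"
proof -
  define W where "W = rec_list P (%a w Pw. SOME Q. pop (Suc (r + length w)) Q & pder_rel 0 a Pw Q)"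
  have W: "W [] = P" "W (a # w) = (SOME Q. pop (Suc (r + length w)) Q & pder_rel 0 a (W w) Q)" for a w
    by (simp_all add: W_def)
  have pW: "pop (r + length w) (W w)" for w
  proof (induction w)
    case (Cons a w)
    then show ?case using someI_ex[OF pop_step[OF Cons, of 0 a]] by (simp add: W)
  qed (simp add: W P)
  have rW: "pder_rel 0 a (W w) (W (a # w))" for a w
    using someI_ex[OF pop_step[OF pW[of w], of 0 a]] by (simp add: W)
  have "ojet r W"
    unfolding ojet_def using pW pop_weak_rot[OF pW pW[of "_ # _", simplified] rW] by auto
  then show ?thesis using W by blast
qed

text \<open>The parameter derivative is chosen separately for every word, so compatibility of
  \<open>V c\<close> along words is not built in. It holds because \<open>V c w\<close> is a limit
  of difference quotients of \<open>W w\<close> in \<open>\<gamma>\<close>, whose weak derivatives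
  are the quotients for \<open>a # w\<close>; weak derivatives being closed, the two
  differentiations commute.\<close>

lemma ojet_pder_exists:
  fixes W :: "(real^3) list => 'p => 'b::euclidean_space jets => real^3 => 'b"
  assumes W: "ojet r W"
  shows "\<exists>V. \<forall>c\<in>Basis. ojet (Suc r) (V c) & (\<forall>w. set w \<subseteq> Basis --> pder_rel c 0 (W w) (V c w))"
proof -
  define V where "V c w = (SOME Q. pop (Suc (r + length w)) Q & pder_rel c 0 (W w) Q)" for c w
  have pW: "pop (r + length w) (W w)" if "set w \<subseteq> Basis" for w using W that by (auto simp: ojet_def)
  have V: "pop (Suc (r + length w)) (V c w)" "pder_rel c 0 (W w) (V c w)" if "set w \<subseteq> Basis" for c w
    using someI_ex[OF pop_step[OF pW[OF that], of c 0]] by (simp_all add: V_def)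
  have "ojet (Suc r) (V c)" if c: "c \<in> Basis" for c
    unfolding ojet_def
  proof (intro conjI allI impI)
    show "pop (Suc r + length w) (V c w)" if "set w \<subseteq> Basis" for w using V that by simp
    fix a and w :: "(real^3) list" and p and J :: "'b jets" and \<gamma>
    assume aw: "set (a # w) \<subseteq> Basis"
      and H: "p >= 1 & wjet (Suc (Suc r + length w)) J & lpjet p (Suc (Suc r + length w)) J & \<gamma> \<in> G"
    have w: "set w \<subseteq> Basis" using aw by auto
    have p: "p >= 1" "p >= 0" and \<gamma>: "\<gamma> \<in> G" using H by auto
    have J: "wjet (Suc (r + length (a # w))) J" "lpjet p (Suc (r + length (a # w))) J" using H by auto
    have J': "wjet (Suc (r + length w)) J" "lpjet p (Suc (r + length w)) J"
      using wjet_mono[OF J(1)] lpjet_mono[OF J(2)] by auto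
    obtain r0 where r0: "r0 > 0" "ball \<gamma> r0 \<subseteq> G" using open_G \<gamma> openE by blast
    define s where "s n = r0 / 2 * inverse (real (Suc n))" for n :: nat
    have s: "s n > 0" "\<gamma> + s n *R c \<in> G" for n
    proof -
      show "s n > 0" using r0 by (simp add: s_def)
      have "r0 / 2 * inverse (real (Suc n)) <= r0 / 2 * 1"
        using r0 by (intro mult_left_mono) (auto simp: inverse_eq_divide)
      then have "s n < r0" using r0 by (simp add: s_def)
      then show "\<gamma> + s n *R c \<in> G" using r0 \<open>s n > 0\<close> c by (auto simp: dist_norm intro!: subsetD[OF r0(2)])
    qed
    have s0: "s \<longlonglongrightarrow> 0"
      unfolding s_def by (rule tendsto_mult_right_zero[OF LIMSEQ_inverse_real_of_nat])
    have quot: "(%n. Lp p (%x. (1 / s n) *R (W v (\<gamma> + s n *R c) J x - W v \<gamma> J x) - V c v \<gamma> J x)) \<longlonglongrightarrow> 0"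
      if v: "set v \<subseteq> Basis" and Jv: "wjet (Suc (r + length v)) J" "lpjet p (Suc (r + length v)) J" for v
    proof (rule LIMSEQ_I)
      fix e :: real assume e: "e > 0"
      obtain d where d: "d > 0" "!!h. norm h < d ==>
        Lp p (%x. W v (\<gamma> + h) J x - W v \<gamma> J x - (\<Sum>c\<in>Basis. (h \<bullet> c) *R V c v \<gamma> J x)) <= (e / 2) * norm h powr p"
        using pop_differentiable[OF pW[OF v] V(1)[OF v] V(2)[OF v] Jv p(1) \<gamma>, of "e / 2"] e by auto
      obtain N where N: "!!n. n >= N ==> s n < d"
        using order_tendstoD(2)[OF s0 d(1)] by (auto simp: eventually_sequentially)
      have "norm (Lp p (%x. (1 / s n) *R (W v (\<gamma> + s n *R c) J x - W v \<gamma> J x) - V c v \<gamma> J x) - 0) < e" if n: "n >= N" for n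
      proof -
        have sn: "(\<Sum>c'\<in>Basis. ((s n *R c) \<bullet> c') *R V c' v \<gamma> J x) = s n *R V c v \<gamma> J x" for x
        proof -
          have "(\<Sum>c'\<in>Basis. ((s n *R c) \<bullet> c') *R V c' v \<gamma> J x) = (\<Sum>c'\<in>Basis. if c' = c then s n *R V c v \<gamma> J x else 0)"
            using c by (intro sum.cong) (auto simp: inner_Basis)
          then show ?thesis using c by simp
        qed
        have le: "Lp p (%x. W v (\<gamma> + s n *R c) J x - W v \<gamma> J x - s n *R V c v \<gamma> J x) <= (e / 2) * s n powr p"
          using d(2)[of "s n *R c"] N[OF n] s(1)[of n] c by (simp only: sn) simp
        have lpR: "lp p (%x. W v (\<gamma> + s n *R c) J x - W v \<gamma> J x - s n *R V c v \<gamma> J x)"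
          using pop_lp[OF pW[OF v] _ lpjet_mono[OF Jv(2)] p(2)] pop_lp[OF V(1)[OF v] \<gamma> Jv(2) p(2)] s(2)[of n] \<gamma>
          by (intro lp_diff(1) lp_scaleR p) auto
        have "(%x. (1 / s n) *R (W v (\<gamma> + s n *R c) J x - W v \<gamma> J x) - V c v \<gamma> J x) =
            (%x. (1 / s n) *R (W v (\<gamma> + s n *R c) J x - W v \<gamma> J x - s n *R V c v \<gamma> J x))"
          using s(1)[of n] by (simp add: fun_eq_iff scaleR_diff_right)
        then have "Lp p (%x. (1 / s n) *R (W v (\<gamma> + s n *R c) J x - W v \<gamma> J x) - V c v \<gamma> J x) =
            \<bar>1 / s n\<bar> powr p * Lp p (%x. W v (\<gamma> + s n *R c) J x - W v \<gamma> J x - s n *R V c v \<gamma> J x)"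
          using lp_scaleR(2)[OF lpR, of "1 / s n"] by simp
        also have "... <= \<bar>1 / s n\<bar> powr p * ((e / 2) * s n powr p)" using le by (intro mult_left_mono) auto
        also have "... = e / 2" using s(1)[of n] by (simp add: powr_divide)
        finally show ?thesis using e by (simp add: Lp_nonneg)
      qed
      then show "\<exists>no. \<forall>n\<ge>no. norm (Lp p (%x. (1 / s n) *R (W v (\<gamma> + s n *R c) J x - W v \<gamma> J x) - V c v \<gamma> J x) - 0) < e"
        by blast
    qed
    have lpW: "lp p (W v \<gamma>' J)" if "set v \<subseteq> Basis" "\<gamma>' \<in> G" "lpjet p (Suc (r + length v)) J" for v \<gamma>'
      using pop_lp[OF pW[OF that(1)] that(2) lpjet_mono[OF that(3)] p(2)] by simp
    have lpq: "lp p (%x. (1 / s n) *R (W v (\<gamma> + s n *R c) J x - W v \<gamma> J x))"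
      if "set v \<subseteq> Basis" "lpjet p (Suc (r + length v)) J" for v n
      by (intro lp_scaleR lp_diff(1) lpW that p s \<gamma>)
    show "weak_rot a (V c w \<gamma> J) (V c (a # w) \<gamma> J)"
    proof (rule weak_rot_limit[OF p(1) _ lpq[OF w J'(2)] lpq[OF aw J(2)] _ _ quot[OF w J'] quot[OF aw J]])
      fix n
      have wr: "weak_rot a (W w \<gamma>' J) (W (a # w) \<gamma>' J)" if "\<gamma>' \<in> G" for \<gamma>'
        using W aw p that J' unfolding ojet_def by blast
      have "weak_rot a (%x. (1 / s n) *R (W w (\<gamma> + s n *R c) J x + (-1) *R W w \<gamma> J x))
         (%x. (1 / s n) *R (W (a # w) (\<gamma> + s n *R c) J x + (-1) *R W (a # w) \<gamma> J x))"
        using weak_rot_mult[OF hsmooth_const weak_rot_add[OF wr[OF s(2)] weak_rot_mult[OF hsmooth_const wr[OF \<gamma>]]], of "1 / s n" n "-1"]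
        by simp
      then show "weak_rot a (%x. (1 / s n) *R (W w (\<gamma> + s n *R c) J x - W w \<gamma> J x))
         (%x. (1 / s n) *R (W (a # w) (\<gamma> + s n *R c) J x - W (a # w) \<gamma> J x))" by simp
    qed (use pop_lp[OF V(1)[OF w] \<gamma> J'(2) p(2)] pop_lp[OF V(1)[OF aw] \<gamma> J(2) p(2)] in auto)
  qed
  then show ?thesis using V by blast
qed

end

section \<open>Pointwise geometry of a metric on the sphere\<close>

lemma tangent_iff: "v \<in> tangent x \<longleftrightarrow> v \<bullet> x = 0"
  by (simp add: tangent_def)

lemma tangent_zero [simp]: "0 \<in> tangent x"
  and tangent_add: "u \<in> tangent x ==> v \<in> tangent x ==> u + v \<in> tangent x"
  and tangent_diff: "u \<in> tangent x ==> v \<in> tangent x ==> u - v \<in> tangent x"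
  and tangent_scaleR: "u \<in> tangent x ==> c *R u \<in> tangent x"
  and tangent_cross [simp]: "a >< x \<in> tangent x" "x >< a \<in> tangent x"
  by (auto simp: tangent_iff inner_add_left inner_diff_left cross_inner_zero)

lemma tangent_sum: "(!!i. i \<in> I ==> f i \<in> tangent x) ==> (\<Sum>i\<in>I. f i) \<in> tangent x"
  by (induction I rule: infinite_finite_induct) (auto intro: tangent_add)

definition inner_on :: "real^3 => (real^3 => real^3 => real) => bool" where
  "inner_on x B \<longleftrightarrow> (\<forall>u\<in>tangent x. \<forall>v\<in>tangent x. \<forall>w\<in>tangent x. \<forall>a b.
      B u v = B v u & B (a *R u + b *R v) w = a * B u w + b * B v w) \<and>
     (\<forall>u\<in>tangent x. u ~= 0 --> B u u > 0)"

lemma inner_onD: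
  assumes "inner_on x B"
  shows inner_on_sym: "u \<in> tangent x ==> v \<in> tangent x ==> B u v = B v u"
    and inner_on_add: "u \<in> tangent x ==> v \<in> tangent x ==> w \<in> tangent x ==> B (u + v) w = B u w + B v w"
    and inner_on_scale: "u \<in> tangent x ==> w \<in> tangent x ==> B (c *R u) w = c * B u w"
    and inner_on_add2: "u \<in> tangent x ==> v \<in> tangent x ==> w \<in> tangent x ==> B w (u + v) = B w u + B w v"
    and inner_on_scale2: "u \<in> tangent x ==> w \<in> tangent x ==> B w (c *R u) = c * B w u"
    and inner_on_pos: "u \<in> tangent x ==> u ~= 0 ==> B u u > 0"
proof -
  show s: "u \<in> tangent x ==> v \<in> tangent x ==> B u v = B v u" for u v
    using assms by (auto simp: inner_on_def)
  show a: "u \<in> tangent x ==> v \<in> tangent x ==> w \<in> tangent x ==> B (u + v) w = B u w + B v w" for u v w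
    using assms unfolding inner_on_def by (metis mult_1 scaleR_one)
  show c: "u \<in> tangent x ==> w \<in> tangent x ==> B (c *R u) w = c * B u w" for u w c
  proof -
    assume "u \<in> tangent x" "w \<in> tangent x"
    then have "B (c *R u + 0 *R u) w = c * B u w + 0 * B u w" using assms unfolding inner_on_def by blast
    then show ?thesis by simp
  qed
  show "u \<in> tangent x ==> v \<in> tangent x ==> w \<in> tangent x ==> B w (u + v) = B w u + B w v"
    using s[of w "u + v"] s[of u w] s[of v w] a[of u v w] by (simp add: tangent_add)
  show "u \<in> tangent x ==> w \<in> tangent x ==> B w (c *R u) = c * B w u"
    using s[of w "c *R u"] s[of u w] c[of u w c] by (simp add: tangent_scaleR)
  show "u \<in> tangent x ==> u ~= 0 ==> B u u > 0" using assms by (auto simp: inner_on_def)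
qed

lemma inner_on_zero: "inner_on x B ==> w \<in> tangent x ==> B 0 w = 0"
  using inner_on_scale[of x B 0 w 0] by simp

lemma tangent_decomp:
  assumes x: "x \<in> S2" and e: "norm e = 1" "e \<in> tangent x" and v: "v \<in> tangent x"
  shows "v = (v \<bullet> e) *R e + (v \<bullet> (x >< e)) *R (x >< e)"
proof -
  define c where "c = x >< e"
  have n: "x \<bullet> x = 1" "e \<bullet> e = 1" "e \<bullet> x = 0" "v \<bullet> x = 0"
    using x e v by (auto simp: mem_sphere_0 norm_eq_1 tangent_iff)
  have cx: "c >< x = e" unfolding c_def by (rule tangent_cross_cross) (use x n in auto)
  have cc: "c \<bullet> c = 1"
    using norm_cross_dot[of x e] x e n unfolding c_def
    by (simp add: mem_sphere_0 power2_norm_eq_inner inner_commute[of x e])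
  have vc: "v >< c = (v \<bullet> e) *R x"
  proof -
    have "v >< c = (v \<bullet> e) *R x - (v \<bullet> x) *R e" unfolding c_def by (simp add: cross3_simps forall_3)
    then show ?thesis using n by simp
  qed
  have "c >< (v >< c) = (c \<bullet> c) *R v - (c \<bullet> v) *R c" by (simp add: cross3_simps forall_3)
  then have "(v \<bullet> e) *R e = v - (c \<bullet> v) *R c"
    unfolding vc cross_mult_right cx cc by simp
  then show ?thesis by (simp add: c_def inner_commute)
qed

lemma exists_unit_tangent:
  assumes "x \<in> S2" obtains e where "e \<in> tangent x" "norm e = 1"
proof -
  obtain a where a: "a >< x ~= 0"
  proof (rule ccontr)
    assume "\<not> thesis"
    then have z: "a >< x = 0" for a using that by blast
    have "x \<bullet> x = 1" using assms by (simp add: mem_sphere_0 norm_eq_1)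
    moreover have "x = 0"
      using z[of "axis 1 1"] z[of "axis 2 1"] z[of "axis 3 1"] by (simp add: cross3_simps forall_3 axis_def)
    ultimately show False by simp
  qed
  show ?thesis
    by (rule that[of "sgn (a >< x)"]) (use a in \<open>auto simp: tangent_iff sgn_div_norm cross_inner_zero\<close>)
qed

definition orthoframe :: "real^3 => (real^3 => real^3 => real) => (real^3) \<times> (real^3) => bool" where
  "orthoframe x B = (%(e1, e2). e1 \<in> tangent x & e2 \<in> tangent x & B e1 e1 = 1 & B e2 e2 = 1 & B e1 e2 = 0)"

text \<open>Gram-Schmidt applied to \<open>e\<close> and \<open>x >< e\<close> shows that the choice
  in \<open>frame\<close> is not vacuous.\<close>

lemma orthoframe_frame:
  assumes x: "x \<in> S2" and B: "inner_on x (g x)" shows "orthoframe x (g x) (frame g x)"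
proof -
  note i = inner_onD[OF B]
  obtain e where e: "e \<in> tangent x" "norm e = 1" using exists_unit_tangent[OF x] .
  define c where "c = x >< e"
  have c: "c \<in> tangent x" "c \<bullet> e = 0" "c ~= 0"
  proof -
    show "c \<in> tangent x" "c \<bullet> e = 0" by (auto simp: c_def cross_inner_zero)
    have "c >< x = e" unfolding c_def by (rule tangent_cross_cross) (use x e in \<open>auto simp: tangent_iff\<close>)
    then show "c ~= 0" using e by auto
  qed
  have e0: "e ~= 0" using e by auto
  define e1 where "e1 = (1 / sqrt (g x e e)) *R e"
  have p1: "g x e e > 0" using i(6)[OF e(1) e0] .
  have e1: "e1 \<in> tangent x" "g x e1 e1 = 1"
  proof -
    show t: "e1 \<in> tangent x" using e by (simp add: e1_def tangent_scaleR)
    show "g x e1 e1 = 1"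
      using e p1 unfolding e1_def by (simp add: i(3) i(5) tangent_scaleR field_simps)
  qed
  define w where "w = c - (g x c e1) *R e1"
  have w: "w \<in> tangent x" using c e1 by (simp add: w_def tangent_diff tangent_scaleR)
  have w0: "w ~= 0"
  proof
    assume "w = 0"
    then have "c = (g x c e1 / sqrt (g x e e)) *R e" by (simp add: w_def e1_def)
    then have "c \<bullet> c = (g x c e1 / sqrt (g x e e)) * (c \<bullet> e)" by (metis inner_scaleR_right)
    then show False using c by simp
  qed
  have we1: "g x w e1 = 0"
  proof -
    have "w = c + (- g x c e1) *R e1" by (simp add: w_def)
    then have "g x w e1 = g x c e1 + (- g x c e1) * g x e1 e1"
      using c e1 by (simp only: i(2) i(3) tangent_scaleR)
    then show ?thesis using e1 by simp
  qed
  define e2 where "e2 = (1 / sqrt (g x w w)) *R w"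
  have p2: "g x w w > 0" using i(6)[OF w w0] .
  have "e2 \<in> tangent x" "g x e2 e2 = 1" "g x e1 e2 = 0"
  proof -
    show "e2 \<in> tangent x" using w by (simp add: e2_def tangent_scaleR)
    show "g x e2 e2 = 1"
      using w p2 unfolding e2_def by (simp add: i(3) i(5) tangent_scaleR field_simps)
    show "g x e1 e2 = 0"
      using w e1 we1 i(1)[OF e1(1) w] unfolding e2_def by (simp add: i(5))
  qed
  then have "orthoframe x (g x) (e1, e2)" using e1 by (simp add: orthoframe_def)
  then have "orthoframe x (g x) (SOME e. orthoframe x (g x) e)" by (rule someI)
  then show ?thesis by (simp add: frame_def orthoframe_def)
qed

text \<open>The Euclidean area form of the tangent plane at \<open>x\<close>.\<close>

definition area :: "real^3 => real^3 => real^3 => real" where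
  "area x u v = x \<bullet> (u >< v)"

lemma area_simps: "area x (u + u') v = area x u v + area x u' v" "area x u (v + v') = area x u v + area x u v'"
  "area x (c *R u) v = c * area x u v" "area x u (c *R v) = c * area x u v" "area x u u = 0"
  by (simp_all add: area_def cross_add_left cross_add_right cross_mult_left cross_mult_right inner_add_right)

lemma area_swap: "area x u v = - area x v u"
  unfolding area_def by (subst cross_skew) simp

lemma area_rot: "x \<in> S2 ==> area x (a >< x) (b >< x) = x \<bullet> (a >< b)"
proof -
  assume x: "x \<in> S2"
  have "area x (a >< x) (b >< x) = (x \<bullet> x) * (x \<bullet> (a >< b))"
    unfolding area_def by (simp add: cross3_simps)
  then show ?thesis using x by (simp add: mem_sphere_0 norm_eq_1)
qed

definition vol_density :: "(real^3 => real^3 => real^3 => real) => real^3 => real" where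
  "vol_density g x = (let (e1, e2) = frame (%_ u v. u \<bullet> v) x in sqrt (g x e1 e1 * g x e2 e2 - (g x e1 e2)\<^sup>2))"

lemma vol_eq_density: "vol g = density mu (%x. ennreal (vol_density g x))"
  by (simp add: vol_def vol_density_def Let_def case_prod_unfold)

lemma inner_on_inner: "inner_on x (\<bullet>)"
  unfolding inner_on_def by (intro conjI ballI allI impI) (rule inner_commute | simp add: inner_add_left)+

text \<open>The left side of the Gram identity is alternating in \<open>u\<close>, \<open>v\<close>
  and in \<open>w\<close>, \<open>z\<close>; in dimension two it is therefore a multiple of the
  product of area forms, and evaluation on \<open>e\<close>, \<open>x >< e\<close> gives the
  factor.\<close>

lemma vol_density_pos_gram:
  assumes x: "x \<in> S2" and B: "inner_on x (g x)"
  shows "vol_density g x > 0"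
    and "[|u \<in> tangent x; v \<in> tangent x; w \<in> tangent x; z \<in> tangent x|] ==>
      g x u w * g x v z - g x u z * g x v w = (vol_density g x)\<^sup>2 * (area x u v * area x w z)"
proof -
  note i = inner_onD[OF B]
  obtain e e2 where f: "frame (%_ u v. u \<bullet> v) x = (e, e2)" by fastforce
  have o: "e \<in> tangent x" "e2 \<in> tangent x" "e \<bullet> e = 1" "e2 \<bullet> e2 = 1" "e \<bullet> e2 = 0"
    using orthoframe_frame[of x "%_ u v. u \<bullet> v", OF x inner_on_inner] by (auto simp: f orthoframe_def)
  define c where "c = x >< e"
  have e: "norm e = 1" using o by (simp add: norm_eq_1)
  have ct: "c \<in> tangent x" "c ~= 0" "c \<bullet> e = 0"
  proof -
    show "c \<in> tangent x" "c \<bullet> e = 0" by (auto simp: c_def cross_inner_zero)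
    have "c >< x = e" unfolding c_def by (rule tangent_cross_cross) (use x o in \<open>auto simp: tangent_iff\<close>)
    then show "c ~= 0" using e by auto
  qed
  have dec: "u = (u \<bullet> e) *R e + (u \<bullet> c) *R c" if "u \<in> tangent x" for u
    unfolding c_def by (rule tangent_decomp[OF x e o(1) that])
  have "x \<bullet> x = 1" using x by (simp add: mem_sphere_0 norm_eq_1)
  then have cc: "c \<bullet> c = 1"
    using norm_cross_dot[of x e] x e o unfolding c_def
    by (simp add: mem_sphere_0 power2_norm_eq_inner inner_commute[of x e] tangent_iff)
  \<comment> \<open>The chosen Euclidean frame may have either orientation: \<open>e2\<close> is
    \<open>x >< e\<close> up to a sign, which disappears in the Gram determinant.\<close>
  have e2c: "e2 = (e2 \<bullet> c) *R c" using dec[OF o(2)] o(5) by (simp add: inner_commute)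
  then have "e2 \<bullet> e2 = (e2 \<bullet> c) * (e2 \<bullet> c)" by (metis inner_scaleR_right)
  then have s: "(e2 \<bullet> c)\<^sup>2 = 1" using o by (simp add: power2_eq_square)
  define s where "s = e2 \<bullet> c"
  have e2s: "e2 = s *R c" "s\<^sup>2 = 1" using e2c s by (auto simp: s_def)
  define D where "D = g x e e * g x c c - (g x e c)\<^sup>2"
  have "g x e2 e2 = s\<^sup>2 * g x c c" "(g x e e2)\<^sup>2 = s\<^sup>2 * (g x e c)\<^sup>2"
    unfolding e2s(1) using ct o by (simp_all add: i(3) i(5) tangent_scaleR power2_eq_square)
  then have vd: "vol_density g x = sqrt D" by (simp add: vol_density_def f D_def e2s(2))
  have "D > 0"
  proof -
    \<comment> \<open>Up to scale, the part of \<open>c\<close> that is \<open>g\<close>-orthogonal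
      to \<open>e\<close>; its square norm is \<open>g x e e * D\<close>, so positivity of
      \<open>D\<close> is the strict Cauchy-Schwarz inequality.\<close>
    define w where "w = g x e e *R c + (- g x e c) *R e"
    have e0: "e ~= 0" using e by auto
    have ee: "g x e e > 0" using i(6)[OF o(1) e0] .
    have "e \<bullet> c = 0" using ct by (simp add: inner_commute)
    then have "w \<bullet> c = g x e e" using cc by (simp add: w_def inner_diff_left)
    then have "w ~= 0" using ee by auto
    moreover have w: "w \<in> tangent x" using ct o by (simp add: w_def tangent_add tangent_scaleR tangent_diff)
    ultimately have "g x w w > 0" using i(6) by blast
    also have "g x w w = g x e e * D"
      unfolding w_def D_def using ct o i(1)[OF ct(1) o(1)]
      by (simp add: i(2) i(3) i(4) i(5) tangent_scaleR tangent_add tangent_diff del: scaleR_minus_left) (simp add: power2_eq_square algebra_simps)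
    finally show ?thesis using ee by (simp add: zero_less_mult_iff)
  qed
  then show "vol_density g x > 0" by (simp add: vd)
  have xc: "area x e c = 1"
  proof -
    have "e >< c = (e \<bullet> e) *R x - (e \<bullet> x) *R e" unfolding c_def by (simp add: cross3_simps forall_3)
    then have "e >< c = x" using o by (simp add: tangent_iff)
    then show ?thesis using x by (simp add: area_def mem_sphere_0 norm_eq_1)
  qed
  assume T: "u \<in> tangent x" "v \<in> tangent x" "w \<in> tangent x" "z \<in> tangent x"
  have ar: "area x u v = (u \<bullet> e) * (v \<bullet> c) - (u \<bullet> c) * (v \<bullet> e)" if "u \<in> tangent x" "v \<in> tangent x" for u v
  proof -
    have "area x u v = area x ((u \<bullet> e) *R e + (u \<bullet> c) *R c) ((v \<bullet> e) *R e + (v \<bullet> c) *R c)"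
      using dec[OF that(1)] dec[OF that(2)] by simp
    then show ?thesis using xc area_swap[of x c e] by (simp add: area_simps)
  qed
  have gg: "g x u v = (u \<bullet> e) * (v \<bullet> e) * g x e e + ((u \<bullet> e) * (v \<bullet> c) + (u \<bullet> c) * (v \<bullet> e)) * g x e c + (u \<bullet> c) * (v \<bullet> c) * g x c c"
    if "u \<in> tangent x" "v \<in> tangent x" for u v
  proof -
    have "g x u v = g x ((u \<bullet> e) *R e + (u \<bullet> c) *R c) ((v \<bullet> e) *R e + (v \<bullet> c) *R c)"
      using dec[OF that(1)] dec[OF that(2)] by simp
    then show ?thesis using o ct i(1)[OF ct(1) o(1)]
      by (simp add: i(2) i(3) i(4) i(5) tangent_scaleR tangent_add) (simp add: algebra_simps)
  qed
  have "(vol_density g x)\<^sup>2 = D" using \<open>D > 0\<close> by (simp add: vd)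
  then show "g x u w * g x v z - g x u z * g x v w = (vol_density g x)\<^sup>2 * (area x u v * area x w z)"
    unfolding D_def gg[OF T(1) T(3)] gg[OF T(2) T(4)] gg[OF T(1) T(4)] gg[OF T(2) T(3)] ar[OF T(1,2)] ar[OF T(3,4)]
    by (simp add: power2_eq_square) (simp add: algebra_simps)
qed

section \<open>Vector fields\<close>

lemma vector_field_tangent: "vector_field X ==> x \<in> S2 ==> X x \<in> tangent x"
  by (simp add: vector_field_def)

lemma smooth_on_S2_cong:
  assumes "smooth_on_S2 f" "!!x. x \<in> S2 ==> f x = h x" shows "smooth_on_S2 h"
  using assms unfolding hsmooth_sgn_comp by (auto intro: hsmooth_cong dest: sgn_in_S2)

lemma smooth_on_S2_bilinear:
  assumes "bounded_bilinear B" "smooth_on_S2 f" "smooth_on_S2 h" shows "smooth_on_S2 (%x. B (f x) (h x))"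
  using hsmooth_bilinear[OF assms(1)] assms(2,3) by (simp add: hsmooth_sgn_comp)

lemma smooth_on_S2_linear:
  assumes "bounded_linear L" "smooth_on_S2 f" shows "smooth_on_S2 (%x. L (f x))"
  using hsmooth_linear_comp[OF assms(1)] assms(2) by (simp add: hsmooth_sgn_comp)

lemma smooth_on_S2_add: "smooth_on_S2 f ==> smooth_on_S2 h ==> smooth_on_S2 (%x. f x + h x)"
  by (simp add: hsmooth_sgn_comp hsmooth_add)

lemma smooth_on_S2_ident: "smooth_on_S2 (%x. x)"
  using hsmooth_sgn by (simp add: hsmooth_sgn_comp)

lemma smooth_on_S2_const: "smooth_on_S2 (%x. c)"
  using hsmooth_const by (simp add: hsmooth_sgn_comp)

lemma smooth_on_S2_continuous: "smooth_on_S2 f ==> continuous_on S2 f"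
  using hsmooth_continuous_on[of "%y. f (sgn y)"] by (simp add: hsmooth_sgn_comp cong: continuous_on_cong)

lemma D_S2_rot: "D_S2 f x (a >< x) = rot a (%y. f (sgn y)) x"
  by (simp add: D_S2_def rot_def Der_def)

lemma D_S2_tangent:
  assumes "smooth_on_S2 f" "x \<in> S2" "v \<in> tangent x"
  shows "D_S2 f x v = (\<Sum>b\<in>Basis. ((x >< v) \<bullet> b) *R D_S2 f x (b >< x))"
  unfolding D_S2_rot unfolding D_S2_def
  by (rule frechet_tangent_rot)
    (use assms in \<open>auto simp: mem_sphere_0 hsmooth_sgn_comp tangent_iff intro!: hsmooth_differentiable[of "%y. f (sgn y)"]\<close>)

lemma D_S2_linear:
  assumes "smooth_on_S2 f" "x \<in> S2" shows "linear (D_S2 f x)"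
  unfolding D_S2_def[abs_def] using assms
  by (intro linear_frechet_derivative hsmooth_differentiable) (auto simp: hsmooth_sgn_comp)

lemma D_S2_cong:
  assumes "x \<in> S2" "!!x. x \<in> S2 ==> f x = h x" shows "D_S2 f x v = D_S2 h x v"
  unfolding D_S2_def
  by (subst frechet_derivative_cong_open[of "- {0}" x "%y. f (sgn y)" "%y. h (sgn y)"])
    (use assms sgn_in_S2 in auto)

lemma D_S2_mult:
  assumes "smooth_on_S2 f" "smooth_on_S2 h" "x \<in> S2"
  shows "D_S2 (%x. f x * h x :: real) x v = f x * D_S2 h x v + D_S2 f x v * h x"
  using Der_bilinear[OF bounded_bilinear_mult, of "%y. f (sgn y)" x "%y. h (sgn y)" "%_. v"] assms
  by (simp add: D_S2_def Der_def hsmooth_sgn_comp hsmooth_differentiable)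

lemma D_S2_add:
  assumes "smooth_on_S2 f" "smooth_on_S2 h" "x \<in> S2"
  shows "D_S2 (%x. f x + h x) x v = D_S2 f x v + D_S2 h x v"
  using Der_add[of "%y. f (sgn y)" x "%y. h (sgn y)" "%_. v"] assms
  by (simp add: D_S2_def Der_def hsmooth_sgn_comp hsmooth_differentiable)

lemma vector_field_rot: "vector_field (%x. a >< x)"
  unfolding vector_field_def
  by (auto intro!: smooth_on_S2_bilinear[OF bounded_bilinear_cross3] smooth_on_S2_const smooth_on_S2_ident)

lemma vector_field_scaleR: "smooth_on_S2 f ==> vector_field X ==> vector_field (%x. f x *R X x)"
  unfolding vector_field_def by (auto intro: smooth_on_S2_bilinear[OF bounded_bilinear_scaleR] tangent_scaleR)

lemma vector_field_add: "vector_field X ==> vector_field Y ==> vector_field (%x. X x + Y x)"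
  unfolding vector_field_def by (auto intro: smooth_on_S2_add tangent_add)

lemma vector_field_zero: "vector_field (%x. 0)"
  unfolding vector_field_def by (auto intro: smooth_on_S2_const)

lemma vector_field_sum: "(!!i. i \<in> I ==> vector_field (F i)) ==> vector_field (%x. \<Sum>i\<in>I. F i x)"
  by (induction I rule: infinite_finite_induct) (auto intro: vector_field_add vector_field_zero)

text \<open>Coefficients of a vector field in the rotation fields, chosen as in
  \<open>tangent_rot_representation\<close>.\<close>

definition vfc :: "(real^3 => real^3) => real^3 => real^3 => real" where
  "vfc X b x = (x >< X x) \<bullet> b"

lemma smooth_vfc: "vector_field X ==> smooth_on_S2 (vfc X b)"
  unfolding vfc_def[abs_def] vector_field_def
  by (intro smooth_on_S2_linear[OF bounded_linear_inner_left] smooth_on_S2_bilinear[OF bounded_bilinear_cross3]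
      smooth_on_S2_ident) auto

lemma vfc_expand: "vector_field X ==> x \<in> S2 ==> X x = (\<Sum>b\<in>Basis. vfc X b x *R (b >< x))"
  unfolding vfc_def by (rule tangent_rot_representation) (auto dest: vector_field_tangent simp: tangent_iff)

section \<open>Density, connection and divergence of a metric\<close>

locale riemannian_S2 =
  fixes g :: "real^3 => real^3 => real^3 => real"
    and nabla :: "(real^3 => real^3) => real^3 => real^3 => real^3"
  assumes metric: "riemannian_metric g" and lc: "levi_civita g nabla"
begin

lemma inner_on_g: "x \<in> S2 ==> inner_on x (g x)"
  using metric unfolding riemannian_metric_def inner_on_def by blast

lemma smooth_g: "vector_field X ==> vector_field Y ==> smooth_on_S2 (%x. g x (X x) (Y x))"
  using metric by (auto simp: riemannian_metric_def)

abbreviation "rho \<equiv> vol_density g"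

lemma rho_pos: "x \<in> S2 ==> rho x > 0"
  by (rule vol_density_pos_gram(1)[OF _ inner_on_g])

lemma gram:
  assumes "x \<in> S2" "u \<in> tangent x" "v \<in> tangent x" "w \<in> tangent x" "z \<in> tangent x"
  shows "g x u w * g x v z - g x u z * g x v w = (rho x)\<^sup>2 * (area x u v * area x w z)"
  using vol_density_pos_gram(2)[of x g u v w z] assms inner_on_g by blast

definition rot_minor :: "real^3 => real^3 => real^3 => real" where
  "rot_minor a b x = g x (a >< x) (a >< x) * g x (b >< x) (b >< x) - g x (a >< x) (b >< x) * g x (b >< x) (a >< x)"

text \<open>\<open>frame\<close> chooses its vectors without continuity, so smoothness of
  \<open>rho\<close> is not visible from its definition. The minors involve global smooth fields
  only; by the Gram identity they are \<open>(rho x) ^ 2\<close> times the squared coordinates of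
  \<open>x\<close>, which add up to one.\<close>

lemma rho_sq:
  assumes x: "x \<in> S2"
  shows "(rho x)\<^sup>2 = rot_minor (axis 1 1) (axis 2 1) x + rot_minor (axis 2 1) (axis 3 1) x + rot_minor (axis 3 1) (axis 1 1) x"
proof -
  have G: "rot_minor a b x = (rho x)\<^sup>2 * (x \<bullet> (a >< b))\<^sup>2" for a b
    using gram[OF x, of "a >< x" "b >< x" "a >< x" "b >< x"] x
    by (simp add: rot_minor_def area_rot power2_eq_square)
  have "x $ 3 * x $ 3 + x $ 1 * x $ 1 + x $ 2 * x $ 2 = x \<bullet> x"
    by (simp add: inner_vec_def sum_3)
  also have "... = 1" using x by (simp add: mem_sphere_0 norm_eq_1)
  finally have "(rho x)\<^sup>2 * (x $ 3 * x $ 3 + x $ 1 * x $ 1 + x $ 2 * x $ 2) = (rho x)\<^sup>2" by simp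
  then show ?thesis unfolding G by (simp add: cross_basis inner_axis power2_eq_square algebra_simps)
qed

lemma smooth_rho: "smooth_on_S2 rho"
proof -
  have "hsmooth (%y. rot_minor a b (sgn y))" for a b
    unfolding rot_minor_def
    by (intro hsmooth_diff hsmooth_mult smooth_g[OF vector_field_rot vector_field_rot, unfolded hsmooth_sgn_comp])
  then have "hsmooth (%y. rot_minor (axis 1 1) (axis 2 1) (sgn y) + rot_minor (axis 2 1) (axis 3 1) (sgn y) + rot_minor (axis 3 1) (axis 1 1) (sgn y))"
    by (intro hsmooth_add)
  then have "hsmooth (%y. (rho (sgn y))\<^sup>2)"
    by (rule hsmooth_cong) (simp add: rho_sq sgn_in_S2)
  then have "smooth_on (- {0}) (%y. sqrt ((rho (sgn y))\<^sup>2))"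
    using rho_pos sgn_in_S2 by (intro smooth_on_sqrt) (auto simp: hsmooth_def less_imp_neq[THEN not_sym])
  then have "smooth_on (- {0}) (%y. rho (sgn y))"
    by (rule smooth_on_cong) (use rho_pos sgn_in_S2 in \<open>auto simp: less_imp_le\<close>)
  then show ?thesis by (simp add: smooth_on_S2_def)
qed

lemma frame_g:
  assumes "x \<in> S2" obtains e1 e2 where "frame g x = (e1, e2)" "e1 \<in> tangent x" "e2 \<in> tangent x"
    "g x e1 e1 = 1" "g x e2 e2 = 1" "g x e1 e2 = 0" "g x e2 e1 = 0"
proof -
  obtain e1 e2 where f: "frame g x = (e1, e2)" by fastforce
  then show ?thesis
    using orthoframe_frame[of x g, OF assms inner_on_g[OF assms]] inner_on_sym[OF inner_on_g[OF assms]]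
    by (intro that[of e1 e2]) (auto simp: orthoframe_def)
qed

text \<open>The residual \<open>r\<close> is \<open>g\<close>-orthogonal to \<open>e1\<close> and
  \<open>e2\<close>. The Gram identity, which encodes that the plane has dimension two, forces first
  \<open>area x r e1 = 0\<close> and then \<open>g x r r = 0\<close>.\<close>

lemma frame_decomp:
  assumes x: "x \<in> S2" and f: "e1 \<in> tangent x" "e2 \<in> tangent x"
    "g x e1 e1 = 1" "g x e2 e2 = 1" "g x e1 e2 = 0" and v: "v \<in> tangent x"
  shows "v = g x v e1 *R e1 + g x v e2 *R e2"
proof -
  note i = inner_onD[OF inner_on_g[OF x]]
  define r where "r = v + (- g x v e1) *R e1 + (- g x v e2) *R e2"
  have t: "(- g x v e1) *R e1 \<in> tangent x" "(- g x v e2) *R e2 \<in> tangent x" using f by (auto intro: tangent_scaleR simp del: scaleR_minus_left)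
  have r: "r \<in> tangent x" unfolding r_def by (intro tangent_add v t)
  have e21: "g x e2 e1 = 0" using i(1)[OF f(1,2)] f by simp
  have r1: "g x r e1 = 0" unfolding r_def using f v t e21
    by (simp add: i(2) i(3) tangent_add del: scaleR_minus_left)
  have r2: "g x r e2 = 0" unfolding r_def using f v t
    by (simp add: i(2) i(3) tangent_add del: scaleR_minus_left)
  have "area x r e1 * area x e1 e2 = 0"
    using gram[OF x r f(1) f(1) f(2)] r1 r2 f rho_pos[OF x] by simp
  moreover have "area x e1 e2 ~= 0"
    using gram[OF x f(1) f(2) f(1) f(2)] f by auto
  ultimately have "area x r e1 = 0" by simp
  then have "g x r r = 0" using gram[OF x r f(1) r f(1)] r1 f i(1)[OF f(1) r] by simp
  then have "r = 0" using i(6)[OF r] by force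
  then show ?thesis by (simp add: r_def algebra_simps)
qed

lemma nabla_vf: "vector_field X ==> vector_field Y ==> vector_field (%x. nabla Y x (X x))"
  using lc by (simp add: levi_civita_def)

lemma nabla_lin: "vector_field Y ==> x \<in> S2 ==> u \<in> tangent x ==> v \<in> tangent x ==>
    nabla Y x (a *R u + b *R v) = a *R nabla Y x u + b *R nabla Y x v"
  using lc by (simp add: levi_civita_def)

lemma nabla_add: "vector_field Y ==> vector_field Z ==> x \<in> S2 ==> v \<in> tangent x ==>
    nabla (%z. Y z + Z z) x v = nabla Y x v + nabla Z x v"
  using lc by (simp add: levi_civita_def)

lemma nabla_leibniz: "smooth_on_S2 f ==> vector_field Y ==> x \<in> S2 ==> v \<in> tangent x ==>
    nabla (%z. f z *R Y z) x v = D_S2 f x v *R Y x + f x *R nabla Y x v"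
  using lc by (simp add: levi_civita_def)

lemma nabla_metric: "vector_field Y ==> vector_field Z ==> x \<in> S2 ==> v \<in> tangent x ==>
    D_S2 (%z. g z (Y z) (Z z)) x v = g x (nabla Y x v) (Z x) + g x (Y x) (nabla Z x v)"
  using lc by (simp add: levi_civita_def)

lemma nabla_torsion: "vector_field X ==> vector_field Y ==> x \<in> S2 ==>
    nabla Y x (X x) - nabla X x (Y x) = D_S2 Y x (X x) - D_S2 X x (Y x)"
  using lc by (simp add: levi_civita_def)

text \<open>Tangency of \<open>nabla\<close> is given only along vector fields; the rotation field
  of \<open>x >< v\<close> passes through \<open>v\<close>.\<close>

lemma nabla_tangent:
  assumes Y: "vector_field Y" and x: "x \<in> S2" and v: "v \<in> tangent x" shows "nabla Y x v \<in> tangent x"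
proof -
  have "(x >< v) >< x = v" using x v by (intro tangent_cross_cross) (auto simp: tangent_iff)
  then show ?thesis
    using vector_field_tangent[OF nabla_vf[OF vector_field_rot[of "x >< v"] Y] x] by simp
qed

lemma nabla_scale: "vector_field Y ==> x \<in> S2 ==> u \<in> tangent x ==> nabla Y x (c *R u) = c *R nabla Y x u"
  using nabla_lin[of Y x u u c 0] by simp

lemma nabla_plus: "vector_field Y ==> x \<in> S2 ==> u \<in> tangent x ==> v \<in> tangent x ==>
   nabla Y x (u + v) = nabla Y x u + nabla Y x v"
  using nabla_lin[of Y x u v 1 1] by simp

text \<open>A field \<open>W\<close> vanishing on the sphere is \<open>f W\<close> with \<open>f\<close> zero on the sphere and one elsewhere, so the
  Leibniz rule shows that \<open>nabla\<close> only sees the values of a field on the sphere.\<close>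

lemma nabla_vanish:
  assumes W: "!!x. x \<in> S2 ==> W x = 0" and x: "x \<in> S2" and v: "v \<in> tangent x"
  shows "nabla W x v = 0"
proof -
  define f where "f z = (if z \<in> S2 then 0 else 1 :: real)" for z :: "real^3"
  have f: "smooth_on_S2 f" by (rule smooth_on_S2_cong[OF smooth_on_S2_const[of 0]]) (simp add: f_def)
  have vW: "vector_field W"
    unfolding vector_field_def using smooth_on_S2_cong[OF smooth_on_S2_const[of 0], of W] W by simp
  have "(%z. f z *R W z) = W" using W by (auto simp: f_def fun_eq_iff)
  then show ?thesis using nabla_leibniz[OF f vW x v] W[OF x] x by (simp add: f_def)
qed

lemma nabla_cong:
  assumes Y: "vector_field Y" and eq: "!!x. x \<in> S2 ==> Y x = Z x" and x: "x \<in> S2" and v: "v \<in> tangent x"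
  shows "nabla Y x v = nabla Z x v"
proof -
  have W: "vector_field (%z. Z z - Y z)"
    unfolding vector_field_def using smooth_on_S2_cong[OF smooth_on_S2_const[of 0], of "%z. Z z - Y z"] eq by simp
  have "nabla (%z. Y z + (Z z - Y z)) x v = nabla Y x v + nabla (%z. Z z - Y z) x v"
    by (rule nabla_add[OF Y W x v])
  then show ?thesis using nabla_vanish[of "%z. Z z - Y z" x v] eq x v by simp
qed

lemma divergence_eq:
  assumes x: "x \<in> S2" and f: "frame g x = (e1, e2)"
  shows "divergence g nabla X x = g x (nabla X x e1) e1 + g x (nabla X x e2) e2"
  by (simp add: divergence_def f)

lemma divergence_add:
  assumes x: "x \<in> S2" and X: "vector_field X" and Y: "vector_field Y"
  shows "divergence g nabla (%z. X z + Y z) x = divergence g nabla X x + divergence g nabla Y x"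
proof -
  note i = inner_onD[OF inner_on_g[OF x]]
  obtain e1 e2 where f: "frame g x = (e1, e2)" "e1 \<in> tangent x" "e2 \<in> tangent x" using frame_g[OF x] by metis
  show ?thesis
    unfolding divergence_eq[OF x f(1)]
    using f X Y x by (simp add: nabla_add i(2) nabla_tangent)
qed

lemma divergence_scale:
  assumes x: "x \<in> S2" and X: "vector_field X" and s: "smooth_on_S2 s"
  shows "divergence g nabla (%z. s z *R X z) x = s x * divergence g nabla X x + D_S2 s x (X x)"
proof -
  note i = inner_onD[OF inner_on_g[OF x]]
  obtain e1 e2 where f: "frame g x = (e1, e2)" "e1 \<in> tangent x" "e2 \<in> tangent x"
    "g x e1 e1 = 1" "g x e2 e2 = 1" "g x e1 e2 = 0" using frame_g[OF x] by metis
  have Xt: "X x \<in> tangent x" using X x by (rule vector_field_tangent)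
  note l = D_S2_linear[OF s x]
  have n: "g x (nabla (%z. s z *R X z) x e) e = D_S2 s x e * g x (X x) e + s x * g x (nabla X x e) e"
    if e: "e \<in> tangent x" for e
    using e Xt nabla_tangent[OF X x e] by (simp add: nabla_leibniz[OF s X x e] i(2) i(3) tangent_scaleR)
  have "D_S2 s x (X x) = D_S2 s x (g x (X x) e1 *R e1 + g x (X x) e2 *R e2)"
    using frame_decomp[OF x f(2-6) Xt] by simp
  also have "... = g x (X x) e1 * D_S2 s x e1 + g x (X x) e2 * D_S2 s x e2"
    by (simp add: linear_add[OF l] linear_cmul[OF l])
  finally show ?thesis
    unfolding divergence_eq[OF x f(1)] n[OF f(2)] n[OF f(3)] by (simp add: algebra_simps)
qed

lemma divergence_cong:
  assumes x: "x \<in> S2" and X: "vector_field X" and eq: "!!x. x \<in> S2 ==> X x = Y x"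
  shows "divergence g nabla X x = divergence g nabla Y x"
proof -
  obtain e1 e2 where f: "frame g x = (e1, e2)" "e1 \<in> tangent x" "e2 \<in> tangent x" using frame_g[OF x] by metis
  show ?thesis unfolding divergence_eq[OF x f(1)] using nabla_cong[OF X eq x] f by simp
qed

lemma D_S2_rot_field:
  assumes x: "x \<in> S2" and v: "v \<in> tangent x" shows "D_S2 (%x. a >< x) x v = a >< v"
proof -
  have l: "bounded_linear (%y. a >< y)" by (rule bounded_bilinear.bounded_linear_right[OF bounded_bilinear_cross3])
  have "D_S2 (%x. a >< x) x v = (\<Sum>b\<in>Basis. ((x >< v) \<bullet> b) *R rot b (%y. a >< sgn y) x)"
    using D_S2_tangent[OF _ x v, of "%x. a >< x"] vector_field_rot[of a] by (simp add: D_S2_rot vector_field_def)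
  also have "... = (\<Sum>b\<in>Basis. ((x >< v) \<bullet> b) *R (a >< (b >< x)))"
    using x by (simp add: rot_linear_comp[OF l hsmooth_sgn] rot_sgn)
  also have "... = a >< (\<Sum>b\<in>Basis. ((x >< v) \<bullet> b) *R (b >< x))"
    by (simp add: bounded_bilinear.sum_right[OF bounded_bilinear_cross3] cross_mult_right)
  also have "... = a >< v"
    using tangent_rot_representation[OF x, of v] v by (simp add: tangent_iff)
  finally show ?thesis .
qed

text \<open>Both sides are compared after differentiating \<open>g(Y,Y) g(Z,Z) - g(Y,Z)\<^sup>2 = \<rho>\<^sup>2 \<omega>(Y,Z)\<^sup>2\<close> along the rotation
  field of \<open>a\<close>, where \<open>Y\<close> and \<open>Z\<close> are rotation fields that are orthonormal at \<open>x\<close>.\<close>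

lemma divergence_rot:
  assumes x: "x \<in> S2"
  shows "rho x * divergence g nabla (%x. a >< x) x = D_S2 rho x (a >< x)"
proof -
  note i = inner_onD[OF inner_on_g[OF x]]
  obtain e1 e2 where f: "frame g x = (e1, e2)" "e1 \<in> tangent x" "e2 \<in> tangent x"
    "g x e1 e1 = 1" "g x e2 e2 = 1" "g x e1 e2 = 0" "g x e2 e1 = 0" using frame_g[OF x] by metis
  define a1 a2 where "a1 = x >< e1" and "a2 = x >< e2"
  have Y: "a1 >< x = e1" "a2 >< x = e2"
    unfolding a1_def a2_def by (intro tangent_cross_cross x; use f in \<open>simp add: tangent_iff\<close>)+
  let ?K = "a >< x"
  define w where "w = area x e1 e2"
  have w: "w = x \<bullet> (a1 >< a2)" using area_rot[OF x, of a1 a2] by (simp add: w_def Y)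
  have rw: "(rho x)\<^sup>2 * w\<^sup>2 = 1"
    using gram[OF x f(2,3) f(2,3)] f by (simp add: w_def power2_eq_square)
  define L1 L2 where "L1 = - ((a >< a1) >< x)" and "L2 = - ((a >< a2) >< x)"
  have Lt: "L1 \<in> tangent x" "L2 \<in> tangent x" by (auto simp: L1_def L2_def tangent_iff cross_inner_zero)
  \<comment> \<open>Vanishing torsion exchanges the roles of two rotation fields. The bracket that
    appears is again a rotation field; \<open>L1\<close> and \<open>L2\<close> are its values for
    \<open>a1\<close> and \<open>a2\<close>.\<close>
  have brk: "nabla (%x. b >< x) x ?K = nabla (%x. a >< x) x (b >< x) - (a >< b) >< x" for b
  proof -
    have "b >< (a >< x) - a >< (b >< x) = - ((a >< b) >< x)" by (simp add: cross3_simps forall_3)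
    moreover have "nabla (%x. b >< x) x ?K - nabla (%x. a >< x) x (b >< x) = b >< (a >< x) - a >< (b >< x)"
      using nabla_torsion[OF vector_field_rot[of a] vector_field_rot[of b] x] x by (simp add: D_S2_rot_field)
    ultimately have "nabla (%x. b >< x) x ?K - nabla (%x. a >< x) x (b >< x) = - ((a >< b) >< x)" by simp
    then show ?thesis by (simp add: diff_eq_eq)
  qed
  have n1: "g x (nabla (%x. a1 >< x) x ?K) e1 = g x (nabla (%x. a >< x) x e1) e1 + g x L1 e1"
    using brk[of a1] Lt f nabla_tangent[OF vector_field_rot x f(2), of a] i(2)[of "nabla (%x. a >< x) x e1" L1 e1]
    by (simp add: Y L1_def)
  have n2: "g x (nabla (%x. a2 >< x) x ?K) e2 = g x (nabla (%x. a >< x) x e2) e2 + g x L2 e2"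
    using brk[of a2] Lt f nabla_tangent[OF vector_field_rot x f(3), of a] i(2)[of "nabla (%x. a >< x) x e2" L2 e2]
    by (simp add: Y L2_def)
  \<comment> \<open>The trace of the bracket terms, computed through the area form; times
    \<open>w\<close> it equals the derivative of \<open>z \<bullet> (a1 >< a2)\<close> along the
    rotation field.\<close>
  have Lw: "g x L1 e1 * w + g x L2 e2 * w = ?K \<bullet> (a1 >< a2)"
  proof -
    have "area x L1 e2 = g x L1 e1 * w"
    proof -
      have "area x L1 e2 = area x (g x L1 e1 *R e1 + g x L1 e2 *R e2) e2"
        using frame_decomp[OF x f(2-6) Lt(1)] by simp
      then show ?thesis by (simp add: area_simps w_def)
    qed
    moreover have "area x e1 L2 = g x L2 e2 * w"
    proof -
      have "area x e1 L2 = area x e1 (g x L2 e1 *R e1 + g x L2 e2 *R e2)"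
        using frame_decomp[OF x f(2-6) Lt(2)] by simp
      then show ?thesis by (simp add: area_simps w_def)
    qed
    moreover have "area x L1 e2 = - (x \<bullet> ((a >< a1) >< a2))"
      using area_rot[OF x, of "a >< a1" a2] area_simps(3)[of x "-1" "(a >< a1) >< x" e2] by (simp add: L1_def Y)
    moreover have "area x e1 L2 = - (x \<bullet> (a1 >< (a >< a2)))"
      using area_rot[OF x, of a1 "a >< a2"] area_simps(4)[of x e1 "-1" "(a >< a2) >< x"] by (simp add: L2_def Y)
    moreover have "- (x \<bullet> ((a >< a1) >< a2)) - (x \<bullet> (a1 >< (a >< a2))) = ?K \<bullet> (a1 >< a2)"
      by (simp add: cross3_simps)
    ultimately show ?thesis by linarith
  qed
  let ?G = "%b c z. g z (b >< z) (c >< z)"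
  note sG = smooth_g[OF vector_field_rot vector_field_rot]
  note sm = smooth_on_S2_bilinear[OF bounded_bilinear_mult]
  have srho: "smooth_on_S2 (%z. rho z * (z \<bullet> (a1 >< a2)))"
    by (intro sm smooth_rho smooth_on_S2_bilinear[OF bounded_bilinear_inner] smooth_on_S2_ident smooth_on_S2_const)
  have sx: "smooth_on_S2 (%z. z \<bullet> (a1 >< a2))"
    by (intro smooth_on_S2_bilinear[OF bounded_bilinear_inner] smooth_on_S2_ident smooth_on_S2_const)
  have Dx: "D_S2 (%z. z \<bullet> (a1 >< a2)) x ?K = ?K \<bullet> (a1 >< a2)"
    using x unfolding D_S2_rot by (simp add: rot_linear_comp[OF bounded_linear_inner_left hsmooth_sgn] rot_sgn)
  have D1: "D_S2 (?G a1 a1) x ?K = 2 * (g x (nabla (%x. a >< x) x e1) e1 + g x L1 e1)"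
    using nabla_metric[OF vector_field_rot[of a1] vector_field_rot[of a1] x, of ?K]
      i(1)[OF nabla_tangent[OF vector_field_rot[of a1] x, of ?K] f(2)] by (simp add: Y n1)
  have D2: "D_S2 (?G a2 a2) x ?K = 2 * (g x (nabla (%x. a >< x) x e2) e2 + g x L2 e2)"
    using nabla_metric[OF vector_field_rot[of a2] vector_field_rot[of a2] x, of ?K]
      i(1)[OF nabla_tangent[OF vector_field_rot[of a2] x, of ?K] f(3)] by (simp add: Y n2)
  have "D_S2 (%z. ?G a1 a1 z * ?G a2 a2 z) x ?K =
     D_S2 (%z. ?G a1 a2 z * ?G a1 a2 z + (rho z * (z \<bullet> (a1 >< a2))) * (rho z * (z \<bullet> (a1 >< a2)))) x ?K"
  proof (rule D_S2_cong[OF x])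
    fix z :: "real^3" assume z: "z \<in> S2"
    show "?G a1 a1 z * ?G a2 a2 z = ?G a1 a2 z * ?G a1 a2 z + (rho z * (z \<bullet> (a1 >< a2))) * (rho z * (z \<bullet> (a1 >< a2)))"
      using gram[OF z, of "a1 >< z" "a2 >< z" "a1 >< z" "a2 >< z"]
        inner_on_sym[OF inner_on_g[OF z], of "a1 >< z" "a2 >< z"] z
      by (simp add: area_rot power2_eq_square algebra_simps)
  qed
  then have "D_S2 (?G a1 a1) x ?K + D_S2 (?G a2 a2) x ?K =
      2 * (rho x * w) * (rho x * (?K \<bullet> (a1 >< a2)) + D_S2 rho x ?K * w)"
    using x f Y
    by (simp add: D_S2_mult D_S2_add sG sm srho smooth_rho sx Dx w[symmetric]) (simp add: algebra_simps)
  then have E: "(g x (nabla (%x. a >< x) x e1) e1 + g x (nabla (%x. a >< x) x e2) e2) + (g x L1 e1 + g x L2 e2)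
     = (rho x * w) * (rho x * (?K \<bullet> (a1 >< a2)) + D_S2 rho x ?K * w)"
    unfolding D1 D2 by simp
  have dv: "divergence g nabla (%x. a >< x) x = g x (nabla (%x. a >< x) x e1) e1 + g x (nabla (%x. a >< x) x e2) e2"
    by (rule divergence_eq[OF x f(1)])
  define d where "d = divergence g nabla (%x. a >< x) x"
  define l where "l = g x L1 e1 + g x L2 e2"
  have lw: "l * w = ?K \<bullet> (a1 >< a2)" using Lw by (simp add: l_def algebra_simps)
  \<comment> \<open>The bracket terms \<open>l\<close> cancel because
    \<open>(rho x) ^ 2 * w ^ 2 = 1\<close>, which isolates the divergence \<open>d\<close>.\<close>
  have "d + l = (rho x * w) * (rho x * (l * w) + D_S2 rho x ?K * w)"
    using E unfolding lw d_def dv by (simp only: l_def)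
  also have "... = ((rho x)\<^sup>2 * w\<^sup>2) * l + rho x * w\<^sup>2 * D_S2 rho x ?K"
    by (simp add: power2_eq_square algebra_simps)
  finally have "d = rho x * w\<^sup>2 * D_S2 rho x ?K" by (simp add: rw)
  then have "rho x * d = ((rho x)\<^sup>2 * w\<^sup>2) * D_S2 rho x ?K" by (simp add: power2_eq_square)
  then show ?thesis by (simp add: rw d_def)
qed

end

section \<open>Multilinear maps on tangent planes\<close>

definition lists_of :: "'a set => nat => 'a list set" where
  "lists_of E j = {es. set es \<subseteq> E & length es = j}"

lemma finite_lists_of: "finite E ==> finite (lists_of E j)"
  unfolding lists_of_def by (rule finite_lists_length_eq)

lemma lists_of_0 [simp]: "lists_of E 0 = {[]}"
  by (auto simp: lists_of_def)

lemma lists_of_Cons [simp]: "a # w \<in> lists_of E (Suc j) \<longleftrightarrow> a \<in> E & w \<in> lists_of E j"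
  by (auto simp: lists_of_def)

lemma lists_of_SucE: "w \<in> lists_of E (Suc j) ==> \<exists>a v. w = a # v & a \<in> E & v \<in> lists_of E j"
  by (cases w) (auto simp: lists_of_def)

lemma sum_lists_of_Suc: "(\<Sum>w\<in>lists_of E (Suc j). f w) = (\<Sum>a\<in>E. \<Sum>w\<in>lists_of E j. f (a # w))"
proof -
  have "bij_betw (%(a, w). a # w) (E \<times> lists_of E j) (lists_of E (Suc j))"
    by (rule bij_betwI'[where Y="lists_of E (Suc j)"]) (auto dest: lists_of_SucE)
  from sum.reindex_bij_betw[OF this, of f]
  have "(\<Sum>w\<in>lists_of E (Suc j). f w) = (\<Sum>(a, w)\<in>E \<times> lists_of E j. f (a # w))"
    by (simp add: case_prod_unfold)
  then show ?thesis by (simp add: sum.cartesian_product)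
qed

lemma multilinear_on_slot:
  assumes T: "multilinear_on V j T" and "length hs = j" "set hs \<subseteq> V" "i < j"
  shows "u \<in> V ==> v \<in> V ==> T (hs[i := a *R u + b *R v]) = a *R T (hs[i := u]) + b *R T (hs[i := v])"
    and "u \<in> V ==> T (hs[i := c *R u]) = c *R T (hs[i := u])"
    and "u \<in> V ==> v \<in> V ==> T (hs[i := u + v]) = T (hs[i := u]) + T (hs[i := v])"
proof -
  show *: "T (hs[i := a *R u + b *R v]) = a *R T (hs[i := u]) + b *R T (hs[i := v])" if "u \<in> V" "v \<in> V" for u v a b
    using assms that unfolding multilinear_on_def by blast
  show "u \<in> V ==> T (hs[i := c *R u]) = c *R T (hs[i := u])" using *[of u u c 0] by simp
  show "u \<in> V ==> v \<in> V ==> T (hs[i := u + v]) = T (hs[i := u]) + T (hs[i := v])" using *[of u v 1 1] by simp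
qed

lemma multilinear_on_sum:
  assumes T: "multilinear_on (tangent x) j T" and hs: "length hs = j" "set hs \<subseteq> tangent x" "i < j"
    and v: "!!k. k \<in> I ==> v k \<in> tangent x"
  shows "T (hs[i := (\<Sum>k\<in>I. c k *R v k)]) = (\<Sum>k\<in>I. c k *R T (hs[i := v k]))"
  using v
proof (induction I rule: infinite_finite_induct)
  case (insert k I)
  have "(\<Sum>k\<in>I. c k *R v k) \<in> tangent x" using insert by (intro tangent_sum tangent_scaleR) auto
  then have "T (hs[i := c k *R v k + 1 *R (\<Sum>k\<in>I. c k *R v k)]) =
      c k *R T (hs[i := v k]) + 1 *R T (hs[i := (\<Sum>k\<in>I. c k *R v k)])"
    using insert by (intro multilinear_on_slot(1)[OF T hs]) auto
  then show ?case using insert by simp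
qed (use multilinear_on_slot(2)[OF T hs, of 0 0] in auto)

lemma multilinear_on_sum_append:
  assumes T: "multilinear_on (tangent x) (length es + Suc (length vs)) T"
    and hs: "set es \<subseteq> tangent x" "set vs \<subseteq> tangent x" and v: "!!k. k \<in> I ==> v k \<in> tangent x"
  shows "T (es @ (\<Sum>k\<in>I. c k *R v k) # vs) = (\<Sum>k\<in>I. c k *R T (es @ v k # vs))"
  using multilinear_on_sum[OF T, of "es @ 0 # vs" "length es" I v c] hs v by (simp add: list_update_length)

text \<open>The arguments are replaced from left to right by elements of \<open>E\<close>; the
  prefix \<open>es\<close> collects those already treated. The same device proves
  \<open>multilinear_on_expand\<close>.\<close>

lemma multilinear_on_bound:
  assumes T: "multilinear_on (tangent x) j T" and E: "finite E" "E \<subseteq> tangent x"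
    and dec: "!!v. v \<in> tangent x ==> v = (\<Sum>e\<in>E. c v e *R e)"
    and M: "!!es. es \<in> lists_of E j ==> norm (T es) <= M" and M0: "M >= 0"
    and B: "B >= 0" "!!v. v \<in> set vs ==> v \<in> tangent x & (\<Sum>e\<in>E. \<bar>c v e\<bar>) <= B"
    and len: "set es \<subseteq> E" "length es + length vs = j"
  shows "norm (T (es @ vs)) <= M * B ^ length vs"
  using B(2) len
proof (induction vs arbitrary: es)
  case Nil
  then show ?case using M[of es] by (simp add: lists_of_def)
next
  case (Cons v vs)
  have "T (es @ v # vs) = T (es @ (\<Sum>e\<in>E. c v e *R e) # vs)" using dec[of v] Cons.prems by auto
  also have "... = (\<Sum>e\<in>E. c v e *R T (es @ e # vs))"
    using T E Cons.prems by (intro multilinear_on_sum_append) auto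
  also have "norm ... <= (\<Sum>e\<in>E. \<bar>c v e\<bar> * (M * B ^ length vs))"
  proof (intro sum_norm_le)
    fix e assume e: "e \<in> E"
    have "norm (T ((es @ [e]) @ vs)) <= M * B ^ length vs"
      using e Cons.prems by (intro Cons.IH) auto
    then show "norm (c v e *R T (es @ e # vs)) <= \<bar>c v e\<bar> * (M * B ^ length vs)"
      by (simp add: mult_left_mono)
  qed
  also have "... = (\<Sum>e\<in>E. \<bar>c v e\<bar>) * (M * B ^ length vs)" by (simp add: sum_distrib_right)
  also have "... <= B * (M * B ^ length vs)"
    using Cons.prems(1)[of v] M0 B(1) by (intro mult_right_mono) auto
  finally show ?case by (simp add: mult_ac)
qed

section \<open>Expansion of multilinear maps in rotation fields\<close>

definition rots :: "(real^3) list => real^3 => (real^3) list" where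
  "rots \<alpha> x = map (%a. a >< x) \<alpha>"

lemma rots_simps [simp]: "rots [] x = []" "rots (a # \<alpha>) x = (a >< x) # rots \<alpha> x" "length (rots \<alpha> x) = length \<alpha>"
    "rots (\<alpha> @ \<beta>) x = rots \<alpha> x @ rots \<beta> x"
  by (simp_all add: rots_def)

lemma rots_update: "rots (\<alpha>[i := c]) x = (rots \<alpha> x)[i := c >< x]"
  by (simp add: rots_def map_update)

lemma rots_tangent: "set (rots \<alpha> x) \<subseteq> tangent x"
  by (auto simp: rots_def)

text \<open>A tangent vector \<open>v\<close> at \<open>x\<close> is the sum of \<open>((x \<times> v) \<bullet> b) (b \<times> x)\<close> over the standard basis; these coefficients are used
  although the fields \<open>b \<times> x\<close> are linearly dependent.\<close>

primrec weight :: "real^3 => (real^3) list => (real^3) list => real" where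
  "weight x [] vs = 1"
| "weight x (b # \<beta>) vs = ((x >< hd vs) \<bullet> b) * weight x \<beta> (tl vs)"

lemma multilinear_on_expand:
  assumes x: "x \<in> S2" and T: "multilinear_on (tangent x) (length es + length vs) T"
    and "set es \<subseteq> tangent x" "set vs \<subseteq> tangent x"
  shows "T (es @ vs) = (\<Sum>\<beta>\<in>lists_of Basis (length vs). weight x \<beta> vs *R T (es @ rots \<beta> x))"
  using assms(2-4)
proof (induction vs arbitrary: es)
  case (Cons v vs)
  have v: "v = (\<Sum>b\<in>Basis. ((x >< v) \<bullet> b) *R (b >< x))"
    using Cons.prems by (intro tangent_rot_representation[OF x]) (auto simp: tangent_iff)
  have "T (es @ v # vs) = T (es @ (\<Sum>b\<in>Basis. ((x >< v) \<bullet> b) *R (b >< x)) # vs)" using v by simp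
  also have "... = (\<Sum>b\<in>Basis. ((x >< v) \<bullet> b) *R T (es @ (b >< x) # vs))"
    using Cons.prems by (intro multilinear_on_sum_append) auto
  also have "... = (\<Sum>b\<in>Basis. ((x >< v) \<bullet> b) *R
      (\<Sum>\<beta>\<in>lists_of Basis (length vs). weight x \<beta> vs *R T ((es @ [b >< x]) @ rots \<beta> x)))"
  proof (intro sum.cong refl)
    fix b :: "real^3"
    have "T ((es @ [b >< x]) @ vs) = (\<Sum>\<beta>\<in>lists_of Basis (length vs). weight x \<beta> vs *R T ((es @ [b >< x]) @ rots \<beta> x))"
      using Cons.prems by (intro Cons.IH) auto
    then show "((x >< v) \<bullet> b) *R T (es @ (b >< x) # vs) = ((x >< v) \<bullet> b) *R
      (\<Sum>\<beta>\<in>lists_of Basis (length vs). weight x \<beta> vs *R T ((es @ [b >< x]) @ rots \<beta> x))" by simp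
  qed
  also have "... = (\<Sum>\<beta>\<in>lists_of Basis (length (v # vs)). weight x \<beta> (v # vs) *R T (es @ rots \<beta> x))"
    by (simp add: sum_lists_of_Suc scaleR_sum_right)
  finally show ?case .
qed simp

lemma weight_update_linear:
  assumes "length hs = length \<beta>" "i < length \<beta>"
  shows "weight x \<beta> (hs[i := a *R u + b *R v]) = a * weight x \<beta> (hs[i := u]) + b * weight x \<beta> (hs[i := v])"
  using assms
proof (induction \<beta> arbitrary: hs i)
  case (Cons c \<beta>)
  then obtain h hs' where hs: "hs = h # hs'" by (cases hs) auto
  show ?case
  proof (cases i)
    case 0
    then show ?thesis by (simp add: hs cross_add_right cross_mult_right inner_add_left algebra_simps)
  next
    case (Suc i')
    then show ?thesis using Cons.IH[of hs' i'] Cons.prems by (simp add: hs algebra_simps)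
  qed
qed simp

lemma smooth_weight:
  "(!!Y. Y \<in> set Ys ==> vector_field Y) ==> length Ys = length \<beta> ==>
    smooth_on_S2 (%x. weight x \<beta> (map (%Y. Y x) Ys))"
proof (induction \<beta> arbitrary: Ys)
  case (Cons b \<beta>)
  then obtain Y Ys' where Ys: "Ys = Y # Ys'" by (cases Ys) auto
  have "smooth_on_S2 (%x. vfc Y b x * weight x \<beta> (map (%Y. Y x) Ys'))"
    using Cons.prems Cons.IH[of Ys'] Ys by (intro smooth_on_S2_bilinear[OF bounded_bilinear_mult] smooth_vfc) auto
  then show ?case by (simp add: Ys vfc_def)
qed (simp add: smooth_on_S2_const)

lemma rots_fields: "rots \<alpha> x = map (%Y. Y x) (map (%a x. a >< x) \<alpha>)"
  by (simp add: rots_def)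

lemma rots_comp: "map ((%Y. Y x) \<circ> (><)) \<alpha> = rots \<alpha> x"
  by (simp add: rots_def)

lemma smooth_weight_rots: "length \<alpha> = length \<beta> ==> smooth_on_S2 (%x. weight x \<beta> (rots \<alpha> x))"
  unfolding rots_fields by (rule smooth_weight) (auto intro: vector_field_rot)

section \<open>Linear combinations of jets with smooth coefficients\<close>

text \<open>Differential operators with smooth coefficients, without parameter or pullback; they
  translate between rotation derivatives and covariant derivatives in both directions.\<close>

inductive cop :: "nat => ('b::euclidean_space jets => real^3 => 'b) => bool" where
  cop_term: "hsmooth c ==> v \<in> words r ==> cop r (%t x. c x *R t v x)"
| cop_add: "cop r F ==> cop r F' ==> cop r (%t x. F t x + F' t x)"

lemma cop_zero: "cop r (%t x. 0)"
  using cop_term[OF hsmooth_const[of 0], of "[]" r] by simp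

lemma cop_jet: "v \<in> words r ==> cop r (%t x. t v x)"
  using cop_term[OF hsmooth_const[of 1], of v r] by simp

lemma cop_sum: "finite I ==> (!!i. i \<in> I ==> cop r (F i)) ==> cop r (%t x. \<Sum>i\<in>I. F i t x)"
  by (induction I rule: finite_induct) (auto intro: cop_zero cop_add)

lemma cop_mult: "cop r F ==> hsmooth d ==> cop r (%t x. d x *R F t x)"
proof (induction rule: cop.induct)
  case (cop_term c v r)
  then show ?case using cop.cop_term[OF hsmooth_mult[of d c], of v r] by simp
next
  case (cop_add r F F')
  then show ?case by (simp add: scaleR_add_right cop.cop_add)
qed

lemma cop_diff: "cop r F ==> cop r F' ==> cop r (%t x. F t x - F' t x)"
  using cop_add[OF _ cop_mult[OF _ hsmooth_const[of "-1"]], of r F F'] by simp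

lemma cop_mono: "cop r F ==> r <= s ==> cop s F"
proof (induction rule: cop.induct)
  case (cop_term c v r)
  then show ?case using words_mono by (intro cop.cop_term) auto
qed (auto intro: cop.cop_add)

lemma cop_bound:
  assumes "cop r F" shows "\<exists>C\<ge>0. \<forall>t. \<forall>x\<in>S2. norm (F t x) <= C * (\<Sum>v\<in>words r. norm (t v x))"
  using assms
proof induction
  case (cop_term c v r)
  obtain B where B: "B > 0" "!!x. x \<in> S2 ==> norm (c x) <= B"
    using continuous_on_S2_bounded[OF hsmooth_continuous_on[OF cop_term(1)]] by metis
  have "norm (c x *R t v x) <= B * (\<Sum>v\<in>words r. norm (t v x))" if "x \<in> S2" for t x
  proof -
    have "norm (c x *R t v x) <= B * norm (t v x)" using B(2)[OF that] by (simp add: mult_right_mono)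
    also have "... <= B * (\<Sum>v\<in>words r. norm (t v x))"
      using B(1) cop_term(2) by (intro mult_left_mono member_le_sum) auto
    finally show ?thesis .
  qed
  then show ?case using B(1) by (intro exI[of _ B]) auto
next
  case (cop_add r F F')
  then obtain C C' where C: "C >= 0" "C' >= 0" "!!t x. x \<in> S2 ==> norm (F t x) <= C * (\<Sum>v\<in>words r. norm (t v x))"
    "!!t x. x \<in> S2 ==> norm (F' t x) <= C' * (\<Sum>v\<in>words r. norm (t v x))" by metis
  have "norm (F t x + F' t x) <= (C + C') * (\<Sum>v\<in>words r. norm (t v x))" if "x \<in> S2" for t x
    using norm_triangle_ineq[of "F t x" "F' t x"] C(3)[OF that, of t] C(4)[OF that, of t] by (simp add: distrib_right)
  then show ?case using C by (intro exI[of _ "C + C'"]) auto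
qed

lemma cop_integrable:
  assumes "cop r F" "!!v. v \<in> words r ==> integrable mu (t v)" shows "integrable mu (F t)"
  using assms by induction (auto intro!: integrable_hsmooth_scaleR)

lemma cop_measurable:
  assumes "cop r F" "!!v. v \<in> words r ==> t v \<in> borel_measurable mu"
  shows "F t \<in> borel_measurable mu"
  using assms
proof induction
  case (cop_term c v r)
  have [measurable]: "c \<in> borel_measurable mu"
    using cop_term by (intro measurable_S2_continuous hsmooth_continuous_on)
  have [measurable]: "t v \<in> borel_measurable mu" using cop_term by auto
  show ?case by measurable
qed auto

text \<open>The jet relation satisfied by the components of covariant derivatives in rotation fields, with connection
  coefficients \<open>\<Gamma>\<close>.\<close>

definition connjet :: "(real^3 => real^3 => real^3 => real^3 => real) => nat =>
    'b::euclidean_space jets => bool" where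
  "connjet \<Gamma> k t \<longleftrightarrow> (\<forall>v\<in>words k. integrable mu (t v)) & (\<forall>a \<alpha>. a # \<alpha> \<in> words k --> weak_rot a (t \<alpha>)
     (%x. t (a # \<alpha>) x + (\<Sum>i<length \<alpha>. \<Sum>c\<in>Basis. \<Gamma> a (\<alpha> ! i) c x *R t (\<alpha>[i := c]) x)))"

lemma connjet_0: "wjet k t ==> connjet (%_ _ _ _. 0) k t"
  by (simp add: connjet_def wjet_def)

text \<open>Stated for \<open>connjet\<close> so that it serves both translations: zero coefficients
  \<open>\<Gamma>\<close> cover ordinary jets, the Christoffel coefficients cover components of
  covariant derivatives.\<close>

lemma cop_step:
  fixes F :: "'b::euclidean_space jets => real^3 => 'b"
  assumes \<Gamma>: "!!a b c. hsmooth (\<Gamma> a b c)" and F: "cop r F" and a: "a \<in> Basis"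
  shows "\<exists>F'. cop (Suc r) F' & (\<forall>k t. connjet \<Gamma> k t & r < k --> weak_rot a (F t) (F' t))"
  using F
proof induction
  case (cop_term c v r)
  define F' where "F' t x = rot a c x *R t v x + c x *R (t (a # v) x +
      (\<Sum>i<length v. \<Sum>b\<in>Basis. \<Gamma> a (v ! i) b x *R t (v[i := b]) x))" for t :: "'b jets" and x
  have "cop (Suc r) F'"
    unfolding F'_def
  proof (intro cop.cop_add cop_mult cop_sum cop_jet finite_lessThan finite_Basis)
    show "v \<in> words (Suc r)" using cop_term words_mono[of r "Suc r"] by auto
    show "a # v \<in> words (Suc r)" using cop_term a by (simp add: words_Cons)
    show "v[i := b] \<in> words (Suc r)" if "b \<in> Basis" for i b
      using cop_term that set_update_subset_insert[of v i b] by (auto simp: words_def)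
  qed (use cop_term \<Gamma> in \<open>auto intro: hsmooth_rot\<close>)
  moreover have "weak_rot a (%x. c x *R t v x) (F' t)" if "connjet \<Gamma> k t" "r < k" for k t
  proof -
    have "a # v \<in> words k" using cop_term that a by (auto simp: words_def)
    then have "weak_rot a (t v) (%x. t (a # v) x + (\<Sum>i<length v. \<Sum>c\<in>Basis. \<Gamma> a (v ! i) c x *R t (v[i := c]) x))"
      using that by (simp add: connjet_def)
    from weak_rot_mult[OF cop_term(1) this] show ?thesis unfolding F'_def .
  qed
  ultimately show ?case by blast
next
  case (cop_add r F1 F2)
  then obtain Q1 Q2 where "cop (Suc r) Q1" "cop (Suc r) Q2"
    "!!k t. connjet \<Gamma> k t ==> r < k ==> weak_rot a (F1 t) (Q1 t)"
    "!!k t. connjet \<Gamma> k t ==> r < k ==> weak_rot a (F2 t) (Q2 t)" by metis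
  then show ?case
    by (intro exI[of _ "%t x. Q1 t x + Q2 t x"]) (auto intro!: cop.cop_add weak_rot_add)
qed

text \<open>The relation is triangular in the order, so the derivative of \<open>t []\<close> along
  a word is a combination of components \<open>t v\<close> with \<open>v\<close> no longer than that
  word. \<open>W\<close> depends on \<open>\<Gamma>\<close> only, not on \<open>t\<close>, which
  makes the resulting bounds uniform.\<close>

lemma cop_family:
  assumes \<Gamma>: "!!a b c. hsmooth (\<Gamma> a b c)"
  shows "\<exists>W :: (real^3) list => 'b::euclidean_space jets => real^3 => 'b.
    W [] = (%t. t []) & (\<forall>w. set w \<subseteq> Basis --> cop (length w) (W w)) \<and>
    (\<forall>k t. connjet \<Gamma> k t --> wjet k (%w. W w t))"
proof -
  define S where "S r a F = (SOME F' :: 'b jets => real^3 => 'b. cop (Suc r) F' \<and>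
    (\<forall>k t. connjet \<Gamma> k t & r < k --> weak_rot a (F t) (F' t)))" for r a F
  have S: "cop (Suc r) (S r a F)" "connjet \<Gamma> k t ==> r < k ==> weak_rot a (F t) (S r a F t)"
    if "cop r F" "a \<in> Basis" for r a F k t
    using someI_ex[OF cop_step[of \<Gamma>, OF \<Gamma> that]] unfolding S_def by blast+
  define W where "W = rec_list (%t. t []) (%a w Pw. S (length w) a Pw)"
  have W: "W [] = (%t. t [])" "W (a # w) = S (length w) a (W w)" for a w by (simp_all add: W_def)
  have c: "cop (length w) (W w)" if "set w \<subseteq> Basis" for w
    using that
  proof (induction w)
    case Nil then show ?case using cop_jet[of "[]" 0] by (simp add: W)
  next
    case (Cons a w) then show ?case using S(1)[of "length w" "W w" a] by (simp add: W)
  qed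
  have "wjet k (%w. W w t)" if t: "connjet \<Gamma> k t" for k t
    unfolding wjet_def
  proof (intro conjI ballI allI impI)
    fix w assume w: "w \<in> words k"
    then have "cop k (W w)" using cop_mono[OF c[of w]] by (auto simp: words_def)
    then show "integrable mu (W w t)" by (rule cop_integrable) (use t in \<open>auto simp: connjet_def\<close>)
  next
    fix a w assume "a # w \<in> words k"
    then show "weak_rot a (W w t) (W (a # w) t)"
      unfolding W using S(2)[OF c[of w] _ t] by (auto simp: words_def)
  qed
  then show ?thesis using W(1) c by blast
qed

section \<open>Covariant derivatives in rotation fields\<close>

context riemannian_S2
begin

text \<open>Christoffel coefficients with respect to the spanning family of rotation fields;
  \<open>sgn\<close> extends them constantly along rays.\<close>

definition chris :: "real^3 => real^3 => real^3 => real^3 => real" where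
  "chris a b c y = vfc (%x. nabla (%x. b >< x) x (a >< x)) c (sgn y)"

lemma hsmooth_chris: "hsmooth (chris a b c)"
  using smooth_vfc[OF nabla_vf[OF vector_field_rot vector_field_rot], of b a c]
  by (simp add: hsmooth_sgn_comp chris_def[abs_def])

lemma nabla_rot_expand:
  assumes "x \<in> S2" shows "nabla (%x. b >< x) x (a >< x) = (\<Sum>c\<in>Basis. chris a b c x *R (c >< x))"
  using vfc_expand[OF nabla_vf[OF vector_field_rot[of a] vector_field_rot[of b]] assms] assms by (simp add: chris_def)

lemma continuous_rho: "continuous_on S2 rho"
  by (rule smooth_on_S2_continuous[OF smooth_rho])

lemma rho_bounds: obtains m M where "m > 0" "!!x. x \<in> S2 ==> m <= rho x" "!!x. x \<in> S2 ==> rho x <= M"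
proof -
  obtain x0 where x0: "x0 \<in> S2" "!!x. x \<in> S2 ==> rho x0 <= rho x"
    using continuous_attains_inf[OF _ _ continuous_rho] axis_in_S2 by (auto simp: compact_sphere)
  obtain B where "!!x. x \<in> S2 ==> norm (rho x) <= B" using continuous_on_S2_bounded[OF continuous_rho] by metis
  then show ?thesis using that[of "rho x0" B] x0 rho_pos by force
qed

lemma measurable_rho [measurable]: "rho \<in> borel_measurable mu"
  by (rule measurable_S2_continuous[OF continuous_rho])

lemma sets_vol [measurable_cong]: "sets (vol g) = sets mu"
  by (simp add: vol_eq_density)

lemma space_vol [simp]: "space (vol g) = S2"
  by (simp add: vol_eq_density)

lemma AE_vol: "(AE x in vol g. P x) \<longleftrightarrow> (AE x in S2_measure. P x)"
proof -
  have "(AE x in vol g. P x) \<longleftrightarrow> (AE x in S2_measure. 0 < ennreal (rho x) --> P x)"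
    unfolding vol_eq_density by (rule AE_density) measurable
  also have "... \<longleftrightarrow> (AE x in S2_measure. P x)" by (rule AE_cong) (use rho_pos in auto)
  finally show ?thesis .
qed

lemma measurable_vol: "f \<in> borel_measurable (vol g) \<longleftrightarrow> f \<in> borel_measurable mu"
  by (simp add: vol_eq_density)

lemma integral_vol:
  fixes f :: "real^3 => 'b::{banach,second_countable_topology}"
  assumes "f \<in> borel_measurable mu"
  shows "integral\<^sup>L (vol g) f = (\<integral>x. rho x *R f x \<partial>mu)"
  unfolding vol_eq_density
  by (rule integral_density) (use assms rho_pos in \<open>auto intro!: AE_I2 less_imp_le\<close>)

lemma integrable_vol:
  fixes f :: "real^3 => 'b::{banach,second_countable_topology}"
  shows "integrable (vol g) f \<longleftrightarrow> integrable mu f"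
proof -
  have 1: "integrable (vol g) f \<longleftrightarrow> integrable mu (%x. rho x *R f x)" if "f \<in> borel_measurable mu"
    unfolding vol_eq_density
    by (rule integrable_density) (use that rho_pos in \<open>auto intro!: AE_I2 less_imp_le\<close>)
  have 2: "integrable mu f" if "integrable mu (%x. rho x *R f x)"
  proof -
    have "continuous_on S2 (%x. inverse (rho x))"
      using rho_pos by (intro continuous_intros continuous_rho) (auto simp: less_imp_neq[THEN not_sym])
    from integrable_S2_mult_continuous[OF this that]
    have "integrable mu (%x. inverse (rho x) *R rho x *R f x)" .
    moreover have "integrable mu (%x. inverse (rho x) *R rho x *R f x) \<longleftrightarrow> integrable mu f"
      by (rule Bochner_Integration.integrable_cong) (use rho_pos in \<open>auto simp: less_imp_neq[THEN not_sym]\<close>)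
    ultimately show ?thesis by simp
  qed
  have 3: "integrable mu (%x. rho x *R f x)" if "integrable mu f"
    using that continuous_rho by (intro integrable_S2_mult_continuous)
  have "f \<in> borel_measurable mu" if "integrable (vol g) f"
    using borel_measurable_integrable[OF that] by (simp add: measurable_vol)
  then show ?thesis using 1 2 3 borel_measurable_integrable by blast
qed

lemma tensor_field_ml: "tensor_field g j T ==> x \<in> S2 ==> multilinear_on (tangent x) j (T x)"
  by (simp add: tensor_field_def)

lemma tensor_field_integrable:
  "tensor_field g j T ==> length Ys = j ==> (!!Y. Y \<in> set Ys ==> vector_field Y) ==>
    integrable mu (%x. T x (map (%Y. Y x) Ys))"
  by (simp add: tensor_field_def integrable_vol)

lemma tensor_field_integrable_rots:
  "tensor_field g j T ==> length \<alpha> = j ==> integrable mu (%x. T x (rots \<alpha> x))"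
  unfolding rots_fields by (rule tensor_field_integrable) (auto intro: vector_field_rot)

text \<open>The integrand of the right hand side of the weak covariant derivative, up to sign.\<close>

definition cov_integrand :: "(real^3 => (real^3) list => 'b::euclidean_space) => (real^3 => real^3) =>
    (real^3 => real^3) list => real^3 => 'b" where
  "cov_integrand T X Ys x = divergence g nabla X x *R T x (map (%Y. Y x) Ys) +
     (\<Sum>i<length Ys. T x ((map (%Y. Y x) Ys)[i := nabla (Ys ! i) x (X x)]))"

text \<open>\<open>rho\<close> times the divergence for \<open>g\<close> is the divergence of
  \<open>rho X\<close> for \<open>mu\<close>. Rotation fields are divergence free for
  \<open>mu\<close>, so only derivatives of the coefficients of \<open>rho X\<close> remain.\<close>

lemma rho_divergence:
  assumes X: "vector_field X" and x: "x \<in> S2"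
  shows "rho x * divergence g nabla X x = (\<Sum>b\<in>Basis. D_S2 (%z. rho z * vfc X b z) x (b >< x))"
proof -
  have Z: "vector_field (%z. \<Sum>b\<in>I. vfc X b z *R (b >< z))" for I
    by (intro vector_field_sum vector_field_scaleR smooth_vfc X vector_field_rot)
  have "rho x * divergence g nabla (%z. \<Sum>b\<in>I. vfc X b z *R (b >< z)) x =
      (\<Sum>b\<in>I. D_S2 (%z. rho z * vfc X b z) x (b >< x))" if "finite I" for I
    using that
  proof (induction I rule: finite_induct)
    case empty
    have "divergence g nabla (%z. 0) x = 0"
      using divergence_scale[OF x vector_field_zero smooth_on_S2_const[of 0]]
      by (simp add: linear_0[OF D_S2_linear[OF smooth_on_S2_const x]])
    then show ?case by simp
  next
    case (insert b I)
    have "divergence g nabla (%z. \<Sum>b\<in>insert b I. vfc X b z *R (b >< z)) x =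
        divergence g nabla (%z. vfc X b z *R (b >< z)) x + divergence g nabla (%z. \<Sum>b\<in>I. vfc X b z *R (b >< z)) x"
      using insert by (simp add: divergence_add[OF x vector_field_scaleR[OF smooth_vfc[OF X] vector_field_rot] Z])
    moreover have "rho x * divergence g nabla (%z. vfc X b z *R (b >< z)) x = D_S2 (%z. rho z * vfc X b z) x (b >< x)"
      unfolding divergence_scale[OF x vector_field_rot smooth_vfc[OF X]] D_S2_mult[OF smooth_rho smooth_vfc[OF X] x]
      using divergence_rot[OF x, of b] by (simp add: algebra_simps)
    ultimately show ?case using insert by (simp add: algebra_simps)
  qed
  from this[OF finite_Basis] show ?thesis
    using divergence_cong[OF x X vfc_expand[OF X]] by simp
qed

lemma rho_divergence_rot:
  assumes u: "smooth_on_S2 u" and x: "x \<in> S2"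
  shows "rho x * divergence g nabla (%z. u z *R (a >< z)) x = D_S2 (%z. rho z * u z) x (a >< x)"
  unfolding divergence_scale[OF x vector_field_rot u] D_S2_mult[OF smooth_rho u x]
  using divergence_rot[OF x, of a] by (simp add: algebra_simps)

text \<open>\<open>divergence\<close> is defined through the chosen frame;
  \<open>rho_divergence\<close> rewrites it as a continuous function on the sphere.\<close>

lemma rho_divergence_integrable:
  fixes f :: "real^3 => 'b::euclidean_space"
  assumes X: "vector_field X" and f: "integrable mu f"
  shows "integrable mu (%x. divergence g nabla X x *R f x)"
proof -
  define d where "d x = inverse (rho x) * (\<Sum>b\<in>Basis. D_S2 (%z. rho z * vfc X b z) x (b >< x))" for x
  have "continuous_on S2 (%x. D_S2 (%z. rho z * vfc X b z) x (b >< x))" for b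
    unfolding D_S2_rot
    using smooth_on_S2_bilinear[OF bounded_bilinear_mult smooth_rho smooth_vfc[OF X]]
    by (intro hsmooth_continuous_on hsmooth_rot) (simp add: hsmooth_sgn_comp)
  then have "continuous_on S2 d"
    unfolding d_def using rho_pos
    by (intro continuous_intros continuous_rho) (auto simp: less_imp_neq[THEN not_sym])
  then have "integrable mu (%x. d x *R f x)" using f by (intro integrable_S2_mult_continuous)
  moreover have "d x = divergence g nabla X x" if "x \<in> S2" for x
    using rho_divergence[OF X that] rho_pos[OF that] by (simp add: d_def field_simps)
  ultimately show ?thesis
    by (subst Bochner_Integration.integrable_cong[OF refl, of _ _ "%x. d x *R f x"]) auto
qed

lemma cov_slot_integrable:
  assumes T: "tensor_field g (length Ys) T" and X: "vector_field X" and Ys: "!!Y. Y \<in> set Ys ==> vector_field Y"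
    and i: "i < length Ys"
  shows "integrable mu (%x. T x ((map (%Y. Y x) Ys)[i := nabla (Ys ! i) x (X x)]))"
proof -
  have "integrable mu (%x. T x (map (%Y. Y x) (Ys[i := (%x. nabla (Ys ! i) x (X x))])))"
    using X Ys i set_update_subset_insert[of Ys i "%x. nabla (Ys ! i) x (X x)"]
    by (intro tensor_field_integrable[OF T]) (auto intro!: nabla_vf)
  then show ?thesis by (simp add: map_update)
qed

lemma weak_covariant_derivative_iff:
  assumes T: "tensor_field g j T" and T': "tensor_field g (Suc j) T'"
  shows "weak_covariant_derivative g nabla j T T' \<longleftrightarrow>
    (\<forall>X Ys. vector_field X & length Ys = j & (\<forall>Y\<in>set Ys. vector_field Y) -->
       (\<integral>x. rho x *R T' x (X x # map (%Y. Y x) Ys) \<partial>mu) =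
      - (\<integral>x. rho x *R cov_integrand T X Ys x \<partial>mu))"
proof -
  have "(integral\<^sup>L (vol g) (%x. T' x (X x # map (%Y. Y x) Ys)) =
        - integral\<^sup>L (vol g) (%x. divergence g nabla X x *R T x (map (%Y. Y x) Ys))
        - (\<Sum>i<j. integral\<^sup>L (vol g) (%x. T x ((map (%Y. Y x) Ys)[i := nabla (Ys ! i) x (X x)])))) \<longleftrightarrow>
      ((\<integral>x. rho x *R T' x (X x # map (%Y. Y x) Ys) \<partial>mu) =
      - (\<integral>x. rho x *R cov_integrand T X Ys x \<partial>mu))"
    if X: "vector_field X" and Ys: "length Ys = j" "\<forall>Y\<in>set Ys. vector_field Y" for X Ys
  proof -
    have i1: "integrable mu (%x. T' x (X x # map (%Y. Y x) Ys))"
      using tensor_field_integrable[OF T', of "X # Ys"] X Ys by auto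
    have i2: "integrable mu (%x. divergence g nabla X x *R T x (map (%Y. Y x) Ys))"
      using tensor_field_integrable[OF T, of Ys] X Ys by (intro rho_divergence_integrable) auto
    have i3: "integrable mu (%x. T x ((map (%Y. Y x) Ys)[i := nabla (Ys ! i) x (X x)]))" if "i < j" for i
      using cov_slot_integrable[of Ys T X i] T X Ys that by auto
    have "(\<integral>x. rho x *R cov_integrand T X Ys x \<partial>mu) =
      integral\<^sup>L (vol g) (%x. divergence g nabla X x *R T x (map (%Y. Y x) Ys))
       + (\<Sum>i<j. integral\<^sup>L (vol g) (%x. T x ((map (%Y. Y x) Ys)[i := nabla (Ys ! i) x (X x)])))"
    proof -
      have "(\<integral>x. rho x *R cov_integrand T X Ys x \<partial>mu) = integral\<^sup>L (vol g) (cov_integrand T X Ys)"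
        unfolding cov_integrand_def[abs_def] using i2 i3 Ys
        by (intro integral_vol[symmetric] borel_measurable_integrable Bochner_Integration.integrable_add
            Bochner_Integration.integrable_sum) auto
      also have "... = integral\<^sup>L (vol g) (%x. divergence g nabla X x *R T x (map (%Y. Y x) Ys))
       + integral\<^sup>L (vol g) (%x. \<Sum>i<j. T x ((map (%Y. Y x) Ys)[i := nabla (Ys ! i) x (X x)]))"
        unfolding cov_integrand_def[abs_def] Ys(1) using i2 i3
        by (intro Bochner_Integration.integral_add Bochner_Integration.integrable_sum) (auto simp: integrable_vol)
      also have "integral\<^sup>L (vol g) (%x. \<Sum>i<j. T x ((map (%Y. Y x) Ys)[i := nabla (Ys ! i) x (X x)])) =
        (\<Sum>i<j. integral\<^sup>L (vol g) (%x. T x ((map (%Y. Y x) Ys)[i := nabla (Ys ! i) x (X x)])))"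
        using i3 by (intro Bochner_Integration.integral_sum) (auto simp: integrable_vol)
      finally show ?thesis .
    qed
    then show ?thesis
      using integral_vol[OF borel_measurable_integrable[OF i1]] by (simp add: algebra_simps)
  qed
  then show ?thesis unfolding weak_covariant_derivative_def by blast
qed

lemma cov_integrand_rots:
  assumes T: "multilinear_on (tangent x) (length \<alpha>) (T x)" and u: "smooth_on_S2 u" and x: "x \<in> S2"
  shows "rho x *R cov_integrand T (%z. u z *R (a >< z)) (map (%a x. a >< x) \<alpha>) x =
    D_S2 (%z. rho z * u z) x (a >< x) *R T x (rots \<alpha> x) +
    (rho x * u x) *R (\<Sum>i<length \<alpha>. \<Sum>c\<in>Basis. chris a (\<alpha> ! i) c x *R T x (rots (\<alpha>[i := c]) x))"
proof -
  have "T x ((rots \<alpha> x)[i := nabla (%x. (\<alpha> ! i) >< x) x (u x *R (a >< x))]) =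
      u x *R (\<Sum>c\<in>Basis. chris a (\<alpha> ! i) c x *R T x (rots (\<alpha>[i := c]) x))" if i: "i < length \<alpha>" for i
  proof -
    have "nabla (%x. (\<alpha> ! i) >< x) x (u x *R (a >< x)) = (\<Sum>c\<in>Basis. (u x * chris a (\<alpha> ! i) c x) *R (c >< x))"
      using nabla_scale[OF vector_field_rot x, of "a >< x" "\<alpha> ! i" "u x"] nabla_rot_expand[OF x]
      by (simp add: scaleR_sum_right)
    then show ?thesis
      using multilinear_on_sum[OF T, of "rots \<alpha> x" i Basis "%c. c >< x" "%c. u x * chris a (\<alpha> ! i) c x"] i rots_tangent
      by (simp add: rots_update scaleR_sum_right)
  qed
  then show ?thesis
    using rho_divergence_rot[OF u x, of a]
    by (simp add: cov_integrand_def rots_comp scaleR_add_right scaleR_sum_right)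
      (simp add: scaleR_scaleR[symmetric] del: scaleR_scaleR)
qed

text \<open>The test function \<open>u\<close> becomes the test field that is \<open>u / rho\<close>
  times the rotation field of \<open>a\<close>. The density cancels, and the divergence term
  reproduces \<open>rot a u\<close>.\<close>

lemma weak_covariant_rots:
  assumes T: "tensor_field g j T" and T': "tensor_field g (Suc j) T'" and w: "weak_covariant_derivative g nabla j T T'"
    and \<alpha>: "length \<alpha> = j"
  shows "weak_rot a (%x. T x (rots \<alpha> x)) (%x. T' x (rots (a # \<alpha>) x) +
     (\<Sum>i<length \<alpha>. \<Sum>c\<in>Basis. chris a (\<alpha> ! i) c x *R T x (rots (\<alpha>[i := c]) x)))"
  unfolding weak_rot_def
proof (intro conjI allI impI)
  let ?C = "%x. (\<Sum>i<length \<alpha>. \<Sum>c\<in>Basis. chris a (\<alpha> ! i) c x *R T x (rots (\<alpha>[i := c]) x))"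
  show i1: "integrable mu (%x. T x (rots \<alpha> x))" using T \<alpha> by (rule tensor_field_integrable_rots)
  have i2: "integrable mu (%x. T' x (rots (a # \<alpha>) x))" using T' \<alpha> by (intro tensor_field_integrable_rots) auto
  have i3: "integrable mu ?C"
    using T \<alpha> by (intro Bochner_Integration.integrable_sum integrable_hsmooth_scaleR hsmooth_chris tensor_field_integrable_rots) auto
  show "integrable mu (%x. T' x (rots (a # \<alpha>) x) + ?C x)" using i2 i3 by auto
  fix u :: "real^3 => real" assume u: "hsmooth u"
  define v where "v x = u x * inverse (rho x)" for x
  have v: "smooth_on_S2 v"
  proof -
    have "smooth_on (- {0}) (%y. inverse (rho (sgn y)))"
      using smooth_rho rho_pos sgn_in_S2 by (intro smooth_on_inverse) (auto simp: smooth_on_S2_def)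
    then show ?thesis
      unfolding v_def using hsmooth_imp_smooth_on_S2[OF u]
      by (intro smooth_on_S2_bilinear[OF bounded_bilinear_mult]) (auto simp: smooth_on_S2_def)
  qed
  have rv: "rho x * v x = u x" if "x \<in> S2" for x using rho_pos[OF that] by (simp add: v_def)
  have Dv: "D_S2 (%z. rho z * v z) x (a >< x) = rot a u x" if x: "x \<in> S2" for x
  proof -
    have "D_S2 (%z. rho z * v z) x (a >< x) = D_S2 u x (a >< x)" by (rule D_S2_cong[OF x rv])
    also have "... = rot a u x" unfolding D_S2_rot using u x by (intro rot_cong) (auto simp: hsmooth_def)
    finally show ?thesis .
  qed
  define X where "X = (%z. v z *R (a >< z))"
  have X: "vector_field X" unfolding X_def by (intro vector_field_scaleR v vector_field_rot)
  have "(\<integral>x. u x *R T' x (rots (a # \<alpha>) x) \<partial>mu) = (\<integral>x. rho x *R T' x (X x # rots \<alpha> x) \<partial>mu)"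
  proof (rule Bochner_Integration.integral_cong[OF refl])
    fix x assume "x \<in> space mu"
    then have x: "x \<in> S2" by simp
    have "T' x (((a >< x) # rots \<alpha> x)[0 := v x *R (a >< x)]) = v x *R T' x (((a >< x) # rots \<alpha> x)[0 := a >< x])"
      using \<alpha> rots_tangent by (intro multilinear_on_slot(2)[OF tensor_field_ml[OF T' x]]) auto
    then show "u x *R T' x (rots (a # \<alpha>) x) = rho x *R T' x (X x # rots \<alpha> x)"
      using rv[OF x] by (simp add: X_def)
  qed
  also have "... = - (\<integral>x. rho x *R cov_integrand T X (map (%a x. a >< x) \<alpha>) x \<partial>mu)"
    unfolding rots_fields
    by (rule w[unfolded weak_covariant_derivative_iff[OF T T'], rule_format]) (use X \<alpha> vector_field_rot in auto)
  also have "(\<integral>x. rho x *R cov_integrand T X (map (%a x. a >< x) \<alpha>) x \<partial>mu) =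
      (\<integral>x. rot a u x *R T x (rots \<alpha> x) + u x *R ?C x \<partial>mu)"
  proof (rule Bochner_Integration.integral_cong[OF refl])
    fix x assume "x \<in> space mu"
    then have x: "x \<in> S2" by simp
    show "rho x *R cov_integrand T X (map (%a x. a >< x) \<alpha>) x = rot a u x *R T x (rots \<alpha> x) + u x *R ?C x"
      unfolding X_def using cov_integrand_rots[of x \<alpha> T v a] tensor_field_ml[OF T x] \<alpha> v x by (simp add: rv Dv)
  qed
  also have "... = (\<integral>x. rot a u x *R T x (rots \<alpha> x) \<partial>mu) + (\<integral>x. u x *R ?C x \<partial>mu)"
    using i1 i3 u by (intro Bochner_Integration.integral_add integrable_hsmooth_scaleR hsmooth_rot)
  finally show "(\<integral>x. u x *R (T' x (rots (a # \<alpha>) x) + ?C x) \<partial>mu) = - (\<integral>x. rot a u x *R T x (rots \<alpha> x) \<partial>mu)"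
    using i2 i3 u by (simp add: scaleR_add_right integrable_hsmooth_scaleR)
qed

end

context riemannian_S2
begin

section \<open>Tensor fields from jets\<close>

lemma nabla_sum_direction:
  assumes Y: "vector_field Y" and x: "x \<in> S2" and v: "!!b. b \<in> I ==> v b \<in> tangent x"
  shows "nabla Y x (\<Sum>b\<in>I. v b) = (\<Sum>b\<in>I. nabla Y x (v b))"
  using v
proof (induction I rule: infinite_finite_induct)
  case (insert b I)
  then show ?case by (simp add: nabla_plus[OF Y x] tangent_sum)
qed (use nabla_scale[OF Y x tangent_zero, of 0] in simp_all)

lemma vector_field_lincomb:
  "(!!b. b \<in> I ==> smooth_on_S2 (f b)) ==> (!!b. b \<in> I ==> vector_field (Y b)) ==> vector_field (%z. \<Sum>b\<in>I. f b z *R Y b z)"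
  by (intro vector_field_sum vector_field_scaleR)

lemma nabla_lincomb:
  assumes f: "!!b. b \<in> I ==> smooth_on_S2 (f b)" and Y: "!!b. b \<in> I ==> vector_field (Y b)"
    and x: "x \<in> S2" and v: "v \<in> tangent x"
  shows "nabla (%z. \<Sum>b\<in>I. f b z *R Y b z) x v = (\<Sum>b\<in>I. D_S2 (f b) x v *R Y b x) + (\<Sum>b\<in>I. f b x *R nabla (Y b) x v)"
  using f Y
proof (induction I rule: infinite_finite_induct)
  case (insert b I)
  then have "nabla (%z. f b z *R Y b z + (\<Sum>b\<in>I. f b z *R Y b z)) x v =
     nabla (%z. f b z *R Y b z) x v + nabla (%z. \<Sum>b\<in>I. f b z *R Y b z) x v"
    by (intro nabla_add x v vector_field_lincomb vector_field_scaleR) auto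
  then show ?case using insert x v by (simp add: nabla_leibniz)
qed (use nabla_vanish[of "%_. 0" x v] x v in simp_all)

lemma divergence_sum:
  assumes X: "!!b. b \<in> I ==> vector_field (F b)" and x: "x \<in> S2"
  shows "divergence g nabla (%z. \<Sum>b\<in>I. F b z) x = (\<Sum>b\<in>I. divergence g nabla (F b) x)"
  using X
proof (induction I rule: infinite_finite_induct)
  case (insert b I)
  then show ?case by (simp add: divergence_add[OF x] vector_field_sum)
next
  case empty
  have "divergence g nabla (%z. 0) x = 0"
    using divergence_scale[OF x vector_field_zero smooth_on_S2_const[of 0]]
    by (simp add: linear_0[OF D_S2_linear[OF smooth_on_S2_const x]])
  then show ?case by simp
next
  case (infinite A)
  have "divergence g nabla (%z. 0) x = 0"
    using divergence_scale[OF x vector_field_zero smooth_on_S2_const[of 0]]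
    by (simp add: linear_0[OF D_S2_linear[OF smooth_on_S2_const x]])
  then show ?case using infinite by simp
qed

lemma cov_integrand_sum:
  assumes T: "multilinear_on (tangent x) (length Ys) (T x)" and x: "x \<in> S2"
    and Ys: "!!Y. Y \<in> set Ys ==> vector_field Y" and F: "!!b. b \<in> I ==> vector_field (F b)"
  shows "cov_integrand T (%z. \<Sum>b\<in>I. F b z) Ys x = (\<Sum>b\<in>I. cov_integrand T (F b) Ys x)"
proof -
  have hs: "set (map (%Y. Y x) Ys) \<subseteq> tangent x" using Ys x by (auto intro: vector_field_tangent)
  have Ft: "b \<in> I ==> F b x \<in> tangent x" for b using F x by (auto intro: vector_field_tangent)
  have "T x ((map (%Y. Y x) Ys)[i := nabla (Ys ! i) x (\<Sum>b\<in>I. F b x)]) =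
      (\<Sum>b\<in>I. T x ((map (%Y. Y x) Ys)[i := nabla (Ys ! i) x (F b x)]))" if i: "i < length Ys" for i
  proof -
    have Yi: "vector_field (Ys ! i)" using Ys i by simp
    show ?thesis
      using multilinear_on_sum[OF T _ hs i, of I "%b. nabla (Ys ! i) x (F b x)" "%_. 1"] i
      by (simp add: nabla_sum_direction[OF Yi x] Ft nabla_tangent[OF Yi x])
  qed
  then have "(\<Sum>i<length Ys. T x ((map (%Y. Y x) Ys)[i := nabla (Ys ! i) x (\<Sum>b\<in>I. F b x)])) =
      (\<Sum>b\<in>I. \<Sum>i<length Ys. T x ((map (%Y. Y x) Ys)[i := nabla (Ys ! i) x (F b x)]))"
    by (subst sum.swap) simp
  then show ?thesis
    by (simp add: cov_integrand_def divergence_sum[OF F x] scaleR_sum_left sum.distrib)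
qed

lemma cov_integrand_cong:
  assumes x: "x \<in> S2" and X: "vector_field X" "!!x. x \<in> S2 ==> X x = X' x"
    and Ys: "!!Y. Y \<in> set Ys ==> vector_field Y" "length Ys' = length Ys"
    "!!i x. i < length Ys ==> x \<in> S2 ==> (Ys ! i) x = (Ys' ! i) x"
  shows "cov_integrand T X Ys x = cov_integrand T X' Ys' x"
proof -
  have m: "map (%Y. Y x) Ys = map (%Y. Y x) Ys'" using Ys x by (intro nth_equalityI) auto
  have n: "nabla (Ys ! i) x (X x) = nabla (Ys' ! i) x (X' x)" if "i < length Ys" for i
    using nabla_cong[of "Ys ! i" "Ys' ! i" x "X x"] Ys(1,3) that X x vector_field_tangent[OF X(1) x] by auto
  have d: "divergence g nabla X x = divergence g nabla X' x" by (rule divergence_cong[OF x X])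
  show ?thesis
    unfolding cov_integrand_def m d using Ys(2) n by (auto intro!: sum.cong)
qed

text \<open>Together with additivity in \<open>X\<close>, this says that the integrand is linear over smooth functions: the
  derivative of a factor moved from an argument to \<open>X\<close> reappears in the divergence.\<close>

lemma cov_integrand_slot:
  assumes T: "multilinear_on (tangent x) (length Ys) (T x)" and x: "x \<in> S2" and X: "vector_field X"
    and Ys: "!!Y. Y \<in> set Ys ==> vector_field Y" and m: "m < length Ys"
    and f: "!!b. b \<in> I ==> smooth_on_S2 (f b)" and Y: "!!b. b \<in> I ==> vector_field (Y b)"
  shows "cov_integrand T X (Ys[m := (%z. \<Sum>b\<in>I. f b z *R Y b z)]) x =
    (\<Sum>b\<in>I. cov_integrand T (%z. f b z *R X z) (Ys[m := Y b]) x)"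
proof -
  define W where "W = (%z. \<Sum>b\<in>I. f b z *R Y b z)"
  define hs where "hs = map (%Y. Y x) Ys"
  have lh: "length hs = length Ys" and hs: "set hs \<subseteq> tangent x"
    using Ys x by (auto simp: hs_def intro: vector_field_tangent)
  have Xt: "X x \<in> tangent x" using X x by (rule vector_field_tangent)
  have Yt: "b \<in> I ==> Y b x \<in> tangent x" for b using Y x by (auto intro: vector_field_tangent)
  have nY: "b \<in> I ==> nabla (Y b) x (X x) \<in> tangent x" for b using Y x Xt by (auto intro: nabla_tangent)
  define z where "z i = nabla (Ys ! i) x (X x)" for i
  have zt: "i < length Ys ==> z i \<in> tangent x" for i using Ys x Xt by (auto simp: z_def intro: nabla_tangent)
  have upd: "set (hs[i := v]) \<subseteq> tangent x" if "v \<in> tangent x" for i v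
    using hs that set_update_subset_insert[of hs i v] by auto
  have ev: "map (%Y. Y x) (Ys[m := V]) = hs[m := V x]" for V :: "real^3 => real^3" by (simp add: hs_def map_update)
  have A: "T x (hs[m := W x]) = (\<Sum>b\<in>I. f b x *R T x (hs[m := Y b x]))"
    unfolding W_def by (rule multilinear_on_sum[OF T lh hs m Yt])
  have B: "T x (hs[m := W x, i := z i]) = (\<Sum>b\<in>I. f b x *R T x (hs[m := Y b x, i := z i]))" if i: "i < length Ys" "i ~= m" for i
  proof -
    have "T x (hs[i := z i, m := W x]) = (\<Sum>b\<in>I. f b x *R T x (hs[i := z i, m := Y b x]))"
      unfolding W_def using lh by (intro multilinear_on_sum[OF T _ upd[OF zt[OF i(1)]] m Yt]) auto
    then show ?thesis using i by (simp add: list_update_swap)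
  qed
  have C: "T x (hs[m := nabla W x (X x)]) = (\<Sum>b\<in>I. D_S2 (f b) x (X x) *R T x (hs[m := Y b x])) +
      (\<Sum>b\<in>I. f b x *R T x (hs[m := nabla (Y b) x (X x)]))"
  proof -
    have "nabla W x (X x) = (\<Sum>b\<in>I. D_S2 (f b) x (X x) *R Y b x) + (\<Sum>b\<in>I. f b x *R nabla (Y b) x (X x))"
      unfolding W_def by (rule nabla_lincomb[OF f Y x Xt])
    then have "T x (hs[m := nabla W x (X x)]) = T x (hs[m := (\<Sum>b\<in>I. D_S2 (f b) x (X x) *R Y b x)]) +
       T x (hs[m := (\<Sum>b\<in>I. f b x *R nabla (Y b) x (X x))])"
      using Yt nY by (simp add: multilinear_on_slot(3)[OF T lh hs m] tangent_sum tangent_scaleR)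
    then show ?thesis using multilinear_on_sum[OF T lh hs m, of I "%b. Y b x" "%b. D_S2 (f b) x (X x)"]
        multilinear_on_sum[OF T lh hs m, of I "%b. nabla (Y b) x (X x)" "%b. f b x"] Yt nY by simp
  qed
  have R: "cov_integrand T (%z. f b z *R X z) (Ys[m := Y b]) x =
     f b x *R (divergence g nabla X x *R T x (hs[m := Y b x])) + D_S2 (f b) x (X x) *R T x (hs[m := Y b x]) +
     f b x *R T x (hs[m := nabla (Y b) x (X x)]) + (\<Sum>i\<in>{..<length Ys}-{m}. f b x *R T x (hs[m := Y b x, i := z i]))"
    if b: "b \<in> I" for b
  proof -
    have s: "T x (hs[m := Y b x, i := nabla ((Ys[m := Y b]) ! i) x (f b x *R X x)]) =
       f b x *R T x (hs[m := Y b x, i := nabla ((Ys[m := Y b]) ! i) x (X x)])" if i: "i < length Ys" for i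
    proof -
      have Yi: "vector_field ((Ys[m := Y b]) ! i)" using Ys Y[OF b] i m by (cases "i = m") auto
      show ?thesis
        unfolding nabla_scale[OF Yi x Xt]
        using lh i by (intro multilinear_on_slot(2)[OF T _ upd[OF Yt[OF b]] i] nabla_tangent[OF Yi x Xt]) auto
    qed
    have "cov_integrand T (%z. f b z *R X z) (Ys[m := Y b]) x =
      (f b x * divergence g nabla X x + D_S2 (f b) x (X x)) *R T x (hs[m := Y b x]) +
      (\<Sum>i<length Ys. f b x *R T x (hs[m := Y b x, i := nabla ((Ys[m := Y b]) ! i) x (X x)]))"
      unfolding cov_integrand_def ev divergence_scale[OF x X f[OF b]] using s by simp
    also have "(\<Sum>i<length Ys. f b x *R T x (hs[m := Y b x, i := nabla ((Ys[m := Y b]) ! i) x (X x)])) =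
       f b x *R T x (hs[m := nabla (Y b) x (X x)]) + (\<Sum>i\<in>{..<length Ys}-{m}. f b x *R T x (hs[m := Y b x, i := z i]))"
      using m by (subst sum.remove[of _ m]) (auto simp: z_def intro!: sum.cong)
    finally show ?thesis by (simp add: scaleR_add_left algebra_simps)
  qed
  have "cov_integrand T X (Ys[m := W]) x = divergence g nabla X x *R T x (hs[m := W x]) +
      (T x (hs[m := nabla W x (X x)]) + (\<Sum>i\<in>{..<length Ys}-{m}. T x (hs[m := W x, i := z i])))"
    unfolding cov_integrand_def ev
    using m by (subst sum.remove[of _ m]) (auto simp: z_def intro!: sum.cong)
  also have "(\<Sum>i\<in>{..<length Ys}-{m}. T x (hs[m := W x, i := z i])) =
     (\<Sum>b\<in>I. \<Sum>i\<in>{..<length Ys}-{m}. f b x *R T x (hs[m := Y b x, i := z i]))"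
    by (subst sum.swap) (auto intro!: sum.cong B)
  finally show ?thesis
    unfolding W_def[symmetric] A C by (simp add: R sum.distrib scaleR_sum_right mult.commute)
qed

text \<open>Arguments are replaced one at a time by rotation fields, their coefficients moving to
  \<open>X\<close> by \<open>cov_integrand_slot\<close>. Thus a weak covariant derivative has to be
  verified on rotation fields only.\<close>

lemma cov_integrand_expand:
  assumes T: "multilinear_on (tangent x) (length \<alpha> + length Ys) (T x)" and x: "x \<in> S2"
    and X: "vector_field X" and Ys: "!!Y. Y \<in> set Ys ==> vector_field Y"
  shows "cov_integrand T X (map (><) \<alpha> @ Ys) x = (\<Sum>\<beta>\<in>lists_of Basis (length Ys).
     cov_integrand T (%z. weight z \<beta> (map (%Y. Y z) Ys) *R X z) (map (><) (\<alpha> @ \<beta>)) x)"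
  using T X Ys
proof (induction Ys arbitrary: \<alpha> X)
  case (Cons Y Ys)
  have Y: "vector_field Y" and Ys: "!!Z. Z \<in> set Ys ==> vector_field Z" using Cons.prems by auto
  have rot_in: "vector_field Z" if "Z \<in> set (map (><) \<alpha>)" for Z
    using that vector_field_rot by auto
  define L where "L = map (><) \<alpha> @ Y # Ys"
  have L: "L[length \<alpha> := V] = map (><) \<alpha> @ V # Ys" for V
    using list_update_length[of "map (><) \<alpha>" Y Ys V] by (simp add: L_def)
  have W: "vector_field (%z. \<Sum>b\<in>Basis. vfc Y b z *R (b >< z))"
    by (intro vector_field_lincomb smooth_vfc Y vector_field_rot)
  have "cov_integrand T X (map (><) \<alpha> @ Y # Ys) x =
      cov_integrand T X (L[length \<alpha> := (%z. \<Sum>b\<in>Basis. vfc Y b z *R (b >< z))]) x"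
  proof (rule cov_integrand_cong[OF x Cons.prems(2) refl])
    show "((map (><) \<alpha> @ Y # Ys) ! i) z = (L[length \<alpha> := (%z. \<Sum>b\<in>Basis. vfc Y b z *R (b >< z))] ! i) z"
      if "i < length (map (><) \<alpha> @ Y # Ys)" "z \<in> S2" for i z
      using that vfc_expand[OF Y that(2)] by (cases "i = length \<alpha>") (auto simp: L_def nth_append)
  qed (use rot_in Cons.prems in \<open>auto simp: L_def\<close>)
  also have "... = (\<Sum>b\<in>Basis. cov_integrand T (%z. vfc Y b z *R X z) (L[length \<alpha> := (%z. b >< z)]) x)"
    using Cons.prems rot_in
    by (intro cov_integrand_slot x smooth_vfc vector_field_rot) (auto simp: L_def)
  also have "... = (\<Sum>b\<in>Basis. \<Sum>\<beta>\<in>lists_of Basis (length Ys).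
     cov_integrand T (%z. weight z (b # \<beta>) (map (%Y. Y z) (Y # Ys)) *R X z) (map (><) (\<alpha> @ b # \<beta>)) x)"
  proof (rule sum.cong[OF refl])
    fix b :: "real^3"
    have "cov_integrand T (%z. vfc Y b z *R X z) (map (><) (\<alpha> @ [b]) @ Ys) x =
      (\<Sum>\<beta>\<in>lists_of Basis (length Ys). cov_integrand T (%z. weight z \<beta> (map (%Y. Y z) Ys) *R vfc Y b z *R X z)
         (map (><) ((\<alpha> @ [b]) @ \<beta>)) x)"
      using Cons.prems by (intro Cons.IH vector_field_scaleR smooth_vfc Y) auto
    then show "cov_integrand T (%z. vfc Y b z *R X z) (L[length \<alpha> := (%z. b >< z)]) x =
      (\<Sum>\<beta>\<in>lists_of Basis (length Ys). cov_integrand T (%z. weight z (b # \<beta>) (map (%Y. Y z) (Y # Ys)) *R X z)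
         (map (><) (\<alpha> @ b # \<beta>)) x)"
      by (simp add: L vfc_def mult.commute)
  qed
  finally show ?case by (simp add: sum_lists_of_Suc)
qed simp

text \<open>A rotation derivative of \<open>F\<close> fixed once for all jets and all orders; the
  choice must not depend on \<open>t\<close>, since the coefficients built from it are again
  operators on jets.\<close>

definition tstep :: "nat => real^3 => ('b::euclidean_space jets => real^3 => 'b) =>
    'b jets => real^3 => 'b" where
  "tstep r a F = (SOME F'. cop (Suc r) F' & (\<forall>k t. wjet k t & r < k --> weak_rot a (F t) (F' t)))"

lemma tstep:
  assumes "cop r F" "a \<in> Basis"
  shows "cop (Suc r) (tstep r a F)" "wjet k t ==> r < k ==> weak_rot a (F t) (tstep r a F t)"
proof -
  have "\<exists>F'. cop (Suc r) F' & (\<forall>k t. wjet k t & r < k --> weak_rot a (F t) (F' t))"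
    using cop_step[of "%_ _ _ _. 0", OF hsmooth_const assms] connjet_0 by blast
  from someI_ex[OF this] show "cop (Suc r) (tstep r a F)"
    "wjet k t ==> r < k ==> weak_rot a (F t) (tstep r a F t)" unfolding tstep_def by blast+
qed

text \<open>Rotation fields are linearly dependent, so freely chosen coefficients \<open>S\<close>
  need not be the values of a tensor on them. Summing with the weights gives the values of the
  tensor that has \<open>S\<close> as coefficients.\<close>

definition tcomp :: "nat => ((real^3) list => 'b::euclidean_space jets => real^3 => 'b) =>
    (real^3) list => 'b jets => real^3 => 'b" where
  "tcomp j S \<alpha> J x = (\<Sum>\<beta>\<in>lists_of Basis j. weight (sgn x) \<beta> (rots \<alpha> (sgn x)) *R S \<beta> J x)"

text \<open>Chosen so that the components \<open>tcomp j (tcoef j) \<alpha>\<close> of \<open>jtensor\<close> satisfy the relation \<open>connjet chris\<close>.\<close>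

primrec tcoef :: "nat => (real^3) list => 'b::euclidean_space jets => real^3 => 'b" where
  "tcoef 0 = (%\<alpha> J. J [])"
| "tcoef (Suc j) = (%\<alpha> J x. tstep j (hd \<alpha>) (tcomp j (tcoef j) (tl \<alpha>)) J x -
     (\<Sum>i<j. \<Sum>c\<in>Basis. chris (hd \<alpha>) (tl \<alpha> ! i) c x *R tcomp j (tcoef j) ((tl \<alpha>)[i := c]) J x))"

lemma cop_tcomp:
  assumes S: "!!\<beta>. \<beta> \<in> lists_of Basis j ==> cop r (S \<beta>)" and "length \<alpha> = j" shows "cop r (tcomp j S \<alpha>)"
  unfolding tcomp_def
proof (intro cop_sum finite_lists_of finite_Basis cop_mult S)
  fix \<beta> :: "(real^3) list" assume "\<beta> \<in> lists_of Basis j"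
  then show "hsmooth (%x. weight (sgn x) \<beta> (rots \<alpha> (sgn x)))"
    using smooth_weight_rots[of \<alpha> \<beta>] assms by (simp add: hsmooth_sgn_comp lists_of_def)
qed

lemma cop_tcoef: "\<alpha> \<in> lists_of Basis j ==>
  cop j (tcoef j \<alpha> :: 'b::euclidean_space jets => real^3 => 'b)"
proof (induction j arbitrary: \<alpha>)
  case 0
  show ?case using cop_jet[of "[]" 0] by simp
next
  case (Suc j)
  obtain a \<alpha>' where \<alpha>: "\<alpha> = a # \<alpha>'" "a \<in> Basis" "\<alpha>' \<in> lists_of Basis j" using lists_of_SucE[OF Suc.prems] by blast
  have c: "cop j (tcomp j (tcoef j) \<gamma> :: 'b jets => real^3 => 'b)" if "length \<gamma> = j" for \<gamma> by (rule cop_tcomp[OF _ that]) (rule Suc.IH)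
  have l: "length \<alpha>' = j" using \<alpha> by (simp add: lists_of_def)
  show ?case
    unfolding tcoef.simps \<alpha>(1) list.sel
    by (intro cop_diff tstep(1) c cop_sum cop_mult hsmooth_chris cop_mono[OF c] l) (use l \<alpha> in auto)
qed

definition jtensor :: "'b::euclidean_space jets => nat => real^3 => (real^3) list => 'b" where
  "jtensor J j x vs = (\<Sum>\<beta>\<in>lists_of Basis j. weight x \<beta> vs *R tcoef j \<beta> J x)"

lemma jtensor_ml: "multilinear_on (tangent x) j (jtensor J j x)"
  unfolding multilinear_on_def
proof (intro allI impI)
  fix hs i u v a b assume H: "length hs = j & set hs \<subseteq> tangent x & i < j & u \<in> tangent x & v \<in> tangent x"
  have "weight x \<beta> (hs[i := a *R u + b *R v]) = a * weight x \<beta> (hs[i := u]) + b * weight x \<beta> (hs[i := v])"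
    if "\<beta> \<in> lists_of Basis j" for \<beta> using that H by (intro weight_update_linear) (auto simp: lists_of_def)
  then show "jtensor J j x (hs[i := a *R u + b *R v]) = a *R jtensor J j x (hs[i := u]) + b *R jtensor J j x (hs[i := v])"
    unfolding jtensor_def scaleR_sum_right sum.distrib[symmetric] by (intro sum.cong refl) (simp add: scaleR_add_left)
qed

lemma jtensor_rots: "x \<in> S2 ==> jtensor J j x (rots \<alpha> x) = tcomp j (tcoef j) \<alpha> J x"
  by (simp add: jtensor_def tcomp_def)

lemma integrable_smooth_scaleR:
  fixes f :: "real^3 => 'b::euclidean_space"
  shows "smooth_on_S2 c ==> integrable mu f ==> integrable mu (%x. c x *R f x)"
  by (intro integrable_S2_mult_continuous smooth_on_S2_continuous)

lemma tcoef_integrable: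
  assumes "wjet k J" "j <= k" "\<alpha> \<in> lists_of Basis j" shows "integrable mu (tcoef j \<alpha> J)"
  by (rule cop_integrable[OF cop_mono[OF cop_tcoef[OF assms(3)] assms(2)]]) (use assms(1) in \<open>auto simp: wjet_def\<close>)

lemma jtensor_field:
  assumes J: "wjet k J" and j: "j <= k" shows "tensor_field g j (jtensor J j)"
  unfolding tensor_field_def integrable_vol
proof (intro conjI ballI allI impI)
  fix Ys :: "(real^3 => real^3) list" assume "length Ys = j & (\<forall>Y\<in>set Ys. vector_field Y)"
  then show "integrable mu (%x. jtensor J j x (map (%Y. Y x) Ys))"
    unfolding jtensor_def
    by (intro Bochner_Integration.integrable_sum integrable_smooth_scaleR smooth_weight tcoef_integrable[OF J j])
      (auto simp: lists_of_def)
qed (rule jtensor_ml)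

lemma tcoef_weak:
  assumes J: "wjet k J" and j: "j < k" and a: "a \<in> Basis" and \<alpha>: "\<alpha> \<in> lists_of Basis j"
  shows "weak_rot a (tcomp j (tcoef j) \<alpha> J) (%x. tcoef (Suc j) (a # \<alpha>) J x +
     (\<Sum>i<length \<alpha>. \<Sum>c\<in>Basis. chris a (\<alpha> ! i) c x *R tcomp j (tcoef j) (\<alpha>[i := c]) J x))"
proof -
  have l: "length \<alpha> = j" using \<alpha> by (simp add: lists_of_def)
  have "cop j (tcomp j (tcoef j) \<alpha> :: ((real^3) list => real^3 => 'a) => real^3 => 'a)" by (rule cop_tcomp[OF _ l]) (rule cop_tcoef)
  from tstep(2)[OF this a J j] show ?thesis by (simp add: l)
qed

text \<open>After expansion of \<open>X\<close> and \<open>Ys\<close> in rotation fields the claim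
  is, term by term, the relation \<open>tcoef_weak\<close> for which \<open>tcoef\<close> was
  defined.\<close>

lemma jtensor_weak_cov:
  fixes J :: "(real^3) list => real^3 => 'b::euclidean_space"
  assumes J: "wjet k J" and j: "j < k"
  shows "weak_covariant_derivative g nabla j (jtensor J j) (jtensor J (Suc j))"
proof -
  have tf: "tensor_field g j (jtensor J j)" "tensor_field g (Suc j) (jtensor J (Suc j))"
    using jtensor_field[OF J] j by auto
  show ?thesis
    unfolding weak_covariant_derivative_iff[OF tf]
  proof (intro allI impI)
    fix X and Ys :: "(real^3 => real^3) list"
    assume H: "vector_field X & length Ys = j & (\<forall>Y\<in>set Ys. vector_field Y)"
    then have X: "vector_field X" and Ys: "length Ys = j" "!!Y. Y \<in> set Ys ==> vector_field Y" by auto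
    define u where "u a \<beta> z = weight z \<beta> (map (%Y. Y z) Ys) * vfc X a z" for a \<beta> z
    have u: "smooth_on_S2 (u a \<beta>)" if "\<beta> \<in> lists_of Basis j" for a \<beta>
      unfolding u_def using that Ys X
      by (intro smooth_on_S2_bilinear[OF bounded_bilinear_mult] smooth_weight smooth_vfc) (auto simp: lists_of_def)
    have ru: "smooth_on_S2 (%z. rho z * u a \<beta> z)" if "\<beta> \<in> lists_of Basis j" for a \<beta>
      by (intro smooth_on_S2_bilinear[OF bounded_bilinear_mult] smooth_rho u that)
    define I where "I a \<beta> x = cov_integrand (jtensor J j) (%z. u a \<beta> z *R (a >< z)) (map (><) \<beta>) x" for a \<beta> x
    let ?C = "%a \<beta> x. (\<Sum>i<length \<beta>. \<Sum>c\<in>Basis. chris a (\<beta> ! i) c x *R tcomp j (tcoef j) (\<beta>[i := c]) J x)"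
    have itc: "integrable mu (tcomp j (tcoef j) \<beta> J)" if "length \<beta> = j" for \<beta>
      proof -
      have "cop j (tcomp j (tcoef j) \<beta> :: 'b jets => real^3 => 'b)"
        by (rule cop_tcomp[OF _ that]) (rule cop_tcoef)
      from cop_integrable[OF cop_mono[OF this less_imp_le[OF j]], of J] J show ?thesis by (auto simp: wjet_def)
    qed
    have iC: "integrable mu (?C a \<beta>)" if "\<beta> \<in> lists_of Basis j" for a \<beta>
      using that by (intro Bochner_Integration.integrable_sum integrable_hsmooth_scaleR hsmooth_chris itc) (auto simp: lists_of_def)
    have its: "integrable mu (tcoef (Suc j) (a # \<beta>) J)" if "a \<in> Basis" "\<beta> \<in> lists_of Basis j" for a \<beta>
      using that j by (intro tcoef_integrable[OF J]) auto
    have rI: "rho x *R I a \<beta> x = rot a (%y. rho (sgn y) * u a \<beta> (sgn y)) x *R tcomp j (tcoef j) \<beta> J x +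
        (rho (sgn x) * u a \<beta> (sgn x)) *R ?C a \<beta> x" if b: "\<beta> \<in> lists_of Basis j" and x: "x \<in> S2" for a \<beta> x
    proof -
      have "length \<beta> = j" using b by (simp add: lists_of_def)
      then have ml: "multilinear_on (tangent x) (length \<beta>) (jtensor J j x)" using jtensor_ml by simp
      show ?thesis
        unfolding I_def using cov_integrand_rots[where T="jtensor J j" and x=x, OF ml u[OF b, of a] x, of a] x
        by (simp add: D_S2_rot jtensor_rots)
    qed
    have irI: "integrable mu (%x. rho x *R I a \<beta> x)" if b: "\<beta> \<in> lists_of Basis j" for a \<beta>
    proof -
      have "integrable mu (%x. rot a (%y. rho (sgn y) * u a \<beta> (sgn y)) x *R tcomp j (tcoef j) \<beta> J x +
        (rho (sgn x) * u a \<beta> (sgn x)) *R ?C a \<beta> x)"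
        using ru[OF b, of a] itc iC[OF b] b
        by (intro Bochner_Integration.integrable_add integrable_hsmooth_scaleR hsmooth_rot)
          (auto simp: hsmooth_sgn_comp lists_of_def)
      then show ?thesis using rI[OF b] by (subst Bochner_Integration.integrable_cong[OF refl]) auto
    qed
    \<comment> \<open>\<open>tcoef_weak\<close> tested with \<open>rho * u\<close>: its connection
      terms pass to the other side and complete the integrand \<open>I\<close>.\<close>
    have key: "(\<integral>x. (rho x * u a \<beta> x) *R tcoef (Suc j) (a # \<beta>) J x \<partial>mu) = - (\<integral>x. rho x *R I a \<beta> x \<partial>mu)"
      if a: "a \<in> Basis" and b: "\<beta> \<in> lists_of Basis j" for a \<beta>
    proof -
      let ?c = "%y. rho (sgn y) * u a \<beta> (sgn y)"
      have c: "hsmooth ?c" using ru[OF b] by (simp add: hsmooth_sgn_comp)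
      have lb: "length \<beta> = j" using b by (simp add: lists_of_def)
      have "(\<integral>x. ?c x *R (tcoef (Suc j) (a # \<beta>) J x + ?C a \<beta> x) \<partial>mu) =
         - (\<integral>x. rot a ?c x *R tcomp j (tcoef j) \<beta> J x \<partial>mu)"
        using tcoef_weak[OF J j a b] c unfolding weak_rot_def by blast
      moreover have "(\<integral>x. ?c x *R (tcoef (Suc j) (a # \<beta>) J x + ?C a \<beta> x) \<partial>mu) =
         (\<integral>x. ?c x *R tcoef (Suc j) (a # \<beta>) J x \<partial>mu) + (\<integral>x. ?c x *R ?C a \<beta> x \<partial>mu)"
        unfolding scaleR_add_right using its[OF a b] iC[OF b] c
        by (intro Bochner_Integration.integral_add integrable_hsmooth_scaleR)
      moreover have "(\<integral>x. rho x *R I a \<beta> x \<partial>mu) =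
         (\<integral>x. rot a ?c x *R tcomp j (tcoef j) \<beta> J x + ?c x *R ?C a \<beta> x \<partial>mu)"
        by (rule Bochner_Integration.integral_cong) (auto simp: rI[OF b])
      moreover have "... = (\<integral>x. rot a ?c x *R tcomp j (tcoef j) \<beta> J x \<partial>mu) + (\<integral>x. ?c x *R ?C a \<beta> x \<partial>mu)"
        using itc[OF lb] iC[OF b] c by (intro Bochner_Integration.integral_add integrable_hsmooth_scaleR hsmooth_rot)
      moreover have "(\<integral>x. ?c x *R tcoef (Suc j) (a # \<beta>) J x \<partial>mu) = (\<integral>x. (rho x * u a \<beta> x) *R tcoef (Suc j) (a # \<beta>) J x \<partial>mu)"
        by (rule Bochner_Integration.integral_cong) auto
      ultimately show ?thesis by (simp add: algebra_simps)
    qed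
    have exp: "cov_integrand (jtensor J j) X Ys x = (\<Sum>a\<in>Basis. \<Sum>\<beta>\<in>lists_of Basis j. I a \<beta> x)" if x: "x \<in> S2" for x
    proof -
      have ml: "multilinear_on (tangent x) (length ([] :: (real^3) list) + length Ys) (jtensor J j x)" using jtensor_ml Ys by simp
      have wX: "vector_field (%z. weight z \<beta> (map (%Y. Y z) Ys) *R X z)" if "\<beta> \<in> lists_of Basis j" for \<beta>
        using that Ys X by (intro vector_field_scaleR smooth_weight) (auto simp: lists_of_def)
      have "cov_integrand (jtensor J j) X Ys x = (\<Sum>\<beta>\<in>lists_of Basis j.
          cov_integrand (jtensor J j) (%z. weight z \<beta> (map (%Y. Y z) Ys) *R X z) (map (><) \<beta>) x)"
        using cov_integrand_expand[where T="jtensor J j" and x=x, OF ml x X Ys(2)] Ys(1) by simp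
      also have "... = (\<Sum>\<beta>\<in>lists_of Basis j. \<Sum>a\<in>Basis. I a \<beta> x)"
      proof (rule sum.cong[OF refl])
        fix \<beta> :: "(real^3) list" assume b: "\<beta> \<in> lists_of Basis j"
        have lb: "length \<beta> = j" using b by (simp add: lists_of_def)
        have vf: "vector_field Z" if "Z \<in> set (map (><) \<beta>)" for Z using that vector_field_rot by auto
        have "cov_integrand (jtensor J j) (%z. weight z \<beta> (map (%Y. Y z) Ys) *R X z) (map (><) \<beta>) x =
          cov_integrand (jtensor J j) (%z. \<Sum>a\<in>Basis. u a \<beta> z *R (a >< z)) (map (><) \<beta>) x"
          by (rule cov_integrand_cong[OF x wX[OF b] _ vf])
            (auto simp: u_def scaleR_sum_right[symmetric] scaleR_scaleR[symmetric] vfc_expand[OF X] simp del: scaleR_scaleR)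
        also have "... = (\<Sum>a\<in>Basis. I a \<beta> x)"
          unfolding I_def using jtensor_ml lb vf
          by (intro cov_integrand_sum x vector_field_scaleR u b vector_field_rot) auto
        finally show "cov_integrand (jtensor J j) (%z. weight z \<beta> (map (%Y. Y z) Ys) *R X z) (map (><) \<beta>) x = (\<Sum>a\<in>Basis. I a \<beta> x)" .
      qed
      finally show ?thesis by (subst sum.swap)
    qed
    have "(\<integral>x. rho x *R jtensor J (Suc j) x (X x # map (%Y. Y x) Ys) \<partial>mu) =
      (\<integral>x. (\<Sum>a\<in>Basis. \<Sum>\<beta>\<in>lists_of Basis j. (rho x * u a \<beta> x) *R tcoef (Suc j) (a # \<beta>) J x) \<partial>mu)"
      by (rule Bochner_Integration.integral_cong)
        (simp_all add: jtensor_def sum_lists_of_Suc scaleR_sum_right u_def vfc_def mult_ac del: tcoef.simps)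
    also have "... = (\<Sum>a\<in>Basis. \<Sum>\<beta>\<in>lists_of Basis j. (\<integral>x. (rho x * u a \<beta> x) *R tcoef (Suc j) (a # \<beta>) J x \<partial>mu))"
      using ru its by (simp add: Bochner_Integration.integral_sum integrable_smooth_scaleR del: tcoef.simps)
    also have "... = - (\<Sum>a\<in>Basis. \<Sum>\<beta>\<in>lists_of Basis j. (\<integral>x. rho x *R I a \<beta> x \<partial>mu))"
      using key by (simp add: sum_negf del: tcoef.simps)
    also have "(\<Sum>a\<in>Basis. \<Sum>\<beta>\<in>lists_of Basis j. (\<integral>x. rho x *R I a \<beta> x \<partial>mu)) =
        (\<integral>x. (\<Sum>a\<in>Basis. \<Sum>\<beta>\<in>lists_of Basis j. rho x *R I a \<beta> x) \<partial>mu)"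
      using irI by (simp add: Bochner_Integration.integral_sum)
    also have "... = (\<integral>x. rho x *R cov_integrand (jtensor J j) X Ys x \<partial>mu)"
      by (rule Bochner_Integration.integral_cong) (simp_all add: exp scaleR_sum_right)
    finally show "(\<integral>x. rho x *R jtensor J (Suc j) x (X x # map (%Y. Y x) Ys) \<partial>mu) =
      - (\<integral>x. rho x *R cov_integrand (jtensor J j) X Ys x \<partial>mu)" .
  qed
qed

end

context riemannian_S2
begin

section \<open>Equivalence of Sobolev norms\<close>

text \<open>The sum over a \<open>g\<close>-orthonormal frame of products of two coefficients as in
  \<open>tangent_rot_representation\<close>, written without the frame and therefore continuous in
  \<open>x\<close>.\<close>

definition hcoef :: "real^3 => real^3 => real^3 => real" where
  "hcoef b c x = g x (x >< (b >< x)) (x >< (c >< x)) / (rho x)\<^sup>2"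

lemma continuous_hcoef: "continuous_on S2 (hcoef b c)"
proof -
  have v: "vector_field (%x. x >< (b >< x))" for b
    unfolding vector_field_def
    using smooth_on_S2_bilinear[OF bounded_bilinear_cross3 smooth_on_S2_ident] vector_field_rot[of b]
    by (simp add: vector_field_def)
  show ?thesis
    unfolding hcoef_def
    using rho_pos by (intro continuous_on_divide continuous_on_power smooth_on_S2_continuous smooth_g v smooth_rho) fastforce
qed

text \<open>By the Gram identity, \<open>\<Sum>e. area x e u * area x e v = g x u v / (rho x)\<^sup>2\<close> over an orthonormal frame.\<close>

lemma frame_sum:
  assumes x: "x \<in> S2" and f: "e1 \<in> tangent x" "e2 \<in> tangent x"
    "g x e1 e1 = 1" "g x e2 e2 = 1" "g x e1 e2 = 0" "g x e2 e1 = 0"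
  shows "(\<Sum>e\<in>{e1, e2}. ((x >< e) \<bullet> b) * ((x >< e) \<bullet> c)) = hcoef b c x"
proof -
  note i = inner_onD[OF inner_on_g[OF x]]
  have a: "(x >< e) \<bullet> b = area x e (x >< (b >< x))" for e b
  proof -
    have "area x e (x >< (b >< x)) = area x e (b + (- (x \<bullet> b)) *R x)"
      using x by (simp add: Lagrange dot_square_norm mem_sphere_0)
    also have "... = area x e b"
      by (simp only: area_simps) (simp add: area_def cross_inner_zero)
    finally show ?thesis using cross_triple[of x e b] by (simp add: area_def inner_commute)
  qed
  define u where "u = x >< (b >< x)"
  define v where "v = x >< (c >< x)"
  have t: "u \<in> tangent x" "v \<in> tangent x" by (simp_all add: u_def v_def)
  have s: "(rho x)\<^sup>2 * (area x e u * area x e v) = g x e e * g x u v - g x e v * g x u e" if "e \<in> tangent x" for e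
    using gram[OF x that t(1) that t(2)] by simp
  have d: "u = g x u e1 *R e1 + g x u e2 *R e2" by (rule frame_decomp[OF x f(1-5) t(1)])
  have "g x u v = g x (g x u e1 *R e1 + g x u e2 *R e2) v" using d by simp
  also have "... = g x u e1 * g x e1 v + g x u e2 * g x e2 v" using f t by (simp add: i tangent_scaleR)
  finally have "(rho x)\<^sup>2 * (area x e1 u * area x e1 v + area x e2 u * area x e2 v) = g x u v"
    using s[OF f(1)] s[OF f(2)] f by (simp add: algebra_simps)
  moreover have "e1 ~= e2" using f by auto
  ultimately show ?thesis using rho_pos[OF x]
    by (simp add: a hcoef_def u_def[symmetric] v_def[symmetric] field_simps)
qed

definition hprod :: "(real^3) list => (real^3) list => real^3 => real" where
  "hprod \<beta> \<beta>' x = prod_list (map2 (%b c. hcoef b c x) \<beta> \<beta>')"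

lemma continuous_hprod: "continuous_on S2 (hprod \<beta> \<beta>')"
proof (induction \<beta> arbitrary: \<beta>')
  case (Cons b \<beta>)
  show ?case
  proof (cases \<beta>')
    case Nil then show ?thesis by (simp add: hprod_def)
  next
    case (Cons c \<beta>'')
    have "continuous_on S2 (%x. hcoef b c x * hprod \<beta> \<beta>'' x)"
      by (intro continuous_on_mult continuous_hcoef Cons.IH)
    then show ?thesis by (simp add: hprod_def Cons)
  qed
qed (simp add: hprod_def)

lemma frame_weight_sum:
  assumes x: "x \<in> S2" and f: "e1 \<in> tangent x" "e2 \<in> tangent x"
    "g x e1 e1 = 1" "g x e2 e2 = 1" "g x e1 e2 = 0" "g x e2 e1 = 0"
    and "length \<beta> = length \<beta>'"
  shows "(\<Sum>es\<in>lists_of {e1, e2} (length \<beta>). weight x \<beta> es * weight x \<beta>' es) = hprod \<beta> \<beta>' x"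
  using assms(8)
proof (induction \<beta> \<beta>' rule: list_induct2)
  case (Cons b \<beta> c \<beta>')
  have "(\<Sum>es\<in>lists_of {e1, e2} (length (b # \<beta>)). weight x (b # \<beta>) es * weight x (c # \<beta>') es) =
    (\<Sum>e\<in>{e1, e2}. \<Sum>es\<in>lists_of {e1, e2} (length \<beta>).
       (((x >< e) \<bullet> b) * ((x >< e) \<bullet> c)) * (weight x \<beta> es * weight x \<beta>' es))"
    unfolding list.size(4) add_Suc_right add_0_right sum_lists_of_Suc by (intro sum.cong refl) simp
  also have "... = hcoef b c x * hprod \<beta> \<beta>' x"
    unfolding sum_product[symmetric] Cons.IH frame_sum[OF x f] ..
  finally show ?case by (simp add: hprod_def)
qed (simp add: hprod_def)

lemma tensor_norm_nonneg: "tensor_norm g j x T >= 0"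
  by (simp add: tensor_norm_def case_prod_unfold Let_def sum_nonneg)

text \<open>\<open>tensor_norm\<close> is defined through a frame chosen pointwise; this frame-free
  quadratic form in the components is what makes it measurable.\<close>

lemma tensor_norm_sq:
  fixes T :: "(real^3) list => 'b::euclidean_space"
  assumes x: "x \<in> S2" and T: "multilinear_on (tangent x) j T"
  shows "(tensor_norm g j x T)\<^sup>2 =
    (\<Sum>\<beta>\<in>lists_of Basis j. \<Sum>\<beta>'\<in>lists_of Basis j. hprod \<beta> \<beta>' x * (T (rots \<beta> x) \<bullet> T (rots \<beta>' x)))"
proof -
  obtain e1 e2 where f: "frame g x = (e1, e2)" "e1 \<in> tangent x" "e2 \<in> tangent x"
    "g x e1 e1 = 1" "g x e2 e2 = 1" "g x e1 e2 = 0" "g x e2 e1 = 0" using frame_g[OF x] by metis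
  let ?L = "lists_of {e1, e2} j" and ?B = "lists_of (Basis :: (real^3) set) j"
  have s: "(norm (T es))\<^sup>2 = (\<Sum>\<beta>\<in>?B. \<Sum>\<beta>'\<in>?B. weight x \<beta> es * weight x \<beta>' es * (T (rots \<beta> x) \<bullet> T (rots \<beta>' x)))"
    if "es \<in> ?L" for es
  proof -
    have "T ([] @ es) = (\<Sum>\<beta>\<in>lists_of Basis (length es). weight x \<beta> es *R T ([] @ rots \<beta> x))"
      using that f T by (intro multilinear_on_expand x) (auto simp: lists_of_def)
    then have "T es = (\<Sum>\<beta>\<in>?B. weight x \<beta> es *R T (rots \<beta> x))" using that by (simp add: lists_of_def)
    then show ?thesis
      by (simp add: power2_norm_eq_inner inner_sum_left inner_sum_right sum_distrib_left mult_ac inner_commute)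
  qed
  have fw: "(\<Sum>es\<in>?L. weight x \<beta> es * weight x \<beta>' es) = hprod \<beta> \<beta>' x" if "\<beta> \<in> ?B" "\<beta>' \<in> ?B" for \<beta> \<beta>'
  proof -
    have "length \<beta> = j" "length \<beta>' = j" using that by (auto simp: lists_of_def)
    with frame_weight_sum[OF x f(2-7), of \<beta> \<beta>'] show ?thesis by simp
  qed
  have e: "{es. length es = j & set es \<subseteq> {e1, e2}} = ?L" by (auto simp: lists_of_def)
  have "(tensor_norm g j x T)\<^sup>2 = (\<Sum>es\<in>?L. (norm (T es))\<^sup>2)"
    by (simp add: tensor_norm_def f(1) e sum_nonneg)
  also have "... = (\<Sum>es\<in>?L. \<Sum>\<beta>\<in>?B. \<Sum>\<beta>'\<in>?B. weight x \<beta> es * weight x \<beta>' es * (T (rots \<beta> x) \<bullet> T (rots \<beta>' x)))"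
    by (rule sum.cong[OF refl s])
  also have "... = (\<Sum>\<beta>\<in>?B. \<Sum>es\<in>?L. \<Sum>\<beta>'\<in>?B. weight x \<beta> es * weight x \<beta>' es * (T (rots \<beta> x) \<bullet> T (rots \<beta>' x)))"
    by (rule sum.swap)
  also have "... = (\<Sum>\<beta>\<in>?B. \<Sum>\<beta>'\<in>?B. \<Sum>es\<in>?L. weight x \<beta> es * weight x \<beta>' es * (T (rots \<beta> x) \<bullet> T (rots \<beta>' x)))"
    by (intro sum.cong refl sum.swap)
  also have "... = (\<Sum>\<beta>\<in>?B. \<Sum>\<beta>'\<in>?B. hprod \<beta> \<beta>' x * (T (rots \<beta> x) \<bullet> T (rots \<beta>' x)))"
    unfolding sum_distrib_right[symmetric] by (intro sum.cong refl) (simp add: fw)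
  finally show ?thesis .
qed

lemma tensor_norm_measurable:
  assumes T: "tensor_field g j T" shows "(%x. tensor_norm g j x (T x)) \<in> borel_measurable mu"
proof -
  have m: "(%x. T x (rots \<beta> x)) \<in> borel_measurable mu" if "\<beta> \<in> lists_of Basis j" for \<beta>
    using tensor_field_integrable_rots[OF T, of \<beta>] that by (auto simp: lists_of_def)
  have "(%x. \<Sum>\<beta>\<in>lists_of Basis j. \<Sum>\<beta>'\<in>lists_of Basis j.
      hprod \<beta> \<beta>' x * (T x (rots \<beta> x) \<bullet> T x (rots \<beta>' x))) \<in> borel_measurable mu"
    by (intro borel_measurable_sum borel_measurable_times borel_measurable_inner m
        measurable_S2_continuous[OF continuous_hprod])
  then have "(%x. sqrt (\<Sum>\<beta>\<in>lists_of Basis j. \<Sum>\<beta>'\<in>lists_of Basis j.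
      hprod \<beta> \<beta>' x * (T x (rots \<beta> x) \<bullet> T x (rots \<beta>' x)))) \<in> borel_measurable mu" by measurable
  then show ?thesis
    by (rule measurable_cong[THEN iffD1, rotated])
      (simp add: tensor_norm_sq[OF _ tensor_field_ml[OF T], symmetric] tensor_norm_nonneg)
qed

text \<open>One bound comes from the quadratic form \<open>tensor_norm_sq\<close>, the other from
  expanding rotation fields in the frame, with coefficients controlled by the lengths of these
  fields on the compact sphere.\<close>

lemma tensor_norm_compare:
  "\<exists>C>0. \<forall>x\<in>S2. \<forall>T :: (real^3) list => 'b::euclidean_space. multilinear_on (tangent x) j T -->
     tensor_norm g j x T <= C * (\<Sum>\<beta>\<in>lists_of Basis j. norm (T (rots \<beta> x))) \<and>
     (\<forall>\<beta>\<in>lists_of Basis j. norm (T (rots \<beta> x)) <= C * tensor_norm g j x T)"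
proof -
  let ?B = "lists_of (Basis :: (real^3) set) j"
  have "continuous_on S2 (%x. \<Sum>\<beta>\<in>?B. \<Sum>\<beta>'\<in>?B. \<bar>hprod \<beta> \<beta>' x\<bar>)"
    by (intro continuous_on_sum continuous_on_rabs continuous_hprod)
  then obtain H where H: "H > 0" "!!x. x \<in> S2 ==> norm (\<Sum>\<beta>\<in>?B. \<Sum>\<beta>'\<in>?B. \<bar>hprod \<beta> \<beta>' x\<bar>) <= H"
    by (rule continuous_on_S2_bounded) blast
  have "continuous_on S2 (%x. \<Sum>b\<in>Basis. g x (b >< x) (b >< x))"
    by (intro continuous_on_sum smooth_on_S2_continuous smooth_g vector_field_rot)
  then obtain A where A: "A > 0" "!!x. x \<in> S2 ==> norm (\<Sum>b\<in>Basis. g x (b >< x) (b >< x)) <= A"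
    by (rule continuous_on_S2_bounded) blast
  define C where "C = sqrt H + (2 * (1 + A)) ^ j"
  have C: "C > 0" "C >= sqrt H" "C >= (2 * (1 + A)) ^ j" using H A by (auto simp: C_def intro!: add_pos_pos)
  show ?thesis
  proof (intro exI[of _ C] conjI ballI allI impI C(1))
    fix x and T :: "(real^3) list => 'b" assume x: "x \<in> S2" and T: "multilinear_on (tangent x) j T"
    let ?n = "tensor_norm g j x T" and ?S = "\<Sum>\<beta>\<in>?B. norm (T (rots \<beta> x))"
    have S0: "?S >= 0" by (rule sum_nonneg) simp
    have fB: "finite ?B" by (simp add: finite_lists_of)
    have le: "norm (T (rots \<beta> x)) <= ?S" if "\<beta> \<in> ?B" for \<beta> by (rule member_le_sum[OF that _ fB]) simp
    have "?n\<^sup>2 <= (\<Sum>\<beta>\<in>?B. \<Sum>\<beta>'\<in>?B. \<bar>hprod \<beta> \<beta>' x\<bar> * (?S * ?S))"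
      unfolding tensor_norm_sq[OF x T]
    proof (intro sum_mono)
      fix \<beta> \<beta>' assume b: "\<beta> \<in> ?B" "\<beta>' \<in> ?B"
      have "hprod \<beta> \<beta>' x * (T (rots \<beta> x) \<bullet> T (rots \<beta>' x)) <= \<bar>hprod \<beta> \<beta>' x\<bar> * \<bar>T (rots \<beta> x) \<bullet> T (rots \<beta>' x)\<bar>"
        by (simp add: abs_mult[symmetric])
      also have "... <= \<bar>hprod \<beta> \<beta>' x\<bar> * (norm (T (rots \<beta> x)) * norm (T (rots \<beta>' x)))"
        by (intro mult_left_mono Cauchy_Schwarz_ineq2) simp
      also have "... <= \<bar>hprod \<beta> \<beta>' x\<bar> * (?S * ?S)" using S0 le b by (intro mult_left_mono mult_mono) auto
      finally show "hprod \<beta> \<beta>' x * (T (rots \<beta> x) \<bullet> T (rots \<beta>' x)) <= \<bar>hprod \<beta> \<beta>' x\<bar> * (?S * ?S)" .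
    qed
    also have "... = (\<Sum>\<beta>\<in>?B. \<Sum>\<beta>'\<in>?B. \<bar>hprod \<beta> \<beta>' x\<bar>) * (?S * ?S)" by (simp add: sum_distrib_right)
    also have "... <= H * (?S * ?S)" using H(2)[OF x] S0 by (intro mult_right_mono) auto
    also have "... = (sqrt H * ?S)\<^sup>2" using H by (simp add: power2_eq_square mult_ac)
    finally have "?n <= sqrt H * ?S" by (rule power2_le_imp_le) (use H S0 in auto)
    also have "... <= C * ?S" using C S0 by (intro mult_right_mono) auto
    finally show "?n <= C * ?S" .
  next
    fix x and T :: "(real^3) list => 'b" and \<beta>
    assume x: "x \<in> S2" and T: "multilinear_on (tangent x) j T" and b: "\<beta> \<in> ?B"
    let ?n = "tensor_norm g j x T"
    obtain e1 e2 where f: "frame g x = (e1, e2)" "e1 \<in> tangent x" "e2 \<in> tangent x"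
      "g x e1 e1 = 1" "g x e2 e2 = 1" "g x e1 e2 = 0" "g x e2 e1 = 0" using frame_g[OF x] by metis
    note i = inner_onD[OF inner_on_g[OF x]]
    have ne: "e1 ~= e2" using f by auto
    have g0: "g x (b >< x) (b >< x) >= 0" for b
      using i(6)[of "b >< x"] inner_on_zero[OF inner_on_g[OF x], of 0] by (cases "b >< x = 0") auto
    have sq: "\<bar>g x v e\<bar> <= 1 + A" if v: "v = b >< x" "b \<in> Basis" and e: "e \<in> {e1, e2}" for v b e
    proof -
      have vt: "v \<in> tangent x" using v by simp
      have d: "v = g x v e1 *R e1 + g x v e2 *R e2" by (rule frame_decomp[OF x f(2-6) vt])
      have "g x v v = g x (g x v e1 *R e1 + g x v e2 *R e2) v" using d by simp
      also have "... = g x v e1 * g x e1 v + g x v e2 * g x e2 v" using f vt by (simp add: i tangent_scaleR)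
      also have "... = (g x v e1)\<^sup>2 + (g x v e2)\<^sup>2" using i(1)[OF vt f(2)] i(1)[OF vt f(3)] by (simp add: power2_eq_square)
      finally have "(g x v e)\<^sup>2 <= g x v v" using e by auto
      also have "g x v v <= (\<Sum>b\<in>Basis. g x (b >< x) (b >< x))"
        unfolding v(1) by (rule member_le_sum[OF v(2)]) (simp_all add: g0)
      also have "... <= A" using A(2)[OF x] by simp
      finally have "(g x v e)\<^sup>2 <= A" .
      \<comment> \<open>The inequality \<open>t <= 1 + t ^ 2\<close> avoids a square root in the
        constant.\<close>
      moreover have "\<bar>g x v e\<bar> <= 1 + (g x v e)\<^sup>2"
        using zero_le_power2[of "\<bar>g x v e\<bar> - 1 / 2"] by (simp add: power2_eq_square algebra_simps)
      ultimately show ?thesis by linarith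
    qed
    have M: "norm (T es) <= ?n" if "es \<in> lists_of {e1, e2} j" for es
    proof (rule power2_le_imp_le[OF _ tensor_norm_nonneg])
      have "{es. length es = j & set es \<subseteq> {e1, e2}} = lists_of {e1, e2} j" by (auto simp: lists_of_def)
      then have "?n\<^sup>2 = (\<Sum>es\<in>lists_of {e1, e2} j. (norm (T es))\<^sup>2)" by (simp add: tensor_norm_def f(1) sum_nonneg)
      then show "(norm (T es))\<^sup>2 <= ?n\<^sup>2"
        using member_le_sum[OF that, of "%es. (norm (T es))\<^sup>2"] by (simp add: finite_lists_of)
    qed
    have "norm (T ([] @ rots \<beta> x)) <= ?n * (2 * (1 + A)) ^ length (rots \<beta> x)"
    proof (rule multilinear_on_bound[where E="{e1, e2}" and c="g x", OF T _ _ _ M tensor_norm_nonneg])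
      show "v = (\<Sum>e\<in>{e1, e2}. g x v e *R e)" if "v \<in> tangent x" for v
        using frame_decomp[OF x f(2-6) that] ne by simp
      show "v \<in> tangent x & (\<Sum>e\<in>{e1, e2}. \<bar>g x v e\<bar>) <= 2 * (1 + A)" if "v \<in> set (rots \<beta> x)" for v
      proof -
        obtain b where "v = b >< x" "b \<in> Basis" using \<open>v \<in> set (rots \<beta> x)\<close> b by (auto simp: rots_def lists_of_def)
        then show ?thesis using sq[of v b e1] sq[of v b e2] ne by simp
      qed
    qed (use f A b in \<open>auto simp: lists_of_def\<close>)
    also have "... <= ?n * C" using C b by (intro mult_left_mono tensor_norm_nonneg) (auto simp: lists_of_def)
    finally show "norm (T (rots \<beta> x)) <= C * ?n" by (simp add: mult.commute)
  qed
qed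

text \<open>On rotation fields a weak covariant derivative is a weak rotation derivative up to
  connection terms of one order less, so induction on \<open>j\<close> reduces uniqueness to
  \<open>weak_rot_unique\<close>.\<close>

lemma weak_jet_unique:
  assumes T: "weak_jet g nabla k f T" and T': "weak_jet g nabla k f T'"
  shows "j <= k ==> \<alpha> \<in> lists_of Basis j ==> AE x in S2_measure. T j x (rots \<alpha> x) = T' j x (rots \<alpha> x)"
proof (induction j arbitrary: \<alpha>)
  case 0
  have "AE x in S2_measure. T 0 x [] = f x" "AE x in S2_measure. T' 0 x [] = f x"
    using T T' by (auto simp: weak_jet_def AE_vol)
  then show ?case using 0 by (auto elim: AE_mp)
next
  case (Suc j)
  obtain a \<beta> where a: "\<alpha> = a # \<beta>" "\<beta> \<in> lists_of Basis j" using lists_of_SucE[OF Suc.prems(2)] by blast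
  have l: "length \<beta> = j" and sb: "set \<beta> \<subseteq> Basis" using a by (auto simp: lists_of_def)
  let ?C = "%T x. (\<Sum>i<length \<beta>. \<Sum>c\<in>Basis. chris a (\<beta> ! i) c x *R T j x (rots (\<beta>[i := c]) x))"
  have w: "weak_rot a (%x. T j x (rots \<beta> x)) (%x. T (Suc j) x (rots (a # \<beta>) x) + ?C T x)"
    if "weak_jet g nabla k f T" for T
    using that Suc.prems by (intro weak_covariant_rots[OF _ _ _ l]) (auto simp: weak_jet_def)
  have "AE x in S2_measure. T (Suc j) x (rots (a # \<beta>) x) + ?C T x = T' (Suc j) x (rots (a # \<beta>) x) + ?C T' x"
    by (rule weak_rot_unique[OF w[OF T] w[OF T'] Suc.IH]) (use Suc.prems a in auto)
  moreover have "AE x in S2_measure. \<forall>\<gamma>\<in>lists_of Basis j. T j x (rots \<gamma> x) = T' j x (rots \<gamma> x)"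
    using Suc.IH Suc.prems by (intro AE_finite_allI finite_lists_of finite_Basis) auto
  ultimately show ?case
  proof eventually_elim
    case (elim x)
    have "\<beta>[i := c] \<in> lists_of Basis j" if "c \<in> Basis" for i c
      using l sb that set_update_subset_insert[of \<beta> i c] by (auto simp: lists_of_def)
    then have "?C T x = ?C T' x" using elim(2) by (intro sum.cong refl) auto
    then show ?case using elim(1) a by simp
  qed
qed

definition sobolev_energy :: "nat => real => (nat => real^3 => (real^3) list => 'b::euclidean_space) => real" where
  "sobolev_energy k p T = (\<Sum>j\<le>k. integral\<^sup>L (vol g) (%x. tensor_norm g j x (T j x) powr p))"

text \<open>The norm uses an arbitrarily chosen weak jet; uniqueness on rotation fields together
  with \<open>tensor_norm_sq\<close> lets any other one be used.\<close>

lemma sobolev_norm_powr: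
  fixes \<xi> :: "'b::euclidean_space S2_fun"
  assumes p: "p >= 1" and T: "weak_jet g nabla k (rep_S2_fun \<xi>) T"
  shows "sobolev_norm g nabla k p \<xi> powr p = sobolev_energy k p T"
proof -
  define T' where "T' = (SOME T. weak_jet g nabla k (rep_S2_fun \<xi>) T)"
  have T': "weak_jet g nabla k (rep_S2_fun \<xi>) T'" unfolding T'_def by (rule someI[where P="weak_jet g nabla k (rep_S2_fun \<xi>)", OF T])
  have "integral\<^sup>L (vol g) (%x. tensor_norm g j x (T j x) powr p) = integral\<^sup>L (vol g) (%x. tensor_norm g j x (T' j x) powr p)"
    if j: "j <= k" for j
  proof (rule integral_cong_AE)
    have tf: "tensor_field g j (T j)" "tensor_field g j (T' j)" using T T' j by (auto simp: weak_jet_def)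
    show "(%x. tensor_norm g j x (T j x) powr p) \<in> borel_measurable (vol g)"
      "(%x. tensor_norm g j x (T' j x) powr p) \<in> borel_measurable (vol g)"
      unfolding measurable_vol using tf[THEN tensor_norm_measurable] by simp_all
    have "AE x in S2_measure. x \<in> S2 & (\<forall>\<gamma>\<in>lists_of Basis j. T j x (rots \<gamma> x) = T' j x (rots \<gamma> x))"
      using weak_jet_unique[OF T T' j] AE_space[of mu]
      by (intro AE_conjI AE_finite_allI finite_lists_of finite_Basis) auto
    then show "AE x in vol g. tensor_norm g j x (T j x) powr p = tensor_norm g j x (T' j x) powr p"
      unfolding AE_vol
    proof eventually_elim
      case (elim x)
      then have "(tensor_norm g j x (T j x))\<^sup>2 = (tensor_norm g j x (T' j x))\<^sup>2"
        using tf[THEN tensor_field_ml] by (simp add: tensor_norm_sq)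
      then show ?case using tensor_norm_nonneg power2_eq_imp_eq by metis
    qed
  qed
  then have "sobolev_energy k p T = sobolev_energy k p T'" by (simp add: sobolev_energy_def)
  moreover have "sobolev_energy k p T' >= 0" unfolding sobolev_energy_def by (intro sum_nonneg) simp
  ultimately show ?thesis
    using p by (simp add: sobolev_norm_def T'_def[symmetric] sobolev_energy_def[symmetric] powr_powr)
qed

lemma cop_lp:
  fixes F :: "'b::euclidean_space jets => real^3 => 'b"
  assumes F: "cop r F" and p: "p >= 1"
  shows "\<exists>C\<ge>0. \<forall>t. lpjet p r t --> lp p (F t) & Lp p (F t) <= C * jetE p r t"
proof -
  obtain B where B: "B >= 0" "!!t x. x \<in> S2 ==> norm (F t x) <= B * (\<Sum>v\<in>words r. norm (t v x))"
    using cop_bound[OF F] by metis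
  define C where "C = B powr p * real (card (words r :: (real^3) list set)) powr p"
  have "lp p (F t) & Lp p (F t) <= C * jetE p r t" if t: "lpjet p r t" for t
  proof -
    let ?s = "%x. \<Sum>v\<in>words r. norm (t v x)"
    have l: "lp p (%x. norm (t v x))" "Lp p (%x. norm (t v x)) = Lp p (t v)" if "v \<in> words r" for v
      using t that by (auto simp: lpjet_def lp_def Lp_def)
    have s: "lp p ?s" "Lp p ?s <= real (card (words r :: (real^3) list set)) powr p * jetE p r t"
      using lp_sum[of "words r" p "%v x. norm (t v x)"] p l by (auto simp: jetE_def)
    have m: "F t \<in> borel_measurable mu"
      using t p by (intro cop_measurable[OF F]) (auto simp: lpjet_def lp_def)
    have b: "AE x in S2_measure. norm (F t x) <= B * norm (?s x)"
      by (rule AE_I2) (use B in \<open>simp add: sum_nonneg\<close>)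
    have "Lp p (F t) <= B powr p * Lp p ?s" "lp p (F t)" using lp_mono[OF s(1) m _ B(1) b] p by auto
    then show ?thesis using order_trans[OF _ mult_left_mono[OF s(2), of "B powr p"]] by (simp add: C_def mult.assoc)
  qed
  then show ?thesis by (intro exI[of _ C]) (simp add: C_def)
qed

lemma vol_integral_bounds:
  obtains m M where "m > 0" "M > 0" "!!f. lp p f ==> m * Lp p f <= integral\<^sup>L (vol g) (%x. norm (f x :: real) powr p)"
    "!!f. lp p f ==> integral\<^sup>L (vol g) (%x. norm (f x :: real) powr p) <= M * Lp p f"
proof -
  obtain m M where r: "m > 0" "!!x. x \<in> S2 ==> m <= rho x" "!!x. x \<in> S2 ==> rho x <= M" by (rule rho_bounds) blast
  have M: "M > 0" using r(1) r(2,3)[OF axis_in_S2, of undefined] by linarith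
  have "m * Lp p f <= integral\<^sup>L (vol g) (%x. norm (f x) powr p) & integral\<^sup>L (vol g) (%x. norm (f x) powr p) <= M * Lp p f"
    if f: "lp p f" for f :: "real^3 => real"
  proof -
    have i: "integrable mu (%x. norm (f x) powr p)" using f by (simp add: lp_def)
    have ir: "integrable mu (%x. rho x *R norm (f x) powr p)"
      by (rule integrable_smooth_scaleR[OF smooth_rho i])
    have "integral\<^sup>L (vol g) (%x. norm (f x) powr p) = (\<integral>x. rho x *R norm (f x) powr p \<partial>mu)"
      using i by (intro integral_vol) auto
    moreover have "(\<integral>x. m *R norm (f x) powr p \<partial>mu) <= (\<integral>x. rho x *R norm (f x) powr p \<partial>mu)"
      by (rule integral_mono) (use r i ir in \<open>auto intro!: mult_right_mono\<close>)
    moreover have "(\<integral>x. rho x *R norm (f x) powr p \<partial>mu) <= (\<integral>x. M *R norm (f x) powr p \<partial>mu)"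
      by (rule integral_mono) (use r i ir in \<open>auto intro!: mult_right_mono\<close>)
    ultimately show ?thesis by (simp add: Lp_def)
  qed
  then show ?thesis using that[OF r(1) M] by blast
qed

text \<open>The values of the covariant derivatives on rotation fields satisfy
  \<open>connjet chris\<close>, and the operators of \<open>cop_family\<close> convert them into a
  jet.\<close>

lemma sobolev_jet:
  assumes p: "p >= 1"
  shows "\<exists>C>0. \<forall>\<xi> :: 'b::euclidean_space S2_fun. \<xi> \<in> sobolev_set g nabla k p -->
     (\<exists>J. wjet k J & lpjet p k J & (AE x in S2_measure. J [] x = rep_S2_fun \<xi> x) \<and>
        jetE p k J <= C * sobolev_norm g nabla k p \<xi> powr p)"
proof -
  obtain W :: "(real^3) list => 'b jets => real^3 => 'b"
    where W: "W [] = (%t. t [])" "!!w. set w \<subseteq> Basis ==> cop (length w) (W w)"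
      "!!k t. connjet chris k t ==> wjet k (%w. W w t)"
    using cop_family[of chris, OF hsmooth_chris] by blast
  have "\<exists>C>0. \<forall>w\<in>words k. \<forall>t. lpjet p k t --> lp p (W w t) & Lp p (W w t) <= C * jetE p k t"
  proof (rule uniform_const[OF finite_words])
    fix w :: "(real^3) list" assume "w \<in> words k"
    then have "set w \<subseteq> Basis" "length w <= k" by (auto simp: words_def)
    then have "cop k (W w)" by (rule cop_mono[OF W(2)])
    then show "\<exists>C\<ge>0. \<forall>t. lpjet p k t --> lp p (W w t) & Lp p (W w t) <= C * jetE p k t" by (rule cop_lp[OF _ p])
  qed (meson jetE_nonneg mult_right_mono order_trans)
  then obtain A where A: "A > 0" "!!w t. w \<in> words k ==> lpjet p k t ==> lp p (W w t) & Lp p (W w t) <= A * jetE p k t" by blast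
  let ?le = "%C j x (T :: (real^3) list => 'b). \<forall>\<beta>\<in>lists_of Basis j. norm (T (rots \<beta> x)) <= C * tensor_norm g j x T"
  have "\<exists>C>0. \<forall>j\<in>{..k}. \<forall>x\<in>S2. \<forall>T. multilinear_on (tangent x) j T --> ?le C j x T"
  proof (rule uniform_const)
    show "\<exists>C\<ge>0. \<forall>x\<in>S2. \<forall>T. multilinear_on (tangent x) j T --> ?le C j x T" for j
      using tensor_norm_compare[where j=j and 'b='b] by (meson less_imp_le)
  qed (auto, meson tensor_norm_nonneg mult_right_mono order_trans)
  then obtain D where D: "D > 0" "!!j x T. j <= k ==> x \<in> S2 ==> multilinear_on (tangent x) j T ==> ?le D j x T" by blast
  obtain m where m: "m > 0" "!!f. lp p f ==> m * Lp p f <= integral\<^sup>L (vol g) (%x. norm (f x :: real) powr p)"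
    using vol_integral_bounds by metis
  let ?N = "real (card (words k :: (real^3) list set))"
  define C where "C = (?N * A) * (?N * (D powr p / m)) + 1"
  have "C > 0" using A m by (auto simp: C_def intro!: add_nonneg_pos)
  moreover have "\<exists>J. wjet k J & lpjet p k J & (AE x in S2_measure. J [] x = rep_S2_fun \<xi> x) \<and>
        jetE p k J <= C * sobolev_norm g nabla k p \<xi> powr p"
    if \<xi>: "\<xi> \<in> sobolev_set g nabla k p" for \<xi> :: "'b S2_fun"
  proof -
    obtain T where T: "weak_jet g nabla k (rep_S2_fun \<xi>) T"
      and i: "!!j. j <= k ==> integrable (vol g) (%x. tensor_norm g j x (T j x) powr p)"
      using \<xi> unfolding sobolev_set_def by blast
    have tf: "tensor_field g j (T j)" if "j <= k" for j using T that by (simp add: weak_jet_def)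
    define E where "E = sobolev_energy k p T"
    have E0: "E >= 0" unfolding E_def sobolev_energy_def by (intro sum_nonneg) simp
    define t where "t \<alpha> x = T (length \<alpha>) x (rots \<alpha> x)" for \<alpha> x
    have "connjet chris k t"
      unfolding connjet_def
    proof (intro conjI ballI allI impI)
      show "integrable mu (t v)" if "v \<in> words k" for v
        unfolding t_def using that by (intro tensor_field_integrable_rots[OF tf]) (auto simp: words_def)
      show "weak_rot a (t \<alpha>) (%x. t (a # \<alpha>) x + (\<Sum>i<length \<alpha>. \<Sum>c\<in>Basis. chris a (\<alpha> ! i) c x *R t (\<alpha>[i := c]) x))"
        if "a # \<alpha> \<in> words k" for a \<alpha>
        using weak_covariant_rots[OF tf tf, of "length \<alpha>" \<alpha> a] T that by (simp add: t_def[abs_def] words_def weak_jet_def Suc_le_eq)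
    qed
    then have J: "wjet k (%w. W w t)" by (rule W(3))
    have tl: "lp p (t v) & Lp p (t v) <= D powr p / m * E" if v: "v \<in> words k" for v
    proof -
      let ?n = "%x. tensor_norm g (length v) x (T (length v) x)"
      have l: "length v <= k" and vl: "v \<in> lists_of Basis (length v)" using v by (auto simp: words_def lists_of_def)
      have n: "lp p ?n"
        using tensor_norm_measurable[OF tf[OF l]] i[OF l] by (simp add: lp_def integrable_vol tensor_norm_nonneg)
      have tm: "t v \<in> borel_measurable mu"
        unfolding t_def using tensor_field_integrable_rots[OF tf[OF l], of v] by auto
      have "norm (t v x) <= D * norm (?n x)" if "x \<in> S2" for x
        using D(2)[OF l that tensor_field_ml[OF tf[OF l] that]] vl by (simp add: t_def tensor_norm_nonneg)
      then have *: "lp p (t v)" "Lp p (t v) <= D powr p * Lp p ?n"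
        using lp_mono[OF n tm _ less_imp_le[OF D(1)] AE_I2] p by auto
      have "m * Lp p ?n <= integral\<^sup>L (vol g) (%x. ?n x powr p)" using m(2)[OF n] by (simp add: tensor_norm_nonneg)
      also have "... <= E" unfolding E_def sobolev_energy_def
        using l by (intro member_le_sum[of "length v" "{..k}"]) auto
      finally have "Lp p ?n <= E / m" using m by (simp add: field_simps)
      from order_trans[OF *(2) mult_left_mono[OF this, of "D powr p"]] *(1) show ?thesis by simp
    qed
    then have lt: "lpjet p k t" by (simp add: lpjet_def)
    have tE: "jetE p k t <= ?N * (D powr p / m) * E"
      unfolding jetE_def mult.assoc using sum_bounded_above[of "words k" "%v. Lp p (t v)" "D powr p / m * E"] tl by blast
    have "jetE p k (%w. W w t) <= ?N * (A * jetE p k t)"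
      unfolding jetE_def[of p k "%w. W w t"] using sum_bounded_above[of "words k" "%w. Lp p (W w t)"] A(2)[OF _ lt] by blast
    also have "... <= ?N * (A * (?N * (D powr p / m) * E))" using tE A(1) by (intro mult_left_mono) auto
    also have "... <= C * E" using E0 by (simp add: C_def algebra_simps)
    finally have "jetE p k (%w. W w t) <= C * sobolev_norm g nabla k p \<xi> powr p"
      using sobolev_norm_powr[OF p T] by (simp add: E_def)
    moreover have "AE x in S2_measure. W [] t x = rep_S2_fun \<xi> x" using T by (simp add: W(1) t_def weak_jet_def AE_vol)
    moreover have "lpjet p k (%w. W w t)" using A(2)[OF _ lt] by (simp add: lpjet_def)
    ultimately show ?thesis using J by (intro exI[of _ "%w. W w t"]) simp
  qed
  ultimately show ?thesis by blast
qed

text \<open>The converse translation: the tensors \<open>jtensor J\<close> form a weak jet, and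
  their values on rotation fields are the operators \<open>tcomp\<close>, bounded on jets.\<close>

lemma jet_sobolev:
  assumes p: "p >= 1"
  shows "\<exists>C>0. \<forall>(\<xi> :: 'b::euclidean_space S2_fun) J. wjet k J & lpjet p k J & (AE x in S2_measure. J [] x = rep_S2_fun \<xi> x) -->
     \<xi> \<in> sobolev_set g nabla k p & sobolev_norm g nabla k p \<xi> powr p <= C * jetE p k J"
proof -
  have "\<exists>C>0. \<forall>j\<in>{..k}. \<forall>J :: (real^3) list => real^3 => 'b. wjet k J --> lpjet p k J -->
     lp p (%x. tensor_norm g j x (jtensor J j x)) & Lp p (%x. tensor_norm g j x (jtensor J j x)) <= C * jetE p k J"
  proof (rule uniform_const)
    fix j assume j: "j \<in> {..k}"
    let ?B = "lists_of (Basis :: (real^3) set) j"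
    obtain D where D: "D > 0" "!!x T. x \<in> S2 ==> multilinear_on (tangent x) j T ==>
        tensor_norm g j x (T :: (real^3) list => 'b) <= D * (\<Sum>\<beta>\<in>?B. norm (T (rots \<beta> x)))"
      using tensor_norm_compare[where j=j and 'b='b] by metis
    let ?F = "%\<beta>. tcomp j (tcoef j) \<beta> :: 'b jets => real^3 => 'b"
    have "\<exists>C>0. \<forall>\<beta>\<in>?B. \<forall>J. lpjet p k J --> lp p (?F \<beta> J) & Lp p (?F \<beta> J) <= C * jetE p k J"
    proof (rule uniform_const[OF finite_lists_of[OF finite_Basis]])
      fix \<beta> :: "(real^3) list" assume "\<beta> \<in> ?B"
      then have "length \<beta> = j" by (simp add: lists_of_def)
      then have "cop j (?F \<beta>)" by (intro cop_tcomp cop_tcoef)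
      moreover have "j <= k" using j by simp
      ultimately have "cop k (?F \<beta>)" by (rule cop_mono)
      then show "\<exists>C\<ge>0. \<forall>J. lpjet p k J --> lp p (?F \<beta> J) & Lp p (?F \<beta> J) <= C * jetE p k J" by (rule cop_lp[OF _ p])
    qed (meson jetE_nonneg mult_right_mono order_trans)
    then obtain A where A: "A > 0" "!!\<beta> J. \<beta> \<in> ?B ==> lpjet p k J ==> lp p (?F \<beta> J) & Lp p (?F \<beta> J) <= A * jetE p k J" by blast
    define C where "C = D powr p * (real (card ?B) powr p * (real (card ?B) * A))"
    have "lp p (%x. tensor_norm g j x (jtensor J j x)) & Lp p (%x. tensor_norm g j x (jtensor J j x)) <= C * jetE p k J"
      if J: "wjet k J" "lpjet p k J" for J :: "'b jets"
    proof -
      let ?s = "%x. \<Sum>\<beta>\<in>?B. norm (?F \<beta> J x)"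
      have tf: "tensor_field g j (jtensor J j)" using jtensor_field[OF J(1)] j by simp
      have n: "lp p (%x. norm (?F \<beta> J x))" "Lp p (%x. norm (?F \<beta> J x)) <= A * jetE p k J" if "\<beta> \<in> ?B" for \<beta>
        using A(2)[OF that J(2)] by (auto simp: lp_def Lp_def)
      have s: "lp p ?s" "Lp p ?s <= real (card ?B) powr p * (\<Sum>\<beta>\<in>?B. Lp p (%x. norm (?F \<beta> J x)))"
        using lp_sum[of ?B p "%\<beta> x. norm (?F \<beta> J x)"] n p by (auto simp: finite_lists_of)
      have "(\<Sum>\<beta>\<in>?B. Lp p (%x. norm (?F \<beta> J x))) <= real (card ?B) * (A * jetE p k J)"
        using sum_bounded_above[of ?B "%\<beta>. Lp p (%x. norm (?F \<beta> J x))"] n(2) by blast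
      with s(2) have s2: "Lp p ?s <= real (card ?B) powr p * (real (card ?B) * (A * jetE p k J))"
        by (meson mult_left_mono order_trans powr_ge_zero)
      have "norm (tensor_norm g j x (jtensor J j x)) <= D * norm (?s x)" if "x \<in> S2" for x
        using D(2)[OF that jtensor_ml[of x j J]] that by (simp add: tensor_norm_nonneg jtensor_rots sum_nonneg)
      then have "lp p (%x. tensor_norm g j x (jtensor J j x)) & Lp p (%x. tensor_norm g j x (jtensor J j x)) <= D powr p * Lp p ?s"
        using lp_mono[OF s(1) tensor_norm_measurable[OF tf] _ less_imp_le[OF D(1)] AE_I2] p by auto
      then show ?thesis
        using order_trans[OF _ mult_left_mono[OF s2, of "D powr p"]] by (simp add: C_def mult.assoc)
    qed
    then show "\<exists>C\<ge>0. \<forall>J :: (real^3) list => real^3 => 'b. wjet k J --> lpjet p k J -->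
     lp p (%x. tensor_norm g j x (jtensor J j x)) & Lp p (%x. tensor_norm g j x (jtensor J j x)) <= C * jetE p k J"
      using A by (intro exI[of _ C]) (auto simp: C_def)
  qed (simp, meson jetE_nonneg mult_right_mono order_trans)
  then obtain A where A: "A > 0" "!!j J. j <= k ==> wjet k J ==> lpjet p k J ==>
     lp p (%x. tensor_norm g j x (jtensor J j x :: _ => 'b)) & Lp p (%x. tensor_norm g j x (jtensor J j x)) <= A * jetE p k J" by auto
  obtain M where M: "M > 0" "!!f. lp p f ==> integral\<^sup>L (vol g) (%x. norm (f x :: real) powr p) <= M * Lp p f"
    using vol_integral_bounds by metis
  have "\<xi> \<in> sobolev_set g nabla k p & sobolev_norm g nabla k p \<xi> powr p <= (real (Suc k) * (M * A)) * jetE p k J"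
    if J: "wjet k J" "lpjet p k J" and e: "AE x in S2_measure. J [] x = rep_S2_fun \<xi> x" for \<xi> :: "'b S2_fun" and J
  proof -
    have T: "weak_jet g nabla k (rep_S2_fun \<xi>) (jtensor J)"
      unfolding weak_jet_def using jtensor_field[OF J(1)] jtensor_weak_cov[OF J(1)] e by (simp add: AE_vol jtensor_def)
    have l: "integrable (vol g) (%x. tensor_norm g j x (jtensor J j x) powr p)"
      "integral\<^sup>L (vol g) (%x. tensor_norm g j x (jtensor J j x) powr p) <= M * (A * jetE p k J)" if "j <= k" for j
    proof -
      note a = A(2)[OF that J]
      then show "integrable (vol g) (%x. tensor_norm g j x (jtensor J j x) powr p)"
        by (simp add: lp_def integrable_vol tensor_norm_nonneg)
      show "integral\<^sup>L (vol g) (%x. tensor_norm g j x (jtensor J j x) powr p) <= M * (A * jetE p k J)"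
        using M(2)[of "%x. tensor_norm g j x (jtensor J j x)"] a order_trans[OF _ mult_left_mono[of _ _ M]] M(1)
        by (simp add: tensor_norm_nonneg)
    qed
    have "sobolev_energy k p (jtensor J) <= real (Suc k) * (M * (A * jetE p k J))"
      unfolding sobolev_energy_def using sum_bounded_above[of "{..k}", OF l(2)] by simp
    moreover have "\<xi> \<in> sobolev_set g nabla k p" unfolding sobolev_set_def using T l(1) by blast
    ultimately show ?thesis using sobolev_norm_powr[OF p T] by (simp add: mult.assoc)
  qed
  moreover have "real (Suc k) * (M * A) > 0" using M A by simp
  ultimately show ?thesis by blast
qed

end

section \<open>An operator calculus for maps of class \<open>C\<^sup>m\<close>\<close>

text \<open>Only quasi-norms are needed, as constants do not matter for differentiability.\<close>

definition qnormed :: "'a::real_vector nspace => bool" where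
  "qnormed Z \<longleftrightarrow> subspace (points Z) & (\<forall>u. nrm Z u >= 0) & (\<exists>\<kappa>>0. \<forall>u\<in>points Z. \<forall>v\<in>points Z. \<forall>a b.
     nrm Z (a *R u + b *R v) <= \<kappa> * (\<bar>a\<bar> * nrm Z u + \<bar>b\<bar> * nrm Z v))"

lemma qnormed_const:
  assumes "qnormed Z"
  obtains \<kappa> where "\<kappa> > 0" "!!u v. u \<in> points Z ==> v \<in> points Z ==> nrm Z (u + v) <= \<kappa> * (nrm Z u + nrm Z v)"
    "!!u a. u \<in> points Z ==> nrm Z (a *R u) <= \<kappa> * \<bar>a\<bar> * nrm Z u"
proof -
  obtain \<kappa> where k: "\<kappa> > 0" "!!u v a b. u \<in> points Z ==> v \<in> points Z ==>
     nrm Z (a *R u + b *R v) <= \<kappa> * (\<bar>a\<bar> * nrm Z u + \<bar>b\<bar> * nrm Z v)" using assms unfolding qnormed_def by blast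
  show ?thesis using k(2)[of _ _ 1 1] k(2)[of _ _ _ 0] by (intro that[of \<kappa>] k(1)) (force simp: mult.assoc)+
qed

lemma qnormed_zero: assumes "qnormed Z" shows "nrm Z 0 = 0"
proof -
  have "0 \<in> points Z" using assms by (auto simp: qnormed_def subspace_0)
  moreover obtain \<kappa> where "!!u a. u \<in> points Z ==> nrm Z (a *R u) <= \<kappa> * \<bar>a\<bar> * nrm Z u"
    by (rule qnormed_const[OF assms]) blast
  ultimately have "nrm Z (0 *R 0) <= \<kappa> * \<bar>0\<bar> * nrm Z 0" by blast
  then show ?thesis using assms by (simp add: qnormed_def order_antisym)
qed

lemma euclidean_nspace_simps [simp]: "points euclidean_nspace = UNIV" "nrm euclidean_nspace = norm"
  by (simp_all add: euclidean_nspace_def)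

lemma qnormed_euclidean: "qnormed euclidean_nspace"
  unfolding qnormed_def euclidean_nspace_simps
  by (auto intro!: exI[of _ 1] norm_triangle_le)

lemma qnormed_prod:
  assumes "qnormed Y" "qnormed Z" shows "qnormed (prod_nspace Y Z)"
proof -
  obtain \<kappa> where k: "\<kappa> > 0" "!!u v a b. u \<in> points Y ==> v \<in> points Y ==>
     nrm Y (a *R u + b *R v) <= \<kappa> * (\<bar>a\<bar> * nrm Y u + \<bar>b\<bar> * nrm Y v)" using assms(1) unfolding qnormed_def by blast
  obtain \<mu> where m: "\<mu> > 0" "!!u v a b. u \<in> points Z ==> v \<in> points Z ==>
     nrm Z (a *R u + b *R v) <= \<mu> * (\<bar>a\<bar> * nrm Z u + \<bar>b\<bar> * nrm Z v)" using assms(2) unfolding qnormed_def by blast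
  have n: "nrm Y u >= 0" "nrm Z v >= 0" for u v using assms by (auto simp: qnormed_def)
  have "nrm Y (a *R u + b *R v) + nrm Z (a *R u' + b *R v') \<le>
      (\<kappa> + \<mu>) * (\<bar>a\<bar> * (nrm Y u + nrm Z u') + \<bar>b\<bar> * (nrm Y v + nrm Z v'))"
    if "u \<in> points Y" "v \<in> points Y" "u' \<in> points Z" "v' \<in> points Z" for a b u v u' v'
  proof -
    have "0 <= \<mu> * (\<bar>a\<bar> * nrm Y u + \<bar>b\<bar> * nrm Y v)" "0 <= \<kappa> * (\<bar>a\<bar> * nrm Z u' + \<bar>b\<bar> * nrm Z v')"
      using k(1) m(1) n by simp_all
    then show ?thesis using k(2)[OF that(1,2), of a b] m(2)[OF that(3,4), of a b] by (simp add: algebra_simps)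
  qed
  moreover have "subspace (points Y \<times> points Z)" using assms by (intro subspace_Times) (auto simp: qnormed_def)
  ultimately show ?thesis
    unfolding qnormed_def prod_nspace_def using k(1) m(1) n
    by (auto intro!: exI[of _ "\<kappa> + \<mu>"])
qed

lemma prod_list_nrm_nonneg: "qnormed X ==> prod_list (map (nrm X) hs) >= 0"
  by (rule prod_list_nonneg) (auto simp: qnormed_def)

lemma prod_list_nrm_le_1: "qnormed X ==> \<forall>h\<in>set hs. nrm X h <= 1 ==> prod_list (map (nrm X) hs) <= 1"
proof (induction hs)
  case (Cons h hs)
  have "nrm X h >= 0" using Cons.prems by (simp add: qnormed_def)
  then show ?case using Cons mult_mono[of "nrm X h" 1 "prod_list (map (nrm X) hs)" 1] by (simp add: prod_list_nrm_nonneg)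
qed simp

lemma bounded_multilinearD:
  assumes "bounded_multilinear X Z j L" "qnormed X"
  obtains C where "C > 0" "!!hs. length hs = j ==> set hs \<subseteq> points X ==> nrm Z (L hs) <= C * prod_list (map (nrm X) hs)"
    "!!hs. length hs = j ==> set hs \<subseteq> points X ==> \<forall>h\<in>set hs. nrm X h <= 1 ==> nrm Z (L hs) <= C"
proof -
  obtain C where C: "!!hs. length hs = j ==> set hs \<subseteq> points X ==> nrm Z (L hs) <= C * prod_list (map (nrm X) hs)"
    using assms(1) unfolding bounded_multilinear_def by blast
  define D where "D = max C 1"
  have D: "nrm Z (L hs) <= D * prod_list (map (nrm X) hs)" if "length hs = j" "set hs \<subseteq> points X" for hs
    using C[OF that] mult_right_mono[of C D, OF _ prod_list_nrm_nonneg[OF assms(2), of hs]] by (simp add: D_def)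
  show ?thesis
  proof (rule that[of D])
    show "nrm Z (L hs) <= D" if "length hs = j" "set hs \<subseteq> points X" "\<forall>h\<in>set hs. nrm X h <= 1" for hs
    proof -
      have "D * prod_list (map (nrm X) hs) <= D * 1"
        by (intro mult_left_mono prod_list_nrm_le_1 assms(2) that(3)) (simp add: D_def)
      then show ?thesis using D[OF that(1,2)] by simp
    qed
  qed (use D in \<open>auto simp: D_def\<close>)
qed

lemma bounded_multilinear_head:
  assumes lin: "!!h. h \<in> points X ==> multilinear_on (points X) j (B h)"
    "!!u v a b hs. u \<in> points X ==> v \<in> points X ==> length hs = j ==> set hs \<subseteq> points X ==>
       B (a *R u + b *R v) hs = a *R B u hs + b *R B v hs"
    and pt: "!!h hs. h \<in> points X ==> length hs = j ==> set hs \<subseteq> points X ==> B h hs \<in> points Z"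
    and bd: "!!h hs. h \<in> points X ==> length hs = j ==> set hs \<subseteq> points X ==>
       nrm Z (B h hs) <= C * (nrm X h * prod_list (map (nrm X) hs))"
  shows "bounded_multilinear X Z (Suc j) (%hs. B (hd hs) (tl hs))"
  unfolding bounded_multilinear_def
proof (intro conjI allI impI exI[of _ C])
  show "multilinear_on (points X) (Suc j) (%hs. B (hd hs) (tl hs))"
    unfolding multilinear_on_def
  proof (intro allI impI)
    fix hs i u v a b
    assume *: "length hs = Suc j & set hs \<subseteq> points X & i < Suc j & u \<in> points X & v \<in> points X"
    then obtain h hs' where hs: "hs = h # hs'" by (cases hs) auto
    show "B (hd (hs[i := a *R u + b *R v])) (tl (hs[i := a *R u + b *R v])) =
      a *R B (hd (hs[i := u])) (tl (hs[i := u])) + b *R B (hd (hs[i := v])) (tl (hs[i := v]))"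
      using * hs lin unfolding multilinear_on_def by (cases i) auto
  qed
next
  fix hs :: "'a list" assume "length hs = Suc j & set hs \<subseteq> points X"
  moreover then obtain h hs' where "hs = h # hs'" by (cases hs) auto
  ultimately show "B (hd hs) (tl hs) \<in> points Z" "nrm Z (B (hd hs) (tl hs)) <= C * prod_list (map (nrm X) hs)"
    using pt bd by auto
qed

text \<open>\<open>ops r\<close> stands for operators that use \<open>r\<close> of \<open>m\<close>
  spare orders. The assumptions grade what remains: with nothing left there are local bounds and
  continuity for fixed \<open>\<xi>\<close>, with one order a Lipschitz bound and derivatives for
  fixed \<open>\<xi>\<close>, with two a quadratic remainder uniform in
  \<open>\<xi>\<close>.\<close>

locale operator_calculus =
  fixes X0 :: "'x::real_vector nspace" and Y :: "'y::real_vector nspace" and G :: "'p::euclidean_space set"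
    and ops :: "nat => ('p => 'x => 'y) set" and m :: nat
  assumes qX0: "qnormed X0" and qY: "qnormed Y"
    and ops_points: "[|r <= m; T \<in> ops r; \<gamma> \<in> G; \<xi> \<in> points X0|] ==> T \<gamma> \<xi> \<in> points Y"
    and ops_linear: "[|r <= m; T \<in> ops r; \<gamma> \<in> G; \<xi> \<in> points X0; \<eta> \<in> points X0|] ==>
      T \<gamma> (a *R \<xi> + b *R \<eta>) = a *R T \<gamma> \<xi> + b *R T \<gamma> \<eta>"
    and ops_bound: "[|r <= m; T \<in> ops r; \<gamma> \<in> G|] ==>
      \<exists>C>0. \<forall>h \<xi>. norm h * C <= 1 & \<xi> \<in> points X0 --> nrm Y (T (\<gamma> + h) \<xi>) <= C * nrm X0 \<xi>"
    and ops_continuous: "[|r <= m; T \<in> ops r; \<gamma> \<in> G; \<xi> \<in> points X0; e > 0|] ==>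
      \<exists>C>0. \<forall>h. norm h * C <= 1 --> nrm Y (T (\<gamma> + h) \<xi> - T \<gamma> \<xi>) <= e"
    and ops_lipschitz: "[|Suc r <= m; T \<in> ops r; \<gamma> \<in> G|] ==>
      \<exists>C>0. \<forall>h \<xi>. norm h * C <= 1 & \<xi> \<in> points X0 --> nrm Y (T (\<gamma> + h) \<xi> - T \<gamma> \<xi>) <= C * norm h * nrm X0 \<xi>"
    and ops_derivative: "[|Suc r <= m; T \<in> ops r|] ==> \<exists>T'. (\<forall>c\<in>Basis. T' c \<in> ops (Suc r)) \<and>
      (\<forall>\<gamma>\<in>G. \<forall>\<xi>\<in>points X0. \<forall>e>0. \<exists>C>0. \<forall>h. norm h * C <= 1 -->
        nrm Y (T (\<gamma> + h) \<xi> - T \<gamma> \<xi> - (\<Sum>c\<in>Basis. (h \<bullet> c) *R T' c \<gamma> \<xi>)) <= e * norm h) \<and>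
      (Suc (Suc r) <= m --> (\<forall>\<gamma>\<in>G. \<exists>C>0. \<forall>h \<xi>. norm h * C <= 1 & \<xi> \<in> points X0 -->
        nrm Y (T (\<gamma> + h) \<xi> - T \<gamma> \<xi> - (\<Sum>c\<in>Basis. (h \<bullet> c) *R T' c \<gamma> \<xi>)) <= C * (norm h * norm h) * nrm X0 \<xi>))"
begin

abbreviation "X \<equiv> prod_nspace (euclidean_nspace :: 'p nspace) X0"
abbreviation "U \<equiv> G \<times> points X0"

lemma qX: "qnormed X"
  by (rule qnormed_prod[OF qnormed_euclidean qX0])

lemma points_X: "h \<in> points X \<longleftrightarrow> snd h \<in> points X0"
  by (cases h) (simp add: prod_nspace_def)

lemma nrm_X: "nrm X h = norm (fst h) + nrm X0 (snd h)"
  by (simp add: prod_nspace_def)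

lemma nrm_nonneg: "nrm X0 \<xi> >= 0" "nrm Y y >= 0" "nrm X h >= 0"
  using qX0 qY qX unfolding qnormed_def by blast+

lemma less_nrm_X:
  "nrm X h < e ==> norm (fst h) < e" "nrm X h < e ==> nrm X0 (snd h) < e"
  "norm (fst h) <= nrm X h" "nrm X0 (snd h) <= nrm X h"
  using nrm_nonneg(1)[of "snd h"] norm_ge_zero[of "fst h"] unfolding nrm_X by linarith+

lemma points_closed:
  "\<xi> \<in> points X0 ==> \<eta> \<in> points X0 ==> \<xi> + \<eta> \<in> points X0" "\<xi> \<in> points X0 ==> a *R \<xi> \<in> points X0"
  "\<xi> \<in> points X0 ==> \<eta> \<in> points X0 ==> \<xi> - \<eta> \<in> points X0"
  "y \<in> points Y ==> z \<in> points Y ==> y + z \<in> points Y" "y \<in> points Y ==> a *R y \<in> points Y"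
  "y \<in> points Y ==> z \<in> points Y ==> y - z \<in> points Y"
  using qX0 qY unfolding qnormed_def by (blast intro: subspace_add subspace_scale subspace_diff)+

lemma points_sum: "(!!c. c \<in> I ==> f c \<in> points Y) ==> (\<Sum>c\<in>I. f c) \<in> points Y"
  using qY unfolding qnormed_def by (blast intro: subspace_sum)

lemma ops_scaleR: "[|r <= m; T \<in> ops r; \<gamma> \<in> G; \<xi> \<in> points X0|] ==> T \<gamma> (a *R \<xi>) = a *R T \<gamma> \<xi>"
  using ops_linear[of r T \<gamma> \<xi> \<xi> a 0] by simp

lemma ops_add: "[|r <= m; T \<in> ops r; \<gamma> \<in> G; \<xi> \<in> points X0; \<eta> \<in> points X0|] ==> T \<gamma> (\<xi> + \<eta>) = T \<gamma> \<xi> + T \<gamma> \<eta>"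
  using ops_linear[of r T \<gamma> \<xi> \<eta> 1 1] by simp

abbreviation "scalar_form j c \<equiv> bounded_multilinear X (euclidean_nspace :: real nspace) j c"
abbreviation "vector_form j L \<equiv> bounded_multilinear X X0 j L"

lemma form_scale_head:
  assumes Z: "qnormed Z" and L: "bounded_multilinear X Z j L"
  shows "bounded_multilinear X Z (Suc j) (%hs. (fst (hd hs) \<bullet> b) *R L (tl hs))"
proof -
  obtain C where C: "C > 0" "!!hs. length hs = j ==> set hs \<subseteq> points X ==> nrm Z (L hs) <= C * prod_list (map (nrm X) hs)"
    by (rule bounded_multilinearD[OF L qX]) blast
  obtain \<kappa> where k: "\<kappa> > 0" "!!u a. u \<in> points Z ==> nrm Z (a *R u) <= \<kappa> * \<bar>a\<bar> * nrm Z u"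
    by (rule qnormed_const[OF Z]) blast
  show ?thesis
  proof (rule bounded_multilinear_head[where B="%h hs. (fst h \<bullet> b) *R L hs" and C="\<kappa> * norm b * C"])
    show "multilinear_on (points X) j (%hs. (fst h \<bullet> b) *R L hs)" for h
      using L unfolding bounded_multilinear_def multilinear_on_def by (simp add: scaleR_add_right mult.commute)
    show pt: "(fst h \<bullet> b) *R L hs \<in> points Z" if "length hs = j" "set hs \<subseteq> points X" for h hs
      using that L Z by (auto simp: bounded_multilinear_def qnormed_def intro: subspace_scale)
    show "nrm Z ((fst h \<bullet> b) *R L hs) <= (\<kappa> * norm b * C) * (nrm X h * prod_list (map (nrm X) hs))"
      if "length hs = j" "set hs \<subseteq> points X" for h hs
    proof -
      have "nrm Z ((fst h \<bullet> b) *R L hs) <= \<kappa> * \<bar>fst h \<bullet> b\<bar> * nrm Z (L hs)"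
        using that L by (intro k(2)) (auto simp: bounded_multilinear_def)
      also have "... <= \<kappa> * (nrm X h * norm b) * (C * prod_list (map (nrm X) hs))"
        using k(1) C that Cauchy_Schwarz_ineq2[of "fst h" b] nrm_nonneg Z
        by (intro mult_mono) (auto simp: nrm_X qnormed_def intro!: mult_nonneg_nonneg order_trans[OF Cauchy_Schwarz_ineq2] mult_right_mono)
      finally show ?thesis by (simp add: mult_ac)
    qed
  qed (auto simp: inner_add_left scaleR_add_left)
qed

lemma form_snd_head:
  assumes c: "scalar_form j c" shows "vector_form (Suc j) (%hs. c (tl hs) *R snd (hd hs))"
proof -
  obtain C where C: "C > 0" "!!hs. length hs = j ==> set hs \<subseteq> points X ==> \<bar>c hs\<bar> <= C * prod_list (map (nrm X) hs)"
    by (rule bounded_multilinearD[OF c qX]) simp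
  obtain \<kappa> where k: "\<kappa> > 0" "!!u a. u \<in> points X0 ==> nrm X0 (a *R u) <= \<kappa> * \<bar>a\<bar> * nrm X0 u"
    by (rule qnormed_const[OF qX0]) blast
  show ?thesis
  proof (rule bounded_multilinear_head[where B="%h hs. c hs *R snd h" and C="\<kappa> * C"])
    show "multilinear_on (points X) j (%hs. c hs *R snd h)" for h
      using c unfolding bounded_multilinear_def multilinear_on_def by (simp add: scaleR_add_left)
    show "nrm X0 (c hs *R snd h) <= (\<kappa> * C) * (nrm X h * prod_list (map (nrm X) hs))"
      if "h \<in> points X" "length hs = j" "set hs \<subseteq> points X" for h hs
    proof -
      have "nrm X0 (c hs *R snd h) <= \<kappa> * \<bar>c hs\<bar> * nrm X0 (snd h)" using that by (intro k(2)) (simp add: points_X)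
      also have "... <= \<kappa> * (C * prod_list (map (nrm X) hs)) * nrm X h"
        using k(1) C that nrm_nonneg prod_list_nrm_nonneg[OF qX, of hs]
        by (intro mult_mono mult_left_mono) (auto simp: nrm_X)
      finally show ?thesis by (simp add: mult_ac)
    qed
  qed (auto simp: points_X points_closed scaleR_add_right mult.commute)
qed

text \<open>The higher derivatives of \<open>(\<gamma>, \<xi>) \<mapsto> T \<gamma> \<xi>\<close> are sums of terms of two kinds, depending on whether the
  argument \<open>\<xi>\<close> has been differentiated.  A term of the second kind depends on \<open>\<gamma>\<close> alone, but has to be
  differentiable uniformly in the argument, which costs one order.\<close>

inductive dterm :: "nat => nat => ('p \<times> 'x => ('p \<times> 'x) list => 'y) => bool" for s j where
  dterm_scalar: "[|T \<in> ops r; r + s <= m; scalar_form j c|] ==> dterm s j (%z hs. c hs *R T (fst z) (snd z))"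
| dterm_vector: "[|T \<in> ops r; Suc (r + s) <= m; vector_form j L|] ==> dterm s j (%z hs. T (fst z) (L hs))"
| dterm_add: "[|dterm s j F; dterm s j F'|] ==> dterm s j (%z hs. F z hs + F' z hs)"

lemma dterm_sum:
  "[|finite I; I ~= {}; !!c. c \<in> I ==> dterm s j (F c)|] ==> dterm s j (%z hs. \<Sum>c\<in>I. F c z hs)"
  by (induction I rule: finite_ne_induct) (auto intro: dterm_add)

definition unit_lists :: "nat => ('p \<times> 'x) list set" where
  "unit_lists j = {hs. length hs = j & (\<forall>h\<in>set hs. h \<in> points X & nrm X h <= 1)}"

lemma op_nrm_le:
  assumes "!!hs. hs \<in> unit_lists j ==> nrm Y (F hs) <= e" shows "op_nrm X Y j F <= e"
  unfolding op_nrm_def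
proof (rule cSUP_least)
  \<comment> \<open>The supremum must range over a nonempty set; a list of zeros is
    admissible.\<close>
  have "0 \<in> points X" using qX by (auto simp: qnormed_def subspace_0)
  then have "replicate j 0 \<in> {hs. length hs = j & (\<forall>h\<in>set hs. h \<in> points X & nrm X h <= 1)}"
    by (simp add: qnormed_zero[OF qX])
  then show "{hs. length hs = j & (\<forall>h\<in>set hs. h \<in> points X & nrm X h <= 1)} ~= {}" by blast
qed (use assms in \<open>auto simp: unit_lists_def\<close>)

lemma dterm_multilinear:
  assumes "dterm s j F" "x \<in> U" shows "bounded_multilinear X Y j (F x)"
  using assms
proof induction
  case (dterm_scalar T r c)
  define y where "y = T (fst x) (snd x)"
  have y: "y \<in> points Y" unfolding y_def using dterm_scalar by (intro ops_points[of r]) auto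
  obtain C where C: "C > 0" "!!hs. length hs = j ==> set hs \<subseteq> points X ==> \<bar>c hs\<bar> <= C * prod_list (map (nrm X) hs)"
    by (rule bounded_multilinearD[OF dterm_scalar(3) qX]) simp
  obtain \<kappa> where k: "\<kappa> > 0" "!!u a. u \<in> points Y ==> nrm Y (a *R u) <= \<kappa> * \<bar>a\<bar> * nrm Y u"
    by (rule qnormed_const[OF qY]) blast
  have "nrm Y (c hs *R y) <= (\<kappa> * C * nrm Y y) * prod_list (map (nrm X) hs)" if "length hs = j" "set hs \<subseteq> points X" for hs
  proof -
    have "nrm Y (c hs *R y) <= \<kappa> * \<bar>c hs\<bar> * nrm Y y" by (rule k(2)[OF y])
    also have "... <= \<kappa> * (C * prod_list (map (nrm X) hs)) * nrm Y y"
      using k(1) C that nrm_nonneg by (intro mult_right_mono mult_left_mono) auto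
    finally show ?thesis by (simp add: mult_ac)
  qed
  then show ?case
    using dterm_scalar(3) y unfolding bounded_multilinear_def multilinear_on_def y_def[symmetric]
    by (auto simp: scaleR_add_left points_closed)
next
  case (dterm_vector T r L)
  then have r: "r <= m" and g: "fst x \<in> G" by auto
  obtain C where C: "C > 0" "!!hs. length hs = j ==> set hs \<subseteq> points X ==> nrm X0 (L hs) <= C * prod_list (map (nrm X) hs)"
    by (rule bounded_multilinearD[OF dterm_vector(3) qX]) blast
  obtain D where D: "D > 0" "!!h \<xi>. norm h * D <= 1 ==> \<xi> \<in> points X0 ==> nrm Y (T (fst x + h) \<xi>) <= D * nrm X0 \<xi>"
    using ops_bound[OF r dterm_vector(1) g] by blast
  have pt: "L hs \<in> points X0" if "length hs = j" "set hs \<subseteq> points X" for hs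
    using dterm_vector(3) that by (auto simp: bounded_multilinear_def)
  have u: "set (hs[i := u]) \<subseteq> points X" if "set hs \<subseteq> points X" "u \<in> points X" for hs i u
    using that set_update_subset_insert[of hs i u] by auto
  have "multilinear_on (points X) j (%hs. T (fst x) (L hs))"
    using dterm_vector(3) ops_linear[OF r dterm_vector(1) g] u pt
    unfolding bounded_multilinear_def multilinear_on_def by simp
  moreover have "nrm Y (T (fst x) (L hs)) <= (D * C) * prod_list (map (nrm X) hs)"
    if "length hs = j" "set hs \<subseteq> points X" for hs
    using D(2)[of 0, OF _ pt[OF that]] order_trans[OF _ mult_left_mono[OF C(2)[OF that], of D]] D(1) by (simp add: mult.assoc)
  ultimately show ?case
    using pt ops_points[OF r dterm_vector(1) g] unfolding bounded_multilinear_def by blast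
next
  case (dterm_add F F')
  then have F: "bounded_multilinear X Y j (F x)" "bounded_multilinear X Y j (F' x)" by auto
  obtain C D where C: "!!hs. length hs = j ==> set hs \<subseteq> points X ==> nrm Y (F x hs) <= C * prod_list (map (nrm X) hs)"
    "!!hs. length hs = j ==> set hs \<subseteq> points X ==> nrm Y (F' x hs) <= D * prod_list (map (nrm X) hs)"
    using F unfolding bounded_multilinear_def by blast
  obtain \<kappa> where k: "\<kappa> > 0" "!!u v. u \<in> points Y ==> v \<in> points Y ==> nrm Y (u + v) <= \<kappa> * (nrm Y u + nrm Y v)"
    by (rule qnormed_const[OF qY]) blast
  have "nrm Y (F x hs + F' x hs) <= (\<kappa> * (C + D)) * prod_list (map (nrm X) hs)" if "length hs = j" "set hs \<subseteq> points X" for hs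
  proof -
    have "nrm Y (F x hs + F' x hs) <= \<kappa> * (nrm Y (F x hs) + nrm Y (F' x hs))"
      using F that by (intro k(2)) (auto simp: bounded_multilinear_def)
    also have "... <= \<kappa> * (C * prod_list (map (nrm X) hs) + D * prod_list (map (nrm X) hs))"
      using C[OF that] k(1) by (intro mult_left_mono add_mono) auto
    finally show ?thesis by (simp add: algebra_simps)
  qed
  then show ?case
    using F points_closed unfolding bounded_multilinear_def multilinear_on_def by (auto simp: scaleR_add_right)
qed

lemma dterm_points: "dterm s j F ==> x \<in> U ==> length hs = j ==> \<forall>h\<in>set hs. h \<in> points X ==> F x hs \<in> points Y"
  using dterm_multilinear unfolding bounded_multilinear_def by blast

text \<open>The weight \<open>w\<close> is \<open>1\<close> for continuity and \<open>nrm X\<close>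
  for differentiability, so that sums, scalar multiples and local estimates are treated
  once.\<close>

definition small :: "('p \<times> 'x => real) => 'p \<times> 'x => nat => ('p \<times> 'x => ('p \<times> 'x) list => 'y) => bool" where
  "small w x j R \<longleftrightarrow> (\<forall>e>0. \<exists>d>0. \<forall>y\<in>U. nrm X (y - x) < d --> (\<forall>hs\<in>unit_lists j. nrm Y (R y hs) <= e * w (y - x)))"

lemma small_cong:
  assumes "small w x j R" "!!y hs. y \<in> U ==> R y hs = R' y hs" shows "small w x j R'"
  unfolding small_def
proof (intro allI impI)
  fix e :: real assume "e > 0"
  then obtain d where "d > 0" "\<forall>y\<in>U. nrm X (y - x) < d --> (\<forall>hs\<in>unit_lists j. nrm Y (R y hs) <= e * w (y - x))"
    using assms(1) unfolding small_def by blast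
  then show "\<exists>d>0. \<forall>y\<in>U. nrm X (y - x) < d --> (\<forall>hs\<in>unit_lists j. nrm Y (R' y hs) <= e * w (y - x))"
    using assms(2) by metis
qed

lemma small_add:
  assumes R: "small w x j R" "small w x j R'" and w: "!!h. w h >= 0"
    and pt: "!!y hs. y \<in> U ==> hs \<in> unit_lists j ==> R y hs \<in> points Y & R' y hs \<in> points Y"
  shows "small w x j (%y hs. R y hs + R' y hs)"
  unfolding small_def
proof (intro allI impI)
  fix e :: real assume e: "e > 0"
  obtain \<kappa> where k: "\<kappa> > 0" "!!u v. u \<in> points Y ==> v \<in> points Y ==> nrm Y (u + v) <= \<kappa> * (nrm Y u + nrm Y v)"
    by (rule qnormed_const[OF qY]) blast
  define e' where "e' = e / (2 * \<kappa>)"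
  have e': "e' > 0" "\<kappa> * (e' + e') = e" using e k(1) by (auto simp: e'_def)
  obtain d where d: "d > 0" "!!y hs. y \<in> U ==> nrm X (y - x) < d ==> hs \<in> unit_lists j ==> nrm Y (R y hs) <= e' * w (y - x)"
    using R(1) e'(1) unfolding small_def by blast
  obtain d' where d': "d' > 0" "!!y hs. y \<in> U ==> nrm X (y - x) < d' ==> hs \<in> unit_lists j ==> nrm Y (R' y hs) <= e' * w (y - x)"
    using R(2) e'(1) unfolding small_def by blast
  show "\<exists>d>0. \<forall>y\<in>U. nrm X (y - x) < d --> (\<forall>hs\<in>unit_lists j. nrm Y (R y hs + R' y hs) <= e * w (y - x))"
  proof (intro exI[of _ "min d d'"] conjI ballI impI)
    fix y hs assume y: "y \<in> U" "nrm X (y - x) < min d d'" "hs \<in> unit_lists j"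
    have "nrm Y (R y hs + R' y hs) <= \<kappa> * (nrm Y (R y hs) + nrm Y (R' y hs))" using pt[OF y(1,3)] by (intro k(2)) auto
    also have "... <= \<kappa> * (e' * w (y - x) + e' * w (y - x))"
      using d(2)[OF y(1) _ y(3)] d'(2)[OF y(1) _ y(3)] y(2) k(1) by (intro mult_left_mono add_mono) auto
    also have "... = (\<kappa> * (e' + e')) * w (y - x)" by (simp only: distrib_left distrib_right mult.assoc)
    finally show "nrm Y (R y hs + R' y hs) <= e * w (y - x)" unfolding e'(2) .
  qed (use d d' in auto)
qed

lemma small_scale:
  assumes R: "small w x 0 (%y _. R y)" and w: "!!h. w h >= 0" and c: "scalar_form j c"
    and pt: "!!y. y \<in> U ==> R y \<in> points Y"
  shows "small w x j (%y hs. c hs *R R y)"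
  unfolding small_def
proof (intro allI impI)
  fix e :: real assume e: "e > 0"
  obtain C where C: "C > 0" "!!hs. hs \<in> unit_lists j ==> \<bar>c hs\<bar> <= C"
    by (rule bounded_multilinearD[OF c qX]) (force simp: unit_lists_def)
  obtain \<kappa> where k: "\<kappa> > 0" "!!u a. u \<in> points Y ==> nrm Y (a *R u) <= \<kappa> * \<bar>a\<bar> * nrm Y u"
    by (rule qnormed_const[OF qY]) blast
  define e' where "e' = e / (\<kappa> * C)"
  have e': "e' > 0" "\<kappa> * C * e' = e" using e k(1) C(1) by (auto simp: e'_def)
  have u0: "[] \<in> unit_lists 0" by (simp add: unit_lists_def)
  obtain d where d: "d > 0" "!!y. y \<in> U ==> nrm X (y - x) < d ==> nrm Y (R y) <= e' * w (y - x)"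
    using R e'(1) u0 unfolding small_def by meson
  show "\<exists>d>0. \<forall>y\<in>U. nrm X (y - x) < d --> (\<forall>hs\<in>unit_lists j. nrm Y (c hs *R R y) <= e * w (y - x))"
  proof (intro exI[of _ d] conjI ballI impI d(1))
    fix y hs assume y: "y \<in> U" "nrm X (y - x) < d" "hs \<in> unit_lists j"
    have "nrm Y (c hs *R R y) <= \<kappa> * \<bar>c hs\<bar> * nrm Y (R y)" by (rule k(2)[OF pt[OF y(1)]])
    also have "... <= \<kappa> * C * (e' * w (y - x))"
      using d(2)[OF y(1,2)] C(2)[OF y(3)] k(1) nrm_nonneg by (intro mult_mono) auto
    also have "... = (\<kappa> * C * e') * w (y - x)" by simp
    finally show "nrm Y (c hs *R R y) <= e * w (y - x)" by (simp add: e'(2))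
  qed
qed

lemma small_near:
  assumes B: "B >= 0" and R: "!!e. e > 0 ==> \<exists>C>0. \<exists>d>0. \<forall>y\<in>U. \<forall>hs\<in>unit_lists j.
      norm (fst (y - x)) * C <= 1 --> nrm X (y - x) < d --> nrm Y (R y hs) <= e * B * w (y - x)"
    and w: "!!h. w h >= 0"
  shows "small w x j R"
  unfolding small_def
proof (intro allI impI)
  fix e :: real assume e: "e > 0"
  then have "e / (B + 1) > 0" using B by simp
  from R[OF this] obtain C d where C: "C > 0" "d > 0" "\<forall>y\<in>U. \<forall>hs\<in>unit_lists j. norm (fst (y - x)) * C <= 1 -->
      nrm X (y - x) < d --> nrm Y (R y hs) <= e / (B + 1) * B * w (y - x)" by blast
  show "\<exists>d>0. \<forall>y\<in>U. nrm X (y - x) < d --> (\<forall>hs\<in>unit_lists j. nrm Y (R y hs) <= e * w (y - x))"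
  proof (intro exI[of _ "min d (1 / C)"] conjI ballI impI)
    fix y hs assume y: "y \<in> U" "nrm X (y - x) < min d (1 / C)" "hs \<in> unit_lists j"
    have "norm (fst (y - x)) < 1 / C" using y(2) by (intro less_nrm_X) simp
    then have "norm (fst (y - x)) * C <= 1" using C(1) by (simp add: field_simps)
    then have "nrm Y (R y hs) <= (e / (B + 1) * B) * w (y - x)" using C(3)[rule_format, OF y(1,3)] y(2) by simp
    also have "... <= e * w (y - x)" using B e w by (intro mult_right_mono) (auto simp: field_simps)
    finally show "nrm Y (R y hs) <= e * w (y - x)" .
  qed (use C in auto)
qed

text \<open>A term of the first kind splits into the variation of the operator at the fixed
  \<open>snd x\<close>, where continuity for fixed argument is enough, and the operator applied to
  the small \<open>snd (y - x)\<close>, where a local bound is enough. The second kind needs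
  uniformity over unit arguments, hence the Lipschitz bound.\<close>

lemma dterm_continuous:
  assumes "dterm s j F" "x \<in> U" shows "small (%_. 1) x j (%y hs. F y hs - F x hs)"
  using assms
proof induction
  case (dterm_scalar T r c)
  then have r: "r <= m" and x: "fst x \<in> G" "snd x \<in> points X0" by auto
  note T = dterm_scalar(1)
  have a: "small (%_. 1) x 0 (%y _. T (fst y) (snd x) - T (fst x) (snd x))"
  proof (rule small_near[of 1])
    fix e :: real assume "e > 0"
    then obtain C where "C > 0" "!!h. norm h * C <= 1 ==> nrm Y (T (fst x + h) (snd x) - T (fst x) (snd x)) <= e"
      using ops_continuous[OF r T x] by meson
    from this(1) this(2)[of "fst (_ - x)"]
    show "\<exists>C>0. \<exists>d>0. \<forall>y\<in>U. \<forall>hs\<in>unit_lists 0. norm (fst (y - x)) * C <= 1 --> nrm X (y - x) < d -->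
        nrm Y (T (fst y) (snd x) - T (fst x) (snd x)) <= e * 1 * 1"
      by (intro exI[of _ C] exI[of _ 1] conjI) simp_all
  qed simp_all
  obtain C where C: "C > 0" "!!h \<xi>. norm h * C <= 1 ==> \<xi> \<in> points X0 ==> nrm Y (T (fst x + h) \<xi>) <= C * nrm X0 \<xi>"
    using ops_bound[OF r T x(1)] by blast
  have b: "small (%_. 1) x 0 (%y _. T (fst y) (snd (y - x)))"
  proof (rule small_near[of C])
    fix e :: real assume e: "e > 0"
    have "nrm Y (T (fst y) (snd (y - x))) <= e * C * 1"
      if "y \<in> U" "norm (fst (y - x)) * C <= 1" "nrm X (y - x) < e" for y
    proof -
      have "nrm Y (T (fst x + fst (y - x)) (snd (y - x))) <= C * nrm X0 (snd (y - x))"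
        using that x by (intro C(2)) (auto simp: points_closed)
      also have "... <= C * e" using that(3) C(1) by (intro mult_left_mono) (auto simp del: fst_diff snd_diff intro: less_imp_le less_nrm_X)
      finally show ?thesis by (simp add: mult.commute)
    qed
    then show "\<exists>C'>0. \<exists>d>0. \<forall>y\<in>U. \<forall>hs\<in>unit_lists 0. norm (fst (y - x)) * C' <= 1 --> nrm X (y - x) < d -->
        nrm Y (T (fst y) (snd (y - x))) <= e * C * 1" using C(1) e by blast
  qed (use C in auto)
  have pt: "T (fst y) (snd x) - T (fst x) (snd x) \<in> points Y" "T (fst y) (snd (y - x)) \<in> points Y" if "y \<in> U" for y
    using that x by (auto intro!: points_closed ops_points[OF r T])
  have sm: "small (%_. 1) x j (%y hs. c hs *R ((T (fst y) (snd x) - T (fst x) (snd x)) + T (fst y) (snd (y - x))))"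
    using pt by (intro small_scale[OF small_add[OF a b] _ dterm_scalar(3)]) (auto intro: points_closed)
  have eq: "(T (fst y) (snd x) - T (fst x) (snd x)) + T (fst y) (snd (y - x)) = T (fst y) (snd y) - T (fst x) (snd x)"
    if "y \<in> U" for y
    using ops_add[OF r T, of "fst y" "snd x" "snd (y - x)"] that x by (auto simp: points_closed)
  show ?case by (rule small_cong[OF sm]) (simp only: eq scaleR_diff_right)
next
  case (dterm_vector T r L)
  then have r: "Suc r <= m" and x: "fst x \<in> G" by auto
  obtain C where C: "C > 0" "!!hs. hs \<in> unit_lists j ==> nrm X0 (L hs) <= C"
    by (rule bounded_multilinearD[OF dterm_vector(3) qX]) (force simp: unit_lists_def)
  obtain D where D: "D > 0" "!!h \<xi>. norm h * D <= 1 ==> \<xi> \<in> points X0 ==>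
      nrm Y (T (fst x + h) \<xi> - T (fst x) \<xi>) <= D * norm h * nrm X0 \<xi>"
    using ops_lipschitz[OF r dterm_vector(1) x] by blast
  show ?case
  proof (rule small_near[of "D * C"])
    fix e :: real assume e: "e > 0"
    have "nrm Y (T (fst y) (L hs) - T (fst x) (L hs)) <= e * (D * C) * 1"
      if "hs \<in> unit_lists j" "norm (fst (y - x)) * D <= 1" "nrm X (y - x) < e" for y hs
    proof -
      have "nrm Y (T (fst x + fst (y - x)) (L hs) - T (fst x) (L hs)) <= D * norm (fst (y - x)) * nrm X0 (L hs)"
        using that dterm_vector(3) by (intro D(2)) (auto simp: bounded_multilinear_def unit_lists_def)
      also have "... <= D * e * C"
        using that C D(1) nrm_nonneg e by (intro mult_mono) (auto simp del: fst_diff snd_diff intro: less_imp_le less_nrm_X)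
      finally show ?thesis by (simp add: mult_ac)
    qed
    then show "\<exists>C'>0. \<exists>d>0. \<forall>y\<in>U. \<forall>hs\<in>unit_lists j. norm (fst (y - x)) * C' <= 1 --> nrm X (y - x) < d -->
        nrm Y (T (fst y) (L hs) - T (fst x) (L hs)) <= e * (D * C) * 1" using D(1) e by blast
  qed (use C D in auto)
next
  case (dterm_add F F')
  have "small (%_. 1) x j (%y hs. (F y hs - F x hs) + (F' y hs - F' x hs))"
    using dterm_add
    by (intro small_add conjI points_closed(6) dterm_points[OF dterm_add(1)] dterm_points[OF dterm_add(2)])
      (simp_all add: unit_lists_def)
  then show ?case by (simp add: algebra_simps)
qed

text \<open>The order count closes: differentiating in \<open>\<gamma>\<close> raises
  \<open>r\<close> while \<open>s\<close> drops by one; differentiating in \<open>\<xi>\<close>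
  keeps \<open>r\<close>, and the drop of \<open>s\<close> pays for the stricter condition on terms
  of the second kind.\<close>

lemma dterm_derivative:
  assumes "dterm (Suc s) j F"
  shows "\<exists>F'. dterm s (Suc j) F' & (\<forall>x\<in>U. small (nrm X) x j (%y hs. F y hs - F x hs - F' x ((y - x) # hs)))"
  using assms
proof induction
  case (dterm_scalar T r c)
  then have r: "r <= m" "Suc r <= m" by auto
  note T = dterm_scalar(1) and c = dterm_scalar(3)
  obtain T' where T': "!!b. b \<in> Basis ==> T' b \<in> ops (Suc r)"
    and dT: "!!\<gamma> \<xi> e. \<gamma> \<in> G ==> \<xi> \<in> points X0 ==> e > 0 ==> \<exists>C>0. \<forall>h. norm h * C <= 1 -->
        nrm Y (T (\<gamma> + h) \<xi> - T \<gamma> \<xi> - (\<Sum>b\<in>Basis. (h \<bullet> b) *R T' b \<gamma> \<xi>)) <= e * norm h"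
    using ops_derivative[OF r(2) T] by blast
  define F' where "F' z hs = (\<Sum>b\<in>Basis. ((fst (hd hs) \<bullet> b) *R c (tl hs)) *R T' b (fst z) (snd z)) +
      T (fst z) (c (tl hs) *R snd (hd hs))" for z hs
  have "dterm s (Suc j) (%z hs. \<Sum>b\<in>Basis. ((fst (hd hs) \<bullet> b) *R c (tl hs)) *R T' b (fst z) (snd z))"
  proof (rule dterm_sum)
    fix b :: 'p assume "b \<in> Basis"
    with T' dterm_scalar(2) show "dterm s (Suc j) (%z hs. ((fst (hd hs) \<bullet> b) *R c (tl hs)) *R T' b (fst z) (snd z))"
      by (intro dterm.dterm_scalar[of _ "Suc r"] form_scale_head[OF qnormed_euclidean c]) auto
  qed auto
  moreover have "dterm s (Suc j) (%z hs. T (fst z) (c (tl hs) *R snd (hd hs)))"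
    using dterm_scalar by (intro dterm.dterm_vector[of _ r] form_snd_head) auto
  ultimately have "dterm s (Suc j) F'" unfolding F'_def[abs_def] by (rule dterm.dterm_add)
  moreover have "small (nrm X) x j (%y hs. c hs *R T (fst y) (snd y) - c hs *R T (fst x) (snd x) - F' x ((y - x) # hs))"
    if x: "x \<in> U" for x
  proof -
    have x': "fst x \<in> G" "snd x \<in> points X0" using x by auto
    \<comment> \<open>\<open>R\<close> is the Taylor remainder at the fixed argument
      \<open>snd x\<close>; \<open>S\<close> is the increment of the operator on
      \<open>snd (y - x)\<close>, a product of two small factors by the Lipschitz bound.\<close>
    define R where "R y = T (fst y) (snd x) - T (fst x) (snd x) - (\<Sum>b\<in>Basis. (fst (y - x) \<bullet> b) *R T' b (fst x) (snd x))" for y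
    define S where "S y = T (fst y) (snd (y - x)) - T (fst x) (snd (y - x))" for y
    have a: "small (nrm X) x 0 (%y _. R y)"
    proof (rule small_near[of 1])
      fix e :: real assume e: "e > 0"
      then obtain C where C: "C > 0" "!!h. norm h * C <= 1 ==> nrm Y (T (fst x + h) (snd x) - T (fst x) (snd x) -
          (\<Sum>b\<in>Basis. (h \<bullet> b) *R T' b (fst x) (snd x))) <= e * norm h" using dT[OF x'] by meson
      have "nrm Y (R y) <= e * 1 * nrm X (y - x)" if "norm (fst (y - x)) * C <= 1" for y
        using C(2)[OF that] order_trans[OF _ mult_left_mono[of "norm (fst (y - x))" "nrm X (y - x)" e]] e nrm_nonneg
        by (simp add: R_def nrm_X)
      then show "\<exists>C>0. \<exists>d>0. \<forall>y\<in>U. \<forall>hs\<in>unit_lists 0. norm (fst (y - x)) * C <= 1 --> nrm X (y - x) < d -->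
          nrm Y (R y) <= e * 1 * nrm X (y - x)" using C(1) e by blast
    qed (use qX in \<open>auto simp: qnormed_def\<close>)
    obtain D where D: "D > 0" "!!h \<xi>. norm h * D <= 1 ==> \<xi> \<in> points X0 ==>
        nrm Y (T (fst x + h) \<xi> - T (fst x) \<xi>) <= D * norm h * nrm X0 \<xi>"
      using ops_lipschitz[OF r(2) T x'(1)] by blast
    have b: "small (nrm X) x 0 (%y _. S y)"
    proof (rule small_near[of D])
      fix e :: real assume e: "e > 0"
      have "nrm Y (S y) <= e * D * nrm X (y - x)" if "y \<in> U" "norm (fst (y - x)) * D <= 1" "nrm X (y - x) < e" for y
      proof -
        have "nrm Y (T (fst x + fst (y - x)) (snd (y - x)) - T (fst x) (snd (y - x))) <= D * norm (fst (y - x)) * nrm X0 (snd (y - x))"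
          using that x' by (intro D(2)) (auto simp: points_closed)
        also have "... <= D * e * nrm X (y - x)"
          using that(3) D(1) nrm_nonneg e by (intro mult_mono) (auto simp del: fst_diff snd_diff intro: less_imp_le less_nrm_X)
        finally show ?thesis by (simp add: S_def mult_ac)
      qed
      then show "\<exists>C>0. \<exists>d>0. \<forall>y\<in>U. \<forall>hs\<in>unit_lists 0. norm (fst (y - x)) * C <= 1 --> nrm X (y - x) < d -->
          nrm Y (S y) <= e * D * nrm X (y - x)" using D(1) e by blast
    qed (use D qX in \<open>auto simp: qnormed_def\<close>)
    have pt: "R y \<in> points Y" "S y \<in> points Y" if "y \<in> U" for y
    proof -
      have "snd (y - x) \<in> points X0" "fst y \<in> G" using that x' by (auto intro: points_closed)
      then show "R y \<in> points Y" "S y \<in> points Y"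
        unfolding R_def S_def using x' T'
        by (auto simp del: snd_diff intro!: points_closed(4-6) points_sum ops_points[OF r(1) T] ops_points[OF r(2)])
    qed
    have "small (nrm X) x j (%y hs. c hs *R (R y + S y))"
      using pt qX by (intro small_scale[OF small_add[OF a b] _ c]) (auto simp: qnormed_def intro: points_closed)
    moreover have "c hs *R (R y + S y) = c hs *R T (fst y) (snd y) - c hs *R T (fst x) (snd x) - F' x ((y - x) # hs)"
      if "y \<in> U" for y hs
    proof -
      have e: "snd y - snd x \<in> points X0" using that x' by (auto intro: points_closed)
      have "T (fst y) (snd y) = T (fst y) (snd x) + T (fst y) (snd y - snd x)"
        using ops_add[OF r(1) T _ x'(2) e, of "fst y"] that by auto
      then show ?thesis
        using ops_scaleR[OF r(1) T x'(1) e, of "c hs"]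
        by (simp add: R_def S_def F'_def scaleR_add_right scaleR_diff_right scaleR_sum_right algebra_simps)
    qed
    ultimately show ?thesis by (rule small_cong)
  qed
  ultimately show ?case by blast
next
  case (dterm_vector T r L)
  then have r: "r <= m" "Suc r <= m" "Suc (Suc r) <= m" by auto
  note T = dterm_vector(1) and L = dterm_vector(3)
  obtain T' where T': "!!b. b \<in> Basis ==> T' b \<in> ops (Suc r)"
    and dT: "!!\<gamma>. \<gamma> \<in> G ==> \<exists>C>0. \<forall>h \<xi>. norm h * C <= 1 & \<xi> \<in> points X0 -->
        nrm Y (T (\<gamma> + h) \<xi> - T \<gamma> \<xi> - (\<Sum>b\<in>Basis. (h \<bullet> b) *R T' b \<gamma> \<xi>)) <= C * (norm h * norm h) * nrm X0 \<xi>"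
    using ops_derivative[OF r(2) T] r(3) by blast
  \<comment> \<open>The factor \<open>fst (hd hs) \<bullet> b\<close> is put inside the operator, so
    that the argument is again a bounded multilinear form.\<close>
  define F' where "F' z hs = (\<Sum>b\<in>Basis. T' b (fst z) ((fst (hd hs) \<bullet> b) *R L (tl hs)))" for z :: "'p \<times> 'x" and hs
  have "dterm s (Suc j) F'"
    unfolding F'_def[abs_def]
  proof (rule dterm_sum)
    fix b :: 'p assume "b \<in> Basis"
    with T' dterm_vector(2) show "dterm s (Suc j) (%z hs. T' b (fst z) ((fst (hd hs) \<bullet> b) *R L (tl hs)))"
      by (intro dterm.dterm_vector[of _ "Suc r"] form_scale_head[OF qX0 L]) auto
  qed auto
  moreover have "small (nrm X) x j (%y hs. T (fst y) (L hs) - T (fst x) (L hs) - F' x ((y - x) # hs))" if x: "x \<in> U" for x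
  proof -
    have x': "fst x \<in> G" using x by auto
    obtain C where C: "C > 0" "!!hs. hs \<in> unit_lists j ==> nrm X0 (L hs) <= C"
      by (rule bounded_multilinearD[OF L qX]) (force simp: unit_lists_def)
    obtain D where D: "D > 0" "!!h \<xi>. norm h * D <= 1 ==> \<xi> \<in> points X0 ==>
        nrm Y (T (fst x + h) \<xi> - T (fst x) \<xi> - (\<Sum>b\<in>Basis. (h \<bullet> b) *R T' b (fst x) \<xi>)) <= D * (norm h * norm h) * nrm X0 \<xi>"
      using dT[OF x'] by blast
    show ?thesis
    proof (rule small_near[of "D * C"])
      fix e :: real assume e: "e > 0"
      have "nrm Y (T (fst y) (L hs) - T (fst x) (L hs) - F' x ((y - x) # hs)) <= e * (D * C) * nrm X (y - x)"
        if "hs \<in> unit_lists j" "norm (fst (y - x)) * D <= 1" "nrm X (y - x) < e" for y hs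
      proof -
        have Lp: "L hs \<in> points X0" using that L by (auto simp: bounded_multilinear_def unit_lists_def)
        let ?h = "fst (y - x)"
        have "T (fst y) (L hs) - T (fst x) (L hs) - F' x ((y - x) # hs) =
            T (fst x + ?h) (L hs) - T (fst x) (L hs) - (\<Sum>b\<in>Basis. (?h \<bullet> b) *R T' b (fst x) (L hs))"
          by (simp add: F'_def ops_scaleR[OF r(2) T' x' Lp])
        also have "nrm Y ... <= D * (norm ?h * norm ?h) * nrm X0 (L hs)" by (rule D(2)[OF that(2) Lp])
        also have "... <= D * (e * nrm X (y - x)) * C"
          using that C D(1) nrm_nonneg e by (intro mult_mono) (auto simp del: fst_diff snd_diff intro: less_imp_le less_nrm_X)
        finally show ?thesis by (simp add: mult_ac)
      qed
      then show "\<exists>C'>0. \<exists>d>0. \<forall>y\<in>U. \<forall>hs\<in>unit_lists j. norm (fst (y - x)) * C' <= 1 --> nrm X (y - x) < d -->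
          nrm Y (T (fst y) (L hs) - T (fst x) (L hs) - F' x ((y - x) # hs)) <= e * (D * C) * nrm X (y - x)"
        using D(1) e by blast
    qed (use C D qX in \<open>auto simp: qnormed_def\<close>)
  qed
  ultimately show ?case by blast
next
  case (dterm_add F1 F2)
  obtain F1' where F1: "dterm s (Suc j) F1'" "!!x. x \<in> U ==> small (nrm X) x j (%y hs. F1 y hs - F1 x hs - F1' x ((y - x) # hs))"
    using dterm_add by blast
  obtain F2' where F2: "dterm s (Suc j) F2'" "!!x. x \<in> U ==> small (nrm X) x j (%y hs. F2 y hs - F2 x hs - F2' x ((y - x) # hs))"
    using dterm_add by blast
  have "small (nrm X) x j (%y hs. F1 y hs + F2 y hs - (F1 x hs + F2 x hs) - (F1' x ((y - x) # hs) + F2' x ((y - x) # hs)))"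
    if x: "x \<in> U" for x
  proof -
    have p: "F y hs - F x hs - F' x ((y - x) # hs) \<in> points Y"
      if "dterm (Suc s) j F" "dterm s (Suc j) F'" "y \<in> U" "hs \<in> unit_lists j" for F F' y hs
      using that x
      by (intro points_closed(6) dterm_points[OF that(1)] dterm_points[OF that(2)])
        (auto simp: unit_lists_def points_X intro: points_closed(3))
    have "small (nrm X) x j (%y hs. (F1 y hs - F1 x hs - F1' x ((y - x) # hs)) + (F2 y hs - F2 x hs - F2' x ((y - x) # hs)))"
      using F1 F2 x p dterm_add qX by (intro small_add) (auto simp: qnormed_def)
    then show ?thesis by (simp add: algebra_simps)
  qed
  with dterm.dterm_add[OF F1(1) F2(1)] show ?case by blast
qed

lemma dterm_Cm: "dterm s j F ==> Cm_multi s X Y U j F"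
proof (induction s arbitrary: j F)
  case 0
  have "\<exists>d>0. \<forall>y\<in>U. nrm X (y - x) < d --> op_nrm X Y j (%hs. F y hs - F x hs) < e" if xe: "x \<in> U" "e > 0" for x e
  proof -
    \<comment> \<open>Half of \<open>e\<close>, because passing to the supremum leaves only a weak
      inequality.\<close>
    have "e / 2 > 0" using xe by simp
    then obtain d where "d > 0" "!!y hs. y \<in> U ==> nrm X (y - x) < d ==> hs \<in> unit_lists j ==> nrm Y (F y hs - F x hs) <= e / 2 * 1"
      using dterm_continuous[OF "0.prems" xe(1)] unfolding small_def by meson
    then show ?thesis using op_nrm_le[of j _ "e / 2"] xe(2) by (intro exI[of _ d]) (fastforce intro: le_less_trans)
  qed
  then show ?case using dterm_multilinear[OF "0.prems"] by simp
next
  case (Suc s)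
  obtain F' where F': "dterm s (Suc j) F'" "!!x. x \<in> U ==> small (nrm X) x j (%y hs. F y hs - F x hs - F' x ((y - x) # hs))"
    using dterm_derivative[OF Suc.prems] by blast
  have "\<exists>d>0. \<forall>y\<in>U. nrm X (y - x) < d --> op_nrm X Y j (%hs. F y hs - F x hs - F' x ((y - x) # hs)) <= e * nrm X (y - x)"
    if xe: "x \<in> U" "e > 0" for x e
  proof -
    obtain d where d: "d > 0" "!!y hs. y \<in> U ==> nrm X (y - x) < d ==> hs \<in> unit_lists j ==>
        nrm Y (F y hs - F x hs - F' x ((y - x) # hs)) <= e * nrm X (y - x)"
      using F'(2)[OF xe(1)] xe(2) unfolding small_def by blast
    show ?thesis using d by (intro exI[of _ d] conjI ballI impI op_nrm_le)
  qed
  then show ?case using dterm_multilinear[OF Suc.prems] Suc.IH[OF F'(1)] unfolding Cm_multi.simps by blast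
qed

lemma ops_Cm_map:
  assumes "T \<in> ops 0" shows "Cm_map m X Y U (%z. T (fst z) (snd z))"
proof -
  have "scalar_form 0 (%_. 1)" by (auto simp: bounded_multilinear_def multilinear_on_def)
  then have "dterm m 0 (%z hs. 1 *R T (fst z) (snd z))" by (intro dterm_scalar[OF assms]) auto
  then show ?thesis unfolding Cm_map_def by (intro dterm_Cm) simp
qed

end

lemma Cm_multi_cong:
  assumes "!!x. x \<in> U ==> F x = F' x" "Cm_multi m X Y U j F" shows "Cm_multi m X Y U j F'"
  using assms(2) by (cases m) (simp_all add: assms(1) cong: ball_cong)

section \<open>Composition operators on Sobolev spaces\<close>

lemma rep_S2_fun_measurable: "rep_S2_fun \<xi> \<in> borel_measurable mu"
  using Quotient3_rep_reflp[OF Quotient3_S2_fun, of \<xi>] by simp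

lemma rep_abs_S2_fun: "f \<in> borel_measurable mu ==> AE x in S2_measure. rep_S2_fun (abs_S2_fun f) x = f x"
  using Quotient3_rep_abs[OF Quotient3_S2_fun, of f] by simp

lemma S2_fun_eqI: "AE x in S2_measure. rep_S2_fun \<xi> x = rep_S2_fun \<eta> x ==> \<xi> = \<eta>"
  using Quotient3_rel_rep[OF Quotient3_S2_fun, of \<xi> \<eta>] rep_S2_fun_measurable by blast

lemma abs_S2_fun_eqI:
  "[|f \<in> borel_measurable mu; h \<in> borel_measurable mu; AE x in S2_measure. f x = h x|] ==> abs_S2_fun f = abs_S2_fun h"
  using Quotient3_rel_abs[OF Quotient3_S2_fun, of f h] by simp

lemma rep_S2_fun_lincomb:
  "AE x in S2_measure. rep_S2_fun (a *R \<xi> + b *R \<eta>) x = a *R rep_S2_fun \<xi> x + b *R rep_S2_fun \<eta> x"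
proof -
  have r: "abs_S2_fun (rep_S2_fun \<zeta>) = \<zeta>" for \<zeta> :: "'a S2_fun" by (rule Quotient3_abs_rep[OF Quotient3_S2_fun])
  have m: "(%x. c *R rep_S2_fun \<zeta> x) \<in> borel_measurable mu" for c and \<zeta> :: "'a S2_fun"
    by (intro borel_measurable_scaleR rep_S2_fun_measurable borel_measurable_const)
  have "a *R abs_S2_fun (rep_S2_fun \<xi>) + b *R abs_S2_fun (rep_S2_fun \<eta>) =
      abs_S2_fun (%x. a *R rep_S2_fun \<xi> x + b *R rep_S2_fun \<eta> x)"
    by (simp add: scaleR_S2_fun.abs_eq plus_S2_fun.abs_eq rep_S2_fun_measurable m)
  then show ?thesis
    unfolding r by (simp add: rep_abs_S2_fun borel_measurable_add m)
qed

definition jet_of :: "real => nat => 'b S2_fun => 'b::euclidean_space jets => bool" where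
  "jet_of p k \<xi> J \<longleftrightarrow> wjet k J & lpjet p k J & (AE x in S2_measure. J [] x = rep_S2_fun \<xi> x)"

lemma wjet_unique:
  assumes "wjet k J" "wjet k J'" "AE x in S2_measure. J [] x = J' [] x" "w \<in> words k"
  shows "AE x in S2_measure. J w x = J' w x"
  using assms(4)
proof (induction w)
  case (Cons a w)
  then show ?case using assms(1,2) words_ConsD[OF Cons.prems] unfolding wjet_def by (blast intro: weak_rot_unique)
qed (use assms(3) in simp)

lemma jet_of_unique: "jet_of p k \<xi> J ==> jet_of p k \<xi> J' ==> w \<in> words k ==> AE x in S2_measure. J w x = J' w x"
  unfolding jet_of_def by (elim conjE, rule wjet_unique) (auto elim: AE_mp)

lemma jet_of_jetE:
  assumes "jet_of p k \<xi> J" "jet_of p k \<xi> J'" shows "jetE p k J = jetE p k J'"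
  unfolding jetE_def
proof (rule sum.cong[OF refl])
  fix w :: "(real^3) list" assume w: "w \<in> words k"
  have "lp p (J w)" "J' w \<in> borel_measurable mu" using assms w by (auto simp: jet_of_def lpjet_def lp_def)
  then show "Lp p (J w) = Lp p (J' w)" using lp_cong_AE(2)[OF _ _ jet_of_unique[OF assms w]] by simp
qed

lemma jet_of_lincomb:
  assumes p: "p >= 1" and J: "jet_of p k \<xi> J" and J': "jet_of p k \<eta> J'"
  shows "jet_of p k (a *R \<xi> + b *R \<eta>) (%w x. a *R J w x + b *R J' w x)"
  unfolding jet_of_def lpjet_def
proof (intro conjI ballI)
  note * = J[unfolded jet_of_def lpjet_def] J'[unfolded jet_of_def lpjet_def]
  show "wjet k (%w x. a *R J w x + b *R J' w x)" using * by (intro wjet_lincomb) auto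
  show "lp p (%x. a *R J w x + b *R J' w x)" if "w \<in> words k" for w using * p that by (auto intro!: lp_add lp_scaleR)
  have "AE x in S2_measure. J [] x = rep_S2_fun \<xi> x" "AE x in S2_measure. J' [] x = rep_S2_fun \<eta> x" using * by auto
  with rep_S2_fun_lincomb[of a \<xi> b \<eta>] show "AE x in S2_measure. a *R J [] x + b *R J' [] x = rep_S2_fun (a *R \<xi> + b *R \<eta>) x"
    by eventually_elim simp
qed

lemma jet_of_eqI: "jet_of p k \<xi> J ==> jet_of p k \<eta> J' ==> J [] = J' [] ==> \<xi> = \<eta>"
  by (rule S2_fun_eqI) (auto simp: jet_of_def elim: AE_mp)

lemma jet_of_zero: assumes "p >= 1" shows "jet_of p k 0 (%_ _. 0)"
proof -
  have "wjet k (%_ _. 0)" "lpjet p k (%_ _. 0)"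
    using assms by (auto simp: wjet_def lpjet_def weak_rot_const intro: lp_continuous)
  moreover have "AE x in S2_measure. 0 = rep_S2_fun 0 x" using rep_S2_fun_lincomb[of 0 0 0 0] by (auto elim: AE_mp)
  ultimately show ?thesis by (simp add: jet_of_def)
qed

lemma jet_of_diff: "p >= 1 ==> jet_of p k \<xi> J ==> jet_of p k \<eta> J' ==> jet_of p k (\<xi> - \<eta>) (%w x. J w x - J' w x)"
  using jet_of_lincomb[of p k \<xi> J \<eta> J' 1 "-1"] by simp

lemma jet_of_sum:
  assumes p: "p >= 1" and J: "!!c. c \<in> I ==> jet_of p k (\<xi> c) (J c)" and I: "finite I"
  shows "jet_of p k (\<Sum>c\<in>I. a c *R \<xi> c) (%w x. \<Sum>c\<in>I. a c *R J c w x)"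
  using I J
proof (induction I rule: finite_induct)
  case (insert c I)
  then show ?case using jet_of_lincomb[OF p, of k "\<xi> c" "J c" "\<Sum>c\<in>I. a c *R \<xi> c" "%w x. \<Sum>c\<in>I. a c *R J c w x" "a c" 1] by simp
qed (simp add: jet_of_zero[OF p])

lemma powr_le_root:
  assumes "x powr p <= C * u powr p" "x >= 0" "u >= 0" "C >= 0" "p > 0" shows "x <= C powr (1 / p) * (u::real)"
proof -
  have "x = (x powr p) powr (1 / p)" using assms by (simp add: powr_powr)
  also have "... <= (C * u powr p) powr (1 / p)" using assms by (intro powr_mono2) auto
  also have "... = C powr (1 / p) * u" using assms by (simp add: powr_mult powr_powr)
  finally show ?thesis .
qed

section \<open>Pullback operators acting on Sobolev spaces\<close>

locale sobolev_pullback = riemannian_S2 g nabla + diffeo_family G phi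
  for g nabla and G :: "'p::euclidean_space set" and phi +
  fixes p :: real and k m :: nat and TYP :: "'b::euclidean_space itself"
  assumes p: "p > 1"
begin

abbreviation "sn l \<equiv> sobolev_norm g nabla l p :: 'b S2_fun => real"
abbreviation "ss l \<equiv> sobolev_set g nabla l p :: 'b S2_fun set"

lemma p_ge: "p >= 1" "p >= 0" "p > 0" "p ~= 0" using p by auto

lemma sn_nonneg: "sn l \<xi> >= 0"
  by (simp add: sobolev_norm_def Let_def)

lemma ss_jet_of: "\<xi> \<in> ss l ==> \<exists>J. jet_of p l \<xi> J"
  using sobolev_jet[OF p_ge(1), of l] unfolding jet_of_def by blast

text \<open>Holds for every jet of \<open>\<xi>\<close>, not only for the one produced by
  \<open>sobolev_jet\<close>, as jets are unique almost everywhere.\<close>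

lemma sobolev_equiv:
  "\<exists>A>0. \<forall>(\<xi> :: 'b S2_fun) J. jet_of p l \<xi> J --> \<xi> \<in> ss l & sn l \<xi> powr p <= A * jetE p l J & jetE p l J <= A * sn l \<xi> powr p"
proof -
  obtain C where C: "C > 0" "!!\<xi> :: 'b S2_fun. \<xi> \<in> ss l ==> \<exists>J. jet_of p l \<xi> J & jetE p l J <= C * sn l \<xi> powr p"
    using sobolev_jet[OF p_ge(1), of l] unfolding jet_of_def by blast
  obtain D where D: "D > 0" "!!(\<xi> :: 'b S2_fun) J. jet_of p l \<xi> J ==> \<xi> \<in> ss l & sn l \<xi> powr p <= D * jetE p l J"
    using jet_sobolev[OF p_ge(1), of l] unfolding jet_of_def by blast
  have "\<xi> \<in> ss l & sn l \<xi> powr p <= (C + D) * jetE p l J & jetE p l J <= (C + D) * sn l \<xi> powr p"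
    if J: "jet_of p l \<xi> J" for \<xi> :: "'b S2_fun" and J
  proof -
    obtain J' where "jet_of p l \<xi> J'" "jetE p l J' <= C * sn l \<xi> powr p" using C(2) D(2)[OF J] by blast
    then have 1: "jetE p l J <= C * sn l \<xi> powr p" using jet_of_jetE[OF J] by simp
    have "C * sn l \<xi> powr p <= (C + D) * sn l \<xi> powr p" "D * jetE p l J <= (C + D) * jetE p l J"
      using C(1) D(1) jetE_nonneg by (auto intro!: mult_right_mono)
    then show ?thesis using 1 D(2)[OF J] by linarith
  qed
  then show ?thesis using C(1) D(1) by (intro exI[of _ "C + D"]) simp
qed

lemma qnormed_sobolev: "qnormed (sobolev_space g nabla l p :: 'b S2_fun nspace)"
proof -
  obtain A where A: "A > 0" "!!(\<xi> :: 'b S2_fun) J. jet_of p l \<xi> J ==>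
      \<xi> \<in> ss l & sn l \<xi> powr p <= A * jetE p l J & jetE p l J <= A * sn l \<xi> powr p" using sobolev_equiv by blast
  \<comment> \<open>In the constant, the two passages between norm and energy give \<open>A\<close>
    twice, the triangle inequality gives \<open>2 powr p\<close>, and bounding both powers by that
    of the sum gives the last 2.\<close>
  have lin: "a *R \<xi> + b *R \<eta> \<in> ss l & sn l (a *R \<xi> + b *R \<eta>) <= (A * 2 powr p * A * 2) powr (1 / p) * (\<bar>a\<bar> * sn l \<xi> + \<bar>b\<bar> * sn l \<eta>)"
    if \<xi>: "\<xi> \<in> ss l" "\<eta> \<in> ss l" for \<xi> \<eta> a b
  proof -
    obtain J J' where J: "jet_of p l \<xi> J" "jet_of p l \<eta> J'" using \<xi> ss_jet_of by meson
    let ?u = "\<bar>a\<bar> * sn l \<xi>" and ?v = "\<bar>b\<bar> * sn l \<eta>"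
    have lJ: "lp p (J w)" "lp p (J' w)" if "w \<in> words l" for w using J that by (auto simp: jet_of_def lpjet_def)
    note L = jet_of_lincomb[OF p_ge(1) J, of a b]
    have "jetE p l (%w x. a *R J w x + b *R J' w x) <= (\<Sum>w\<in>words l. 2 powr p * (\<bar>a\<bar> powr p * Lp p (J w) + \<bar>b\<bar> powr p * Lp p (J' w)))"
      unfolding jetE_def
    proof (rule sum_mono)
      fix w :: "(real^3) list" assume w: "w \<in> words l"
      show "Lp p (%x. a *R J w x + b *R J' w x) <= 2 powr p * (\<bar>a\<bar> powr p * Lp p (J w) + \<bar>b\<bar> powr p * Lp p (J' w))"
        using lp_add(2)[OF p_ge(2) lp_scaleR(1)[OF lJ(1)[OF w]] lp_scaleR(1)[OF lJ(2)[OF w]]]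
        by (simp add: lp_scaleR(2)[OF lJ(1)[OF w]] lp_scaleR(2)[OF lJ(2)[OF w]])
    qed
    also have "... = 2 powr p * (\<bar>a\<bar> powr p * jetE p l J + \<bar>b\<bar> powr p * jetE p l J')"
      by (simp add: jetE_def sum_distrib_left sum.distrib algebra_simps)
    also have "... <= 2 powr p * (\<bar>a\<bar> powr p * (A * sn l \<xi> powr p) + \<bar>b\<bar> powr p * (A * sn l \<eta> powr p))"
      using A(2)[OF J(1)] A(2)[OF J(2)] by (intro mult_left_mono add_mono) auto
    also have "... = 2 powr p * A * (?u powr p + ?v powr p)" using sn_nonneg by (simp add: powr_mult algebra_simps)
    also have "... <= 2 powr p * A * ((?u + ?v) powr p + (?u + ?v) powr p)"
      using A(1) sn_nonneg p by (intro mult_left_mono add_mono powr_mono2) auto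
    finally have "A * jetE p l (%w x. a *R J w x + b *R J' w x) <= A * (2 powr p * A * ((?u + ?v) powr p + (?u + ?v) powr p))"
      using A(1) by (intro mult_left_mono) auto
    then have "sn l (a *R \<xi> + b *R \<eta>) powr p <= (A * 2 powr p * A * 2) * (?u + ?v) powr p" using A(2)[OF L] by simp
    then show ?thesis using A(1) A(2)[OF L] sn_nonneg p by (intro conjI powr_le_root) auto
  qed
  have "0 \<in> ss l" using A(2)[OF jet_of_zero[OF p_ge(1)]] by blast
  then have "subspace (ss l)"
    using lin[of _ _ 1 1] lin[of _ _ _ 0] unfolding subspace_def by fastforce
  then show ?thesis
    unfolding qnormed_def sobolev_space_def using lin A(1) sn_nonneg
    by (auto intro!: exI[of _ "(A * 2 powr p * A * 2) powr (1 / p)"])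
qed

definition "jetof (\<xi> :: 'b S2_fun) = (SOME J. jet_of p (k + m) \<xi> J)"

definition opr :: "((real^3) list => 'p => 'b jets => real^3 => 'b) => 'p => 'b S2_fun => 'b S2_fun" where
  "opr W \<gamma> \<xi> = abs_S2_fun (W [] \<gamma> (jetof \<xi>))"

text \<open>The jet chosen by \<open>jetof\<close> is immaterial: two jets of \<open>\<xi>\<close>
  differ by a family of zero energy, which \<open>W []\<close> sends to zero almost everywhere by
  boundedness.\<close>

lemma opr_jet:
  assumes W: "ojet r W" and r: "r <= m" and \<gamma>: "\<gamma> \<in> G" and J: "jet_of p (k + m) \<xi> J"
  shows "jet_of p k (opr W \<gamma> \<xi>) (%w. W w \<gamma> J)"
proof -
  have J': "jet_of p (k + m) \<xi> (jetof \<xi>)" unfolding jetof_def by (rule someI[where P="jet_of p (k + m) \<xi>", OF J])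
  have P: "pop (r + length w) (W w)" if "w \<in> words k" for w using W that by (auto simp: ojet_def words_def)
  have l: "lpjet p (r + length w) J" "lpjet p (r + length w) (jetof \<xi>)" if "w \<in> words k" for w
    using J J' r that by (auto simp: jet_of_def words_def intro!: lpjet_mono[of p "k + m"])
  have lp: "lp p (W w \<gamma> J)" "lp p (W w \<gamma> (jetof \<xi>))" if "w \<in> words k" for w
    using pop_lp[OF P[OF that] \<gamma> _ p_ge(2)] l[OF that] by auto
  have "jetE p r (%w x. J w x - jetof \<xi> w x) = 0"
    unfolding jetE_def
  proof (intro sum.neutral ballI)
    fix w :: "(real^3) list" assume "w \<in> words r"
    then have "w \<in> words (k + m)" using r by (auto simp: words_def)
    from jet_of_unique[OF J J' this] show "Lp p (%x. J w x - jetof \<xi> w x) = 0"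
      unfolding Lp_def using p by (intro integral_eq_zero_AE) (auto elim: AE_mp)
  qed
  moreover obtain B where "!!J. lpjet p r J ==> lp p (W [] \<gamma> J) & Lp p (W [] \<gamma> J) <= B * jetE p r J"
    using pop_bound[of r "W []" "{\<gamma>}" p] P[of "[]"] \<gamma> p_ge(2) by auto
  ultimately have "lp p (W [] \<gamma> (%w x. J w x - jetof \<xi> w x))" "Lp p (W [] \<gamma> (%w x. J w x - jetof \<xi> w x)) <= 0"
    using lpjet_diff[OF p_ge(2) l[of "[]"]] by fastforce+
  then have "AE x in S2_measure. W [] \<gamma> (%w x. J w x - jetof \<xi> w x) x = 0"
    using Lp_nonneg by (intro Lp_eq_0_imp_AE) (auto intro: order_antisym)
  moreover have "W [] \<gamma> (%w x. J w x - jetof \<xi> w x) = (%x. W [] \<gamma> J x - W [] \<gamma> (jetof \<xi>) x)"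
    using pop_diff[OF P[of "[]"]] by simp
  moreover have "AE x in S2_measure. rep_S2_fun (opr W \<gamma> \<xi>) x = W [] \<gamma> (jetof \<xi>) x"
    unfolding opr_def using lp(2)[of "[]"] by (intro rep_abs_S2_fun lp_measurable) simp
  ultimately have "AE x in S2_measure. W [] \<gamma> J x = rep_S2_fun (opr W \<gamma> \<xi>) x" by (auto elim!: AE_mp)
  moreover have "wjet k (%w. W w \<gamma> J)"
    unfolding wjet_def
  proof (intro conjI ballI allI impI)
    show "integrable mu (W w \<gamma> J)" if "w \<in> words k" for w by (rule lp_integrable[OF lp(1)[OF that] p_ge(1)])
    fix a w assume w: "a # w \<in> words k"
    then have "Suc (r + length w) <= k + m" "set (a # w) \<subseteq> Basis" using r by (auto simp: words_def)
    then show "weak_rot a (W w \<gamma> J) (W (a # w) \<gamma> J)"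
      using W J \<gamma> p_ge(1) wjet_mono[of "k + m" J "Suc (r + length w)"] lpjet_mono[of p "k + m" J "Suc (r + length w)"]
      unfolding ojet_def jet_of_def by blast
  qed
  ultimately show ?thesis using lp(1) by (simp add: jet_of_def lpjet_def)
qed

text \<open>\<open>D w\<close> is the derivative along \<open>w\<close> of the function represented
  by \<open>Z\<close>; the bounds over all words of length at most \<open>k\<close> add up to a
  bound in the Sobolev norm after taking the p-th root, which enters \<open>M\<close>.\<close>

lemma opr_estimate:
  fixes u :: "'p => real" and Z :: "'p => 'b S2_fun => 'b S2_fun"
    and D :: "(real^3) list => 'p => 'b jets => real^3 => 'b"
  assumes D: "!!w. w \<in> words k ==> \<exists>C>0. near_le p (k + m) (%h. u h powr p) (D w) C"
    and u: "!!h. u h >= 0" and \<gamma>: "\<gamma> \<in> G"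
    and Z: "!!h \<xi> J. \<gamma> + h \<in> G ==> jet_of p (k + m) \<xi> J ==> jet_of p k (Z h \<xi>) (%w. D w h J)"
  shows "\<exists>C>0. \<forall>h \<xi>. norm h * C <= 1 & \<xi> \<in> ss (k + m) --> sn k (Z h \<xi>) <= C * u h * sn (k + m) \<xi>"
proof -
  let ?K = "k + m"
  obtain C where C: "C > 0" "!!w. w \<in> words k ==> near_le p ?K (%h. u h powr p) (D w) C"
    using near_le_uniform[where F=D and I="words k", OF finite_words _ D] by auto
  obtain A where A: "A > 0" "!!(\<xi> :: 'b S2_fun) J. jet_of p ?K \<xi> J ==> jetE p ?K J <= A * sn ?K \<xi> powr p" using sobolev_equiv by blast
  obtain B where B: "B > 0" "!!(\<xi> :: 'b S2_fun) J. jet_of p k \<xi> J ==> sn k \<xi> powr p <= B * jetE p k J" using sobolev_equiv by blast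
  obtain E where E: "E > 0" "!!h. norm h * E <= 1 ==> \<gamma> + h \<in> G" using near_G[OF \<gamma>] by blast
  let ?N = "real (card (words k :: (real^3) list set))"
  define M where "M = (B * (?N * (C * A))) powr (1 / p)"
  have "sn k (Z h \<xi>) <= (C + E + M) * u h * sn ?K \<xi>" if h: "norm h * (C + E + M) <= 1" and \<xi>: "\<xi> \<in> ss ?K" for h \<xi>
  proof -
    have "norm h * C <= norm h * (C + E + M)" "norm h * E <= norm h * (C + E + M)"
      using C(1) E(1) by (auto intro!: mult_left_mono simp: M_def)
    then have h': "norm h * C <= 1" "norm h * E <= 1" using h by linarith+
    obtain J where J: "jet_of p ?K \<xi> J" using ss_jet_of[OF \<xi>] by blast
    have "jetE p k (%w. D w h J) <= ?N * (C * u h powr p * jetE p ?K J)"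
      unfolding jetE_def[of p k] using J near_leD[OF C(2) h'(1)] by (intro sum_bounded_above) (auto simp: jet_of_def)
    also have "... <= ?N * (C * u h powr p * (A * sn ?K \<xi> powr p))"
      using A(2)[OF J] C(1) by (intro mult_left_mono) auto
    finally have "B * jetE p k (%w. D w h J) <= B * (?N * (C * u h powr p * (A * sn ?K \<xi> powr p)))"
      using B(1) by (intro mult_left_mono) auto
    then have "sn k (Z h \<xi>) powr p <= (B * (?N * (C * A))) * (u h * sn ?K \<xi>) powr p"
      using B(2)[OF Z[OF E(2)[OF h'(2)] J]] u sn_nonneg by (simp add: powr_mult mult_ac)
    then have "sn k (Z h \<xi>) <= M * (u h * sn ?K \<xi>)"
      unfolding M_def using A(1) B(1) C(1) u sn_nonneg p by (intro powr_le_root) auto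
    also have "... <= (C + E + M) * (u h * sn ?K \<xi>)" using C(1) E(1) u sn_nonneg by (intro mult_right_mono) auto
    finally show ?thesis by (simp add: mult.assoc)
  qed
  moreover have "C + E + M > 0" using C(1) E(1) by (auto simp: M_def intro!: add_pos_nonneg)
  ultimately show ?thesis by blast
qed

text \<open>The counterpart for a fixed argument: \<open>D\<close> no longer takes a jet, and the
  neighbourhood may depend on it.\<close>

lemma opr_small:
  fixes u :: "'p => real" and Z :: "'p => 'b S2_fun" and D :: "(real^3) list => 'p => real^3 => 'b"
  assumes D: "!!w e. w \<in> words k ==> e > 0 ==> \<exists>d>0. \<forall>h. norm h < d --> Lp p (D w h) <= e * u h powr p"
    and u: "!!h. u h >= 0" and \<gamma>: "\<gamma> \<in> G" and Z: "!!h. \<gamma> + h \<in> G ==> jet_of p k (Z h) (%w. D w h)"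
    and e: "e > 0"
  shows "\<exists>C>0. \<forall>h. norm h * C <= 1 --> sn k (Z h) <= e * u h"
proof -
  obtain B where B: "B > 0" "!!(\<xi> :: 'b S2_fun) J. jet_of p k \<xi> J ==> sn k \<xi> powr p <= B * jetE p k J" using sobolev_equiv by blast
  obtain E where E: "E > 0" "!!h. norm h * E <= 1 ==> \<gamma> + h \<in> G" using near_G[OF \<gamma>] by blast
  let ?N = "real (card (words k :: (real^3) list set))"
  have N: "?N > 0" using card_gt_0_iff words_Nil finite_words by (metis empty_iff of_nat_0_less_iff)
  define e' where "e' = e powr p / (B * ?N)"
  have e': "e' > 0" "B * ?N * e' = e powr p" using e B(1) N by (auto simp: e'_def)
  have "\<exists>C>0. \<forall>w\<in>words k. \<forall>h. norm h * C <= 1 --> Lp p (D w h) <= e' * u h powr p"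
  proof (rule uniform_const[OF finite_words])
    fix w :: "(real^3) list" assume "w \<in> words k"
    then obtain d where d: "d > 0" "!!h. norm h < d ==> Lp p (D w h) <= e' * u h powr p" using D e'(1) by blast
    have "norm h < d" if "norm h * (2 / d) <= 1" for h
    proof -
      have "norm h <= d / 2" using that d(1) by (simp add: field_simps)
      then show ?thesis using d(1) by linarith
    qed
    then show "\<exists>C\<ge>0. \<forall>h. norm h * C <= 1 --> Lp p (D w h) <= e' * u h powr p" using d by (intro exI[of _ "2 / d"]) auto
  qed (meson mult_left_mono norm_ge_zero order_trans)
  then obtain C where C: "C > 0" "!!w h. w \<in> words k ==> norm h * C <= 1 ==> Lp p (D w h) <= e' * u h powr p" by blast
  have "sn k (Z h) <= e * u h" if h: "norm h * (C + E) <= 1" for h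
  proof -
    have "norm h * C <= norm h * (C + E)" "norm h * E <= norm h * (C + E)"
      using C(1) E(1) by (auto intro!: mult_left_mono)
    then have h': "norm h * C <= 1" "norm h * E <= 1" using h by linarith+
    have "jetE p k (%w. D w h) <= ?N * (e' * u h powr p)"
      unfolding jetE_def[of p k] using C(2)[OF _ h'(1)] by (intro sum_bounded_above)
    then have "B * jetE p k (%w. D w h) <= B * (?N * (e' * u h powr p))"
      using B(1) by (intro mult_left_mono) auto
    then have "sn k (Z h) powr p <= (B * ?N * e') * u h powr p" using B(2)[OF Z[OF E(2)[OF h'(2)]]] by (simp add: mult.assoc)
    then have "sn k (Z h) <= (e powr p) powr (1 / p) * u h" unfolding e'(2) using u sn_nonneg p by (intro powr_le_root) auto
    then show ?thesis using e p by (simp add: powr_powr)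
  qed
  then show ?thesis using C(1) E(1) by (intro exI[of _ "C + E"]) simp
qed

lemma near_le_lift: "\<exists>C>0. near_le p s v F C ==> s <= s' ==> (!!h. v h >= 0) ==> \<exists>C>0. near_le p s' v F C"
  using near_le_mono less_imp_le order_refl by metis

text \<open>The operators \<open>W w\<close> with \<open>length w <= k\<close> have order up to
  \<open>r + k\<close>, and jets of order \<open>k + m\<close> are given. So \<open>m - r\<close>
  orders are spare, and each axiom is the corresponding estimate for \<open>pop\<close> with that
  many orders in reserve.\<close>

lemma operator_calculus_opr:
  "operator_calculus (sobolev_space g nabla (k + m) p) (sobolev_space g nabla k p) G (%r. {opr W |W. ojet r W}) m"
proof (unfold_locales, goal_cases)
  case 1 show ?case by (rule qnormed_sobolev)
next
  case 2 show ?case by (rule qnormed_sobolev)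
next
  case (3 r T \<gamma> \<xi>)
  then obtain W where W: "T = opr W" "ojet r W" by auto
  obtain J where "jet_of p (k + m) \<xi> J" using 3(4) ss_jet_of unfolding sobolev_space_def by auto
  with opr_jet[OF W(2) 3(1,3)] sobolev_equiv[of k] show ?case unfolding W(1) sobolev_space_def by auto
next
  case (4 r T \<gamma> \<xi> \<eta> a b)
  then obtain W where W: "T = opr W" "ojet r W" by auto
  obtain J J' where J: "jet_of p (k + m) \<xi> J" "jet_of p (k + m) \<eta> J'"
    using 4(4,5) ss_jet_of unfolding sobolev_space_def by (metis nspace.select_convs(1))
  note o = opr_jet[OF W(2) 4(1,3)]
  have "pop r (W [])" using W(2) by (auto simp: ojet_def dest: spec[of _ "[]"])
  then show ?case unfolding W(1)
    by (intro jet_of_eqI[OF o[OF jet_of_lincomb[OF p_ge(1) J]] jet_of_lincomb[OF p_ge(1) o[OF J(1)] o[OF J(2)]]])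
      (auto simp: pop_linear)
next
  case (5 r T \<gamma>)
  then obtain W where W: "T = opr W" "ojet r W" by auto
  have "\<exists>C>0. \<forall>h \<xi>. norm h * C <= 1 & \<xi> \<in> ss (k + m) --> sn k (opr W (\<gamma> + h) \<xi>) <= C * 1 * sn (k + m) \<xi>"
  proof (rule opr_estimate[where D="%w h. W w (\<gamma> + h)"])
    fix w :: "(real^3) list" assume w: "w \<in> words k"
    have "pop (r + length w) (W w)" using W(2) w by (auto simp: ojet_def words_def)
    then show "\<exists>C>0. near_le p (k + m) (%h. 1 powr p) (%h. W w (\<gamma> + h)) C"
      using near_le_lift[OF pop_near[OF _ 5(3) p_ge(2)], of "r + length w" "W w" "k + m"] w 5(1) by (simp add: words_def)
  qed (use opr_jet[OF W(2) 5(1)] 5(3) in auto)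
  then show ?case by (simp add: sobolev_space_def W(1))
next
  case (6 r T \<gamma> \<xi> e)
  then obtain W where W: "T = opr W" "ojet r W" by auto
  obtain J where J: "jet_of p (k + m) \<xi> J" using 6(4) ss_jet_of unfolding sobolev_space_def by auto
  have "\<exists>C>0. \<forall>h. norm h * C <= 1 --> sn k (opr W (\<gamma> + h) \<xi> - opr W \<gamma> \<xi>) <= e * 1"
  proof (rule opr_small[where D="%w h x. W w (\<gamma> + h) J x - W w \<gamma> J x"])
    fix w :: "(real^3) list" and e :: real assume w: "w \<in> words k" and e: "e > 0"
    have P: "pop (r + length w) (W w)" using W(2) w by (auto simp: ojet_def words_def)
    have l: "wjet (r + length w) J" "lpjet p (r + length w) J"
      using J w 6(1) by (auto simp: jet_of_def words_def intro!: lpjet_mono[of p "k + m"] wjet_mono[of "k + m"])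
    show "\<exists>d>0. \<forall>h. norm h < d --> Lp p (%x. W w (\<gamma> + h) J x - W w \<gamma> J x) <= e * 1 powr p"
      using pop_continuous[OF P l p_ge(1) 6(3) e] by simp
  qed (use opr_jet[OF W(2) 6(1) _ J] 6 in \<open>auto intro: jet_of_diff[OF p_ge(1)]\<close>)
  then show ?case by (simp add: sobolev_space_def W(1))
next
  case (7 r T \<gamma>)
  then obtain W where W: "T = opr W" "ojet r W" by auto
  have "\<exists>C>0. \<forall>h \<xi>. norm h * C <= 1 & \<xi> \<in> ss (k + m) --> sn k (opr W (\<gamma> + h) \<xi> - opr W \<gamma> \<xi>) <= C * norm h * sn (k + m) \<xi>"
  proof (rule opr_estimate[where D="%w h J x. W w (\<gamma> + h) J x - W w \<gamma> J x"])
    fix w :: "(real^3) list" assume w: "w \<in> words k"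
    then have "pop (r + length w) (W w)" using W(2) by (auto simp: ojet_def words_def)
    then show "\<exists>C>0. near_le p (k + m) (%h. norm h powr p) (%h J x. W w (\<gamma> + h) J x - W w \<gamma> J x) C"
      using near_le_lift[OF pop_lipschitz[OF _ 7(3) p_ge(1)], of "r + length w" "W w" "k + m"] w 7(1) by (simp add: words_def)
  qed (use opr_jet[OF W(2)] 7 in \<open>auto intro: jet_of_diff[OF p_ge(1)]\<close>)
  then show ?case by (simp add: sobolev_space_def W(1))
next
  case (8 r T)
  then obtain W where W: "T = opr W" "ojet r W" by auto
  obtain V where V: "!!c. c \<in> Basis ==> ojet (Suc r) (V c)" "!!c w. c \<in> Basis ==> set w \<subseteq> Basis ==> pder_rel c 0 (W w) (V c w)"
    using ojet_pder_exists[OF W(2)] by blast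
  have P: "pop (r + length w) (W w)" "!!c. c \<in> Basis ==> pop (Suc (r + length w)) (V c w)" if "w \<in> words k" for w
    using W(2) V(1) that by (auto simp: ojet_def words_def)
  have wB: "set w \<subseteq> Basis" if "w \<in> words k" for w :: "(real^3) list" using that by (simp add: words_def)
  let ?Z = "%\<gamma> h \<xi>. opr W (\<gamma> + h) \<xi> - opr W \<gamma> \<xi> - (\<Sum>c\<in>Basis. (h \<bullet> c) *R opr (V c) \<gamma> \<xi>)"
  let ?D = "%\<gamma> w h J x. W w (\<gamma> + h) J x - W w \<gamma> J x - (\<Sum>c\<in>Basis. (h \<bullet> c) *R V c w \<gamma> J x)"
  have Z: "jet_of p k (?Z \<gamma> h \<xi>) (%w. ?D \<gamma> w h J)" if "\<gamma> \<in> G" "\<gamma> + h \<in> G" "jet_of p (k + m) \<xi> J" for \<gamma> h \<xi> J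
    using that 8(1) by (intro jet_of_diff[OF p_ge(1)] jet_of_sum[OF p_ge(1)] opr_jet[OF W(2)] opr_jet[OF V(1)]) auto
  have a: "\<exists>C>0. \<forall>h. norm h * C <= 1 --> sn k (?Z \<gamma> h \<xi>) <= e * norm h"
    if \<gamma>: "\<gamma> \<in> G" and \<xi>: "\<xi> \<in> ss (k + m)" and e: "e > 0" for \<gamma> \<xi> e
  proof -
    obtain J where J: "jet_of p (k + m) \<xi> J" using ss_jet_of[OF \<xi>] by blast
    show ?thesis
    proof (rule opr_small[where D="%w h. ?D \<gamma> w h J"])
      fix w :: "(real^3) list" and e :: real assume w: "w \<in> words k" and e: "e > 0"
      have l: "wjet (Suc (r + length w)) J" "lpjet p (Suc (r + length w)) J"
        using J w 8(1) by (auto simp: jet_of_def words_def intro!: lpjet_mono[of p "k + m"] wjet_mono[of "k + m"])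
      show "\<exists>d>0. \<forall>h. norm h < d --> Lp p (?D \<gamma> w h J) <= e * norm h powr p"
        using pop_differentiable[OF P[OF w] V(2)[OF _ wB[OF w]] l p_ge(1) \<gamma> e] by blast
    qed (use Z[OF \<gamma> _ J] \<gamma> e in auto)
  qed
  have b: "\<exists>C>0. \<forall>h \<xi>. norm h * C <= 1 & \<xi> \<in> ss (k + m) --> sn k (?Z \<gamma> h \<xi>) <= C * (norm h * norm h) * sn (k + m) \<xi>"
    if \<gamma>: "\<gamma> \<in> G" and r: "Suc (Suc r) <= m" for \<gamma>
  proof (rule opr_estimate[where D="?D \<gamma>"])
    fix w :: "(real^3) list" assume w: "w \<in> words k"
    show "\<exists>C>0. near_le p (k + m) (%h. (norm h * norm h) powr p) (?D \<gamma> w) C"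
      using near_le_lift[OF pop_taylor(2)[OF P[OF w] V(2)[OF _ wB[OF w]] \<gamma> p_ge(1)], of "k + m"] w r
      by (simp add: words_def powr_mult)
  qed (use Z \<gamma> in auto)
  show ?case
    unfolding W(1) using V(1) a b
    by (intro exI[of _ "%c. opr (V c)"]) (auto simp: sobolev_space_def)
qed

text \<open>\<open>S2_comp\<close> uses a representative of \<open>\<xi>\<close>, \<open>opr\<close>
  a jet. These agree off a null set, and the pullback respects this because it keeps functions of
  zero energy at zero energy.\<close>

lemma S2_comp_opr:
  assumes W: "W [] = (%\<gamma> J x. J [] (phi \<gamma> x))" and \<gamma>: "\<gamma> \<in> G" and \<xi>: "\<xi> \<in> ss (k + m)"
  shows "S2_comp \<xi> (phi \<gamma>) = opr W \<gamma> \<xi>"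
proof -
  define J where "J = jetof \<xi>"
  have J: "jet_of p (k + m) \<xi> J" unfolding J_def jetof_def using ss_jet_of[OF \<xi>] by (rule someI_ex)
  then have l: "lp p (J [])" and AE: "AE x in S2_measure. J [] x = rep_S2_fun \<xi> x" by (auto simp: jet_of_def lpjet_def)
  note m = rep_S2_fun_measurable[of \<xi>] lp_measurable[OF l]
  obtain B where phi: "phi \<gamma> \<in> measurable mu mu"
    and B: "!!f :: real^3 => 'b. lp p f ==> lp p (%x. f (phi \<gamma> x)) & Lp p (%x. f (phi \<gamma> x)) <= B * Lp p f"
    using lp_pullback[of "{\<gamma>}"] \<gamma> by (metis bot_least compact_insert compact_empty insert_subset singletonI)
  let ?d = "%x. J [] x - rep_S2_fun \<xi> x"
  \<comment> \<open>Vanishing almost everywhere is expressed as a bound by \<open>J []\<close> with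
    the constant 0, to which \<open>lp_mono\<close> applies.\<close>
  have "lp p ?d" "Lp p ?d <= 0 powr p * Lp p (J [])"
    by (rule lp_mono[OF l _ p_ge(2), of ?d 0]; use m AE in \<open>auto elim: AE_mp\<close>)+
  then have "lp p (%x. ?d (phi \<gamma> x))" "Lp p (%x. ?d (phi \<gamma> x)) = 0"
    using B[of ?d] Lp_nonneg[of p ?d] Lp_nonneg[of p "%x. ?d (phi \<gamma> x)"] p_ge(4) by (simp_all add: order_antisym)
  then have "AE x in S2_measure. ?d (phi \<gamma> x) = 0" by (rule Lp_eq_0_imp_AE)
  then show ?thesis
    unfolding S2_comp_def opr_def W J_def[symmetric]
    by (intro abs_S2_fun_eqI measurable_compose[OF phi] m) (auto elim: AE_mp)
qed

theorem S2_comp_Cm: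
  "Cm_map m (prod_nspace euclidean_nspace (sobolev_space g nabla (k + m) p)) (sobolev_space g nabla k p)
     (G \<times> points (sobolev_space g nabla (k + m) p)) (%(\<gamma>, \<xi> :: 'b S2_fun). S2_comp \<xi> (phi \<gamma>))"
proof -
  interpret operator_calculus "sobolev_space g nabla (k + m) p" "sobolev_space g nabla k p" G "%r. {opr W |W. ojet r W}" m
    by (rule operator_calculus_opr)
  have "pop 0 (%\<gamma> (J :: (real^3) list => real^3 => 'b) x. J [] (phi \<gamma> x))"
    using pop_term[OF hsm_const[of 1], of "[]" 0] by simp
  then obtain W :: "(real^3) list => 'p => 'b jets => real^3 => 'b"
    where W: "ojet 0 W" "W [] = (%\<gamma> J x. J [] (phi \<gamma> x))" using ojet_exists by blast
  have "Cm_map m X (sobolev_space g nabla k p) U (%z. opr W (fst z) (snd z))" using W(1) by (intro ops_Cm_map) blast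
  then show ?thesis
    unfolding Cm_map_def by (rule Cm_multi_cong[rotated]) (auto simp: sobolev_space_def S2_comp_opr[where W=W, OF W(2)])
qed

end

theorem theorem1p1:
  fixes g :: "real^3 \<Rightarrow> real^3 \<Rightarrow> real^3 \<Rightarrow> real"
    and nabla :: "(real^3 \<Rightarrow> real^3) \<Rightarrow> real^3 \<Rightarrow> real^3 \<Rightarrow> real^3"
    and phi :: "real^'n \<Rightarrow> real^3 \<Rightarrow> real^3"
    and p \<epsilon> :: real
    and k m :: nat
  assumes "riemannian_metric g" and "levi_civita g nabla"
    and "1 \<le> k" and "1 < p" and "\<lfloor>real k - 2 / p\<rfloor> > 0" and "\<epsilon> > 0"
    and "smooth_on (ball 0 \<epsilon> \<times> (- {0})) (\<lambda>(\<gamma>, y). phi \<gamma> (sgn y))"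
    and "\<And>\<gamma>. \<gamma> \<in> ball 0 \<epsilon> \<Longrightarrow> S2_diffeo (phi \<gamma>)"
  shows "Cm_map m
           (prod_nspace euclidean_nspace (sobolev_space g nabla (k + m) p))
           (sobolev_space g nabla k p)
           (ball 0 \<epsilon> \<times> points (sobolev_space g nabla (k + m) p))
           (\<lambda>(\<gamma>, \<xi> :: (real^'N) S2_fun). S2_comp \<xi> (phi \<gamma>))"
proof -
  interpret sobolev_pullback g nabla "ball 0 \<epsilon>" phi p k m "TYPE(real^'N)"
    using assms by unfold_locales auto
  show ?thesis by (rule S2_comp_Cm)
qed

end
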